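(* Let $(M_p)_{p\in\mathbb{N}_0}$ be a sequence of positive real numbers with $M_0=1$ satisfying (M.1), (M.2) and (M.3'), let $X$ be a non-trivial complex Banach space, let $*$ denote either the Beurling case $(M_p)$ or the Roumieu case $\{M_p\}$, and let $T\in\mathcal{D}^{\prime *}_{L^1}(M_p:X)$. Let $\mathcal{A}$ denote $AAP(\mathbb{R}:X)$, resp. $AAA(\mathbb{R}:X)$, and correspondingly let $B^{\prime *}_{\mathcal{A}}(X)$ denote $B^{\prime *}_{AAP}(X)$, resp. $B^{\prime *}_{AAA}(X)$ (so the theorem consists of two versions: the asymptotically almost periodic one and the asymptotically almost automorphic one). Consider the following assertions: (i) There exist an element $S\in\mathcal{D}^{\prime *}_{L^1}(M_p:X)$, a number $l>0$ in the Beurling case / a sequence $(r_p)\in\mathrm{R}$ in the Roumieu case, and bounded functions $f,g\in\mathcal{A}$ such that $S=P_l(D)f+g$ in the Beurling case, resp. $S=P_{r_p}(D)f+g$ in the Roumieu case, and $S=T$ on $[0,\infty)$. (ii) There exist a number $l>0$ in the Beurling case, resp. a sequence $(r_p)\in\mathrm{R}$ in the Roumieu case, and bounded functions $f,g\in\mathcal{A}$ such that $T=P_l(D)f+g$, resp. $T=P_{r_p}(D)f+g$, on $[0,\infty)$. (iii) There exist an ultradifferential operator $P(D)=\sum_{p=0}^\infty a_pD^p$ of $*$-class and bounded functions $f_1,f_2\in\mathcal{A}$ such that $T=P(D)f_1+f_2$ on $[0,\infty)$. (iv) There exist an element $S\in\mathcal{D}^{\prime *}_{L^1}(M_p:X)$,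 an ultradifferential operator $P(D)=\sum_{p=0}^\infty a_pD^p$ of $*$-class and bounded functions $f_1,f_2\in\mathcal{A}$ such that $S=P(D)f_1+f_2$ and $S=T$ on $[0,\infty)$. (v) $T\in B^{\prime *}_{\mathcal{A}}(X)$, and there exist an element $S\in\mathcal{D}^{\prime *}_{L^1}(M_p:X)$, an ultradifferential operator $P(D)=\sum_{p=0}^\infty a_pD^p$ of $*$-class and bounded functions $f_1,f_2\in\mathcal{A}$ such that $S=P(D)f_1+f_2$ and $S=T$ on $[0,\infty)$. (vi) $T\in B^{\prime *}_{\mathcal{A}}(X)$, and there exists an element $S\in\mathcal{D}^{\prime *}_{L^1}(M_p:X)$ such that $S=T$ on $[0,\infty)$ and $S*\varphi\in\mathcal{A}$ for all $\varphi\in\mathcal{D}^*$. (vii) $T\in B^{\prime *}_{\mathcal{A}}(X)$. (viii) $T*\varphi\in\mathcal{A}$ for all $\varphi\in\mathcal{D}^*_0$. (ix) There exists a sequence $(T_n)$ in $\mathcal{E}^*(X)\cap\mathcal{A}$ such that $\lim_{n\to\infty}T_n=T$ in $\mathcal{D}^{\prime *}_{L^1}(M_p:X)$. (x) $T*\varphi\in\mathcal{A}$ for all $\varphi\in\mathcal{D}^*$. Then (i) $\Rightarrow$ (ii) $\Rightarrow$ (iii) $\Rightarrow$ (iv) $\Rightarrow$ (v) $\Rightarrow$ (vi) $\Leftrightarrow$ (vii) $\Leftrightarrow$ (viii) $\Leftrightarrow$ (ix) $\Leftrightarrow$ (x). Furthermore, if $(M_p)$ additionally satisfies (M.3), then the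 assertions (i)-(x) are equivalent for the Beurling class.
   Context: **Conditions on $(M_p)$.** (M.1): $M_p^2\le M_{p+1}M_{p-1}$, $p\in\mathbb{N}$. (M.2): $M_p\le AH^p\sup_{0\le i\le p}M_iM_{p-i}$, $p\in\mathbb{N}$, for some $A,H>1$. (M.3'): $\sum_{p=1}^\infty M_{p-1}/M_p<\infty$. (M.3): $\sup_{p\in\mathbb{N}}\sum_{q=p+1}^\infty\frac{M_{q-1}M_{p+1}}{pM_pM_q}<\infty$. Put $m_p:=M_p/M_{p-1}$, $p\in\mathbb{N}$. **Test spaces.** For compact $K\subset\mathbb{R}$ and $h>0$, $\mathcal{D}^{M_p,h}_K$ is the space of $\phi\in C^\infty(\mathbb{R})$ (complex valued) with $\operatorname{supp}\phi\subseteq K$ and $\sup\{h^p|\phi^{(p)}(t)|/M_p:t\in K,p\in\mathbb{N}_0\}<\infty$, normed by this supremum. $\mathcal{D}^{(M_p)}_K$ is the projective limit as $h\to\infty$, $\mathcal{D}^{\{M_p\}}_K$ the inductive limit as $h\to0$, and $\mathcal{D}^{*}$ is the inductive limit of $\mathcal{D}^*_K$ over compact $K$. $\mathcal{D}^*_0:=\{\varphi\in\mathcal{D}^*:\operatorname{supp}\varphi\subseteq[0,\infty)\}$. $\mathcal{D}^{\prime *}(X)$ is the space of continuous linear maps $\mathcal{D}^*\to X$. $\mathcal{E}^*(X)$ is the space of $\phi\in C^\infty(\mathbb{R}:X)$ such that for every compact $K$, $\sup_{p\ge0}h^p\sup_{t\in K}\|\phi^{(p)}(t)\|/M_p<\infty$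 for every $h>0$ (Beurling case), resp. for some $h>0$ (Roumieu case). **Bounded ultradistributions.** $\mathcal{D}_{L^1}$ is the space of $f\in C^\infty(\mathbb{R})$ with $f^{(j)}\in L^1(\mathbb{R})$ for all $j\in\mathbb{N}_0$. For $h>0$, $\mathcal{D}_{L^1}((M_p),h):=\{f\in\mathcal{D}_{L^1}:\|f\|_{1,h}:=\sup_{p\in\mathbb{N}_0}h^p\|f^{(p)}\|_1/M_p<\infty\}$, a Banach space. $\mathcal{D}_{L^1}((M_p))$ is the projective limit as $h\to+\infty$, and $\mathcal{D}_{L^1}(\{M_p\})$ the inductive limit as $h\to0+$. $\mathcal{D}^{\prime *}_{L^1}(M_p:X)$ (also written $\mathcal{D}^{\prime *}_{L^1}(X)$) is the space of continuous linear maps from $\mathcal{D}_{L^1}((M_p))$ (Beurling), resp. $\mathcal{D}_{L^1}(\{M_p\})$ (Roumieu), into $X$, with the strong topology (uniform convergence on bounded sets). Functions are identified with regular ultradistributions. Equality "$S=T$ on $[0,\infty)$" means $\langle S,\varphi\rangle=\langle T,\varphi\rangle$ for all $\varphi\in\mathcal{D}^*_0$. Convolution: $(T*\varphi)(x)=\langle T,\varphi(x-\cdot)\rangle$. Translation: $\langle T_h,\varphi\rangle:=\langle T,\varphi(\cdot-h)\rangle$. **Ultradifferential operators.** $P(D)=\sum_{p=0}^\infty a_pD^p$ (complex $a_p$) is of class $(M_p)$, resp. $\{M_p\}$, if there exist $l>0$ and $C>0$, resp. for every $l>0$ there exists $C>0$, with $|a_p|\le Cl^p/M_p$ for $p\in\mathbb{N}$.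 Here $D=-i\,d/dx$ (Komatsu's convention). $\mathrm{R}$ is the family of all sequences of positive reals tending to infinity. For $l>0$ and $(r_p)\in\mathrm{R}$: $P_l(x)=(1+x^2)\prod_{p\in\mathbb{N}}\bigl(1+\frac{x^2}{l^2m_p^2}\bigr)$ and $P_{r_p}(x)=(1+x^2)\prod_{p\in\mathbb{N}}\bigl(1+\frac{x^2}{r_p^2m_p^2}\bigr)$. **Functions.** A continuous $f:\mathbb{R}\to X$ is almost periodic ($f\in AP(\mathbb{R}:X)$) if for every $\epsilon>0$ there is $l>0$ such that every interval of length $l$ contains $\tau>0$ when contained in $(0,\infty)$ (equivalently, the set of $\epsilon$-periods is relatively dense), where $\tau$ is an $\epsilon$-period if $\|f(t+\tau)-f(t)\|\le\epsilon$ for all $t\in\mathbb{R}$. A bounded continuous $f:\mathbb{R}\to X$ is almost automorphic ($f\in AA(\mathbb{R}:X)$) if every real sequence $(b_n)$ has a subsequence $(a_n)$ and there is a map $g:\mathbb{R}\to X$ with $\lim_nf(t+a_n)=g(t)$ and $\lim_ng(t-a_n)=f(t)$ pointwise for $t\in\mathbb{R}$. $C_0([0,\infty):X)$ is the space of bounded continuous functions $[0,\infty)\to X$ vanishing at $+\infty$. $AAP(\mathbb{R}:X)$, resp. $AAA(\mathbb{R}:X)$, is the space of continuous $f:\mathbb{R}\to X$ for which there are $q\in C_0([0,\infty):X)$ and $g\in AP(\mathbb{R}:X)$, resp. $g\in AA(\mathbb{R}:X)$, with $f(t)=g(t)+q(t)$ for $t\ge0$ (no condition on boundedness for $t<0$).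 **Ultradistribution classes.** $B^{\prime *}_{+,0}(X):=\{T\in\mathcal{D}^{\prime *}_{L^1}(M_p:X):\lim_{h\to+\infty}\langle T_h,\varphi\rangle=0\ \forall\varphi\in\mathcal{D}^*\}$. $B^{\prime *}_{AP}(X)$, resp. $B^{\prime *}_{AA}(X)$, is the space of $T\in\mathcal{D}^{\prime *}_{L^1}(M_p:X)$ with $T*\varphi\in AP(\mathbb{R}:X)$, resp. $AA(\mathbb{R}:X)$, for all $\varphi\in\mathcal{D}^*$. $B^{\prime *}_{AAP}(X)$, resp. $B^{\prime *}_{AAA}(X)$, is the space of $T\in\mathcal{D}^{\prime *}_{L^1}(M_p:X)$ for which there exist $T_1\in B^{\prime *}_{AP}(X)$, resp. $T_1\in B^{\prime *}_{AA}(X)$, and $Q\in B^{\prime *}_{+,0}(X)$ with $\langle T,\varphi\rangle=\langle T_1,\varphi\rangle+\langle Q,\varphi\rangle$ for all $\varphi\in\mathcal{D}^*_0$.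
   Formalization: (M.2) is taken with the minimum (Komatsu's condition) in place of the printed supremum, which would make it void; and in (i), (ii) the operators P_l(D), P_{r_p}(D) are required to be of *-class, as otherwise P_l(D)f, P_{r_p}(D)f are undefined. *)

theory Defs
  imports "HOL-Complex_Analysis.Complex_Analysis"
begin

section \<open>Complex Banach spaces\<close>

text \<open>The libraries only have real Banach spaces; the underlying real structure is the one of
  class \<open>banach\<close>.\<close>

class complex_banach = banach +
  fixes scaleC :: "complex \<Rightarrow> 'a \<Rightarrow> 'a" (infixr "*\<^sub>C" 75)
  assumes scaleC_add_right: "c *\<^sub>C (x + y) = c *\<^sub>C x + c *\<^sub>C y"
    and scaleC_add_left: "(c + d) *\<^sub>C x = c *\<^sub>C x + d *\<^sub>C x"
    and scaleC_scaleC: "c *\<^sub>C (d *\<^sub>C x) = (c * d) *\<^sub>C x"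
    and scaleC_of_real: "complex_of_real r *\<^sub>C x = r *\<^sub>R x"
    and norm_scaleC: "norm (c *\<^sub>C x) = cmod c * norm x"

instantiation complex :: complex_banach
begin
definition scaleC_complex_def: "c *\<^sub>C (z::complex) = c * z"
instance
proof
  fix c d z w :: complex and r :: real
  show "c *\<^sub>C (z + w) = c *\<^sub>C z + c *\<^sub>C w"
    by (simp only: scaleC_complex_def distrib_left)
  show "(c + d) *\<^sub>C z = c *\<^sub>C z + d *\<^sub>C z"
    by (simp only: scaleC_complex_def distrib_right)
  show "c *\<^sub>C (d *\<^sub>C z) = (c * d) *\<^sub>C z"
    by (simp only: scaleC_complex_def mult.assoc)
  show "complex_of_real r *\<^sub>C z = r *\<^sub>R z"
    by (simp only: scaleC_complex_def scaleR_conv_of_real)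
  show "norm (c *\<^sub>C z) = cmod c * norm z"
    by (simp only: scaleC_complex_def norm_mult)
qed
end

section \<open>Weight sequences\<close>

text \<open>\<open>Beurling\<close> stands for the case (M_p), \<open>Roumieu\<close> for the case {M_p}.
  The index set of the conditions (M.1)--(M.3) is the set of positive integers.\<close>

datatype ultra_case = Beurling | Roumieu

definition cond_M1 :: "(nat \<Rightarrow> real) \<Rightarrow> bool" where
  "cond_M1 M \<longleftrightarrow> (\<forall>p\<ge>1. (M p)\<^sup>2 \<le> M (p + 1) * M (p - 1))"

text \<open>This is Komatsu's stability under ultradifferential operators, with the minimum over the
  products. With a supremum in place of the minimum (a misprint that occurs in the literature) the
  condition would hold for every sequence with \<open>M 0 = 1\<close>, because of the term \<open>i = 0\<close>.\<close>

definition cond_M2 :: "(nat \<Rightarrow> real) \<Rightarrow> bool" where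
  "cond_M2 M \<longleftrightarrow> (\<exists>A>1. \<exists>H>1. \<forall>p\<ge>1. M p \<le> A * H ^ p * (MIN i\<in>{..p}. M i * M (p - i)))"

definition cond_M3' :: "(nat \<Rightarrow> real) \<Rightarrow> bool" where
  "cond_M3' M \<longleftrightarrow> summable (\<lambda>p. M p / M (Suc p))"

text \<open>The summation index is shifted: \<open>q = p + 1 + j\<close>.\<close>

definition cond_M3 :: "(nat \<Rightarrow> real) \<Rightarrow> bool" where
  "cond_M3 M \<longleftrightarrow>
     (\<exists>C. \<forall>p\<ge>1. summable (\<lambda>j. M (p + j) * M (p + 1) / (real p * M p * M (p + 1 + j))) \<and>
        (\<Sum>j. M (p + j) * M (p + 1) / (real p * M p * M (p + 1 + j))) \<le> C)"

definition m_seq :: "(nat \<Rightarrow> real) \<Rightarrow> nat \<Rightarrow> real" where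
  "m_seq M p = M p / M (p - 1)"

section \<open>Smooth functions and test functions\<close>

definition nderiv :: "nat \<Rightarrow> (real \<Rightarrow> 'a::real_normed_vector) \<Rightarrow> real \<Rightarrow> 'a" where
  "nderiv n f = ((\<lambda>g t. vector_derivative g (at t)) ^^ n) f"

definition smooth :: "(real \<Rightarrow> 'a::real_normed_vector) \<Rightarrow> bool" where
  "smooth f \<longleftrightarrow> (\<forall>n t. nderiv n f differentiable (at t))"

definition supp :: "(real \<Rightarrow> 'a::zero) \<Rightarrow> real set" where
  "supp f = closure {t. f t \<noteq> 0}"

definition D_step :: "(nat \<Rightarrow> real) \<Rightarrow> real set \<Rightarrow> real \<Rightarrow> (real \<Rightarrow> complex) set" where
  "D_step M K h = {\<phi>. smooth \<phi> \<and> supp \<phi> \<subseteq> K \<and>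
     bdd_above ((\<lambda>(p, t). h ^ p * cmod (nderiv p \<phi> t) / M p) ` (UNIV \<times> K))}"

definition D_on :: "ultra_case \<Rightarrow> (nat \<Rightarrow> real) \<Rightarrow> real set \<Rightarrow> (real \<Rightarrow> complex) set" where
  "D_on c M K = (case c of Beurling \<Rightarrow> (\<Inter>h\<in>{0<..}. D_step M K h)
                         | Roumieu \<Rightarrow> (\<Union>h\<in>{0<..}. D_step M K h))"

definition D_space :: "ultra_case \<Rightarrow> (nat \<Rightarrow> real) \<Rightarrow> (real \<Rightarrow> complex) set" where
  "D_space c M = (\<Union>K\<in>{K. compact K}. D_on c M K)"

definition D0_space :: "ultra_case \<Rightarrow> (nat \<Rightarrow> real) \<Rightarrow> (real \<Rightarrow> complex) set" where
  "D0_space c M = {\<phi> \<in> D_space c M. supp \<phi> \<subseteq> {0..}}"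

definition E_space :: "ultra_case \<Rightarrow> (nat \<Rightarrow> real) \<Rightarrow> (real \<Rightarrow> 'a::real_normed_vector) set" where
  "E_space c M = {f. smooth f \<and> (\<forall>K. compact K \<longrightarrow>
     (let bd = (\<lambda>h. bdd_above ((\<lambda>(p, t). h ^ p * norm (nderiv p f t) / M p) ` (UNIV \<times> K)))
      in case c of Beurling \<Rightarrow> (\<forall>h>0. bd h) | Roumieu \<Rightarrow> (\<exists>h>0. bd h)))}"

section \<open>Bounded ultradistributions\<close>

definition DL1 :: "(real \<Rightarrow> complex) set" where
  "DL1 = {f. smooth f \<and> (\<forall>j. integrable lborel (nderiv j f))}"

definition DL1_quot :: "(nat \<Rightarrow> real) \<Rightarrow> real \<Rightarrow> (real \<Rightarrow> complex) \<Rightarrow> nat \<Rightarrow> real" where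
  "DL1_quot M h f p = h ^ p * (LINT t|lborel. cmod (nderiv p f t)) / M p"

definition DL1_norm :: "(nat \<Rightarrow> real) \<Rightarrow> real \<Rightarrow> (real \<Rightarrow> complex) \<Rightarrow> real" where
  "DL1_norm M h f = (SUP p. DL1_quot M h f p)"

definition DL1_step :: "(nat \<Rightarrow> real) \<Rightarrow> real \<Rightarrow> (real \<Rightarrow> complex) set" where
  "DL1_step M h = {f \<in> DL1. bdd_above (range (DL1_quot M h f))}"

definition DL1_space :: "ultra_case \<Rightarrow> (nat \<Rightarrow> real) \<Rightarrow> (real \<Rightarrow> complex) set" where
  "DL1_space c M = (case c of Beurling \<Rightarrow> (\<Inter>h\<in>{0<..}. DL1_step M h)
                            | Roumieu \<Rightarrow> (\<Union>h\<in>{0<..}. DL1_step M h))"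

definition seminorm_on :: "(real \<Rightarrow> complex) set \<Rightarrow> ((real \<Rightarrow> complex) \<Rightarrow> real) \<Rightarrow> bool" where
  "seminorm_on E p \<longleftrightarrow>
     (\<forall>\<phi>\<in>E. 0 \<le> p \<phi>) \<and>
     (\<forall>\<phi>\<in>E. \<forall>\<psi>\<in>E. p (\<lambda>t. \<phi> t + \<psi> t) \<le> p \<phi> + p \<psi>) \<and>
     (\<forall>a. \<forall>\<phi>\<in>E. p (\<lambda>t. a * \<phi> t) = cmod a * p \<phi>)"

text \<open>Projective limit: the topology generated by the norms of all steps. Inductive limit: the
  finest locally convex topology for which the inclusions of the steps are continuous, that is, the
  one generated by all seminorms whose restriction to each step is continuous.\<close>

definition DL1_seminorms :: "ultra_case \<Rightarrow> (nat \<Rightarrow> real) \<Rightarrow> ((real \<Rightarrow> complex) \<Rightarrow> real) set" where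
  "DL1_seminorms c M = (case c of
       Beurling \<Rightarrow> {DL1_norm M h |h. h > 0}
     | Roumieu \<Rightarrow> {p. seminorm_on (DL1_space c M) p \<and>
                     (\<forall>h>0. \<exists>C. \<forall>\<phi>\<in>DL1_step M h. p \<phi> \<le> C * DL1_norm M h \<phi>)})"

definition seminorm_open ::
  "(real \<Rightarrow> complex) set \<Rightarrow> ((real \<Rightarrow> complex) \<Rightarrow> real) set \<Rightarrow> (real \<Rightarrow> complex) set \<Rightarrow> bool" where
  "seminorm_open E P U \<longleftrightarrow> U \<subseteq> E \<and>
     (\<forall>\<phi>\<in>U. \<exists>F \<epsilon>. finite F \<and> F \<subseteq> P \<and> 0 < \<epsilon> \<and>
        {\<psi> \<in> E. \<forall>p\<in>F. p (\<lambda>t. \<psi> t - \<phi> t) < \<epsilon>} \<subseteq> U)"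

lemma seminorm_openD:
  assumes "seminorm_open E P U" and "\<phi> \<in> U"
  obtains F \<epsilon> where "finite F" and "F \<subseteq> P" and "0 < \<epsilon>"
    and "{\<psi> \<in> E. \<forall>p\<in>F. p (\<lambda>t. \<psi> t - \<phi> t) < \<epsilon>} \<subseteq> U"
proof -
  have "\<exists>F \<epsilon>. finite F \<and> F \<subseteq> P \<and> 0 < \<epsilon> \<and>
      {\<psi> \<in> E. \<forall>p\<in>F. p (\<lambda>t. \<psi> t - \<phi> t) < \<epsilon>} \<subseteq> U"
    using assms unfolding seminorm_open_def by (elim conjE) (erule (1) bspec)
  then show thesis using that by (elim exE conjE)
qed

lemma seminorm_openI:
  assumes "U \<subseteq> E"
    and "\<And>\<phi>. \<phi> \<in> U \<Longrightarrow> \<exists>F \<epsilon>. finite F \<and> F \<subseteq> P \<and> 0 < \<epsilon> \<and>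
      {\<psi> \<in> E. \<forall>p\<in>F. p (\<lambda>t. \<psi> t - \<phi> t) < \<epsilon>} \<subseteq> U"
  shows "seminorm_open E P U"
  unfolding seminorm_open_def using assms by (intro conjI ballI)

lemma istopology_seminorm_open: "istopology (seminorm_open E P)"
  unfolding istopology_def
proof (intro conjI allI impI)
  fix S T assume S: "seminorm_open E P S" and T: "seminorm_open E P T"
  show "seminorm_open E P (S \<inter> T)"
  proof (rule seminorm_openI)
    show "S \<inter> T \<subseteq> E" using S by (auto simp: seminorm_open_def)
    fix \<phi> assume "\<phi> \<in> S \<inter> T"
    then have \<phi>: "\<phi> \<in> S" "\<phi> \<in> T" by simp_all
    obtain F d where F: "finite F" "F \<subseteq> P" "0 < d"
      "{\<psi> \<in> E. \<forall>p\<in>F. p (\<lambda>t. \<psi> t - \<phi> t) < d} \<subseteq> S"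
      using S \<phi>(1) by (rule seminorm_openD)
    obtain G e where G: "finite G" "G \<subseteq> P" "0 < e"
      "{\<psi> \<in> E. \<forall>p\<in>G. p (\<lambda>t. \<psi> t - \<phi> t) < e} \<subseteq> T"
      using T \<phi>(2) by (rule seminorm_openD)
    have sub: "{\<psi> \<in> E. \<forall>p\<in>F \<union> G. p (\<lambda>t. \<psi> t - \<phi> t) < min d e} \<subseteq> S \<inter> T"
    proof
      fix \<psi> assume "\<psi> \<in> {\<psi> \<in> E. \<forall>p\<in>F \<union> G. p (\<lambda>t. \<psi> t - \<phi> t) < min d e}"
      then have "\<psi> \<in> {\<psi> \<in> E. \<forall>p\<in>F. p (\<lambda>t. \<psi> t - \<phi> t) < d}"
        and "\<psi> \<in> {\<psi> \<in> E. \<forall>p\<in>G. p (\<lambda>t. \<psi> t - \<phi> t) < e}"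
        by simp_all
      with F(4) G(4) show "\<psi> \<in> S \<inter> T" by (intro IntI) (erule (1) subsetD)+
    qed
    have "finite (F \<union> G)" "F \<union> G \<subseteq> P" "0 < min d e"
      using F(1-3) G(1-3) by simp_all
    with sub show "\<exists>F \<epsilon>. finite F \<and> F \<subseteq> P \<and> 0 < \<epsilon> \<and>
        {\<psi> \<in> E. \<forall>p\<in>F. p (\<lambda>t. \<psi> t - \<phi> t) < \<epsilon>} \<subseteq> S \<inter> T"
      by (intro exI[of _ "F \<union> G"] exI[of _ "min d e"] conjI)
  qed
next
  fix \<K> assume K: "\<forall>S\<in>\<K>. seminorm_open E P S"
  show "seminorm_open E P (\<Union>\<K>)"
  proof (rule seminorm_openI)
    show "\<Union>\<K> \<subseteq> E" using K by (auto simp: seminorm_open_def)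
    fix \<phi> assume "\<phi> \<in> \<Union>\<K>"
    then obtain S where S: "S \<in> \<K>" "\<phi> \<in> S" by (rule UnionE)
    obtain F e where F: "finite F" "F \<subseteq> P" "0 < e"
      and sub: "{\<psi> \<in> E. \<forall>p\<in>F. p (\<lambda>t. \<psi> t - \<phi> t) < e} \<subseteq> S"
      using bspec[OF K S(1)] S(2) by (rule seminorm_openD)
    have "{\<psi> \<in> E. \<forall>p\<in>F. p (\<lambda>t. \<psi> t - \<phi> t) < e} \<subseteq> \<Union>\<K>"
      using sub Union_upper[OF S(1)] by (rule subset_trans)
    with F show "\<exists>F \<epsilon>. finite F \<and> F \<subseteq> P \<and> 0 < \<epsilon> \<and>
        {\<psi> \<in> E. \<forall>p\<in>F. p (\<lambda>t. \<psi> t - \<phi> t) < \<epsilon>} \<subseteq> \<Union>\<K>"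
      by (intro exI[of _ F] exI[of _ e] conjI)
  qed
qed

definition DL1_topology :: "ultra_case \<Rightarrow> (nat \<Rightarrow> real) \<Rightarrow> (real \<Rightarrow> complex) topology" where
  "DL1_topology c M = topology (seminorm_open (DL1_space c M) (DL1_seminorms c M))"

definition DL1_bounded :: "ultra_case \<Rightarrow> (nat \<Rightarrow> real) \<Rightarrow> (real \<Rightarrow> complex) set \<Rightarrow> bool" where
  "DL1_bounded c M B \<longleftrightarrow> B \<subseteq> DL1_space c M \<and> (\<forall>p\<in>DL1_seminorms c M. bdd_above (p ` B))"

definition linear_map_on ::
  "(real \<Rightarrow> complex) set \<Rightarrow> ((real \<Rightarrow> complex) \<Rightarrow> 'a::complex_banach) \<Rightarrow> bool" where
  "linear_map_on E T \<longleftrightarrow>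
     (\<forall>\<phi>\<in>E. \<forall>\<psi>\<in>E. T (\<lambda>t. \<phi> t + \<psi> t) = T \<phi> + T \<psi>) \<and>
     (\<forall>a. \<forall>\<phi>\<in>E. T (\<lambda>t. a * \<phi> t) = a *\<^sub>C T \<phi>)"

text \<open>A map is only considered on \<open>DL1_space c M\<close>; its values elsewhere are irrelevant.\<close>

definition DL1_dual ::
  "ultra_case \<Rightarrow> (nat \<Rightarrow> real) \<Rightarrow> ((real \<Rightarrow> complex) \<Rightarrow> 'a::complex_banach) set" where
  "DL1_dual c M = {T. linear_map_on (DL1_space c M) T \<and>
                      continuous_map (DL1_topology c M) euclidean T}"

definition DL1_dual_tendsto :: "ultra_case \<Rightarrow> (nat \<Rightarrow> real) \<Rightarrow>
    (nat \<Rightarrow> (real \<Rightarrow> complex) \<Rightarrow> 'a::complex_banach) \<Rightarrow> ((real \<Rightarrow> complex) \<Rightarrow> 'a) \<Rightarrow> bool" where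
  "DL1_dual_tendsto c M U T \<longleftrightarrow> (\<forall>B. DL1_bounded c M B \<longrightarrow> uniform_limit B U T sequentially)"

definition convol ::
  "((real \<Rightarrow> complex) \<Rightarrow> 'a) \<Rightarrow> (real \<Rightarrow> complex) \<Rightarrow> real \<Rightarrow> 'a" where
  "convol T \<phi> x = T (\<lambda>t. \<phi> (x - t))"

definition translate ::
  "real \<Rightarrow> ((real \<Rightarrow> complex) \<Rightarrow> 'a) \<Rightarrow> (real \<Rightarrow> complex) \<Rightarrow> 'a" where
  "translate h T \<phi> = T (\<lambda>t. \<phi> (t - h))"

text \<open>The Henstock--Kurzweil integral is used because the Bochner integral of the library is
  restricted to separable spaces.\<close>

definition regular :: "(real \<Rightarrow> 'a::complex_banach) \<Rightarrow> (real \<Rightarrow> complex) \<Rightarrow> 'a" where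
  "regular f \<phi> = integral UNIV (\<lambda>t. \<phi> t *\<^sub>C f t)"

section \<open>Ultradifferential operators\<close>

definition ultradiff_class :: "ultra_case \<Rightarrow> (nat \<Rightarrow> real) \<Rightarrow> (nat \<Rightarrow> complex) \<Rightarrow> bool" where
  "ultradiff_class c M a \<longleftrightarrow> (case c of
       Beurling \<Rightarrow> (\<exists>l>0. \<exists>C>0. \<forall>p\<ge>1. cmod (a p) \<le> C * l ^ p / M p)
     | Roumieu \<Rightarrow> (\<forall>l>0. \<exists>C>0. \<forall>p\<ge>1. cmod (a p) \<le> C * l ^ p / M p))"

text \<open>\<open>\<langle>P(D)f, \<phi>\<rangle>\<close> for the operator with coefficients \<open>a\<close>: here \<open>D = -\<i> d/dx\<close>, and the factor
  \<open>(-1) ^ p\<close> comes from moving the derivatives onto the test function.\<close>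

definition ultradiff ::
  "(nat \<Rightarrow> complex) \<Rightarrow> (real \<Rightarrow> 'a::complex_banach) \<Rightarrow> (real \<Rightarrow> complex) \<Rightarrow> 'a" where
  "ultradiff a f \<phi> = (\<Sum>p. (a p * (- \<i>) ^ p * (- 1) ^ p) *\<^sub>C regular f (nderiv p \<phi>))"

text \<open>\<open>S = P(D)f + g\<close>, tested on \<open>\<Phi>\<close>. The expression \<open>P(D)f\<close> is meaningful for operators of the
  class under consideration only; for bounded continuous \<open>f\<close> the class condition makes the
  series for \<open>P(D)f\<close> converge.\<close>

definition ultradiff_repr :: "ultra_case \<Rightarrow> (nat \<Rightarrow> real) \<Rightarrow> (real \<Rightarrow> complex) set \<Rightarrow>
    ((real \<Rightarrow> complex) \<Rightarrow> 'a::complex_banach) \<Rightarrow> (nat \<Rightarrow> complex) \<Rightarrow>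
    (real \<Rightarrow> 'a) \<Rightarrow> (real \<Rightarrow> 'a) \<Rightarrow> bool" where
  "ultradiff_repr c M \<Phi> S a f g \<longleftrightarrow>
     ultradiff_class c M a \<and> (\<forall>\<phi>\<in>\<Phi>. S \<phi> = ultradiff a f \<phi> + regular g \<phi>)"

text \<open>The functions \<open>P_l\<close> and \<open>P_{r_p}\<close>, for a constant and for a general sequence \<open>s\<close>
  respectively. The product runs over the positive integers.\<close>

definition P_fun :: "(nat \<Rightarrow> real) \<Rightarrow> (nat \<Rightarrow> real) \<Rightarrow> complex \<Rightarrow> complex" where
  "P_fun M s z = (1 + z\<^sup>2) *
     (\<Prod>p. 1 + z\<^sup>2 / ((complex_of_real (s (Suc p)))\<^sup>2 * (complex_of_real (m_seq M (Suc p)))\<^sup>2))"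

definition P_coeff :: "(nat \<Rightarrow> real) \<Rightarrow> (nat \<Rightarrow> real) \<Rightarrow> nat \<Rightarrow> complex" where
  "P_coeff M s = fps_nth (fps_expansion (P_fun M s) 0)"

definition P_scales :: "ultra_case \<Rightarrow> (nat \<Rightarrow> real) set" where
  "P_scales c = (case c of
       Beurling \<Rightarrow> {(\<lambda>_. l) |l. l > 0}
     | Roumieu \<Rightarrow> {r. (\<forall>p. r p > 0) \<and> filterlim r at_top sequentially})"

section \<open>Almost periodic and almost automorphic functions\<close>

definition AP :: "(real \<Rightarrow> 'a::real_normed_vector) set" where
  "AP = {f. continuous_on UNIV f \<and>
     (\<forall>\<epsilon>>0. \<exists>l>0. \<forall>a>0. \<exists>\<tau>\<in>{a..a + l}. \<forall>t. norm (f (t + \<tau>) - f t) \<le> \<epsilon>)}"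

definition AA :: "(real \<Rightarrow> 'a::real_normed_vector) set" where
  "AA = {f. continuous_on UNIV f \<and> bounded (range f) \<and>
     (\<forall>b :: nat \<Rightarrow> real. \<exists>r :: nat \<Rightarrow> nat. \<exists>g. strict_mono r \<and>
        (\<forall>t. (\<lambda>n. f (t + b (r n))) \<longlonglongrightarrow> g t) \<and>
        (\<forall>t. (\<lambda>n. g (t - b (r n))) \<longlonglongrightarrow> f t))}"

definition C0_half :: "(real \<Rightarrow> 'a::real_normed_vector) set" where
  "C0_half = {q. continuous_on {0..} q \<and> bounded (q ` {0..}) \<and> (q \<longlongrightarrow> 0) at_top}"

definition asymp :: "(real \<Rightarrow> 'a::real_normed_vector) set \<Rightarrow> (real \<Rightarrow> 'a) set" where
  "asymp G = {f. continuous_on UNIV f \<and> (\<exists>q\<in>C0_half. \<exists>g\<in>G. \<forall>t\<ge>0. f t = g t + q t)}"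

datatype asymp_kind = Periodic | Automorphic

definition kind_fun :: "asymp_kind \<Rightarrow> (real \<Rightarrow> 'a::real_normed_vector) set" where
  "kind_fun k = (case k of Periodic \<Rightarrow> AP | Automorphic \<Rightarrow> AA)"

text \<open>AAP, resp. AAA, and the bounded functions therein.\<close>

definition asymp_fun :: "asymp_kind \<Rightarrow> (real \<Rightarrow> 'a::real_normed_vector) set" where
  "asymp_fun k = asymp (kind_fun k)"

definition bdd_asymp_fun :: "asymp_kind \<Rightarrow> (real \<Rightarrow> 'a::real_normed_vector) set" where
  "bdd_asymp_fun k = {f \<in> asymp_fun k. bounded (range f)}"

section \<open>The corresponding ultradistributions\<close>

definition B_plus0 ::
  "ultra_case \<Rightarrow> (nat \<Rightarrow> real) \<Rightarrow> ((real \<Rightarrow> complex) \<Rightarrow> 'a::complex_banach) set" where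
  "B_plus0 c M = {T \<in> DL1_dual c M. \<forall>\<phi>\<in>D_space c M. ((\<lambda>h. translate h T \<phi>) \<longlongrightarrow> 0) at_top}"

text \<open>\<open>B_kind\<close> is B'_AP, resp. B'_AA, and \<open>B_asymp\<close> is B'_AAP, resp. B'_AAA.\<close>

definition B_kind :: "asymp_kind \<Rightarrow> ultra_case \<Rightarrow> (nat \<Rightarrow> real) \<Rightarrow>
    ((real \<Rightarrow> complex) \<Rightarrow> 'a::complex_banach) set" where
  "B_kind k c M = {T \<in> DL1_dual c M. \<forall>\<phi>\<in>D_space c M. convol T \<phi> \<in> kind_fun k}"

definition B_asymp :: "asymp_kind \<Rightarrow> ultra_case \<Rightarrow> (nat \<Rightarrow> real) \<Rightarrow>
    ((real \<Rightarrow> complex) \<Rightarrow> 'a::complex_banach) set" where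
  "B_asymp k c M = {T \<in> DL1_dual c M. \<exists>T1\<in>B_kind k c M. \<exists>Q\<in>B_plus0 c M.
     \<forall>\<phi>\<in>D0_space c M. T \<phi> = T1 \<phi> + Q \<phi>}"

definition eq_half :: "ultra_case \<Rightarrow> (nat \<Rightarrow> real) \<Rightarrow>
    ((real \<Rightarrow> complex) \<Rightarrow> 'a) \<Rightarrow> ((real \<Rightarrow> complex) \<Rightarrow> 'a) \<Rightarrow> bool" where
  "eq_half c M S T \<longleftrightarrow> (\<forall>\<phi>\<in>D0_space c M. S \<phi> = T \<phi>)"

section \<open>The ten assertions\<close>

context
  fixes k :: asymp_kind and c :: ultra_case and M :: "nat \<Rightarrow> real"
    and T :: "(real \<Rightarrow> complex) \<Rightarrow> 'a::complex_banach"
begin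

definition assertion_i :: bool where
  "assertion_i \<longleftrightarrow> (\<exists>S\<in>DL1_dual c M. \<exists>s\<in>P_scales c.
     \<exists>f\<in>bdd_asymp_fun k. \<exists>g\<in>bdd_asymp_fun k.
       ultradiff_repr c M (DL1_space c M) S (P_coeff M s) f g \<and> eq_half c M S T)"

definition assertion_ii :: bool where
  "assertion_ii \<longleftrightarrow> (\<exists>s\<in>P_scales c. \<exists>f\<in>bdd_asymp_fun k. \<exists>g\<in>bdd_asymp_fun k.
     ultradiff_repr c M (D0_space c M) T (P_coeff M s) f g)"

definition assertion_iii :: bool where
  "assertion_iii \<longleftrightarrow> (\<exists>a. \<exists>f1\<in>bdd_asymp_fun k. \<exists>f2\<in>bdd_asymp_fun k.
     ultradiff_repr c M (D0_space c M) T a f1 f2)"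

definition assertion_iv :: bool where
  "assertion_iv \<longleftrightarrow> (\<exists>S\<in>DL1_dual c M. \<exists>a.
     \<exists>f1\<in>bdd_asymp_fun k. \<exists>f2\<in>bdd_asymp_fun k.
       ultradiff_repr c M (DL1_space c M) S a f1 f2 \<and> eq_half c M S T)"

definition assertion_v :: bool where
  "assertion_v \<longleftrightarrow> T \<in> B_asymp k c M \<and>
     (\<exists>S\<in>DL1_dual c M. \<exists>a. \<exists>f1\<in>bdd_asymp_fun k. \<exists>f2\<in>bdd_asymp_fun k.
       ultradiff_repr c M (DL1_space c M) S a f1 f2 \<and> eq_half c M S T)"

definition assertion_vi :: bool where
  "assertion_vi \<longleftrightarrow> T \<in> B_asymp k c M \<and>
     (\<exists>S\<in>DL1_dual c M. eq_half c M S T \<and> (\<forall>\<phi>\<in>D_space c M. convol S \<phi> \<in> asymp_fun k))"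

definition assertion_vii :: bool where
  "assertion_vii \<longleftrightarrow> T \<in> B_asymp k c M"

definition assertion_viii :: bool where
  "assertion_viii \<longleftrightarrow> (\<forall>\<phi>\<in>D0_space c M. convol T \<phi> \<in> asymp_fun k)"

text \<open>\<open>U n\<close> is the element of the dual space that is identified with the function \<open>u n\<close>. As the
  latter may be unbounded near minus infinity, the identification is tested on compactly supported
  functions.\<close>

definition assertion_ix :: bool where
  "assertion_ix \<longleftrightarrow> (\<exists>u U.
     (\<forall>n. u n \<in> E_space c M \<inter> asymp_fun k \<and> U n \<in> DL1_dual c M \<and>
          (\<forall>\<phi>\<in>D_space c M. U n \<phi> = regular (u n) \<phi>)) \<and>
     DL1_dual_tendsto c M U T)"

definition assertion_x :: bool where
  "assertion_x \<longleftrightarrow> (\<forall>\<phi>\<in>D_space c M. convol T \<phi> \<in> asymp_fun k)"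

end

end

theory Submission
  imports Defs "HOL-Library.Diagonal_Subsequence"
begin

text \<open>
  All assertions are compared with the last one, \<open>T * \<phi> \<in> \<A>\<close> for all test functions \<open>\<phi>\<close> with
  compact support, which for reflected \<open>\<phi>\<close> says that the orbit \<open>x \<mapsto> \<langle>T\<^sub>x, \<phi>\<rangle>\<close> of \<open>T\<close> under
  translations belongs to the class \<open>\<A>\<close>. Three properties of \<open>\<A>\<close> are responsible for the theorem.
  It only depends on the behaviour near plus infinity; it is closed under limits that are uniform
  on a half-line (\<open>asymp_fun_uniform_limit\<close>); and the almost periodic or almost automorphic part of
  a function in \<open>\<A>\<close> is unique and bounded by the function near plus infinity, because such a part
  comes back close to each of its values arbitrarily late (\<open>kind_fun_norm_le_tail\<close>).

  \<^item> If \<open>T = P(D)f\<^sub>1 + f\<^sub>2\<close> on the half-line, then far translates of \<open>\<phi>\<close> only see the right-hand side,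
    whose orbit is a uniformly convergent series of convolutions of \<open>f\<^sub>1\<close> and \<open>f\<^sub>2\<close> with test functions
    (\<open>asymp_fun_translate_ultradiff\<close>, \<open>assertion_iv_imp_x\<close>). The same translation argument reduces
    \<open>\<phi>\<close> to support in \<open>[0, \<infinity>)\<close> (\<open>assertion_viii_imp_x\<close>).
  \<^item> Compactly supported test functions are dense (\<open>D_space_dense\<close>), so the assertion extends to the
    orbits of all \<open>\<phi>\<close> in the test space of bounded ultradistributions. Sending \<open>\<phi>\<close> to the value at
    \<open>0\<close> of the recurrent part of its orbit defines \<open>T\<^sub>1\<close>; uniqueness makes it linear and compatible
    with translations, the bound makes it continuous, and \<open>Q = T - T\<^sub>1\<close> vanishes at infinity
    (\<open>assertion_x_imp_vii\<close>).
  \<^item> Convolution with a mollifier approximates \<open>T\<close> by smooth orbits of \<open>T\<close>, uniformly on bounded sets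
    of test functions (\<open>assertion_x_imp_ix\<close>); conversely the translates of one \<open>\<phi>\<close> form a bounded
    set, so that approximation of \<open>T\<close> is uniform approximation of its orbits (\<open>assertion_ix_imp_x\<close>).
  \<^item> Under (M.3), in the Beurling case, \<open>f\<close> with \<open>P\<^sub>l(D)f = T\<close> is found by pairing \<open>T\<close> with the
    translates of a fundamental solution. Formally \<open>P\<^sub>l(D)\<close> is the product of the operators
    \<open>1 - (l m\<^sub>p)\<^sup>-\<^sup>2 (d/dx)\<^sup>2\<close>, each inverted by convolution with a Laplace density
    (\<open>conv_laplace_inverse\<close>), so the fundamental solution is an infinite convolution of probability
    densities (\<open>parametrix\<close>). The \<open>L\<^sup>1\<close> norm of its \<open>p\<close>-th derivative is at most
    \<open>(2 l)\<^sup>p M\<^sub>p\<close>, and for small \<open>l\<close> this is within the range of continuity of \<open>T\<close>. Only mollified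
    versions are test functions; the
    additional factor \<open>1 + x\<^sup>2\<close> in \<open>P\<^sub>l\<close> makes them converge in norm, hence makes their orbits converge
    uniformly, to an \<open>f\<close> in \<open>\<A>\<close> (\<open>assertion_x_imp_i\<close>). Condition (M.3) enters through the Taylor
    coefficients of \<open>P\<^sub>l\<close>: by Cauchy's estimate at the radii \<open>l m\<^sub>k\<close> it puts \<open>P\<^sub>l(D)\<close> into the class
    (\<open>canonical_product_growth\<close>).

  The same mechanism of infinite convolution (\<open>infinite_convolution\<close>), with boxes in place of Laplace
  densities, produces the compactly supported test functions from (M.3').
\<close>

section \<open>Iterated derivatives\<close>

lemma nderiv_0 [simp]: "nderiv 0 f = f"
  by (simp add: nderiv_def)

lemma nderiv_Suc: "nderiv (Suc n) f t = vector_derivative (nderiv n f) (at t)"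
  by (simp add: nderiv_def)

lemma nderiv_nderiv: "nderiv m (nderiv n f) = nderiv (m + n) f"
  by (simp add: nderiv_def funpow_add)

lemma smooth_has_vector_derivative:
  "smooth f \<Longrightarrow> (nderiv n f has_vector_derivative nderiv (Suc n) f t) (at t)"
  by (simp add: nderiv_Suc smooth_def vector_derivative_works[symmetric])

lemma smooth_nderiv: "smooth f \<Longrightarrow> smooth (nderiv n f)"
  by (simp add: smooth_def nderiv_nderiv)

lemma smooth_by_derivatives:
  assumes "F 0 = f" and "\<And>n t. (F n has_vector_derivative F (Suc n) t) (at t)"
  shows "smooth f" and "nderiv n f = F n"
proof -
  have eq: "nderiv n f = F n" for n
  proof (induction n)
    case (Suc n)
    show ?case
      using vector_derivative_at[OF assms(2)[of n]] by (auto simp: nderiv_Suc Suc)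
  qed (simp add: assms(1))
  show "nderiv n f = F n" by (rule eq)
  show "smooth f" unfolding smooth_def eq
    using assms(2) by (blast intro: differentiableI_vector)
qed

lemma smooth_continuous_on: "smooth f \<Longrightarrow> continuous_on A (nderiv n f)"
  unfolding smooth_def
  by (meson continuous_at_imp_continuous_on differentiable_imp_continuous_within)

lemma smooth_measurable: 
  fixes f :: "real \<Rightarrow> 'a::{real_normed_vector,second_countable_topology}"
  shows "smooth f \<Longrightarrow> nderiv n f \<in> borel_measurable borel"
  by (intro borel_measurable_continuous_onI smooth_continuous_on)

lemma nderiv_add:
  assumes "smooth f" "smooth g"
  shows "smooth (\<lambda>t. f t + g t)" and "nderiv n (\<lambda>t. f t + g t) = (\<lambda>t. nderiv n f t + nderiv n g t)"
  by (rule smooth_by_derivatives[where F = "\<lambda>n t. nderiv n f t + nderiv n g t"];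
      auto intro!: derivative_eq_intros smooth_has_vector_derivative assms)+

lemma nderiv_cmult:
  fixes f :: "real \<Rightarrow> complex"
  assumes "smooth f"
  shows "smooth (\<lambda>t. a * f t)" and "nderiv n (\<lambda>t. a * f t) = (\<lambda>t. a * nderiv n f t)"
  by (rule smooth_by_derivatives[where F = "\<lambda>n t. a * nderiv n f t"];
      auto intro!: has_vector_derivative_mult_right smooth_has_vector_derivative assms)+

lemma nderiv_affine:
  fixes \<alpha> \<beta> :: real
  assumes "smooth f"
  shows "smooth (\<lambda>t. f (\<alpha> * t + \<beta>))"
    and "nderiv n (\<lambda>t. f (\<alpha> * t + \<beta>)) = (\<lambda>t. \<alpha> ^ n *\<^sub>R nderiv n f (\<alpha> * t + \<beta>))"
proof -
  have *: "((\<lambda>t. \<alpha> ^ n *\<^sub>R nderiv n f (\<alpha> * t + \<beta>)) has_vector_derivative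
      \<alpha> ^ Suc n *\<^sub>R nderiv (Suc n) f (\<alpha> * t + \<beta>)) (at t)" for n t
  proof -
    have "((\<lambda>t. \<alpha> * t + \<beta>) has_vector_derivative \<alpha>) (at t)"
      by (auto intro!: derivative_eq_intros)
    from vector_diff_chain_at[OF this, of "nderiv n f", OF smooth_has_vector_derivative[OF assms]]
    have "((\<lambda>t. nderiv n f (\<alpha> * t + \<beta>)) has_vector_derivative \<alpha> *\<^sub>R nderiv (Suc n) f (\<alpha> * t + \<beta>)) (at t)"
      by (simp add: o_def)
    from has_vector_derivative_scaleR[OF DERIV_const this, of "\<alpha> ^ n"] show ?thesis by (simp add: mult.commute)
  qed
  show "smooth (\<lambda>t. f (\<alpha> * t + \<beta>))"
    by (rule smooth_by_derivatives[where F = "\<lambda>n t. \<alpha> ^ n *\<^sub>R nderiv n f (\<alpha> * t + \<beta>)", OF _ *]) simp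
  show "nderiv n (\<lambda>t. f (\<alpha> * t + \<beta>)) = (\<lambda>t. \<alpha> ^ n *\<^sub>R nderiv n f (\<alpha> * t + \<beta>))"
    by (rule smooth_by_derivatives[where F = "\<lambda>n t. \<alpha> ^ n *\<^sub>R nderiv n f (\<alpha> * t + \<beta>)", OF _ *]) simp
qed

lemma binomial_sum_Suc:
  fixes x y :: "nat \<Rightarrow> 'a::comm_ring_1"
  shows "(\<Sum>j\<le>Suc n. of_nat (Suc n choose j) * x j * y (Suc n - j)) =
    (\<Sum>j\<le>n. of_nat (n choose j) * (x (Suc j) * y (n - j) + x j * y (Suc n - j)))"
proof -
  have 1: "(\<Sum>j\<le>n. of_nat (n choose j) * x j * y (Suc n - j)) =
      x 0 * y (Suc n) + (\<Sum>j\<le>n. of_nat (n choose Suc j) * x (Suc j) * y (n - j))"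
  proof -
    have "(\<Sum>j\<le>n. of_nat (n choose j) * x j * y (Suc n - j)) =
        (\<Sum>j\<le>Suc n. of_nat (n choose j) * x j * y (Suc n - j))"
      by (simp add: binomial_eq_0)
    also have "\<dots> = x 0 * y (Suc n) + (\<Sum>j\<le>n. of_nat (n choose Suc j) * x (Suc j) * y (n - j))"
      by (subst sum.atMost_Suc_shift) (simp add: binomial_eq_0 del: sum.atMost_Suc)
    finally show ?thesis .
  qed
  have "(\<Sum>j\<le>Suc n. of_nat (Suc n choose j) * x j * y (Suc n - j)) =
      x 0 * y (Suc n) + (\<Sum>j\<le>n. of_nat (n choose j) * x (Suc j) * y (n - j))
        + (\<Sum>j\<le>n. of_nat (n choose Suc j) * x (Suc j) * y (n - j))"
    by (subst sum.atMost_Suc_shift) (simp add: sum.distrib algebra_simps del: sum.atMost_Suc)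
  then show ?thesis
    using 1 by (simp add: sum.distrib algebra_simps)
qed

lemma nderiv_mult:
  fixes f g :: "real \<Rightarrow> complex"
  assumes "smooth f" "smooth g"
  shows "smooth (\<lambda>t. f t * g t)"
    and "nderiv n (\<lambda>t. f t * g t) = (\<lambda>t. \<Sum>j\<le>n. of_nat (n choose j) * nderiv j f t * nderiv (n - j) g t)"
proof -
  let ?F = "\<lambda>n t. \<Sum>j\<le>n. of_nat (n choose j) * nderiv j f t * nderiv (n - j) g t"
  have *: "(?F n has_vector_derivative ?F (Suc n) t) (at t)" for n t
  proof -
    have "(?F n has_vector_derivative (\<Sum>j\<le>n. of_nat (n choose j) *
       (nderiv (Suc j) f t * nderiv (n - j) g t + nderiv j f t * nderiv (Suc n - j) g t))) (at t)"
    proof (rule has_vector_derivative_sum)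
      fix j assume "j \<in> {..n}"
      then have j: "Suc (n - j) = Suc n - j" by auto
      have "((\<lambda>t. nderiv j f t * nderiv (n - j) g t) has_vector_derivative
          (nderiv j f t * nderiv (Suc n - j) g t + nderiv (Suc j) f t * nderiv (n - j) g t)) (at t)"
        using has_vector_derivative_mult[OF smooth_has_vector_derivative[OF assms(1), of j t]
          smooth_has_vector_derivative[OF assms(2), of "n - j" t]] j by simp
      from has_vector_derivative_mult_right[OF this, of "of_nat (n choose j)"]
      show "((\<lambda>t. of_nat (n choose j) * nderiv j f t * nderiv (n - j) g t) has_vector_derivative
        of_nat (n choose j) *
       (nderiv (Suc j) f t * nderiv (n - j) g t + nderiv j f t * nderiv (Suc n - j) g t)) (at t)"
        by (simp add: algebra_simps)
    qed
    then show ?thesis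
      by (subst binomial_sum_Suc[of n "\<lambda>j. nderiv j f t" "\<lambda>j. nderiv j g t"])
  qed
  show "smooth (\<lambda>t. f t * g t)"
    by (rule smooth_by_derivatives[where F = ?F, OF _ *]) simp
  show "nderiv n (\<lambda>t. f t * g t) = ?F n"
    by (rule smooth_by_derivatives[where F = ?F, OF _ *]) simp
qed

section \<open>The norm of \<open>L\<^sup>1\<close> and smooth functions with integrable derivatives\<close>

definition L1 :: "(real \<Rightarrow> complex) \<Rightarrow> real" where
  "L1 f = (LINT t|lborel. cmod (f t))"

lemma L1_nonneg: "0 \<le> L1 f"
  by (simp add: L1_def)

lemma L1_triangle:
  assumes "integrable lborel f" "integrable lborel g"
  shows "L1 (\<lambda>t. f t + g t) \<le> L1 f + L1 g"
proof -
  have "L1 (\<lambda>t. f t + g t) \<le> (LINT t|lborel. cmod (f t) + cmod (g t))"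
    unfolding L1_def using assms by (intro integral_mono) (auto intro: norm_triangle_ineq)
  also have "\<dots> = L1 f + L1 g" unfolding L1_def using assms by simp
  finally show ?thesis .
qed

lemma L1_triangle_diff:
  assumes "integrable lborel f" "integrable lborel g"
  shows "L1 (\<lambda>t. f t - g t) \<le> L1 f + L1 g"
  using L1_triangle[of f "\<lambda>t. - g t"] assms by (simp add: L1_def)

lemma L1_cmult: "L1 (\<lambda>t. a * f t) = cmod a * L1 f"
  by (simp add: L1_def norm_mult)

lemma L1_affine:
  assumes "\<alpha> \<noteq> 0"
  shows "L1 (\<lambda>t. f (\<alpha> * t + \<beta>)) = L1 f / \<bar>\<alpha>\<bar>"
  using lborel_integral_real_affine[OF assms, of "\<lambda>t. cmod (f t)" \<beta>] assms
  by (simp add: L1_def field_simps)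

lemma L1_shift: "L1 (\<lambda>t. f (t - y)) = L1 f"
  using L1_affine[of 1 f "- y"] by simp

lemma integrable_shift:
  "integrable lborel f \<Longrightarrow> integrable lborel (\<lambda>t::real. f (t - y) :: complex)"
  using lborel_integrable_real_affine[of f 1 "- y"] by simp

lemma DL1_smooth: "\<phi> \<in> DL1 \<Longrightarrow> smooth \<phi>"
  and DL1_integrable: "\<phi> \<in> DL1 \<Longrightarrow> integrable lborel (nderiv p \<phi>)"
  by (auto simp: DL1_def)

lemma DL1_integrable0: "\<phi> \<in> DL1 \<Longrightarrow> integrable lborel \<phi>"
  using DL1_integrable[of \<phi> 0] by simp

lemma DL1_nderiv: "\<phi> \<in> DL1 \<Longrightarrow> nderiv p \<phi> \<in> DL1"
  by (auto simp: DL1_def smooth_nderiv nderiv_nderiv)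

lemma DL1_add: "\<phi> \<in> DL1 \<Longrightarrow> \<psi> \<in> DL1 \<Longrightarrow> (\<lambda>t. \<phi> t + \<psi> t) \<in> DL1"
  by (auto simp: DL1_def nderiv_add)

lemma DL1_cmult: "\<phi> \<in> DL1 \<Longrightarrow> (\<lambda>t. a * \<phi> t) \<in> DL1"
  by (auto simp: DL1_def nderiv_cmult)

lemma DL1_diff: "\<phi> \<in> DL1 \<Longrightarrow> \<psi> \<in> DL1 \<Longrightarrow> (\<lambda>t. \<phi> t - \<psi> t) \<in> DL1"
  using DL1_add[OF _ DL1_cmult, of \<phi> \<psi> "-1"] by simp

lemma nderiv_diff:
  fixes \<phi> \<psi> :: "real \<Rightarrow> complex"
  assumes "smooth \<phi>" "smooth \<psi>"
  shows "nderiv p (\<lambda>t. \<phi> t - \<psi> t) = (\<lambda>t. nderiv p \<phi> t - nderiv p \<psi> t)"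
  using nderiv_add(2)[OF assms(1) nderiv_cmult(1)[OF assms(2), of "-1"], of p]
    nderiv_cmult(2)[OF assms(2), of p "-1"]
  by (simp add: fun_eq_iff)

lemma DL1_affine:
  assumes "\<phi> \<in> DL1" "\<alpha> \<noteq> 0"
  shows "(\<lambda>t. \<phi> (\<alpha> * t + \<beta>)) \<in> DL1"
  unfolding DL1_def mem_Collect_eq nderiv_affine(2)[OF DL1_smooth[OF assms(1)]]
proof (intro conjI allI integrable_scaleR_right)
  fix j
  show "integrable lborel (\<lambda>t. nderiv j \<phi> (\<alpha> * t + \<beta>))"
    using lborel_integrable_real_affine[OF DL1_integrable[OF assms(1)] assms(2), of j \<beta>]
    by (simp add: add.commute)
qed (rule nderiv_affine(1)[OF DL1_smooth[OF assms(1)]])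

lemma L1_nderiv_affine:
  assumes "\<phi> \<in> DL1" "\<alpha> \<noteq> 0"
  shows "L1 (nderiv p (\<lambda>t. \<phi> (\<alpha> * t + \<beta>))) = \<bar>\<alpha>\<bar> ^ p / \<bar>\<alpha>\<bar> * L1 (nderiv p \<phi>)"
proof -
  have "L1 (nderiv p (\<lambda>t. \<phi> (\<alpha> * t + \<beta>))) = L1 (\<lambda>t. complex_of_real (\<alpha> ^ p) * nderiv p \<phi> (\<alpha> * t + \<beta>))"
    by (simp add: nderiv_affine(2)[OF DL1_smooth[OF assms(1)]] scaleR_conv_of_real)
  also have "\<dots> = \<bar>\<alpha>\<bar> ^ p * L1 (\<lambda>t. nderiv p \<phi> (\<alpha> * t + \<beta>))"
    by (subst L1_cmult) (simp only: norm_of_real power_abs)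
  also have "\<dots> = \<bar>\<alpha>\<bar> ^ p / \<bar>\<alpha>\<bar> * L1 (nderiv p \<phi>)"
    using L1_affine[OF assms(2), of "nderiv p \<phi>" \<beta>] by simp
  finally show ?thesis .
qed

lemma increment_le_L1:
  fixes F F' :: "real \<Rightarrow> complex"
  assumes F: "\<And>x. (F has_vector_derivative F' x) (at x)"
    and F': "continuous_on UNIV F'" "integrable lborel F'"
  shows "cmod (F x - F y) \<le> L1 F'"
proof -
  have *: "cmod (F b - F a) \<le> L1 F'" if "a \<le> b" for a b
  proof -
    have "F b - F a = (LINT x|lborel. indicator {a..b} x *\<^sub>R F' x)"
      by (rule integral_FTC_Icc[symmetric])
        (use that F' in \<open>auto intro!: has_vector_derivative_at_within F intro: continuous_on_subset\<close>)
    also have "cmod \<dots> \<le> (LINT x|lborel. cmod (indicator {a..b} x *\<^sub>R F' x))"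
      by (rule integral_norm_bound)
    also have "\<dots> \<le> L1 F'"
      unfolding L1_def
      by (intro integral_mono integrable_norm integrable_mult_indicator F'(2))
        (auto simp: indicator_def)
    finally show ?thesis .
  qed
  show ?thesis
    using *[of x y] *[of y x] by (cases "x \<le> y") (auto simp: norm_minus_commute)
qed

text \<open>A primitive of an integrable function that is itself integrable vanishes at infinity along some
  sequence, so increments bound values.\<close>

lemma DL1_sup_bound:
  assumes "\<phi> \<in> DL1"
  shows "cmod (nderiv p \<phi> x) \<le> L1 (nderiv (Suc p) \<phi>)"
proof (rule field_le_epsilon)
  fix e :: real assume e: "e > 0"
  let ?f = "nderiv p \<phi>"
  have "\<exists>y. cmod (?f y) < e"
  proof (rule ccontr)
    assume "\<nexists>y. cmod (?f y) < e"
    then have "e \<le> cmod (?f y)" for y by (meson not_le)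
    then have "integrable lborel (\<lambda>y::real. e)"
      using e by (intro Bochner_Integration.integrable_bound[OF DL1_integrable[OF assms, of p]]) auto
    then show False using e by (auto simp: integrable_iff_bounded)
  qed
  then obtain y where y: "cmod (?f y) < e" by blast
  have "cmod (?f x - ?f y) \<le> L1 (nderiv (Suc p) \<phi>)"
    using DL1_smooth[OF assms]
    by (intro increment_le_L1 smooth_has_vector_derivative smooth_continuous_on DL1_integrable[OF assms])
  then show "cmod (?f x) \<le> L1 (nderiv (Suc p) \<phi>) + e"
    using y norm_triangle_sub[of "?f x" "?f y"] by linarith
qed

section \<open>Convolution with an integrable kernel\<close>

definition conv :: "(real \<Rightarrow> complex) \<Rightarrow> (real \<Rightarrow> complex) \<Rightarrow> real \<Rightarrow> complex" where
  "conv k \<phi> s = (LINT t|lborel. k t * \<phi> (s - t))"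

lemma conv_integrable:
  assumes "integrable lborel k" "\<phi> \<in> borel_measurable borel" "\<And>x. cmod (\<phi> x) \<le> B"
  shows "integrable lborel (\<lambda>t. k t * \<phi> (s - t))"
proof (rule Bochner_Integration.integrable_bound)
  show "integrable lborel (\<lambda>t. B * cmod (k t))" using assms by simp
  show "(\<lambda>t. k t * \<phi> (s - t)) \<in> borel_measurable lborel"
    using assms by (simp add: borel_measurable_integrable)
  have "0 \<le> B" using assms(3)[of 0] norm_ge_zero order_trans by blast
  then show "AE t in lborel. norm (k t * \<phi> (s - t)) \<le> norm (B * cmod (k t))"
    using assms(3) by (auto simp: norm_mult mult.commute[of B] intro!: mult_left_mono)
qed

lemma conv_integrable_DL1:
  assumes "integrable lborel k" "\<phi> \<in> DL1"
  shows "integrable lborel (\<lambda>t. k t * nderiv p \<phi> (s - t))"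
  using DL1_sup_bound[OF assms(2)] smooth_measurable[OF DL1_smooth[OF assms(2)]]
  by (intro conv_integrable[OF assms(1), of _ "L1 (nderiv (Suc p) \<phi>)"])

text \<open>A form of differentiability that survives integration and continuous linear maps, because it
  is a single inequality.\<close>

lemma quadratic_remainder_has_vector_derivative:
  assumes "\<And>\<delta>. norm (f (s + \<delta>) - f s - \<delta> *\<^sub>R d) \<le> C * \<delta>\<^sup>2"
  shows "(f has_vector_derivative d) (at s)"
  unfolding has_vector_derivative_def has_derivative_at
proof (intro conjI bounded_linear_scaleR_left)
  show "(\<lambda>h. norm (f (s + h) - f s - h *\<^sub>R d) / norm h) \<midarrow>0\<rightarrow> 0"
  proof (rule tendsto_sandwich[of "\<lambda>_. 0" _ _ "\<lambda>h. C * \<bar>h\<bar>"])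
    show "\<forall>\<^sub>F h in at 0. norm (f (s + h) - f s - h *\<^sub>R d) / norm h \<le> C * \<bar>h\<bar>"
    proof (intro always_eventually allI)
      fix h :: real
      show "norm (f (s + h) - f s - h *\<^sub>R d) / norm h \<le> C * \<bar>h\<bar>"
        using assms[of h] by (cases "h = 0") (auto simp: divide_simps power2_eq_square mult.assoc)
    qed
    show "((\<lambda>h. C * \<bar>h\<bar>) \<longlongrightarrow> 0) (at 0)"
      by (auto intro!: tendsto_eq_intros)
  qed auto
qed

lemma smooth_quadratic_remainder:
  fixes \<phi> :: "real \<Rightarrow> complex"
  assumes "smooth \<phi>" "\<And>t. cmod (nderiv (Suc (Suc p)) \<phi> t) \<le> B"
  shows "cmod (nderiv p \<phi> (x + \<delta>) - nderiv p \<phi> x - \<delta> *\<^sub>R nderiv (Suc p) \<phi> x) \<le> B * \<delta>\<^sup>2"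
proof -
  let ?S = "closed_segment x (x + \<delta>)"
  have lip: "norm (nderiv (Suc p) \<phi> y - nderiv (Suc p) \<phi> x) \<le> B * \<bar>\<delta>\<bar>" if "y \<in> ?S" for y
  proof -
    have "norm (nderiv (Suc p) \<phi> y - nderiv (Suc p) \<phi> x) \<le> B * norm (y - x)"
    proof (rule differentiable_bound[of UNIV _ "\<lambda>z r. r *\<^sub>R nderiv (Suc (Suc p)) \<phi> z"])
      show "(nderiv (Suc p) \<phi> has_derivative (\<lambda>r. r *\<^sub>R nderiv (Suc (Suc p)) \<phi> z)) (at z within UNIV)" for z
        using smooth_has_vector_derivative[OF assms(1)] by (simp add: has_vector_derivative_def)
      show "onorm (\<lambda>r. r *\<^sub>R nderiv (Suc (Suc p)) \<phi> z) \<le> B" for z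
        using assms(2)[of z] by (subst onorm_scaleR_left) (auto simp: onorm_id)
    qed auto
    moreover have "norm (y - x) \<le> \<bar>\<delta>\<bar>"
      using that segment_bound[of y x "x + \<delta>"] by simp
    moreover have "0 \<le> B" using assms(2)[of 0] norm_ge_zero order_trans by blast
    ultimately show ?thesis by (meson mult_left_mono order_trans)
  qed
  have "norm (nderiv p \<phi> (x + \<delta>) - nderiv p \<phi> x - (x + \<delta> - x) *\<^sub>R nderiv (Suc p) \<phi> x) \<le> norm (x + \<delta> - x) * (B * \<bar>\<delta>\<bar>)"
    by (rule vector_differentiable_bound_linearization[of ?S])
      (auto intro!: has_vector_derivative_at_within smooth_has_vector_derivative assms(1) lip)
  moreover have "norm (x + \<delta> - x) * (B * \<bar>\<delta>\<bar>) = B * \<delta>\<^sup>2"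
    by (simp only: add_diff_cancel_left' real_norm_def power2_eq_square) (simp add: mult.left_commute)
  ultimately show ?thesis by (simp only: add_diff_cancel_left')
qed

lemma conv_has_vector_derivative:
  assumes k: "integrable lborel k" and \<phi>: "\<phi> \<in> DL1"
  shows "(conv k (nderiv p \<phi>) has_vector_derivative conv k (nderiv (Suc p) \<phi>) s) (at s)"
proof (rule quadratic_remainder_has_vector_derivative[where C = "L1 k * L1 (nderiv (Suc (Suc (Suc p))) \<phi>)"])
  fix \<delta> :: real
  let ?B = "L1 (nderiv (Suc (Suc (Suc p))) \<phi>)"
  let ?r = "\<lambda>t. nderiv p \<phi> (s + \<delta> - t) - nderiv p \<phi> (s - t) - \<delta> *\<^sub>R nderiv (Suc p) \<phi> (s - t)"
  have r: "cmod (?r t) \<le> ?B * \<delta>\<^sup>2" for t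
    using smooth_quadratic_remainder[OF DL1_smooth[OF \<phi>] DL1_sup_bound[OF \<phi>], of p "s - t" \<delta>]
    by (simp add: algebra_simps)
  have eq: "k t * ?r t = k t * nderiv p \<phi> (s + \<delta> - t) - k t * nderiv p \<phi> (s - t)
      - \<delta> *\<^sub>R (k t * nderiv (Suc p) \<phi> (s - t))" for t
    by (simp add: algebra_simps scaleR_conv_of_real)
  note int = conv_integrable_DL1[OF k \<phi>]
  have int': "integrable lborel (\<lambda>t. k t * ?r t)"
    unfolding eq by (intro Bochner_Integration.integrable_diff integrable_scaleR_right int)
  have lhs: "conv k (nderiv p \<phi>) (s + \<delta>) - conv k (nderiv p \<phi>) s - \<delta> *\<^sub>R conv k (nderiv (Suc p) \<phi>) s
      = (LINT t|lborel. k t * ?r t)"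
    unfolding conv_def eq
    unfolding Bochner_Integration.integral_diff[OF Bochner_Integration.integrable_diff[OF int int] integrable_scaleR_right[OF int]]
      Bochner_Integration.integral_diff[OF int int] integral_scaleR_right ..
  have "cmod (LINT t|lborel. k t * ?r t) \<le> (LINT t|lborel. cmod (k t * ?r t))" 
    by (rule integral_norm_bound)
  also have "\<dots> \<le> (LINT t|lborel. cmod (k t) * (?B * \<delta>\<^sup>2))"
  proof (rule integral_mono[OF integrable_norm[OF int']])
    show "integrable lborel (\<lambda>t. cmod (k t) * (?B * \<delta>\<^sup>2))" using k by simp
    show "cmod (k t * ?r t) \<le> cmod (k t) * (?B * \<delta>\<^sup>2)" for t
      unfolding norm_mult by (rule mult_left_mono[OF r norm_ge_zero])
  qed
  also have "\<dots> = L1 k * ?B * \<delta>\<^sup>2"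
    using k by (simp add: L1_def mult.assoc)
  finally show "norm (conv k (nderiv p \<phi>) (s + \<delta>) - conv k (nderiv p \<phi>) s - \<delta> *\<^sub>R conv k (nderiv (Suc p) \<phi>) s)
      \<le> L1 k * ?B * \<delta>\<^sup>2" unfolding lhs .
qed

lemma conv_smooth:
  assumes "integrable lborel k" "\<phi> \<in> DL1"
  shows "smooth (conv k \<phi>)" and "nderiv p (conv k \<phi>) = conv k (nderiv p \<phi>)"
  using smooth_by_derivatives[of "\<lambda>p. conv k (nderiv p \<phi>)" "conv k \<phi>"] conv_has_vector_derivative[OF assms]
  by auto

text \<open>Minkowski's inequality for the continuous superposition of the functions \<open>\<Phi> t\<close> with weights \<open>k t\<close>;
  the premises are only imposed where the weight does not vanish.\<close>

lemma L1_superposition: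
  fixes \<Phi> :: "real \<Rightarrow> real \<Rightarrow> complex"
  assumes k: "integrable lborel k"
    and m: "(\<lambda>(t, s). \<Phi> t s) \<in> borel_measurable (borel \<Otimes>\<^sub>M borel)"
    and i: "\<And>t. k t \<noteq> 0 \<Longrightarrow> integrable lborel (\<Phi> t)" and B: "\<And>t. k t \<noteq> 0 \<Longrightarrow> L1 (\<Phi> t) \<le> B"
  shows "integrable lborel (\<lambda>s. LINT t|lborel. k t * \<Phi> t s)"
    and "L1 (\<lambda>s. LINT t|lborel. k t * \<Phi> t s) \<le> L1 k * B"
    and "integrable (lborel \<Otimes>\<^sub>M lborel) (\<lambda>(t, s). k t * \<Phi> t s)"
proof -
  let ?f = "\<lambda>(t, s). k t * \<Phi> t s"
  have [measurable]: "(\<lambda>(t, s). \<Phi> t s) \<in> borel_measurable (lborel \<Otimes>\<^sub>M lborel)"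
    using m measurable_cong_sets[OF sets_pair_measure_cong[OF sets_lborel sets_lborel] refl] by blast
  have km: "k \<in> borel_measurable lborel" using k by (rule borel_measurable_integrable)
  have "(\<lambda>x. k (fst x) * (case x of (t, s) \<Rightarrow> \<Phi> t s)) \<in> borel_measurable (lborel \<Otimes>\<^sub>M lborel)"
    by (intro borel_measurable_times measurable_compose[OF measurable_fst km]) measurable
  then have fm: "?f \<in> borel_measurable (lborel \<Otimes>\<^sub>M lborel)"
    by (simp add: case_prod_unfold)
  have n: "(LINT s|lborel. norm (?f (t, s))) = cmod (k t) * L1 (\<Phi> t)" for t
    by (simp add: norm_mult L1_def)
  have le: "cmod (k t) * L1 (\<Phi> t) \<le> cmod (k t) * B" for t
    using B[of t] by (cases "k t = 0") (auto intro: mult_left_mono)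
  have i1: "integrable lborel (\<lambda>t. LINT s|lborel. norm (?f (t, s)))"
  proof (rule Bochner_Integration.integrable_bound)
    show "integrable lborel (\<lambda>t. cmod (k t) * B)" using k by simp
    show "(\<lambda>t. LINT s|lborel. norm (?f (t, s))) \<in> borel_measurable lborel"
      using fm by measurable
    show "AE t in lborel. norm (LINT s|lborel. norm (?f (t, s))) \<le> norm (cmod (k t) * B)"
    proof (rule AE_I2)
      fix t :: real
      have "0 \<le> cmod (k t) * L1 (\<Phi> t)" by (simp add: L1_nonneg)
      then show "norm (LINT s|lborel. norm (?f (t, s))) \<le> norm (cmod (k t) * B)"
        unfolding n real_norm_def using le[of t] by linarith
    qed
  qed
  show fi: "integrable (lborel \<Otimes>\<^sub>M lborel) ?f"
  proof (rule lborel_pair.Fubini_integrable[OF fm i1], rule AE_I2)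
    fix t show "integrable lborel (\<lambda>s. ?f (t, s))"
      using i[of t] by (cases "k t = 0") auto
  qed
  have fn: "integrable (lborel \<Otimes>\<^sub>M lborel) (\<lambda>(t, s). norm (k t * \<Phi> t s))"
    using integrable_norm[OF fi] by (simp add: case_prod_unfold)
  show i2: "integrable lborel (\<lambda>s. LINT t|lborel. k t * \<Phi> t s)"
    using lborel_pair.integrable_snd[OF fi] .
  have "L1 (\<lambda>s. LINT t|lborel. k t * \<Phi> t s) \<le> (LINT s|lborel. LINT t|lborel. norm (k t * \<Phi> t s))"
    unfolding L1_def
    by (intro integral_mono integrable_norm i2 lborel_pair.integrable_snd[OF fn]) simp
  also have "\<dots> = (LINT t|lborel. LINT s|lborel. norm (k t * \<Phi> t s))"
    by (rule lborel_pair.Fubini_integral[OF fn])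
  also have "\<dots> \<le> (LINT t|lborel. cmod (k t) * B)"
    using i1 n le k by (intro integral_mono) auto
  also have "\<dots> = L1 k * B" using k by (simp add: L1_def)
  finally show "L1 (\<lambda>s. LINT t|lborel. k t * \<Phi> t s) \<le> L1 k * B" .
qed

lemma conv_integrable_L1:
  assumes k: "integrable lborel k" and \<phi>: "integrable lborel \<phi>" 
  shows "integrable lborel (conv k \<phi>)" and "L1 (conv k \<phi>) \<le> L1 k * L1 \<phi>"
    and "(LINT s|lborel. conv k \<phi> s) = (LINT t|lborel. k t) * (LINT t|lborel. \<phi> t)"
proof -
  have m: "(\<lambda>(t, s). \<phi> (s - t)) \<in> borel_measurable (borel \<Otimes>\<^sub>M borel)"
    using borel_measurable_integrable[OF \<phi>] by simp
  note * = L1_superposition[OF k m, of "L1 \<phi>"]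
  show "integrable lborel (conv k \<phi>)" "L1 (conv k \<phi>) \<le> L1 k * L1 \<phi>"
    unfolding conv_def using * integrable_shift[OF \<phi>] by (simp_all add: L1_shift)
  have i: "integrable (lborel \<Otimes>\<^sub>M lborel) (\<lambda>(t, s). k t * \<phi> (s - t))"
    using * integrable_shift[OF \<phi>] by (simp add: L1_shift)
  have "(LINT s|lborel. conv k \<phi> s) = (LINT t|lborel. LINT s|lborel. k t * \<phi> (s - t))"
    unfolding conv_def by (rule lborel_pair.Fubini_integral[OF i])
  also have "\<dots> = (LINT t|lborel. k t * (LINT s|lborel. \<phi> s))"
  proof (rule Bochner_Integration.integral_cong[OF refl])
    fix t
    show "(LINT s|lborel. k t * \<phi> (s - t)) = k t * (LINT s|lborel. \<phi> s)"
      using lborel_integral_real_affine[of 1 \<phi> "- t"] by simp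
  qed
  also have "\<dots> = (LINT t|lborel. k t) * (LINT t|lborel. \<phi> t)" by simp
  finally show "(LINT s|lborel. conv k \<phi> s) = (LINT t|lborel. k t) * (LINT t|lborel. \<phi> t)" .
qed

lemma conv_DL1:
  assumes "integrable lborel k" "\<phi> \<in> DL1"
  shows "conv k \<phi> \<in> DL1" and "L1 (nderiv p (conv k \<phi>)) \<le> L1 k * L1 (nderiv p \<phi>)"
  using conv_smooth[OF assms] conv_integrable_L1[OF assms(1) DL1_integrable[OF assms(2)]]
  by (auto simp: DL1_def)

lemma conv_left_commute:
  assumes k: "integrable lborel k" and k': "integrable lborel k'"
    and \<phi>: "\<phi> \<in> borel_measurable borel" "\<And>x. cmod (\<phi> x) \<le> B"
  shows "conv k (conv k' \<phi>) = conv k' (conv k \<phi>)"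
proof
  fix s
  have kk: "k \<in> borel_measurable borel" "k' \<in> borel_measurable borel"
    using k k' borel_measurable_integrable by auto
  have m: "(\<lambda>(t, u). k' u * \<phi> (s - t - u)) \<in> borel_measurable (borel \<Otimes>\<^sub>M borel)"
    using kk \<phi>(1) by simp
  have m2: "(\<lambda>u. k' u * \<phi> (s - t - u)) \<in> borel_measurable lborel" for t
    using kk \<phi>(1) by simp
  have i: "integrable lborel (\<lambda>u. k' u * \<phi> (s - t - u))" for t
    by (rule conv_integrable[OF k' \<phi>])
  have b: "L1 (\<lambda>u. k' u * \<phi> (s - t - u)) \<le> L1 k' * B" for t
  proof -
    have "L1 (\<lambda>u. k' u * \<phi> (s - t - u)) \<le> (LINT u|lborel. cmod (k' u) * B)"
      unfolding L1_def using i[of t] k'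
      by (intro integral_mono integrable_norm) (auto simp: norm_mult intro!: mult_left_mono \<phi>(2))
    also have "\<dots> = L1 k' * B" using k' by (simp add: L1_def)
    finally show ?thesis .
  qed
  from L1_superposition(3)[OF k m i b]
  have i3: "integrable (lborel \<Otimes>\<^sub>M lborel) (\<lambda>(t, u). k t * (k' u * \<phi> (s - t - u)))" .
  have "conv k (conv k' \<phi>) s = (LINT t|lborel. LINT u|lborel. k t * (k' u * \<phi> (s - t - u)))"
    by (simp add: conv_def)
  also have "\<dots> = (LINT u|lborel. LINT t|lborel. k t * (k' u * \<phi> (s - t - u)))"
    by (rule lborel_pair.Fubini_integral[OF i3, symmetric])
  also have "\<dots> = (LINT u|lborel. k' u * (LINT t|lborel. k t * \<phi> (s - u - t)))"
  proof (rule Bochner_Integration.integral_cong[OF refl])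
    fix u
    have "(LINT t|lborel. k t * (k' u * \<phi> (s - t - u))) = (LINT t|lborel. k' u * (k t * \<phi> (s - u - t)))"
      by (rule Bochner_Integration.integral_cong) (auto simp: algebra_simps)
    then show "(LINT t|lborel. k t * (k' u * \<phi> (s - t - u))) = k' u * (LINT t|lborel. k t * \<phi> (s - u - t))"
      by simp
  qed
  also have "\<dots> = conv k' (conv k \<phi>) s" by (simp add: conv_def)
  finally show "conv k (conv k' \<phi>) s = conv k' (conv k \<phi>) s" .
qed

lemma conv_commute: "conv k \<phi> = conv \<phi> k"
proof
  fix s
  show "conv k \<phi> s = conv \<phi> k s"
    unfolding conv_def using lborel_integral_real_affine[of "-1" "\<lambda>t. k t * \<phi> (s - t)" s]
    by (simp add: mult.commute algebra_simps)
qed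

lemma indicator_kernel:
  fixes a b :: real
  assumes "a \<le> b"
  shows "integrable lborel (indicator {a..b} :: real \<Rightarrow> complex)"
    and "L1 (indicator {a..b}) = b - a" and "(LINT t|lborel. indicator {a..b} t) = complex_of_real (b - a)"
proof -
  have eq: "(indicator {a..b} :: real \<Rightarrow> complex) = (\<lambda>t. complex_of_real (indicator {a..b} t))"
    by (auto simp: indicator_def)
  have i: "integrable lborel (indicator {a..b} :: real \<Rightarrow> real)"
    by (rule integrable_real_indicator) (auto simp: assms)
  have v: "(LINT t|lborel. indicator {a..b} t) = b - a" using assms by simp
  show "integrable lborel (indicator {a..b} :: real \<Rightarrow> complex)"
    unfolding eq by (rule integrable_of_real[OF i])
  show "(LINT t|lborel. indicator {a..b} t) = complex_of_real (b - a)"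
    unfolding eq using v by (simp only: integral_complex_of_real)
  show "L1 (indicator {a..b}) = b - a"
    unfolding L1_def eq using v by simp
qed

text \<open>The mean value formula, written as an integral over \<open>[0, 1]\<close> so that it is itself a superposition.\<close>

lemma translation_increment:
  assumes "\<phi> \<in> DL1"
  shows "\<phi> (s - y) - \<phi> s = (LINT r|lborel. indicator {0..1} r * (- complex_of_real y * nderiv 1 \<phi> (s - y * r)))"
proof -
  let ?\<Phi> = "\<lambda>r. - complex_of_real y * nderiv 1 \<phi> (s - y * r)"
  have d: "((\<lambda>r. \<phi> (s - y * r)) has_vector_derivative ?\<Phi> r) (at r within {0..1})" for r
  proof -
    have "((\<lambda>r. s - y * r) has_vector_derivative - y) (at r)"
      by (auto intro!: derivative_eq_intros)
    from vector_diff_chain_at[OF this, of \<phi>] smooth_has_vector_derivative[OF DL1_smooth[OF assms], of 0]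
    show ?thesis by (auto simp: o_def scaleR_conv_of_real intro: has_vector_derivative_at_within)
  qed
  have "(LINT r|lborel. indicator {0..1} r *\<^sub>R ?\<Phi> r) = \<phi> (s - y * 1) - \<phi> (s - y * 0)"
    by (rule integral_FTC_Icc[OF _ d])
      (auto intro!: continuous_intros continuous_on_compose2[OF smooth_continuous_on[OF DL1_smooth[OF assms], of UNIV]])
  moreover have "(LINT r|lborel. indicator {0..1} r *\<^sub>R ?\<Phi> r) = (LINT r|lborel. indicator {0..1} r * ?\<Phi> r)"
    by (rule Bochner_Integration.integral_cong) (auto simp: indicator_def)
  ultimately show ?thesis by simp
qed

lemma translation_L1_bound:
  assumes "\<phi> \<in> DL1"
  shows "L1 (\<lambda>s. \<phi> (s - y) - \<phi> s) \<le> \<bar>y\<bar> * L1 (nderiv 1 \<phi>)"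
proof -
  let ?k = "indicator {0..1::real} :: real \<Rightarrow> complex"
  let ?\<Phi> = "\<lambda>r s. - complex_of_real y * nderiv 1 \<phi> (s - y * r)"
  have k: "integrable lborel ?k" "L1 ?k = 1" using indicator_kernel[of 0 1] by auto
  have "nderiv 1 \<phi> \<in> borel_measurable borel"
    by (rule smooth_measurable[OF DL1_smooth[OF assms]])
  then have m: "(\<lambda>(r, s). ?\<Phi> r s) \<in> borel_measurable (borel \<Otimes>\<^sub>M borel)" by simp
  have i: "integrable lborel (?\<Phi> r)" for r
    by (intro integrable_mult_right integrable_shift DL1_integrable[OF assms])
  have b: "L1 (?\<Phi> r) \<le> \<bar>y\<bar> * L1 (nderiv 1 \<phi>)" for r
    unfolding L1_cmult L1_shift by simp
  show ?thesis unfolding translation_increment[OF assms] using L1_superposition(2)[OF k(1) m i b] k(2) by simp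
qed

lemma translation_L1_remainder:
  assumes "\<phi> \<in> DL1"
  shows "L1 (\<lambda>s. \<phi> (s - y) - \<phi> s + complex_of_real y * nderiv 1 \<phi> s) \<le> y\<^sup>2 * L1 (nderiv 2 \<phi>)"
proof -
  let ?k = "indicator {0..1::real} :: real \<Rightarrow> complex"
  let ?\<Phi> = "\<lambda>r s. - complex_of_real y * (nderiv 1 \<phi> (s - y * r) - nderiv 1 \<phi> s)"
  have k: "integrable lborel ?k" "L1 ?k = 1" "(LINT r|lborel. ?k r) = 1" using indicator_kernel[of 0 1] by auto
  note \<phi>1 = DL1_nderiv[OF assms, of 1]
  have "nderiv 1 \<phi> \<in> borel_measurable borel"
    by (rule smooth_measurable[OF DL1_smooth[OF assms]])
  then have m: "(\<lambda>(r, s). ?\<Phi> r s) \<in> borel_measurable (borel \<Otimes>\<^sub>M borel)" by simp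
  have i: "integrable lborel (?\<Phi> r)" for r
    by (intro integrable_mult_right Bochner_Integration.integrable_diff integrable_shift DL1_integrable[OF assms])
  have b: "L1 (?\<Phi> r) \<le> y\<^sup>2 * L1 (nderiv 2 \<phi>)" if "?k r \<noteq> 0" for r
  proof -
    have r: "0 \<le> r" "r \<le> 1" using that by (auto simp: indicator_def split: if_splits)
    have "L1 (?\<Phi> r) = \<bar>y\<bar> * L1 (\<lambda>s. nderiv 1 \<phi> (s - y * r) - nderiv 1 \<phi> s)"
      unfolding L1_cmult by simp
    also have "\<dots> \<le> \<bar>y\<bar> * (\<bar>y * r\<bar> * L1 (nderiv 2 \<phi>))"
      using translation_L1_bound[OF \<phi>1, of "y * r"] by (intro mult_left_mono) (auto simp: nderiv_nderiv numeral_2_eq_2)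
    also have "\<dots> = (y\<^sup>2 * L1 (nderiv 2 \<phi>)) * r" 
      unfolding abs_mult abs_of_nonneg[OF r(1)] power2_abs[of y, symmetric] power2_eq_square[of "\<bar>y\<bar>"]
      by (simp only: mult_ac)
    also have "\<dots> \<le> y\<^sup>2 * L1 (nderiv 2 \<phi>)" using r by (intro mult_left_le mult_nonneg_nonneg L1_nonneg) simp_all
    finally show ?thesis .
  qed
  have "\<phi> (s - y) - \<phi> s + complex_of_real y * nderiv 1 \<phi> s = (LINT r|lborel. ?k r * ?\<Phi> r s)" for s
  proof -
    have i1: "integrable lborel (\<lambda>r. ?k r * (- complex_of_real y * nderiv 1 \<phi> (s - y * r)))"
    proof (rule Bochner_Integration.integrable_bound[OF integrable_mult_right[OF k(1), of "\<bar>y\<bar> * L1 (nderiv 2 \<phi>)"]])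
      show "(\<lambda>r. ?k r * (- complex_of_real y * nderiv 1 \<phi> (s - y * r))) \<in> borel_measurable lborel"
        using \<open>nderiv 1 \<phi> \<in> borel_measurable borel\<close> by simp
      have "cmod (- complex_of_real y * nderiv 1 \<phi> u) \<le> \<bar>y\<bar> * L1 (nderiv 2 \<phi>)" for u
        using DL1_sup_bound[OF assms, of 1 u] by (simp add: norm_mult numeral_2_eq_2 mult_left_mono)
      then show "AE r in lborel. norm (?k r * (- complex_of_real y * nderiv 1 \<phi> (s - y * r)))
          \<le> norm (complex_of_real (\<bar>y\<bar> * L1 (nderiv 2 \<phi>)) * ?k r)"
        by (intro AE_I2) (auto simp: indicator_def L1_nonneg norm_mult)
    qed
    have i2: "integrable lborel (\<lambda>r. ?k r * (complex_of_real y * nderiv 1 \<phi> s))" using k(1) by simp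
    have "(LINT r|lborel. ?k r * ?\<Phi> r s) = (LINT r|lborel. ?k r * (- complex_of_real y * nderiv 1 \<phi> (s - y * r))
        + ?k r * (complex_of_real y * nderiv 1 \<phi> s))"
      by (rule Bochner_Integration.integral_cong) (simp_all add: algebra_simps)
    also have "\<dots> = (\<phi> (s - y) - \<phi> s) + complex_of_real y * nderiv 1 \<phi> s"
      unfolding Bochner_Integration.integral_add[OF i1 i2] translation_increment[OF assms, symmetric]
      using k(3) by simp
    finally show ?thesis by simp
  qed
  then show ?thesis using L1_superposition(2)[OF k(1) m i b] k(2) by simp
qed

text \<open>A kernel living near \<open>0\<close> acts like its total mass, up to one derivative: this gives the rate at
  which mollifiers converge.\<close>

lemma conv_concentrated_bound:
  assumes k: "integrable lborel k" and supp: "\<And>t. k t \<noteq> 0 \<Longrightarrow> \<bar>t\<bar> \<le> \<delta>" and \<phi>: "\<phi> \<in> DL1"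
  shows "L1 (\<lambda>s. conv k \<phi> s - (LINT t|lborel. k t) * \<phi> s) \<le> L1 k * (\<delta> * L1 (nderiv 1 \<phi>))"
proof -
  have m: "\<phi> \<in> borel_measurable borel"
    using smooth_measurable[OF DL1_smooth[OF \<phi>], of 0] by simp
  then have m': "(\<lambda>(t, s). \<phi> (s - t) - \<phi> s) \<in> borel_measurable (borel \<Otimes>\<^sub>M borel)" by simp
  have i: "integrable lborel (\<lambda>s. \<phi> (s - t) - \<phi> s)" for t
    using integrable_shift[OF DL1_integrable0[OF \<phi>]] DL1_integrable0[OF \<phi>] by simp
  have b: "L1 (\<lambda>s. \<phi> (s - t) - \<phi> s) \<le> \<delta> * L1 (nderiv 1 \<phi>)" if "k t \<noteq> 0" for t
    using translation_L1_bound[OF \<phi>, of t] supp[OF that]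
    by (meson L1_nonneg mult_right_mono order_trans)
  have "conv k \<phi> s - (LINT t|lborel. k t) * \<phi> s = (LINT t|lborel. k t * (\<phi> (s - t) - \<phi> s))" for s
    unfolding conv_def right_diff_distrib
    using conv_integrable_DL1[OF k \<phi>, of 0] k by (subst Bochner_Integration.integral_diff) auto
  then show ?thesis using L1_superposition(2)[OF k m' i b] by simp
qed

section \<open>The spaces of test functions\<close>

lemma DL1_quot_L1: "DL1_quot M h f p = h ^ p * L1 (nderiv p f) / M p"
  by (simp add: DL1_quot_def L1_def)

text \<open>How a scale is quantified in estimates for continuous maps and in the classes of operators.\<close>

definition at_scales :: "ultra_case \<Rightarrow> (real \<Rightarrow> bool) \<Rightarrow> bool" where
  "at_scales c Q \<longleftrightarrow> (case c of Beurling \<Rightarrow> \<exists>h>0. Q h | Roumieu \<Rightarrow> \<forall>h>0. Q h)"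

lemma at_scales_Roumieu: "at_scales c Q \<Longrightarrow> c = Roumieu \<Longrightarrow> h > 0 \<Longrightarrow> Q h"
  by (simp add: at_scales_def)

lemma at_scales_rescale:
  assumes "at_scales c Q" "L > 0" "\<And>h. h > 0 \<Longrightarrow> Q h \<Longrightarrow> Q' (L * h)"
  shows "at_scales c Q'"
proof (cases c)
  case Beurling
  then obtain h where "h > 0" "Q h" using assms(1) by (auto simp: at_scales_def)
  then have "L * h > 0" "Q' (L * h)" using assms(2,3) by auto
  then show ?thesis unfolding at_scales_def Beurling by auto
next
  case Roumieu
  show ?thesis unfolding at_scales_def Roumieu ultra_case.case
  proof (intro allI impI)
    fix h :: real assume "h > 0"
    then have "Q (h / L)" "h / L > 0" using assms Roumieu by (auto simp: at_scales_def)
    from assms(3)[OF this(2,1)] show "Q' h" using assms(2) by simp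
  qed
qed

lemma at_scales_mono:
  "at_scales c Q \<Longrightarrow> (\<And>h. h > 0 \<Longrightarrow> Q h \<Longrightarrow> Q' h) \<Longrightarrow> at_scales c Q'"
  using at_scales_rescale[of c Q 1 Q'] by simp

text \<open>The two quantifiers of the definitions of a continuous map and of the test space are dual to each
  other: in either case they meet in one step. The factor \<open>L\<close> leaves room for losses in the scale.\<close>

lemma at_scales_DL1_space:
  assumes "at_scales c Q" "\<phi> \<in> DL1_space c M" "L > 0"
  obtains h where "h > 0" "Q h" "\<phi> \<in> DL1_step M (L * h)"
proof (cases c)
  case Beurling
  then show ?thesis using assms that by (auto simp: at_scales_def DL1_space_def)
next
  case Roumieu
  then obtain h where h: "h > 0" "\<phi> \<in> DL1_step M h" using assms by (auto simp: DL1_space_def)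
  then have "h / L > 0" "\<phi> \<in> DL1_step M (L * (h / L))" using assms(3) by auto
  moreover have "Q (h / L)" using assms(1) Roumieu h assms(3) by (auto simp: at_scales_def)
  ultimately show ?thesis using that by blast
qed

lemma DL1_space_transfer:
  assumes "\<phi> \<in> DL1_space c M" "L > 0"
    and "\<And>h. h > 0 \<Longrightarrow> \<phi> \<in> DL1_step M (L * h) \<Longrightarrow> \<psi> \<in> DL1_step M h"
  shows "\<psi> \<in> DL1_space c M"
proof (cases c)
  case Beurling
  then show ?thesis using assms by (auto simp: DL1_space_def)
next
  case Roumieu
  then obtain h where h: "h > 0" "\<phi> \<in> DL1_step M h" using assms by (auto simp: DL1_space_def)
  then have "h / L > 0" "\<phi> \<in> DL1_step M (L * (h / L))" using assms(2) by auto
  from assms(3)[OF this] this(1) show ?thesis using Roumieu by (auto simp: DL1_space_def)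
qed

lemma DL1_step_DL1: "\<phi> \<in> DL1_step M h \<Longrightarrow> \<phi> \<in> DL1"
  by (simp add: DL1_step_def)

lemma DL1_space_DL1: "\<phi> \<in> DL1_space c M \<Longrightarrow> \<phi> \<in> DL1"
  by (cases c) (auto simp: DL1_space_def DL1_step_def intro: zero_less_one)

lemma DL1_step_quot_le:
  assumes "\<phi> \<in> DL1_step M h"
  shows "h ^ p * L1 (nderiv p \<phi>) / M p \<le> DL1_norm M h \<phi>"
  using assms unfolding DL1_norm_def DL1_step_def
  by (auto simp: DL1_quot_L1[symmetric] intro: cSUP_upper)

lemma DL1_stepI:
  assumes "\<phi> \<in> DL1" "\<And>p. h ^ p * L1 (nderiv p \<phi>) / M p \<le> B"
  shows "\<phi> \<in> DL1_step M h" and "DL1_norm M h \<phi> \<le> B"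
  using assms
  by (auto simp: DL1_norm_def DL1_step_def bdd_above_def DL1_quot_L1 intro!: exI[of _ B] cSUP_least)

locale positive_sequence =
  fixes M :: "nat \<Rightarrow> real"
  assumes M_pos: "M p > 0"
begin

lemma M_nonneg: "0 \<le> M p"
  using M_pos[of p] by linarith

lemma DL1_step_L1_le:
  assumes "\<phi> \<in> DL1_step M h" "h > 0"
  shows "L1 (nderiv p \<phi>) \<le> DL1_norm M h \<phi> * M p / h ^ p"
  using DL1_step_quot_le[OF assms(1), of p] assms(2) M_pos[of p]
  by (simp add: field_simps)

lemma DL1_norm_nonneg:
  assumes "\<phi> \<in> DL1_step M h" "h > 0"
  shows "0 \<le> DL1_norm M h \<phi>"
proof -
  have "0 \<le> h ^ 0 * L1 (nderiv 0 \<phi>) / M 0"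
    using M_nonneg L1_nonneg by simp
  then show ?thesis using DL1_step_quot_le[OF assms(1), of 0] by linarith
qed

lemma DL1_step_dominated:
  assumes "\<psi> \<in> DL1" "\<And>p. L1 (nderiv p \<psi>) \<le> K * L1 (nderiv p \<phi>)" "\<phi> \<in> DL1_step M h" "h > 0" "K \<ge> 0"
  shows "\<psi> \<in> DL1_step M h" and "DL1_norm M h \<psi> \<le> K * DL1_norm M h \<phi>"
proof -
  have *: "h ^ p * L1 (nderiv p \<psi>) / M p \<le> K * DL1_norm M h \<phi>" for p
  proof -
    have "h ^ p * L1 (nderiv p \<psi>) / M p \<le> h ^ p * (K * L1 (nderiv p \<phi>)) / M p"
      using assms(2)[of p] assms(4) M_nonneg[of p]
      by (intro divide_right_mono mult_left_mono) auto
    also have "\<dots> = K * (h ^ p * L1 (nderiv p \<phi>) / M p)" by simp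
    also have "\<dots> \<le> K * DL1_norm M h \<phi>"
      by (rule mult_left_mono[OF DL1_step_quot_le[OF assms(3)] assms(5)])
    finally show ?thesis .
  qed
  show "\<psi> \<in> DL1_step M h" "DL1_norm M h \<psi> \<le> K * DL1_norm M h \<phi>"
    by (rule DL1_stepI[OF assms(1) *])+
qed

lemma DL1_step_mono:
  assumes "\<phi> \<in> DL1_step M h'" "0 < h" "h \<le> h'"
  shows "\<phi> \<in> DL1_step M h" and "DL1_norm M h \<phi> \<le> DL1_norm M h' \<phi>"
proof -
  have *: "h ^ p * L1 (nderiv p \<phi>) / M p \<le> DL1_norm M h' \<phi>" for p
  proof -
    have "h ^ p * L1 (nderiv p \<phi>) / M p \<le> h' ^ p * L1 (nderiv p \<phi>) / M p"
      using assms M_nonneg[of p] L1_nonneg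
      by (intro divide_right_mono mult_right_mono power_mono) auto
    also have "\<dots> \<le> DL1_norm M h' \<phi>" by (rule DL1_step_quot_le[OF assms(1)])
    finally show ?thesis .
  qed
  show "\<phi> \<in> DL1_step M h" "DL1_norm M h \<phi> \<le> DL1_norm M h' \<phi>"
    by (rule DL1_stepI[OF DL1_step_DL1[OF assms(1)] *])+
qed

lemma DL1_step_add:
  assumes "\<phi> \<in> DL1_step M h" "\<psi> \<in> DL1_step M h" "h > 0"
  shows "(\<lambda>t. \<phi> t + \<psi> t) \<in> DL1_step M h"
    and "DL1_norm M h (\<lambda>t. \<phi> t + \<psi> t) \<le> DL1_norm M h \<phi> + DL1_norm M h \<psi>"
proof -
  note d = DL1_step_DL1[OF assms(1)] DL1_step_DL1[OF assms(2)]
  have *: "h ^ p * L1 (nderiv p (\<lambda>t. \<phi> t + \<psi> t)) / M p \<le> DL1_norm M h \<phi> + DL1_norm M h \<psi>" for p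
  proof -
    have "L1 (nderiv p (\<lambda>t. \<phi> t + \<psi> t)) \<le> L1 (nderiv p \<phi>) + L1 (nderiv p \<psi>)"
      unfolding nderiv_add(2)[OF DL1_smooth[OF d(1)] DL1_smooth[OF d(2)]]
      by (rule L1_triangle[OF DL1_integrable[OF d(1)] DL1_integrable[OF d(2)]])
    then have "h ^ p * L1 (nderiv p (\<lambda>t. \<phi> t + \<psi> t)) / M p
        \<le> h ^ p * (L1 (nderiv p \<phi>) + L1 (nderiv p \<psi>)) / M p"
      using assms M_nonneg[of p] by (intro divide_right_mono mult_left_mono) auto
    also have "\<dots> = h ^ p * L1 (nderiv p \<phi>) / M p + h ^ p * L1 (nderiv p \<psi>) / M p"
      by (simp add: field_simps add_divide_distrib)
    also have "\<dots> \<le> DL1_norm M h \<phi> + DL1_norm M h \<psi>"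
      by (intro add_mono DL1_step_quot_le assms)
    finally show ?thesis .
  qed
  show "(\<lambda>t. \<phi> t + \<psi> t) \<in> DL1_step M h"
    "DL1_norm M h (\<lambda>t. \<phi> t + \<psi> t) \<le> DL1_norm M h \<phi> + DL1_norm M h \<psi>"
    by (rule DL1_stepI[OF DL1_add[OF d] *])+
qed

lemma DL1_step_cmult:
  assumes "\<phi> \<in> DL1_step M h" "h > 0"
  shows "(\<lambda>t. a * \<phi> t) \<in> DL1_step M h"
    and "DL1_norm M h (\<lambda>t. a * \<phi> t) = cmod a * DL1_norm M h \<phi>"
proof -
  have le: "(\<lambda>t. b * \<psi> t) \<in> DL1_step M h \<and> DL1_norm M h (\<lambda>t. b * \<psi> t) \<le> cmod b * DL1_norm M h \<psi>"
    if "\<psi> \<in> DL1_step M h" for b \<psi>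
    using DL1_step_dominated[OF DL1_cmult[OF DL1_step_DL1[OF that]] _ that assms(2), of b "cmod b"]
    by (simp add: nderiv_cmult[OF DL1_smooth[OF DL1_step_DL1[OF that]]] L1_cmult)
  show 1: "(\<lambda>t. a * \<phi> t) \<in> DL1_step M h" using le[OF assms(1)] by blast
  have "cmod a * DL1_norm M h \<phi> \<le> DL1_norm M h (\<lambda>t. a * \<phi> t)"
  proof (cases "a = 0")
    case True
    then show ?thesis using DL1_norm_nonneg[OF 1 assms(2)] by simp
  next
    case False
    have "DL1_norm M h \<phi> \<le> cmod (1 / a) * DL1_norm M h (\<lambda>t. a * \<phi> t)"
      using le[OF 1, of "1 / a"] False by simp
    then show ?thesis using False by (simp add: norm_divide field_simps)
  qed
  then show "DL1_norm M h (\<lambda>t. a * \<phi> t) = cmod a * DL1_norm M h \<phi>"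
    using le[OF assms(1), of a] by linarith
qed

lemma DL1_space_mono_step:
  assumes "\<phi> \<in> DL1_space c M" "\<psi> \<in> DL1"
    and "\<And>p. L1 (nderiv p \<psi>) \<le> K * L1 (nderiv p \<phi>)" "K \<ge> 0"
  shows "\<psi> \<in> DL1_space c M"
  by (rule DL1_space_transfer[OF assms(1) zero_less_one])
    (use DL1_step_dominated(1)[OF assms(2,3)] assms(4) in auto)

lemma DL1_space_cmult: "\<phi> \<in> DL1_space c M \<Longrightarrow> (\<lambda>t. a * \<phi> t) \<in> DL1_space c M"
  by (rule DL1_space_transfer[of \<phi> c M 1]) (auto intro: DL1_step_cmult)

lemma DL1_space_add:
  assumes "\<phi> \<in> DL1_space c M" "\<psi> \<in> DL1_space c M"
  shows "(\<lambda>t. \<phi> t + \<psi> t) \<in> DL1_space c M"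
proof (cases c)
  case Beurling
  then show ?thesis using assms by (auto simp: DL1_space_def intro: DL1_step_add)
next
  case Roumieu
  then obtain h h' where h: "h > 0" "\<phi> \<in> DL1_step M h" "h' > 0" "\<psi> \<in> DL1_step M h'"
    using assms by (auto simp: DL1_space_def)
  have "\<phi> \<in> DL1_step M (min h h')" "\<psi> \<in> DL1_step M (min h h')"
    using h by (auto intro: DL1_step_mono)
  then have "(\<lambda>t. \<phi> t + \<psi> t) \<in> DL1_step M (min h h')" using h by (intro DL1_step_add) auto
  then show ?thesis using Roumieu h by (auto simp: DL1_space_def intro!: bexI[of _ "min h h'"])
qed

lemma DL1_space_diff:
  "\<phi> \<in> DL1_space c M \<Longrightarrow> \<psi> \<in> DL1_space c M \<Longrightarrow> (\<lambda>t. \<phi> t - \<psi> t) \<in> DL1_space c M"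
  using DL1_space_add[OF _ DL1_space_cmult, of \<phi> c \<psi> "-1"] by simp

lemma DL1_step_isometry:
  assumes "\<phi> \<in> DL1_step M h" "h > 0" "\<bar>\<alpha>\<bar> = 1"
  shows "(\<lambda>t. \<phi> (\<alpha> * t + \<beta>)) \<in> DL1_step M h"
    and "DL1_norm M h (\<lambda>t. \<phi> (\<alpha> * t + \<beta>)) \<le> DL1_norm M h \<phi>"
proof -
  have "\<alpha> \<noteq> 0" using assms(3) by auto
  note d = DL1_step_DL1[OF assms(1)]
  show "(\<lambda>t. \<phi> (\<alpha> * t + \<beta>)) \<in> DL1_step M h"
    "DL1_norm M h (\<lambda>t. \<phi> (\<alpha> * t + \<beta>)) \<le> DL1_norm M h \<phi>"
    using DL1_step_dominated[OF DL1_affine[OF d \<open>\<alpha> \<noteq> 0\<close>] _ assms(1,2), of \<beta> 1]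
      L1_nderiv_affine[OF d \<open>\<alpha> \<noteq> 0\<close>] assms(3) by auto
qed

lemma DL1_space_affine:
  assumes "\<phi> \<in> DL1_space c M" "\<alpha> \<noteq> 0"
  shows "(\<lambda>t. \<phi> (\<alpha> * t + \<beta>)) \<in> DL1_space c M"
proof (rule DL1_space_transfer[OF assms(1)])
  show "\<bar>\<alpha>\<bar> > 0" using assms by simp
  fix h :: real assume h: "h > 0" "\<phi> \<in> DL1_step M (\<bar>\<alpha>\<bar> * h)"
  note d = DL1_step_DL1[OF h(2)]
  show "(\<lambda>t. \<phi> (\<alpha> * t + \<beta>)) \<in> DL1_step M h"
  proof (rule DL1_stepI(1)[OF DL1_affine[OF d assms(2)]])
    fix p
    have "h ^ p * L1 (nderiv p (\<lambda>t. \<phi> (\<alpha> * t + \<beta>))) / M p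
        = 1 / \<bar>\<alpha>\<bar> * ((\<bar>\<alpha>\<bar> * h) ^ p * L1 (nderiv p \<phi>) / M p)"
      unfolding L1_nderiv_affine[OF d assms(2)] by (simp add: power_mult_distrib)
    also have "\<dots> \<le> 1 / \<bar>\<alpha>\<bar> * DL1_norm M (\<bar>\<alpha>\<bar> * h) \<phi>"
      by (rule mult_left_mono[OF DL1_step_quot_le[OF h(2)]]) simp
    finally show "h ^ p * L1 (nderiv p (\<lambda>t. \<phi> (\<alpha> * t + \<beta>))) / M p \<le> 1 / \<bar>\<alpha>\<bar> * DL1_norm M (\<bar>\<alpha>\<bar> * h) \<phi>" .
  qed
qed

lemma DL1_space_shift: "\<phi> \<in> DL1_space c M \<Longrightarrow> (\<lambda>t. \<phi> (t - y)) \<in> DL1_space c M"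
  using DL1_space_affine[of \<phi> c 1 "- y"] by simp

lemma DL1_space_reflect: "\<phi> \<in> DL1_space c M \<Longrightarrow> (\<lambda>t. \<phi> (y - t)) \<in> DL1_space c M"
  using DL1_space_affine[of \<phi> c "-1" y] by simp

lemma conv_DL1_step:
  assumes "integrable lborel k" "\<phi> \<in> DL1_step M h" "h > 0"
  shows "conv k \<phi> \<in> DL1_step M h" and "DL1_norm M h (conv k \<phi>) \<le> L1 k * DL1_norm M h \<phi>"
  using DL1_step_dominated[OF conv_DL1[OF assms(1) DL1_step_DL1[OF assms(2)]] assms(2,3) L1_nonneg] by auto

lemma conv_DL1_space:
  assumes "integrable lborel k" "\<phi> \<in> DL1_space c M"
  shows "conv k \<phi> \<in> DL1_space c M"
  by (rule DL1_space_mono_step[OF assms(2) conv_DL1[OF assms(1) DL1_space_DL1[OF assms(2)]] L1_nonneg])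

end

locale weight_sequence = positive_sequence +
  assumes M_0: "M 0 = 1" and M1: "cond_M1 M" and M2: "cond_M2 M"
begin

lemma M_ratio_mono: "i \<le> j \<Longrightarrow> M (Suc i) / M i \<le> M (Suc j) / M j"
proof (rule lift_Suc_mono_le[where f = "\<lambda>i. M (Suc i) / M i"])
  fix n
  have "(M (Suc n))\<^sup>2 \<le> M (Suc (Suc n)) * M n"
    using M1 unfolding cond_M1_def by (auto dest: spec[of _ "Suc n"])
  then show "M (Suc n) / M n \<le> M (Suc (Suc n)) / M (Suc n)"
    using M_pos[of n] M_pos[of "Suc n"] by (simp add: field_simps power2_eq_square)
qed

text \<open>Logarithmic convexity together with \<open>M 0 = 1\<close>: the quotients increase, so \<open>M (i + j) / M i\<close> is a
  product of larger quotients than \<open>M j\<close>.\<close>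

lemma M_supermult: "M i * M j \<le> M (i + j)"
proof (induction i)
  case 0
  then show ?case by (simp add: M_0)
next
  case (Suc i)
  have "M (Suc i) * M j = M (Suc i) / M i * (M i * M j)" using M_pos[of i] by simp
  also have "\<dots> \<le> M (Suc (i + j)) / M (i + j) * M (i + j)"
    using M_ratio_mono[of i "i + j"] Suc M_nonneg by (intro mult_mono) auto
  also have "\<dots> = M (Suc i + j)" using M_pos[of "i + j"] by simp
  finally show ?case .
qed

text \<open>The minimum in (M.2) bounds every product, in particular the one that belongs to a given splitting.\<close>

lemma M_stability:
  obtains A H where "A > 1" "H > 1" "\<And>p q. M (p + q) \<le> A * H ^ (p + q) * (M p * M q)"
proof -
  obtain A H where AH: "A > 1" "H > 1"
    and le: "\<And>p. p \<ge> 1 \<Longrightarrow> M p \<le> A * H ^ p * (MIN i\<in>{..p}. M i * M (p - i))"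
    using M2 unfolding cond_M2_def by blast
  have "M (p + q) \<le> A * H ^ (p + q) * (M p * M q)" for p q
  proof (cases "p + q = 0")
    case True
    then show ?thesis using AH by (simp add: M_0)
  next
    case False
    have "(MIN i\<in>{..p + q}. M i * M (p + q - i)) \<le> M p * M (p + q - p)"
      by (intro Min_le image_eqI[of _ _ p]) auto
    then have "A * H ^ (p + q) * (MIN i\<in>{..p + q}. M i * M (p + q - i)) \<le> A * H ^ (p + q) * (M p * M q)"
      using AH by (intro mult_left_mono) auto
    then show ?thesis using le[of "p + q"] False by linarith
  qed
  then show thesis using that AH by blast
qed

text \<open>Stability under differentiation, at the price of the factor \<open>H\<close> in the scale: \<open>M (p + q)\<close> is
  compared with \<open>M p * M q\<close>.\<close>

lemma nderiv_DL1_step: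
  assumes "A > 1" "H > 1" "\<And>p q. M (p + q) \<le> A * H ^ (p + q) * (M p * M q)"
    and \<phi>: "\<phi> \<in> DL1_step M (H * h)" "h > 0"
  shows "nderiv q \<phi> \<in> DL1_step M h"
    and "DL1_norm M h (nderiv q \<phi>) \<le> A * M q / h ^ q * DL1_norm M (H * h) \<phi>"
proof -
  let ?N = "DL1_norm M (H * h) \<phi>"
  have Hh: "H * h > 0" using assms by simp
  have N: "0 \<le> ?N" by (rule DL1_norm_nonneg[OF \<phi>(1) Hh])
  have *: "h ^ p * L1 (nderiv p (nderiv q \<phi>)) / M p \<le> A * M q / h ^ q * ?N" for p
  proof -
    have "L1 (nderiv (p + q) \<phi>) \<le> ?N * M (p + q) / (H * h) ^ (p + q)"
      by (rule DL1_step_L1_le[OF \<phi>(1) Hh])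
    also have "\<dots> \<le> ?N * (A * H ^ (p + q) * (M p * M q)) / (H * h) ^ (p + q)"
      using N assms by (intro divide_right_mono mult_left_mono) auto
    also have "\<dots> = ?N * A * M p * M q / h ^ (p + q)"
      using assms by (simp add: power_mult_distrib)
    finally have "h ^ p * L1 (nderiv (p + q) \<phi>) / M p \<le> h ^ p * (?N * A * M p * M q / h ^ (p + q)) / M p"
      using M_nonneg[of p] \<phi>(2) by (intro divide_right_mono mult_left_mono) auto
    also have "\<dots> = A * M q / h ^ q * ?N"
      using M_pos[of p] \<phi>(2) by (simp add: power_add)
    finally show ?thesis by (simp add: nderiv_nderiv)
  qed
  show "nderiv q \<phi> \<in> DL1_step M h"
    "DL1_norm M h (nderiv q \<phi>) \<le> A * M q / h ^ q * DL1_norm M (H * h) \<phi>"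
    by (rule DL1_stepI[OF DL1_nderiv[OF DL1_step_DL1[OF \<phi>(1)]] *])+
qed

lemma DL1_space_nderiv:
  assumes "\<phi> \<in> DL1_space c M"
  shows "nderiv q \<phi> \<in> DL1_space c M"
proof -
  obtain A H where AH: "A > 1" "H > 1" "\<And>p q. M (p + q) \<le> A * H ^ (p + q) * (M p * M q)"
    by (rule M_stability) blast
  show ?thesis
    by (rule DL1_space_transfer[OF assms, of H]) (use AH nderiv_DL1_step(1)[OF AH] in auto)
qed

end

section \<open>Continuity of linear maps on the test space\<close>

interpretation scaleC: bounded_bilinear "scaleC :: complex \<Rightarrow> 'a::complex_banach \<Rightarrow> 'a"
proof
  fix c d :: complex and x y :: 'a and r :: real
  show "(c + d) *\<^sub>C x = c *\<^sub>C x + d *\<^sub>C x" by (rule scaleC_add_left)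
  show "c *\<^sub>C (x + y) = c *\<^sub>C x + c *\<^sub>C y" by (rule scaleC_add_right)
  show "(r *\<^sub>R c) *\<^sub>C x = r *\<^sub>R (c *\<^sub>C x)"
    by (simp only: scaleR_conv_of_real scaleC_of_real[symmetric] scaleC_scaleC)
  show "c *\<^sub>C (r *\<^sub>R x) = r *\<^sub>R (c *\<^sub>C x)"
    by (simp only: scaleC_of_real[symmetric] scaleC_scaleC mult.commute)
  show "\<exists>K. \<forall>(a::complex) b::'a. norm (a *\<^sub>C b) \<le> norm a * norm b * K"
    by (rule exI[of _ 1]) (simp add: norm_scaleC)
qed

lemma scaleC_one: "1 *\<^sub>C x = (x::'a::complex_banach)"
  using scaleC_of_real[of 1 x] by simp

lemma scaleC_minus_one: "(- 1) *\<^sub>C x = - (x::'a::complex_banach)"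
  using scaleC.minus_left[of 1 x] by (simp add: scaleC_one)

lemma linear_map_on_add: "linear_map_on E T \<Longrightarrow> \<phi> \<in> E \<Longrightarrow> \<psi> \<in> E \<Longrightarrow> T (\<lambda>t. \<phi> t + \<psi> t) = T \<phi> + T \<psi>"
  and linear_map_on_cmult: "linear_map_on E T \<Longrightarrow> \<phi> \<in> E \<Longrightarrow> T (\<lambda>t. a * \<phi> t) = a *\<^sub>C T \<phi>"
  by (auto simp: linear_map_on_def)

lemma openin_DL1_topology: "openin (DL1_topology c M) = seminorm_open (DL1_space c M) (DL1_seminorms c M)"
  unfolding DL1_topology_def by (rule topology_inverse'[OF istopology_seminorm_open])

lemma topspace_DL1_topology: "topspace (DL1_topology c M) = DL1_space c M"
proof (rule antisym)
  show "topspace (DL1_topology c M) \<subseteq> DL1_space c M"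
    unfolding topspace_def openin_DL1_topology by (auto simp: seminorm_open_def)
  have "openin (DL1_topology c M) (DL1_space c M)"
    unfolding openin_DL1_topology seminorm_open_def
    by (auto intro!: exI[of _ "{}"] exI[of _ "1::real"])
  then show "DL1_space c M \<subseteq> topspace (DL1_topology c M)" by (rule openin_subset)
qed

context positive_sequence
begin

lemma DL1_seminorms_seminorm_on:
  assumes "p \<in> DL1_seminorms c M"
  shows "seminorm_on (DL1_space c M) p"
proof (cases c)
  case Beurling
  then obtain h where h: "h > 0" "p = DL1_norm M h" using assms by (auto simp: DL1_seminorms_def)
  have "\<phi> \<in> DL1_step M h" if "\<phi> \<in> DL1_space c M" for \<phi>
    using that Beurling h by (auto simp: DL1_space_def)
  then show ?thesis
    unfolding seminorm_on_def h(2)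
    using DL1_norm_nonneg[OF _ h(1)] DL1_step_add(2)[OF _ _ h(1)] DL1_step_cmult(2)[OF _ h(1)] by blast
next
  case Roumieu
  then show ?thesis using assms by (auto simp: DL1_seminorms_def)
qed

text \<open>In the projective limit the largest of the finitely many scales serves all seminorms; in the
  inductive limit each seminorm is bounded on each step by definition.\<close>

lemma finite_seminorms_bound:
  assumes "finite F" "F \<subseteq> DL1_seminorms c M"
  shows "at_scales c (\<lambda>h. \<exists>C\<ge>0. \<forall>p\<in>F. \<forall>\<phi>\<in>DL1_space c M \<inter> DL1_step M h. p \<phi> \<le> C * DL1_norm M h \<phi>)"
  using assms
proof (induction F)
  case empty
  then show ?case by (auto simp: at_scales_def split: ultra_case.split intro: exI[of _ "1::real"])
next
  case (insert q F)
  show ?case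
  proof (cases c)
    case Beurling
    then obtain h where h: "h > 0" "q = DL1_norm M h" using insert by (auto simp: DL1_seminorms_def)
    obtain h' C where h': "h' > 0" "C \<ge> 0"
      "\<And>p \<phi>. p \<in> F \<Longrightarrow> \<phi> \<in> DL1_space c M \<inter> DL1_step M h' \<Longrightarrow> p \<phi> \<le> C * DL1_norm M h' \<phi>"
      using insert Beurling by (auto simp: at_scales_def)
    have "p \<phi> \<le> (C + 1) * DL1_norm M (max h h') \<phi>"
      if "p \<in> insert q F" "\<phi> \<in> DL1_space c M \<inter> DL1_step M (max h h')" for p \<phi>
    proof -
      have \<phi>: "\<phi> \<in> DL1_step M (max h h')" using that by simp
      have n: "0 \<le> DL1_norm M (max h h') \<phi>" using DL1_norm_nonneg[OF \<phi>] h(1) by simp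
      have le: "\<phi> \<in> DL1_step M h'" "DL1_norm M h \<phi> \<le> DL1_norm M (max h h') \<phi>"
          "DL1_norm M h' \<phi> \<le> DL1_norm M (max h h') \<phi>"
        using DL1_step_mono[OF \<phi>] h h' by auto
      show ?thesis
      proof (cases "p = q")
        case True
        have "0 \<le> C * DL1_norm M (max h h') \<phi>" by (rule mult_nonneg_nonneg[OF h'(2) n])
        then show ?thesis using le(2) True h(2) by (simp add: distrib_right)
      next
        case False
        then have "p \<phi> \<le> C * DL1_norm M h' \<phi>" using h'(3) le(1) that by auto
        also have "\<dots> \<le> C * DL1_norm M (max h h') \<phi>" by (rule mult_left_mono[OF le(3) h'(2)])
        finally show ?thesis using n by (simp add: distrib_right)
      qed
    qed
    then show ?thesis
      unfolding at_scales_def Beurling ultra_case.case using h h'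
      by (intro exI[of _ "max h h'"] conjI exI[of _ "C + 1"]) (auto simp: Beurling)
  next
    case Roumieu
    show ?thesis unfolding at_scales_def Roumieu ultra_case.case
    proof (intro allI impI)
      fix h :: real assume h: "h > 0"
      have "\<exists>C\<ge>0. \<forall>p\<in>F. \<forall>\<phi>\<in>DL1_space c M \<inter> DL1_step M h. p \<phi> \<le> C * DL1_norm M h \<phi>"
        by (rule at_scales_Roumieu[OF insert.IH Roumieu h]) (use insert.prems in auto)
      then obtain C where C: "C \<ge> 0"
        "\<And>p \<phi>. p \<in> F \<Longrightarrow> \<phi> \<in> DL1_space c M \<inter> DL1_step M h \<Longrightarrow> p \<phi> \<le> C * DL1_norm M h \<phi>"
        by blast
      have "\<exists>K. \<forall>\<phi>\<in>DL1_step M h. q \<phi> \<le> K * DL1_norm M h \<phi>"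
        using insert.prems Roumieu h by (simp add: DL1_seminorms_def)
      then obtain K where K: "\<And>\<phi>. \<phi> \<in> DL1_step M h \<Longrightarrow> q \<phi> \<le> K * DL1_norm M h \<phi>"
        by blast
      have "p \<phi> \<le> max C K * DL1_norm M h \<phi>"
        if "p \<in> insert q F" "\<phi> \<in> DL1_space c M \<inter> DL1_step M h" for p \<phi>
      proof -
        have n: "0 \<le> DL1_norm M h \<phi>" using DL1_norm_nonneg[of \<phi> h] h that by simp
        have "p \<phi> \<le> C * DL1_norm M h \<phi> \<or> p \<phi> \<le> K * DL1_norm M h \<phi>"
          using C(2)[of p \<phi>] K[of \<phi>] that by auto
        then show ?thesis
          using mult_right_mono[OF max.cobounded1[of C K] n] mult_right_mono[OF max.cobounded2[of K C] n] by linarith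
      qed
      then show "\<exists>C\<ge>0. \<forall>p\<in>insert q F. \<forall>\<phi>\<in>DL1_space Roumieu M \<inter> DL1_step M h. p \<phi> \<le> C * DL1_norm M h \<phi>"
        using C(1) Roumieu by (intro exI[of _ "max C K"]) auto
    qed
  qed
qed

text \<open>The topology is eliminated once and for all: continuity is an estimate by the norm of one step
  (projective limit), resp. of each step (inductive limit). In the latter case \<open>\<lambda>\<phi>. norm (T \<phi>)\<close> is itself
  one of the seminorms that generate the topology.\<close>

lemma DL1_dual_iff:
  fixes T :: "(real \<Rightarrow> complex) \<Rightarrow> 'a::complex_banach"
  shows "T \<in> DL1_dual c M \<longleftrightarrow> linear_map_on (DL1_space c M) T \<and>
    at_scales c (\<lambda>h. \<exists>C\<ge>0. \<forall>\<phi>\<in>DL1_space c M \<inter> DL1_step M h. norm (T \<phi>) \<le> C * DL1_norm M h \<phi>)"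
    (is "_ \<longleftrightarrow> _ \<and> ?B")
proof
  assume T: "T \<in> DL1_dual c M"
  then have lin: "linear_map_on (DL1_space c M) T"
    and cont: "continuous_map (DL1_topology c M) euclidean T" by (auto simp: DL1_dual_def)
  let ?E = "DL1_space c M"
  have "openin (DL1_topology c M) {\<phi> \<in> topspace (DL1_topology c M). T \<phi> \<in> ball 0 1}"
    by (rule openin_continuous_map_preimage[OF cont]) auto
  then have U: "seminorm_open ?E (DL1_seminorms c M) {\<phi> \<in> ?E. norm (T \<phi>) < 1}"
    by (simp add: openin_DL1_topology topspace_DL1_topology)
  show "linear_map_on ?E T \<and> ?B"
  proof (cases "?E = {}")
    case True
    then show ?thesis using lin by (auto simp: at_scales_def split: ultra_case.split intro: exI[of _ "1::real"])
  next
    case False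
    then obtain \<phi>0 where \<phi>0: "\<phi>0 \<in> ?E" by blast
    have 0: "(\<lambda>t. 0) \<in> ?E" using DL1_space_cmult[OF \<phi>0, of 0] by simp
    have "T (\<lambda>t. 0) = 0" using linear_map_on_cmult[OF lin \<phi>0, of 0] by (simp add: scaleC.zero_left)
    then have "(\<lambda>t. 0) \<in> {\<phi> \<in> ?E. norm (T \<phi>) < 1}" using 0 by simp
    from seminorm_openD[OF U this] obtain F e where F: "finite F" "F \<subseteq> DL1_seminorms c M" "0 < e"
      and sub: "{\<psi> \<in> ?E. \<forall>p\<in>F. p (\<lambda>t. \<psi> t - 0) < e} \<subseteq> {\<phi> \<in> ?E. norm (T \<phi>) < 1}" .
    \<comment> \<open>Scaling \<open>\<psi>\<close> into the neighbourhood; as \<open>s\<close> may be \<open>0\<close>, a slightly larger \<open>s'\<close> is used first.\<close>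
  have key: "norm (T \<psi>) \<le> 2 / e * s" if \<psi>: "\<psi> \<in> ?E" and s: "s \<ge> 0" "\<And>p. p \<in> F \<Longrightarrow> p \<psi> \<le> s" for \<psi> s
    proof -
      have *: "norm (T \<psi>) \<le> 2 / e * s'" if s': "s' > s" for s'
      proof -
        let ?r = "complex_of_real (e / (2 * s'))"
        have pos: "s' > 0" using s' s by simp
        have "p (\<lambda>t. ?r * \<psi> t - 0) < e" if "p \<in> F" for p
        proof -
          have "p (\<lambda>t. ?r * \<psi> t) = cmod ?r * p \<psi>"
            using DL1_seminorms_seminorm_on[OF subsetD[OF F(2) that]] \<psi> unfolding seminorm_on_def by blast
          also have "\<dots> = e / (2 * s') * p \<psi>" using pos F(3) by (simp add: norm_divide norm_mult)
          also have "\<dots> \<le> e / (2 * s') * s'"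
            using s(2)[OF that] s' pos F(3) by (intro mult_left_mono) auto
          also have "\<dots> < e" using pos F(3) by simp
          finally show ?thesis by simp
        qed
        then have "norm (T (\<lambda>t. ?r * \<psi> t)) < 1" using sub DL1_space_cmult[OF \<psi>, of ?r] by blast
        then have "e / (2 * s') * norm (T \<psi>) < 1"
          using linear_map_on_cmult[OF lin \<psi>, of ?r] pos F(3) by (simp add: norm_scaleC norm_divide norm_mult)
        then show ?thesis using pos F(3) by (simp add: field_simps)
      qed
      show ?thesis
      proof (rule field_le_epsilon)
        fix d :: real assume "d > 0"
        then have "norm (T \<psi>) \<le> 2 / e * (s + d * e / 2)" using F(3) by (intro *) auto
        then show "norm (T \<psi>) \<le> 2 / e * s + d" using F(3) by (simp add: field_simps)
      qed
    qed
    have ?B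
    proof (rule at_scales_mono[OF finite_seminorms_bound[OF F(1,2)]])
      fix h :: real assume h: "h > 0"
        "\<exists>C\<ge>0. \<forall>p\<in>F. \<forall>\<phi>\<in>?E \<inter> DL1_step M h. p \<phi> \<le> C * DL1_norm M h \<phi>"
      then obtain C where C: "C \<ge> 0" "\<And>p \<phi>. p \<in> F \<Longrightarrow> \<phi> \<in> ?E \<inter> DL1_step M h \<Longrightarrow> p \<phi> \<le> C * DL1_norm M h \<phi>"
        by blast
      have "norm (T \<psi>) \<le> 2 / e * (C * DL1_norm M h \<psi>)" if "\<psi> \<in> ?E \<inter> DL1_step M h" for \<psi>
        using that C DL1_norm_nonneg[OF _ h(1)] by (intro key) auto
      then show "\<exists>C\<ge>0. \<forall>\<phi>\<in>?E \<inter> DL1_step M h. norm (T \<phi>) \<le> C * DL1_norm M h \<phi>"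
        using C(1) F(3) by (intro exI[of _ "2 / e * C"]) (auto simp: mult.assoc)
    qed
    then show ?thesis using lin by blast
  qed
next
  assume "linear_map_on (DL1_space c M) T \<and> ?B"
  then have lin: "linear_map_on (DL1_space c M) T" and B: ?B by auto
  let ?E = "DL1_space c M"
  have diff: "T \<psi> = T \<phi> + T (\<lambda>t. \<psi> t - \<phi> t)" if "\<phi> \<in> ?E" "\<psi> \<in> ?E" for \<phi> \<psi>
    using linear_map_on_add[OF lin that(1) DL1_space_diff[OF that(2,1)]] by simp
  have nhd: "\<exists>F \<epsilon>. finite F \<and> F \<subseteq> DL1_seminorms c M \<and> 0 < \<epsilon> \<and>
      (\<forall>\<eta>\<in>?E. (\<forall>p\<in>F. p \<eta> < \<epsilon>) \<longrightarrow> norm (T \<eta>) < e)" if e: "e > 0" for e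
  proof (cases c)
    case Beurling
    then obtain h C where hC: "h > 0" "C \<ge> 0" "\<And>\<phi>. \<phi> \<in> ?E \<inter> DL1_step M h \<Longrightarrow> norm (T \<phi>) \<le> C * DL1_norm M h \<phi>"
      using B by (auto simp: at_scales_def)
    have "norm (T \<eta>) < e" if "\<eta> \<in> ?E" "DL1_norm M h \<eta> < e / (C + 1)" for \<eta>
    proof -
      have s: "\<eta> \<in> DL1_step M h" using that Beurling hC by (auto simp: DL1_space_def)
      have "norm (T \<eta>) \<le> C * DL1_norm M h \<eta>" using hC(3) that s by blast
      also have "\<dots> \<le> (C + 1) * DL1_norm M h \<eta>"
        using DL1_norm_nonneg[OF s hC(1)] by (simp add: distrib_right)
      also have "\<dots> < e" using that(2) hC(2) by (simp add: field_simps)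
      finally show ?thesis .
    qed
    then show ?thesis using hC e Beurling
      by (intro exI[of _ "{DL1_norm M h}"] exI[of _ "e / (C + 1)"]) (auto simp: DL1_seminorms_def)
  next
    case Roumieu
    have "(\<lambda>\<phi>. norm (T \<phi>)) \<in> DL1_seminorms c M"
      unfolding DL1_seminorms_def Roumieu ultra_case.case mem_Collect_eq seminorm_on_def
    proof (intro conjI ballI allI impI)
      fix h :: real assume h: "h > 0"
      obtain C where "\<forall>\<phi>\<in>?E \<inter> DL1_step M h. norm (T \<phi>) \<le> C * DL1_norm M h \<phi>"
        using at_scales_Roumieu[OF B Roumieu h] by blast
      moreover have "DL1_step M h \<subseteq> ?E" using h Roumieu by (auto simp: DL1_space_def)
      ultimately show "\<exists>C. \<forall>\<phi>\<in>DL1_step M h. norm (T \<phi>) \<le> C * DL1_norm M h \<phi>" by blast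
    qed (use lin Roumieu in \<open>auto simp: linear_map_on_add linear_map_on_cmult norm_scaleC norm_triangle_ineq\<close>)
    then show ?thesis using e by (intro exI[of _ "{\<lambda>\<phi>. norm (T \<phi>)}"] exI[of _ e]) auto
  qed
  have "continuous_map (DL1_topology c M) euclidean T"
    unfolding continuous_map_def topspace_DL1_topology openin_DL1_topology
  proof (intro conjI allI impI)
    show "T \<in> ?E \<rightarrow> topspace euclidean" by simp
    fix V :: "'a set" assume "openin euclidean V"
    then have V: "open V" by simp
    show "seminorm_open ?E (DL1_seminorms c M) {\<phi> \<in> ?E. T \<phi> \<in> V}"
    proof (rule seminorm_openI)
      fix \<phi> assume "\<phi> \<in> {\<phi> \<in> ?E. T \<phi> \<in> V}"
      then have \<phi>: "\<phi> \<in> ?E" "T \<phi> \<in> V" by auto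
      then obtain e where e: "e > 0" "ball (T \<phi>) e \<subseteq> V" using V open_contains_ball by blast
      obtain F \<epsilon> where F: "finite F" "F \<subseteq> DL1_seminorms c M" "0 < \<epsilon>"
        "\<And>\<eta>. \<eta> \<in> ?E \<Longrightarrow> (\<forall>p\<in>F. p \<eta> < \<epsilon>) \<Longrightarrow> norm (T \<eta>) < e" using nhd[OF e(1)] by blast
      have "{\<psi> \<in> ?E. \<forall>p\<in>F. p (\<lambda>t. \<psi> t - \<phi> t) < \<epsilon>} \<subseteq> {\<phi> \<in> ?E. T \<phi> \<in> V}"
      proof safe
        fix \<psi> assume \<psi>: "\<psi> \<in> ?E" "\<forall>p\<in>F. p (\<lambda>t. \<psi> t - \<phi> t) < \<epsilon>"
        have "norm (T (\<lambda>t. \<psi> t - \<phi> t)) < e"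
          using F(4)[OF DL1_space_diff[OF \<psi>(1) \<phi>(1)] \<psi>(2)] .
        then have "T \<psi> \<in> ball (T \<phi>) e" using diff[OF \<phi>(1) \<psi>(1)] by (simp add: dist_norm)
        then show "T \<psi> \<in> V" using e by blast
      qed
      then show "\<exists>F \<epsilon>. finite F \<and> F \<subseteq> DL1_seminorms c M \<and> 0 < \<epsilon> \<and>
          {\<psi> \<in> ?E. \<forall>p\<in>F. p (\<lambda>t. \<psi> t - \<phi> t) < \<epsilon>} \<subseteq> {\<phi> \<in> ?E. T \<phi> \<in> V}"
        using F by blast
    qed auto
  qed
  then show "T \<in> DL1_dual c M" using lin by (simp add: DL1_dual_def)
qed

lemma DL1_dual_linear: "T \<in> DL1_dual c M \<Longrightarrow> linear_map_on (DL1_space c M) T"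
  by (simp add: DL1_dual_def)

lemma DL1_dual_diff:
  assumes "T \<in> DL1_dual c M" "\<phi> \<in> DL1_space c M" "\<psi> \<in> DL1_space c M"
  shows "T (\<lambda>t. \<phi> t - \<psi> t) = T \<phi> - T \<psi>"
  using linear_map_on_add[OF DL1_dual_linear[OF assms(1)] assms(3) DL1_space_diff[OF assms(2,3)]] by simp

lemma DL1_dual_bound:
  fixes T :: "(real \<Rightarrow> complex) \<Rightarrow> 'a::complex_banach"
  assumes "T \<in> DL1_dual c M" "\<phi> \<in> DL1_space c M" "L > 0"
  obtains h C where "h > 0" "C \<ge> 0" "\<phi> \<in> DL1_step M (L * h)"
    "\<And>\<psi>. \<psi> \<in> DL1_space c M \<Longrightarrow> \<psi> \<in> DL1_step M h \<Longrightarrow> norm (T \<psi>) \<le> C * DL1_norm M h \<psi>"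
proof -
  have "at_scales c (\<lambda>h. \<exists>C\<ge>0. \<forall>\<phi>\<in>DL1_space c M \<inter> DL1_step M h. norm (T \<phi>) \<le> C * DL1_norm M h \<phi>)"
    using assms(1) DL1_dual_iff by blast
  from at_scales_DL1_space[OF this assms(2,3)] that show thesis by (metis IntI)
qed

end

section \<open>Regular ultradistributions and ultradifferential operators\<close>

text \<open>Henstock--Kurzweil integrability on the line follows from that on compact intervals, where the
  integrand is continuous, and an integrable majorant. The sets \<open>S\<close> that are needed are half-lines and
  the whole line.\<close>

lemma scaleC_integrable_restrict:
  fixes f :: "real \<Rightarrow> 'a::complex_banach" and \<phi> :: "real \<Rightarrow> complex"
  assumes f: "continuous_on UNIV f" "\<And>t. norm (f t) \<le> B"
    and \<phi>: "continuous_on UNIV \<phi>" "integrable lborel \<phi>"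
    and S: "\<And>a b. \<exists>a' b'. S \<inter> {a..b} = {a'..b'::real}"
  shows "(\<lambda>t. if t \<in> S then \<phi> t *\<^sub>C f t else 0) integrable_on UNIV"
proof -
  have B: "0 \<le> B" using f(2)[of 0] norm_ge_zero order_trans by blast
  have "(\<lambda>t. if t \<in> S then \<phi> t *\<^sub>C f t else 0) integrable_on UNIV"
  proof (rule integrable_on_all_intervals_integrable_bound[where g = "\<lambda>t. cmod (\<phi> t) * B"])
    fix a b :: real
    obtain a' b' where ab: "S \<inter> {a..b} = {a'..b'}" using S by blast
    have "(\<lambda>t. \<phi> t *\<^sub>C f t) integrable_on S \<inter> {a..b}"
      unfolding ab by (intro integrable_continuous_interval scaleC.continuous_on)
        (auto intro: continuous_on_subset f \<phi>)
    then show "(\<lambda>t. if t \<in> UNIV then if t \<in> S then \<phi> t *\<^sub>C f t else 0 else 0) integrable_on cbox a b"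
      using integrable_restrict_Int[of S "\<lambda>t. \<phi> t *\<^sub>C f t" "{a..b}"] by simp
  next
    have "integrable lborel (\<lambda>t. cmod (\<phi> t) * B)" using \<phi>(2) by simp
    then show "(\<lambda>t. cmod (\<phi> t) * B) integrable_on UNIV" by (rule integrable_on_lborel)
  qed (auto simp: norm_scaleC B intro!: mult_left_mono f(2))
  then show ?thesis .
qed

lemma scaleC_integrable_UNIV:
  fixes f :: "real \<Rightarrow> 'a::complex_banach" and \<phi> :: "real \<Rightarrow> complex"
  assumes "continuous_on UNIV f" "\<And>t. norm (f t) \<le> B"
    and "continuous_on UNIV \<phi>" "integrable lborel \<phi>"
  shows "(\<lambda>t. \<phi> t *\<^sub>C f t) integrable_on UNIV"
proof -
  have "\<exists>a' b'. UNIV \<inter> {a..b} = {a'..b'}" for a b :: real by auto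
  from scaleC_integrable_restrict[OF assms this] show ?thesis by simp
qed

lemma norm_integral_scaleC_le:
  fixes f :: "real \<Rightarrow> 'a::complex_banach"
  assumes "integrable lborel k" "\<And>t. k t \<noteq> 0 \<Longrightarrow> norm (f t) \<le> B" "(\<lambda>t. k t *\<^sub>C f t) integrable_on UNIV"
  shows "norm (integral UNIV (\<lambda>t. k t *\<^sub>C f t)) \<le> B * L1 k"
proof -
  have i: "integrable lborel (\<lambda>t. cmod (k t) * B)" using assms(1) by simp
  have "norm (integral UNIV (\<lambda>t. k t *\<^sub>C f t)) \<le> integral UNIV (\<lambda>t. cmod (k t) * B)"
  proof (rule integral_norm_bound_integral[OF assms(3) integrable_on_lborel[OF i]])
    fix t
    show "norm (k t *\<^sub>C f t) \<le> cmod (k t) * B"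
      using assms(2)[of t] by (cases "k t = 0") (auto simp: norm_scaleC intro: mult_left_mono)
  qed
  also have "\<dots> = B * L1 k"
    using integral_lborel[OF i] assms(1) by (simp add: L1_def mult.commute)
  finally show ?thesis .
qed

lemma regular_integrable:
  fixes f :: "real \<Rightarrow> 'a::complex_banach"
  assumes "continuous_on UNIV f" "\<And>t. norm (f t) \<le> B" "\<phi> \<in> DL1"
  shows "(\<lambda>t. nderiv p \<phi> t *\<^sub>C f t) integrable_on UNIV"
  by (rule scaleC_integrable_UNIV[OF assms(1,2)])
    (auto intro: smooth_continuous_on DL1_smooth DL1_integrable assms(3))

lemma regular_bound:
  fixes f :: "real \<Rightarrow> 'a::complex_banach"
  assumes "continuous_on UNIV f" "\<And>t. norm (f t) \<le> B" "\<phi> \<in> DL1"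
  shows "norm (regular f (nderiv p \<phi>)) \<le> B * L1 (nderiv p \<phi>)"
  unfolding regular_def
  by (rule norm_integral_scaleC_le[OF DL1_integrable[OF assms(3)] assms(2) regular_integrable[OF assms]])

lemma regular_add:
  fixes f :: "real \<Rightarrow> 'a::complex_banach"
  assumes "continuous_on UNIV f" "\<And>t. norm (f t) \<le> B" "\<phi> \<in> DL1" "\<psi> \<in> DL1"
  shows "regular f (\<lambda>t. \<phi> t + \<psi> t) = regular f \<phi> + regular f \<psi>"
  unfolding regular_def scaleC_add_left
  using regular_integrable[OF assms(1,2,3), of 0] regular_integrable[OF assms(1,2,4), of 0]
  by (intro Henstock_Kurzweil_Integration.integral_add) auto

lemma regular_cmult:
  fixes f :: "real \<Rightarrow> 'a::complex_banach"
  assumes "continuous_on UNIV f" "\<And>t. norm (f t) \<le> B" "\<phi> \<in> DL1"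
  shows "regular f (\<lambda>t. a * \<phi> t) = a *\<^sub>C regular f \<phi>"
  unfolding regular_def scaleC_scaleC[symmetric]
  using integral_linear[OF regular_integrable[OF assms, of 0] scaleC.bounded_linear_right[of a]]
  by (simp add: o_def)

lemma ultradiff_class_iff:
  assumes "\<And>p. M p > 0"
  shows "ultradiff_class c M a \<longleftrightarrow> at_scales c (\<lambda>l. \<exists>C\<ge>0. \<forall>p. cmod (a p) \<le> C * l ^ p / M p)"
proof -
  have "(\<exists>C>0. \<forall>p\<ge>1. cmod (a p) \<le> C * l ^ p / M p) \<longleftrightarrow> (\<exists>C\<ge>0. \<forall>p. cmod (a p) \<le> C * l ^ p / M p)"
    if "l > 0" for l
  proof
    assume "\<exists>C>0. \<forall>p\<ge>1. cmod (a p) \<le> C * l ^ p / M p"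
    then obtain C where C: "C > 0" "\<And>p. p \<ge> 1 \<Longrightarrow> cmod (a p) \<le> C * l ^ p / M p" by blast
    let ?C = "C + cmod (a 0) * M 0"
    have "cmod (a p) \<le> ?C * l ^ p / M p" for p
    proof (cases "p = 0")
      case True
      then show ?thesis using assms[of 0] C(1) by (simp add: field_simps)
    next
      case False
      then have "cmod (a p) \<le> C * l ^ p / M p" using C(2)[of p] by simp
      also have "\<dots> \<le> ?C * l ^ p / M p"
        using assms[of p] assms[of 0] that by (intro divide_right_mono mult_right_mono) auto
      finally show ?thesis .
    qed
    moreover have "0 \<le> ?C" using C(1) assms[of 0] by simp
    ultimately show "\<exists>C\<ge>0. \<forall>p. cmod (a p) \<le> C * l ^ p / M p" by blast
  next
    assume "\<exists>C\<ge>0. \<forall>p. cmod (a p) \<le> C * l ^ p / M p"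
    then obtain C where C: "C \<ge> 0" "\<And>p. cmod (a p) \<le> C * l ^ p / M p" by blast
    have "cmod (a p) \<le> (C + 1) * l ^ p / M p" for p
    proof -
      have "C * l ^ p / M p \<le> (C + 1) * l ^ p / M p"
        using assms[of p] that by (intro divide_right_mono mult_right_mono) auto
      then show ?thesis using C(2)[of p] by linarith
    qed
    then show "\<exists>C>0. \<forall>p\<ge>1. cmod (a p) \<le> C * l ^ p / M p" using C(1) by (intro exI[of _ "C + 1"]) auto
  qed
  then show ?thesis unfolding ultradiff_class_def at_scales_def
    by (cases c) (simp_all only: ultra_case.case, blast+)
qed

definition ultradiff_term :: "(nat \<Rightarrow> complex) \<Rightarrow> (real \<Rightarrow> 'a::complex_banach) \<Rightarrow> (real \<Rightarrow> complex) \<Rightarrow> nat \<Rightarrow> 'a" where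
  "ultradiff_term a f \<phi> p = (a p * (- \<i>) ^ p * (- 1) ^ p) *\<^sub>C regular f (nderiv p \<phi>)"

lemma ultradiff_eq: "ultradiff a f \<phi> = (\<Sum>p. ultradiff_term a f \<phi> p)"
  by (simp add: ultradiff_def ultradiff_term_def)

context positive_sequence
begin

text \<open>Half of the scale is spent on a geometric factor, which makes the series converge.\<close>

lemma ultradiff_term_bound:
  fixes f :: "real \<Rightarrow> 'a::complex_banach"
  assumes f: "continuous_on UNIV f" "\<And>t. norm (f t) \<le> B"
    and a: "\<And>p. cmod (a p) \<le> C * l ^ p / M p" "C \<ge> 0"
    and \<phi>: "\<phi> \<in> DL1_step M (2 * l)" and l: "l > 0"
  shows "norm (ultradiff_term a f \<phi> p) \<le> C * B * DL1_norm M (2 * l) \<phi> * (1 / 2) ^ p"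
proof -
  let ?N = "DL1_norm M (2 * l) \<phi>"
  have B: "0 \<le> B" using f(2)[of 0] norm_ge_zero order_trans by blast
  have "norm (ultradiff_term a f \<phi> p) = cmod (a p) * norm (regular f (nderiv p \<phi>))"
    by (simp add: ultradiff_term_def norm_scaleC norm_mult norm_power)
  also have "\<dots> \<le> (C * l ^ p / M p) * (B * L1 (nderiv p \<phi>))"
    using a l M_nonneg[of p] by (intro mult_mono regular_bound f DL1_step_DL1[OF \<phi>]) auto
  also have "\<dots> \<le> (C * l ^ p / M p) * (B * (?N * M p / (2 * l) ^ p))"
    using a l M_nonneg[of p] B by (intro mult_left_mono DL1_step_L1_le[OF \<phi>]) auto
  also have "\<dots> = C * B * ?N * (1 / 2) ^ p"
    using M_pos[of p] l by (simp add: power_mult_distrib power_divide)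
  finally show ?thesis .
qed

lemma ultradiff_summable:
  fixes f :: "real \<Rightarrow> 'a::complex_banach"
  assumes f: "continuous_on UNIV f" "\<And>t. norm (f t) \<le> B"
    and a: "ultradiff_class c M a" and \<phi>: "\<phi> \<in> DL1_space c M"
  shows "summable (ultradiff_term a f \<phi>)"
proof -
  from a have "at_scales c (\<lambda>l. \<exists>C\<ge>0. \<forall>p. cmod (a p) \<le> C * l ^ p / M p)"
    using ultradiff_class_iff[of M, OF M_pos] by blast
  then obtain l where l: "l > 0" "\<exists>C\<ge>0. \<forall>p. cmod (a p) \<le> C * l ^ p / M p" "\<phi> \<in> DL1_step M (2 * l)"
    by (rule at_scales_DL1_space[OF _ \<phi>, of _ 2]) auto
  then obtain C where C: "C \<ge> 0" "\<And>p. cmod (a p) \<le> C * l ^ p / M p" by blast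
  show ?thesis
    by (rule summable_comparison_test'[OF _ ultradiff_term_bound[OF f C(2,1) l(3,1)]])
      (intro summable_mult summable_geometric, simp)
qed

lemma ultradiff_dual:
  fixes f g :: "real \<Rightarrow> 'a::complex_banach"
  assumes f: "continuous_on UNIV f" "bounded (range f)"
    and g: "continuous_on UNIV g" "bounded (range g)"
    and a: "ultradiff_class c M a"
  shows "(\<lambda>\<phi>. ultradiff a f \<phi> + regular g \<phi>) \<in> DL1_dual c M"
proof -
  obtain B where B: "\<And>t. norm (f t) \<le> B" using f(2) by (auto simp: bounded_iff)
  obtain B' where B': "\<And>t. norm (g t) \<le> B'" using g(2) by (auto simp: bounded_iff)
  have B0: "0 \<le> B" using B[of 0] norm_ge_zero order_trans by blast
  have B0': "0 \<le> B'" using B'[of 0] norm_ge_zero order_trans by blast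
  note sm = ultradiff_summable[OF f(1) B a]
  show ?thesis unfolding DL1_dual_iff
  proof
    show "linear_map_on (DL1_space c M) (\<lambda>\<phi>. ultradiff a f \<phi> + regular g \<phi>)"
      unfolding linear_map_on_def
    proof (intro conjI ballI allI)
      fix \<phi> \<psi> assume \<phi>: "\<phi> \<in> DL1_space c M" and \<psi>: "\<psi> \<in> DL1_space c M"
      note d = DL1_space_DL1[OF \<phi>] DL1_space_DL1[OF \<psi>]
      have "ultradiff_term a f (\<lambda>t. \<phi> t + \<psi> t) p = ultradiff_term a f \<phi> p + ultradiff_term a f \<psi> p" for p
        unfolding ultradiff_term_def nderiv_add(2)[OF DL1_smooth[OF d(1)] DL1_smooth[OF d(2)]]
          regular_add[OF f(1) B DL1_nderiv[OF d(1)] DL1_nderiv[OF d(2)]]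
        by (rule scaleC_add_right)
      then have "ultradiff a f (\<lambda>t. \<phi> t + \<psi> t) = ultradiff a f \<phi> + ultradiff a f \<psi>"
        unfolding ultradiff_eq using suminf_add[OF sm[OF \<phi>] sm[OF \<psi>]] by presburger
      then show "ultradiff a f (\<lambda>t. \<phi> t + \<psi> t) + regular g (\<lambda>t. \<phi> t + \<psi> t) =
          ultradiff a f \<phi> + regular g \<phi> + (ultradiff a f \<psi> + regular g \<psi>)"
        using regular_add[OF g(1) B' d] by simp
    next
      fix b \<phi> assume \<phi>: "\<phi> \<in> DL1_space c M"
      note d = DL1_space_DL1[OF \<phi>]
      have "ultradiff_term a f (\<lambda>t. b * \<phi> t) p = b *\<^sub>C ultradiff_term a f \<phi> p" for p
        unfolding ultradiff_term_def nderiv_cmult(2)[OF DL1_smooth[OF d]]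
          regular_cmult[OF f(1) B DL1_nderiv[OF d]] scaleC_scaleC by (simp add: mult_ac)
      then have "ultradiff a f (\<lambda>t. b * \<phi> t) = b *\<^sub>C ultradiff a f \<phi>"
        unfolding ultradiff_eq using bounded_linear.suminf[OF scaleC.bounded_linear_right sm[OF \<phi>], of b] by presburger
      then show "ultradiff a f (\<lambda>t. b * \<phi> t) + regular g (\<lambda>t. b * \<phi> t) =
          b *\<^sub>C (ultradiff a f \<phi> + regular g \<phi>)"
        using regular_cmult[OF g(1) B' d] by (simp add: scaleC_add_right)
    qed
    from a have "at_scales c (\<lambda>l. \<exists>C\<ge>0. \<forall>p. cmod (a p) \<le> C * l ^ p / M p)"
      using ultradiff_class_iff[of M, OF M_pos] by blast
    then show "at_scales c (\<lambda>h. \<exists>C\<ge>0. \<forall>\<phi>\<in>DL1_space c M \<inter> DL1_step M h.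
        norm (ultradiff a f \<phi> + regular g \<phi>) \<le> C * DL1_norm M h \<phi>)"
    proof (rule at_scales_rescale[of _ _ 2])
      fix l :: real assume l: "l > 0" "\<exists>C\<ge>0. \<forall>p. cmod (a p) \<le> C * l ^ p / M p"
      then obtain C where C: "C \<ge> 0" "\<And>p. cmod (a p) \<le> C * l ^ p / M p" by blast
      have "norm (ultradiff a f \<phi> + regular g \<phi>) \<le> (C * B * 2 + B' * M 0) * DL1_norm M (2 * l) \<phi>"
        if "\<phi> \<in> DL1_step M (2 * l)" for \<phi>
      proof -
        let ?N = "DL1_norm M (2 * l) \<phi>"
        have geo: "(\<lambda>p. C * B * ?N * (1 / 2) ^ p) sums (C * B * ?N * 2)"
          using sums_mult[OF geometric_sums[of "1 / 2::real"], of "C * B * ?N"] by simp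
        have "norm (ultradiff a f \<phi>) \<le> (\<Sum>p. C * B * ?N * (1 / 2) ^ p)"
          unfolding ultradiff_eq
          by (rule norm_suminf_le) (use geo ultradiff_term_bound[OF f(1) B C(2,1) that l(1)] in \<open>auto simp: sums_iff\<close>)
        also have "\<dots> = C * B * 2 * ?N" using geo by (simp add: sums_iff)
        finally have 1: "norm (ultradiff a f \<phi>) \<le> C * B * 2 * ?N" .
        have "norm (regular g \<phi>) \<le> B' * L1 \<phi>"
          using regular_bound[OF g(1) B' DL1_step_DL1[OF that], of 0] by simp
        also have "\<dots> \<le> B' * (?N * M 0)"
          using DL1_step_L1_le[OF that, of 0] l B0' by (intro mult_left_mono) auto
        finally show ?thesis
          using 1 norm_triangle_ineq[of "ultradiff a f \<phi>" "regular g \<phi>"]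
          by (simp add: algebra_simps)
      qed
      moreover have "0 \<le> C * B * 2 + B' * M 0" using C(1) B0 B0' M_nonneg by simp
      ultimately show "\<exists>C\<ge>0. \<forall>\<phi>\<in>DL1_space c M \<inter> DL1_step M (2 * l).
          norm (ultradiff a f \<phi> + regular g \<phi>) \<le> C * DL1_norm M (2 * l) \<phi>" by blast
    qed simp
  qed
qed

lemma regular_zero: "regular (\<lambda>_. 0 :: 'a::complex_banach) \<phi> = 0"
  by (simp add: regular_def scaleC.zero_right)

lemma regular_dual:
  fixes g :: "real \<Rightarrow> 'a::complex_banach"
  assumes "continuous_on UNIV g" "bounded (range g)"
  shows "regular g \<in> DL1_dual c M"
proof -
  have "ultradiff_class c M (\<lambda>_. 0)"
    using M_nonneg by (auto simp: ultradiff_class_def split: ultra_case.split intro!: exI[of _ "1::real"])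
  from ultradiff_dual[OF _ _ assms this, of "\<lambda>_. 0"]
  have "(\<lambda>\<phi>. ultradiff (\<lambda>_. 0) (\<lambda>_. 0 :: 'a) \<phi> + regular g \<phi>) \<in> DL1_dual c M" by auto
  then show ?thesis by (simp add: ultradiff_def scaleC.zero_left)
qed

end

section \<open>Superposition of translates\<close>

lemma L1_tail_tendsto:
  assumes "integrable lborel \<psi>" "\<And>n. S n \<in> sets borel" "\<And>t. eventually (\<lambda>n. t \<notin> S n) sequentially"
  shows "(\<lambda>n. L1 (\<lambda>t. indicator (S n) t * \<psi> t)) \<longlonglongrightarrow> 0"
proof -
  have [measurable]: "\<psi> \<in> borel_measurable borel" "\<And>n. S n \<in> sets borel"
    using borel_measurable_integrable[OF assms(1)] assms(2) by auto
  have "(\<lambda>n. LINT t|lborel. cmod (indicator (S n) t * \<psi> t)) \<longlonglongrightarrow> (LINT t|(lborel :: real measure). 0)"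
  proof (rule integral_dominated_convergence[where w = "\<lambda>t. cmod (\<psi> t)"])
    show "AE t in lborel. (\<lambda>n. cmod (indicator (S n) t * \<psi> t)) \<longlonglongrightarrow> 0"
    proof (rule AE_I2)
      fix t
      show "(\<lambda>n. cmod (indicator (S n) t * \<psi> t)) \<longlonglongrightarrow> 0"
        by (rule tendsto_eventually[OF eventually_mono[OF assms(3)[of t]]]) auto
    qed
  qed (use assms(1) in \<open>auto simp: indicator_def\<close>)
  then show ?thesis by (simp add: L1_def)
qed

lemma integrable_indicator_mult:
  assumes "integrable lborel \<psi>" "S \<in> sets borel"
  shows "integrable lborel (\<lambda>t::real. indicator S t * \<psi> t :: complex)"
proof -
  have [measurable]: "\<psi> \<in> borel_measurable borel" "S \<in> sets borel"
    using borel_measurable_integrable[OF assms(1)] assms(2) by auto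
  show ?thesis
    by (rule Bochner_Integration.integrable_bound[OF assms(1)]) (auto simp: indicator_def)
qed

lemma conv_concentrated_at_bound:
  assumes k: "integrable lborel k" and supp: "\<And>t. k t \<noteq> 0 \<Longrightarrow> \<bar>t - x\<bar> \<le> \<delta>" and \<phi>: "\<phi> \<in> DL1"
  shows "L1 (\<lambda>s. conv k \<phi> s - (LINT t|lborel. k t) * \<phi> (s - x)) \<le> L1 k * (\<delta> * L1 (nderiv 1 \<phi>))"
proof -
  let ?k = "\<lambda>t. k (t + x)"
  have k': "integrable lborel ?k" using integrable_shift[OF k, of "- x"] by simp
  have eq: "conv ?k \<phi> s = conv k \<phi> (s + x)" for s
    unfolding conv_def
    using lborel_integral_real_affine[of 1 "\<lambda>u. k u * \<phi> (s + x - u)" x] by (simp add: algebra_simps)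
  have i: "(LINT t|lborel. ?k t) = (LINT t|lborel. k t)"
    using lborel_integral_real_affine[of 1 k x] by (simp add: algebra_simps)
  have n: "L1 ?k = L1 k" using L1_shift[of k "- x"] by simp
  have "L1 (\<lambda>s. conv k \<phi> s - (LINT t|lborel. k t) * \<phi> (s - x))
      = L1 (\<lambda>s. (\<lambda>s. conv ?k \<phi> s - (LINT t|lborel. ?k t) * \<phi> s) (s - x))"
    by (simp add: eq i)
  also have "\<dots> = L1 (\<lambda>s. conv ?k \<phi> s - (LINT t|lborel. ?k t) * \<phi> s)" by (rule L1_shift)
  also have "\<dots> \<le> L1 ?k * (\<delta> * L1 (nderiv 1 \<phi>))"
    by (rule conv_concentrated_bound[OF k' _ \<phi>]) (use supp in force)
  finally show ?thesis by (simp add: n)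
qed

lemma conv_diff_kernel:
  assumes "integrable lborel k" "integrable lborel k'" "\<phi> \<in> DL1"
  shows "conv (\<lambda>t. k t - k' t) \<phi> = (\<lambda>s. conv k \<phi> s - conv k' \<phi> s)"
  using conv_integrable_DL1[OF assms(1,3), of 0] conv_integrable_DL1[OF assms(2,3), of 0]
  by (simp add: conv_def left_diff_distrib fun_eq_iff)

context positive_sequence
begin

lemma conv_concentrated_step:
  assumes k: "integrable lborel k" "\<And>t. k t \<noteq> 0 \<Longrightarrow> \<bar>t - x\<bar> \<le> \<delta>" "\<delta> \<ge> 0"
    and w: "w \<in> DL1" "nderiv 1 w \<in> DL1_step M h" "h > 0"
  shows "(\<lambda>s. conv k w s - (LINT t|lborel. k t) * w (s - x)) \<in> DL1_step M h" (is "?e \<in> _")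
    and "DL1_norm M h (\<lambda>s. conv k w s - (LINT t|lborel. k t) * w (s - x)) \<le> L1 k * \<delta> * DL1_norm M h (nderiv 1 w)"
proof -
  let ?c = "LINT t|lborel. k t"
  note cw = conv_DL1(1)[OF k(1) w(1)]
  have ws: "(\<lambda>s. w (s - x)) \<in> DL1" using DL1_affine[OF w(1), of 1 "- x"] by simp
  have e: "?e \<in> DL1" by (rule DL1_diff[OF cw DL1_cmult[OF ws]])
  have "L1 (nderiv p ?e) \<le> L1 k * \<delta> * L1 (nderiv p (nderiv 1 w))" for p
  proof -
    have "nderiv p ?e = (\<lambda>s. conv k (nderiv p w) s - ?c * nderiv p w (s - x))"
      using nderiv_diff[OF DL1_smooth[OF cw] nderiv_cmult(1)[OF DL1_smooth[OF ws]], of p ?c]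
        conv_smooth(2)[OF k(1) w(1), of p] nderiv_cmult(2)[OF DL1_smooth[OF ws], of p ?c]
        nderiv_affine(2)[OF DL1_smooth[OF w(1)], of p 1 "- x"]
      by simp
    then show ?thesis
      using conv_concentrated_at_bound[OF k(1,2) DL1_nderiv[OF w(1)], of p]
      by (simp add: nderiv_nderiv mult.assoc)
  qed
  from DL1_step_dominated[OF e this w(2,3)] k(3)
  show "?e \<in> DL1_step M h" "DL1_norm M h ?e \<le> L1 k * \<delta> * DL1_norm M h (nderiv 1 w)"
    by (simp_all add: L1_nonneg)
qed

lemma translation_step_bound:
  assumes w: "w \<in> DL1" "nderiv 1 w \<in> DL1_step M h" "h > 0"
  shows "(\<lambda>s. w (s - y) - w (s - x)) \<in> DL1_step M h" (is "?e \<in> _")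
    and "DL1_norm M h (\<lambda>s. w (s - y) - w (s - x)) \<le> \<bar>y - x\<bar> * DL1_norm M h (nderiv 1 w)"
proof -
  have ws: "(\<lambda>s. w (s - x)) \<in> DL1" for x using DL1_affine[OF w(1), of 1 "- x"] by simp
  have e: "?e \<in> DL1" by (rule DL1_diff[OF ws ws])
  have "L1 (nderiv p ?e) \<le> \<bar>y - x\<bar> * L1 (nderiv p (nderiv 1 w))" for p
  proof -
    have "nderiv p ?e = (\<lambda>s. nderiv p w (s - y) - nderiv p w (s - x))"
      using nderiv_diff[OF DL1_smooth[OF ws] DL1_smooth[OF ws], of p y x]
        nderiv_affine(2)[OF DL1_smooth[OF w(1)], of p 1 "- x"] nderiv_affine(2)[OF DL1_smooth[OF w(1)], of p 1 "- y"]
      by simp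
    also have "\<dots> = (\<lambda>s. (\<lambda>s. nderiv p w (s - (y - x)) - nderiv p w s) (s - x))" by (simp add: algebra_simps)
    finally have "L1 (nderiv p ?e) = L1 (\<lambda>s. nderiv p w (s - (y - x)) - nderiv p w s)"
      using L1_shift[of "\<lambda>s. nderiv p w (s - (y - x)) - nderiv p w s" x] by simp
    then show ?thesis
      using translation_L1_bound[OF DL1_nderiv[OF w(1)], of p "y - x"] by (simp add: nderiv_nderiv)
  qed
  from DL1_step_dominated[OF e this w(2,3)]
  show "?e \<in> DL1_step M h" "DL1_norm M h ?e \<le> \<bar>y - x\<bar> * DL1_norm M h (nderiv 1 w)" by simp_all
qed

end

context weight_sequence
begin

lemma DL1_dual_bound_deriv:
  fixes T :: "(real \<Rightarrow> complex) \<Rightarrow> 'a::complex_banach"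
  assumes "T \<in> DL1_dual c M" "\<phi> \<in> DL1_space c M"
  obtains h C where "h > 0" "C \<ge> 0" "\<phi> \<in> DL1_step M h" "\<And>q. nderiv q \<phi> \<in> DL1_step M h"
    "\<And>\<psi>. \<psi> \<in> DL1_space c M \<Longrightarrow> \<psi> \<in> DL1_step M h \<Longrightarrow> norm (T \<psi>) \<le> C * DL1_norm M h \<psi>"
proof -
  obtain A H where AH: "A > 1" "H > 1" "\<And>p q. M (p + q) \<le> A * H ^ (p + q) * (M p * M q)"
    by (rule M_stability) blast
  have H: "H > 0" using AH(2) by simp
  obtain h C where h: "h > 0" "C \<ge> 0" "\<phi> \<in> DL1_step M (H * h)"
    "\<And>\<psi>. \<psi> \<in> DL1_space c M \<Longrightarrow> \<psi> \<in> DL1_step M h \<Longrightarrow> norm (T \<psi>) \<le> C * DL1_norm M h \<psi>"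
    by (rule DL1_dual_bound[OF assms H]) blast
  have "\<phi> \<in> DL1_step M h"
    using DL1_step_mono(1)[OF h(3,1)] AH(2) h(1) by simp
  then show thesis using that[of h C] h nderiv_DL1_step(1)[OF AH h(3,1)] by blast
qed

text \<open>Translations are isometries of each step, and an increment costs one derivative.\<close>

lemma translates_bounded_lipschitz:
  fixes T :: "(real \<Rightarrow> complex) \<Rightarrow> 'a::complex_banach"
  assumes T: "T \<in> DL1_dual c M" and w: "w \<in> DL1_space c M"
  obtains B where "B \<ge> 0" "\<And>x. norm (T (\<lambda>t. w (t - x))) \<le> B"
    "\<And>x y. norm (T (\<lambda>t. w (t - y)) - T (\<lambda>t. w (t - x))) \<le> B * \<bar>y - x\<bar>"
proof -
  obtain h C where h: "h > 0" "C \<ge> 0" "w \<in> DL1_step M h" "nderiv 1 w \<in> DL1_step M h"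
    "\<And>\<psi>. \<psi> \<in> DL1_space c M \<Longrightarrow> \<psi> \<in> DL1_step M h \<Longrightarrow> norm (T \<psi>) \<le> C * DL1_norm M h \<psi>"
    by (rule DL1_dual_bound_deriv[OF T w]) blast
  let ?N = "DL1_norm M h w" and ?N' = "DL1_norm M h (nderiv 1 w)"
  have N: "0 \<le> ?N" "0 \<le> ?N'" using DL1_norm_nonneg h by auto
  let ?B = "C * ?N + C * ?N'"
  have "norm (T (\<lambda>t. w (t - x))) \<le> ?B" for x
  proof -
    have s: "(\<lambda>t. w (t - x)) \<in> DL1_step M h" "DL1_norm M h (\<lambda>t. w (t - x)) \<le> ?N"
      using DL1_step_isometry[OF h(3,1), of 1 "- x"] by simp_all
    have "norm (T (\<lambda>t. w (t - x))) \<le> C * DL1_norm M h (\<lambda>t. w (t - x))"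
      by (rule h(5)[OF DL1_space_shift[OF w] s(1)])
    also have "\<dots> \<le> C * ?N" by (rule mult_left_mono[OF s(2) h(2)])
    finally show ?thesis using mult_nonneg_nonneg[OF h(2) N(2)] by linarith
  qed
  moreover have "norm (T (\<lambda>t. w (t - y)) - T (\<lambda>t. w (t - x))) \<le> ?B * \<bar>y - x\<bar>" for x y
  proof -
    note e = translation_step_bound[OF DL1_space_DL1[OF w] h(4,1), of y x]
    have "norm (T (\<lambda>t. w (t - y)) - T (\<lambda>t. w (t - x))) = norm (T (\<lambda>s. w (s - y) - w (s - x)))"
      using DL1_dual_diff[OF T DL1_space_shift[OF w] DL1_space_shift[OF w], of y x] by simp
    also have "\<dots> \<le> C * DL1_norm M h (\<lambda>s. w (s - y) - w (s - x))"
      by (rule h(5)[OF DL1_space_diff[OF DL1_space_shift[OF w] DL1_space_shift[OF w]] e(1)])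
    also have "\<dots> \<le> C * (\<bar>y - x\<bar> * ?N')" by (rule mult_left_mono[OF e(2) h(2)])
    also have "\<dots> \<le> ?B * \<bar>y - x\<bar>"
      using mult_nonneg_nonneg[OF mult_nonneg_nonneg[OF h(2) N(1)], of "\<bar>y - x\<bar>"] by (simp add: algebra_simps)
    finally show ?thesis .
  qed
  moreover have "0 \<le> ?B" using h N by simp
  ultimately show thesis using that by blast
qed

lemma translates_continuous_bounded:
  fixes T :: "(real \<Rightarrow> complex) \<Rightarrow> 'a::complex_banach"
  assumes "T \<in> DL1_dual c M" "w \<in> DL1_space c M"
  shows "continuous_on UNIV (\<lambda>x. T (\<lambda>t. w (t - x)))" "bounded (range (\<lambda>x. T (\<lambda>t. w (t - x))))"
proof -
  obtain B where B: "B \<ge> 0" "\<And>x. norm (T (\<lambda>t. w (t - x))) \<le> B"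
    "\<And>x y. norm (T (\<lambda>t. w (t - y)) - T (\<lambda>t. w (t - x))) \<le> B * \<bar>y - x\<bar>"
    by (rule translates_bounded_lipschitz[OF assms]) blast
  have "B-lipschitz_on UNIV (\<lambda>x. T (\<lambda>t. w (t - x)))"
    using B by (auto simp: lipschitz_on_def dist_norm)
  then show "continuous_on UNIV (\<lambda>x. T (\<lambda>t. w (t - x)))" by (rule lipschitz_on_continuous_on)
  show "bounded (range (\<lambda>x. T (\<lambda>t. w (t - x))))" using B(2) by (auto simp: bounded_iff)
qed

text \<open>A Fubini theorem for a map that is only defined on test functions. Let \<open>\<Lambda> S\<close> be the difference of
  both sides for \<open>\<psi>\<close> restricted to \<open>S\<close>. It is additive in \<open>S\<close>, and on an interval of length \<open>\<delta>\<close> both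
  sides are approximated by the mass of \<open>\<psi>\<close> times one value of the orbit, so \<open>\<Lambda>\<close> is there of order \<open>\<delta>\<^sup>2\<close>.
  Hence \<open>x \<mapsto> \<Lambda> {..x}\<close> has derivative \<open>0\<close>; being constant and small near minus infinity, it vanishes.\<close>

lemma regular_translates:
  fixes T :: "(real \<Rightarrow> complex) \<Rightarrow> 'a::complex_banach"
  assumes T: "T \<in> DL1_dual c M" and w: "w \<in> DL1_space c M" and \<psi>: "\<psi> \<in> DL1"
  shows "regular (\<lambda>x. T (\<lambda>t. w (t - x))) \<psi> = T (conv \<psi> w)"
proof -
  define F where "F x = T (\<lambda>t. w (t - x))" for x
  obtain B where B: "B \<ge> 0" "\<And>x. norm (F x) \<le> B" "\<And>x y. norm (F y - F x) \<le> B * \<bar>y - x\<bar>"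
    unfolding F_def by (rule translates_bounded_lipschitz[OF T w]) blast
  have Fc: "continuous_on UNIV F"
    using translates_continuous_bounded(1)[OF T w] by (simp add: F_def[abs_def])
  obtain h C where h: "h > 0" "C \<ge> 0" "w \<in> DL1_step M h" "nderiv 1 w \<in> DL1_step M h"
    "\<And>\<psi>. \<psi> \<in> DL1_space c M \<Longrightarrow> \<psi> \<in> DL1_step M h \<Longrightarrow> norm (T \<psi>) \<le> C * DL1_norm M h \<psi>"
    by (rule DL1_dual_bound_deriv[OF T w]) blast
  let ?N = "DL1_norm M h w" and ?N' = "DL1_norm M h (nderiv 1 w)"
  have N: "0 \<le> ?N" "0 \<le> ?N'" using DL1_norm_nonneg h by auto
  note wD = DL1_space_DL1[OF w]
  have \<psi>c: "continuous_on UNIV \<psi>" using smooth_continuous_on[OF DL1_smooth[OF \<psi>], of UNIV 0] by simp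
  define P :: real where "P = L1 (nderiv 1 \<psi>)"
  have P: "cmod (\<psi> t) \<le> P" for t using DL1_sup_bound[OF \<psi>, of 0] by (simp add: P_def)
  have P0: "0 \<le> P" by (simp add: P_def L1_nonneg)
  define k where "k S t = indicator S t * \<psi> t" for S t
  have ki: "integrable lborel (k S)" if "S \<in> sets borel" for S
    unfolding k_def using integrable_indicator_mult[OF DL1_integrable0[OF \<psi>] that] .
  define good where "good S \<longleftrightarrow> S \<in> sets borel \<and> (\<lambda>t. k S t *\<^sub>C F t) integrable_on UNIV" for S
  define \<Lambda> where "\<Lambda> S = T (conv (k S) w) - integral UNIV (\<lambda>t. k S t *\<^sub>C F t)" for S
  have keq: "k S t *\<^sub>C F t = (if t \<in> S then \<psi> t *\<^sub>C F t else 0)" for S t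
    by (simp add: k_def scaleC.zero_left)
  have half_good: "good {..x}" for x
  proof -
    have "\<exists>a' b'. {..x} \<inter> {a..b} = {a'..b'}" for a b :: real
      by (rule exI[of _ a], rule exI[of _ "min x b"]) auto
    from scaleC_integrable_restrict[OF Fc B(2) \<psi>c DL1_integrable0[OF \<psi>] this]
    show ?thesis unfolding good_def keq by auto
  qed
  have univ_good: "good UNIV"
    using scaleC_integrable_UNIV[OF Fc B(2) \<psi>c DL1_integrable0[OF \<psi>]] unfolding good_def keq by simp
  have diff: "good (S' - S) \<and> \<Lambda> (S' - S) = \<Lambda> S' - \<Lambda> S" if "good S" "good S'" "S \<subseteq> S'" for S S'
  proof -
    have kd: "k (S' - S) = (\<lambda>t. k S' t - k S t)"
      using that(3) by (auto simp: k_def indicator_def fun_eq_iff)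
    have s: "S \<in> sets borel" "S' \<in> sets borel" using that by (auto simp: good_def)
    have i: "(\<lambda>t. k S t *\<^sub>C F t) integrable_on UNIV" "(\<lambda>t. k S' t *\<^sub>C F t) integrable_on UNIV"
      using that by (auto simp: good_def)
    have "T (conv (k (S' - S)) w) = T (conv (k S') w) - T (conv (k S) w)"
      unfolding kd conv_diff_kernel[OF ki[OF s(2)] ki[OF s(1)] wD]
      by (rule DL1_dual_diff[OF T conv_DL1_space[OF ki[OF s(2)] w] conv_DL1_space[OF ki[OF s(1)] w]])
    then show ?thesis
      unfolding \<Lambda>_def good_def kd scaleC.diff_left
      using i s Henstock_Kurzweil_Integration.integrable_diff[OF i(2,1)]
        Henstock_Kurzweil_Integration.integral_diff[OF i(2,1)] by auto
  qed
  have bound1: "norm (\<Lambda> S) \<le> (C * ?N + B) * L1 (k S)" if "good S" for S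
  proof -
    have s: "S \<in> sets borel" "(\<lambda>t. k S t *\<^sub>C F t) integrable_on UNIV" using that by (auto simp: good_def)
    have "norm (T (conv (k S) w)) \<le> C * DL1_norm M h (conv (k S) w)"
      by (rule h(5)[OF conv_DL1_space[OF ki[OF s(1)] w] conv_DL1_step(1)[OF ki[OF s(1)] h(3,1)]])
    also have "\<dots> \<le> C * (L1 (k S) * ?N)"
      by (rule mult_left_mono[OF conv_DL1_step(2)[OF ki[OF s(1)] h(3,1)] h(2)])
    finally have 1: "norm (T (conv (k S) w)) \<le> C * (L1 (k S) * ?N)" .
    have 2: "norm (integral UNIV (\<lambda>t. k S t *\<^sub>C F t)) \<le> B * L1 (k S)"
      by (rule norm_integral_scaleC_le[OF ki[OF s(1)] B(2) s(2)])
    show ?thesis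
      using 1 2 norm_triangle_ineq4[of "T (conv (k S) w)" "integral UNIV (\<lambda>t. k S t *\<^sub>C F t)"]
      unfolding \<Lambda>_def by (simp add: algebra_simps)
  qed
  have bound2: "norm (\<Lambda> S) \<le> (C * ?N' + B) * P * \<delta>\<^sup>2" if "good S" "S \<subseteq> {x..x + \<delta>}" "\<delta> \<ge> 0" for S x \<delta>
  proof -
    have s: "S \<in> sets borel" "(\<lambda>t. k S t *\<^sub>C F t) integrable_on UNIV" using that by (auto simp: good_def)
    note ks = ki[OF s(1)]
    have sup: "\<bar>t - x\<bar> \<le> \<delta>" if "k S t \<noteq> 0" for t
      using that \<open>S \<subseteq> {x..x + \<delta>}\<close> by (auto simp: k_def indicator_def split: if_splits)
    let ?c = "LINT t|lborel. k S t"
    have sx: "(\<lambda>t. w (t - x)) \<in> DL1_space c M" by (rule DL1_space_shift[OF w])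
    note e = conv_concentrated_step[OF ks sup that(3) wD h(4,1)]
    have "T (conv (k S) w) - ?c *\<^sub>C F x = T (\<lambda>s. conv (k S) w s - ?c * w (s - x))"
      using DL1_dual_diff[OF T conv_DL1_space[OF ks w] DL1_space_cmult[OF sx]]
        linear_map_on_cmult[OF DL1_dual_linear[OF T] sx, of ?c]
      by (simp add: F_def)
    also have "norm \<dots> \<le> C * DL1_norm M h (\<lambda>s. conv (k S) w s - ?c * w (s - x))"
      by (rule h(5)[OF DL1_space_diff[OF conv_DL1_space[OF ks w] DL1_space_cmult[OF sx]] e(1)])
    also have "\<dots> \<le> C * (L1 (k S) * \<delta> * ?N')" by (rule mult_left_mono[OF e(2) h(2)])
    finally have 1: "norm (T (conv (k S) w) - ?c *\<^sub>C F x) \<le> C * ?N' * \<delta> * L1 (k S)" by (simp add: mult_ac)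
    have "((\<lambda>t. k S t *\<^sub>C F x) has_integral ?c *\<^sub>C F x) UNIV"
      using has_integral_linear[OF has_integral_integral_lborel[OF ks] scaleC.bounded_linear_left[of "F x"]]
      by (simp add: o_def)
    then have ci: "(\<lambda>t. k S t *\<^sub>C F x) integrable_on UNIV" "integral UNIV (\<lambda>t. k S t *\<^sub>C F x) = ?c *\<^sub>C F x"
      by (auto simp: has_integral_iff)
    have "norm (integral UNIV (\<lambda>t. k S t *\<^sub>C (F t - F x))) \<le> (B * \<delta>) * L1 (k S)"
    proof (rule norm_integral_scaleC_le[OF ks])
      show "norm (F t - F x) \<le> B * \<delta>" if "k S t \<noteq> 0" for t
        using B(3)[of t x] mult_left_mono[OF sup[OF that] B(1)] by linarith
      show "(\<lambda>t. k S t *\<^sub>C (F t - F x)) integrable_on UNIV"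
        unfolding scaleC.diff_right by (rule Henstock_Kurzweil_Integration.integrable_diff[OF s(2) ci(1)])
    qed
    also have "integral UNIV (\<lambda>t. k S t *\<^sub>C (F t - F x)) = integral UNIV (\<lambda>t. k S t *\<^sub>C F t) - ?c *\<^sub>C F x"
      unfolding scaleC.diff_right
      using Henstock_Kurzweil_Integration.integral_diff[OF s(2) ci(1)] ci(2) by simp
    finally have 2: "norm (integral UNIV (\<lambda>t. k S t *\<^sub>C F t) - ?c *\<^sub>C F x) \<le> B * \<delta> * L1 (k S)" .
    have 3: "L1 (k S) \<le> P * \<delta>"
    proof -
      have "L1 (k S) \<le> (LINT t|lborel. indicator {x..x + \<delta>} t * P)"
        unfolding L1_def
      proof (rule integral_mono[OF integrable_norm[OF ks]])
        show "integrable lborel (\<lambda>t. indicator {x..x + \<delta>} t * P)"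
          using that(3) by (intro integrable_mult_left integrable_real_indicator) auto
        show "cmod (k S t) \<le> indicator {x..x + \<delta>} t * P" for t
          using that(2) P[of t] P0 by (auto simp: k_def indicator_def)
      qed
      then show ?thesis using that(3) by (simp add: mult.commute)
    qed
    have "norm (\<Lambda> S) \<le> C * ?N' * \<delta> * L1 (k S) + B * \<delta> * L1 (k S)"
      using 1 2 norm_triangle_ineq4[of "T (conv (k S) w) - ?c *\<^sub>C F x" "integral UNIV (\<lambda>t. k S t *\<^sub>C F t) - ?c *\<^sub>C F x"]
      unfolding \<Lambda>_def by simp
    also have "\<dots> = (C * ?N' + B) * \<delta> * L1 (k S)" by (simp add: algebra_simps)
    also have "\<dots> \<le> (C * ?N' + B) * \<delta> * (P * \<delta>)"
      using h(2) N B(1) that(3) by (intro mult_left_mono[OF 3]) auto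
    finally show ?thesis by (simp add: power2_eq_square mult_ac)
  qed
  define A where "A x = \<Lambda> {..x}" for x
  have step: "norm (A (x + \<delta>) - A x) \<le> (C * ?N' + B) * P * \<delta>\<^sup>2" if "\<delta> \<ge> 0" for x \<delta>
  proof -
    have "good ({..x + \<delta>} - {..x}) \<and> \<Lambda> ({..x + \<delta>} - {..x}) = A (x + \<delta>) - A x"
      unfolding A_def by (rule diff[OF half_good half_good]) (use that in auto)
    moreover have "{..x + \<delta>} - {..x} \<subseteq> {x..x + \<delta>}" by auto
    ultimately show ?thesis using bound2 that by metis
  qed
  \<comment> \<open>The increments of \<open>A\<close> are quadratically small.\<close>
  have "(A has_vector_derivative 0) (at x)" for x
  proof (rule quadratic_remainder_has_vector_derivative)
    fix \<delta> :: real
    show "norm (A (x + \<delta>) - A x - \<delta> *\<^sub>R 0) \<le> (C * ?N' + B) * P * \<delta>\<^sup>2"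
      using step[of \<delta> x] step[of "- \<delta>" "x + \<delta>"] by (cases "\<delta> \<ge> 0") (auto simp: norm_minus_commute)
  qed
  then have "\<exists>a. \<forall>x\<in>UNIV. A x = a"
    by (intro has_derivative_zero_constant) (auto simp: has_vector_derivative_def)
  then obtain a where a: "\<And>x. A x = a" by auto
  have "(\<lambda>n. (C * ?N + B) * L1 (\<lambda>t. indicator {..- real n} t * \<psi> t)) \<longlonglongrightarrow> (C * ?N + B) * 0"
  proof (intro tendsto_mult_left L1_tail_tendsto DL1_integrable0[OF \<psi>])
    fix t :: real
    obtain n0 :: nat where "- t < real n0" using reals_Archimedean2 by blast
    then show "\<forall>\<^sub>F n in sequentially. t \<notin> {..- real n}"
      by (intro eventually_sequentiallyI[of n0]) auto
  qed auto
  moreover have "norm a \<le> (C * ?N + B) * L1 (\<lambda>t. indicator {..- real n} t * \<psi> t)" for n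
    using bound1[OF half_good, of "- real n"] a[of "- real n"] by (simp add: A_def k_def[abs_def])
  ultimately have "norm a \<le> 0"
    by (intro LIMSEQ_le_const) auto
  then have a0: "a = 0" by simp
  have "(\<lambda>n. (C * ?N + B) * L1 (\<lambda>t. indicator (UNIV - {..real n}) t * \<psi> t)) \<longlonglongrightarrow> (C * ?N + B) * 0"
  proof (intro tendsto_mult_left L1_tail_tendsto DL1_integrable0[OF \<psi>])
    fix t :: real
    obtain n0 :: nat where "t < real n0" using reals_Archimedean2 by blast
    then show "\<forall>\<^sub>F n in sequentially. t \<notin> UNIV - {..real n}"
      by (intro eventually_sequentiallyI[of n0]) auto
  qed auto
  moreover have "norm (\<Lambda> UNIV) \<le> (C * ?N + B) * L1 (\<lambda>t. indicator (UNIV - {..real n}) t * \<psi> t)" for n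
  proof -
    have "good (UNIV - {..real n})" "\<Lambda> (UNIV - {..real n}) = \<Lambda> UNIV"
      using diff[OF half_good univ_good, of "real n"] a[of "real n"] a0 by (auto simp: A_def)
    then show ?thesis using bound1[of "UNIV - {..real n}"] by (simp add: k_def[abs_def])
  qed
  ultimately have "norm (\<Lambda> UNIV) \<le> 0"
    by (intro LIMSEQ_le_const) auto
  then show ?thesis
    by (simp add: \<Lambda>_def k_def[abs_def] regular_def F_def)
qed

end

section \<open>Almost periodic functions\<close>

lemma AP_continuous: "f \<in> AP \<Longrightarrow> continuous_on UNIV f"
  by (simp add: AP_def)

lemma AP_period:
  assumes "f \<in> AP" "\<epsilon> > 0"
  obtains l where "l > 0" "\<And>a. a > 0 \<Longrightarrow> \<exists>\<tau>\<in>{a..a + l}. \<forall>t. norm (f (t + \<tau>) - f t) \<le> \<epsilon>"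
  using assms unfolding AP_def by blast

text \<open>Every point is moved by an \<open>\<epsilon>\<close>-period into one compact interval; for positive \<open>t\<close> the negative of a
  period, again a period, is used. Properties of \<open>f\<close> on that interval thereby hold on the line.\<close>

lemma AP_recur:
  assumes "f \<in> AP" "\<epsilon> > 0"
  obtains l where "l > 0"
    "\<And>t. \<exists>\<sigma>. t + \<sigma> \<in> {- 1 - l..1 + l} \<and> (\<forall>s. norm (f (s + \<sigma>) - f s) \<le> \<epsilon>)"
proof -
  obtain l where l: "l > 0" "\<And>a. a > 0 \<Longrightarrow> \<exists>\<tau>\<in>{a..a + l}. \<forall>t. norm (f (t + \<tau>) - f t) \<le> \<epsilon>"
    by (rule AP_period[OF assms]) blast
  have "\<exists>\<sigma>. t + \<sigma> \<in> {- 1 - l..1 + l} \<and> (\<forall>s. norm (f (s + \<sigma>) - f s) \<le> \<epsilon>)" for t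
  proof (cases "t \<le> 0")
    case True
    then obtain \<tau> where \<tau>: "\<tau> \<in> {1 - t..1 - t + l}" "\<forall>s. norm (f (s + \<tau>) - f s) \<le> \<epsilon>"
      using l(2)[of "1 - t"] by auto
    then show ?thesis using l(1) by (intro exI[of _ \<tau>]) auto
  next
    case False
    then obtain \<tau> where \<tau>: "\<tau> \<in> {t + 1..t + 1 + l}" "\<forall>s. norm (f (s + \<tau>) - f s) \<le> \<epsilon>"
      using l(2)[of "t + 1"] by auto
    have "norm (f (s + - \<tau>) - f s) \<le> \<epsilon>" for s
      using \<tau>(2)[rule_format, of "s - \<tau>"] by (simp add: norm_minus_commute)
    then show ?thesis using \<tau>(1) l(1) by (intro exI[of _ "- \<tau>"]) auto
  qed
  then show thesis using that l(1) by blast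
qed

lemma AP_bounded:
  assumes "f \<in> AP"
  shows "bounded (range f)"
proof -
  obtain l where l: "l > 0"
    "\<And>t. \<exists>\<sigma>. t + \<sigma> \<in> {- 1 - l..1 + l} \<and> (\<forall>s. norm (f (s + \<sigma>) - f s) \<le> 1)"
    by (rule AP_recur[OF assms zero_less_one]) blast
  have "bounded (f ` {- 1 - l..1 + l})"
    by (intro compact_imp_bounded compact_continuous_image continuous_on_subset[OF AP_continuous[OF assms]]) auto
  then obtain B where B: "\<And>s. s \<in> {- 1 - l..1 + l} \<Longrightarrow> norm (f s) \<le> B"
    unfolding bounded_iff by blast
  have "norm (f t) \<le> B + 1" for t
  proof -
    obtain \<sigma> where "t + \<sigma> \<in> {- 1 - l..1 + l}" "norm (f (t + \<sigma>) - f t) \<le> 1" using l(2) by blast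
    then show ?thesis
      using B[of "t + \<sigma>"] norm_triangle_sub[of "f t" "f (t + \<sigma>)"] by (simp add: norm_minus_commute)
  qed
  then show ?thesis by (auto simp: bounded_iff)
qed

lemma AP_uniformly_continuous:
  assumes "f \<in> AP" "\<epsilon> > 0"
  obtains \<delta> where "\<delta> > 0" "\<And>s t. \<bar>s - t\<bar> < \<delta> \<Longrightarrow> norm (f s - f t) \<le> \<epsilon>"
proof -
  have "\<epsilon> / 3 > 0" using assms by simp
  then obtain l where l: "l > 0"
    "\<And>t. \<exists>\<sigma>. t + \<sigma> \<in> {- 1 - l..1 + l} \<and> (\<forall>s. norm (f (s + \<sigma>) - f s) \<le> \<epsilon> / 3)"
    by (rule AP_recur[OF assms(1)]) blast
  have "uniformly_continuous_on {- 2 - l..2 + l} f"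
    by (intro compact_uniformly_continuous continuous_on_subset[OF AP_continuous[OF assms(1)]]) auto
  then obtain d where d: "d > 0"
    "\<And>s t. s \<in> {- 2 - l..2 + l} \<Longrightarrow> t \<in> {- 2 - l..2 + l} \<Longrightarrow> dist s t < d \<Longrightarrow> dist (f s) (f t) < \<epsilon> / 3"
    using \<open>\<epsilon> / 3 > 0\<close> unfolding uniformly_continuous_on_def by (metis dist_commute)
  have "norm (f s - f t) \<le> \<epsilon>" if "\<bar>s - t\<bar> < min d 1" for s t
  proof -
    obtain \<sigma> where \<sigma>: "t + \<sigma> \<in> {- 1 - l..1 + l}" "\<And>s. norm (f (s + \<sigma>) - f s) \<le> \<epsilon> / 3" using l(2) by blast
    have "dist (f (s + \<sigma>)) (f (t + \<sigma>)) < \<epsilon> / 3"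
      using \<sigma>(1) that by (intro d(2)) (auto simp: dist_real_def)
    moreover have "norm (f s - f t) \<le> norm (f (s + \<sigma>) - f s) + norm (f (s + \<sigma>) - f (t + \<sigma>)) + norm (f (t + \<sigma>) - f t)"
    proof -
      have "f s - f t = - (f (s + \<sigma>) - f s) + (f (s + \<sigma>) - f (t + \<sigma>)) + (f (t + \<sigma>) - f t)" by simp
      then show ?thesis
        using norm_triangle_ineq[of "- (f (s + \<sigma>) - f s) + (f (s + \<sigma>) - f (t + \<sigma>))" "f (t + \<sigma>) - f t"]
          norm_triangle_ineq[of "- (f (s + \<sigma>) - f s)" "f (s + \<sigma>) - f (t + \<sigma>)"]
        by (simp only: norm_minus_cancel)
    qed
    ultimately show ?thesis using \<sigma>(2)[of s] \<sigma>(2)[of t] by (simp add: dist_norm)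
  qed
  then show thesis using that[of "min d 1"] d(1) by auto
qed

text \<open>Common almost periods of \<open>f\<close> and \<open>g\<close>. Choose periods \<open>\<tau> n\<close> of \<open>f\<close> and \<open>\<sigma> n\<close> of \<open>g\<close> near each integer \<open>n\<close>.
  Their differences are bounded, so by the pigeonhole principle finitely many indices represent all of
  them up to \<open>\<delta>\<close>. If \<open>i\<close> represents \<open>n\<close>, then \<open>\<tau> n - \<tau> i\<close> and \<open>\<sigma> n - \<sigma> i\<close> differ by less than \<open>\<delta>\<close>, and uniform
  continuity of \<open>g\<close> makes the former a period of both functions.\<close>

lemma AP_add:
  assumes f: "f \<in> AP" and g: "g \<in> AP"
  shows "(\<lambda>t. f t + g t) \<in> AP"
  unfolding AP_def mem_Collect_eq
proof (intro conjI allI impI)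
  show "continuous_on UNIV (\<lambda>t. f t + g t)"
    using f g by (intro continuous_intros AP_continuous)
  fix \<epsilon> :: real assume "\<epsilon> > 0"
  define e where "e = \<epsilon> / 5"
  have e: "e > 0" using \<open>\<epsilon> > 0\<close> by (simp add: e_def)
  obtain l1 where l1: "l1 > 0" "\<And>a. a > 0 \<Longrightarrow> \<exists>\<tau>\<in>{a..a + l1}. \<forall>t. norm (f (t + \<tau>) - f t) \<le> e"
    by (rule AP_period[OF f e]) blast
  obtain l2 where l2: "l2 > 0" "\<And>a. a > 0 \<Longrightarrow> \<exists>\<tau>\<in>{a..a + l2}. \<forall>t. norm (g (t + \<tau>) - g t) \<le> e"
    by (rule AP_period[OF g e]) blast
  obtain \<delta> where \<delta>: "\<delta> > 0" "\<And>s t. \<bar>s - t\<bar> < \<delta> \<Longrightarrow> norm (g s - g t) \<le> e"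
    by (rule AP_uniformly_continuous[OF g e]) blast
  define l where "l = max l1 l2"
  have "\<exists>\<tau>\<in>{real n + 1..real n + 1 + l}. \<forall>t. norm (f (t + \<tau>) - f t) \<le> e" for n
    using l1(2)[of "real n + 1"] by (force simp: l_def)
  then obtain \<tau> where \<tau>: "\<And>n. \<tau> n \<in> {real n + 1..real n + 1 + l}" "\<And>n t. norm (f (t + \<tau> n) - f t) \<le> e"
    by metis
  have "\<exists>\<tau>\<in>{real n + 1..real n + 1 + l}. \<forall>t. norm (g (t + \<tau>) - g t) \<le> e" for n
    using l2(2)[of "real n + 1"] by (force simp: l_def)
  then obtain \<sigma> where \<sigma>: "\<And>n. \<sigma> n \<in> {real n + 1..real n + 1 + l}" "\<And>n t. norm (g (t + \<sigma> n) - g t) \<le> e"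
    by metis
  define cell where "cell n = \<lfloor>(\<tau> n - \<sigma> n) / \<delta>\<rfloor>" for n
  \<comment> \<open>The differences \<open>\<tau> n - \<sigma> n\<close> lie in \<open>[-l, l]\<close>, hence in finitely many cells of length \<open>\<delta>\<close>.\<close>
  have "range cell \<subseteq> {\<lfloor>- l / \<delta>\<rfloor>..\<lfloor>l / \<delta>\<rfloor>}"
  proof clarify
    fix n
    have "- l \<le> \<tau> n - \<sigma> n" "\<tau> n - \<sigma> n \<le> l" using \<tau>(1)[of n] \<sigma>(1)[of n] by auto
    then show "cell n \<in> {\<lfloor>- l / \<delta>\<rfloor>..\<lfloor>l / \<delta>\<rfloor>}"
      using divide_right_mono[of "- l" "\<tau> n - \<sigma> n" \<delta>] divide_right_mono[of "\<tau> n - \<sigma> n" l \<delta>] \<delta>(1)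
      unfolding cell_def by (auto intro!: floor_mono)
  qed
  then have fin: "finite (range cell)" using finite_subset by blast
  \<comment> \<open>One index for each cell; finitely many, hence bounded.\<close>
  define rep where "rep n = (SOME m. cell m = cell n)" for n
  have rep: "cell (rep n) = cell n" for n
    unfolding rep_def by (rule someI[of "\<lambda>m. cell m = cell n" n]) simp
  have "rep n = (\<lambda>c. SOME m. cell m = c) (cell n)" for n by (simp add: rep_def)
  then have "range rep \<subseteq> (\<lambda>c. SOME m. cell m = c) ` range cell" by auto
  then have "finite (range rep)" using fin finite_subset by blast
  then obtain N where N: "\<And>n. rep n \<le> N" using finite_nat_set_iff_bounded_le by (metis rangeI)
  define K where "K = real N + 1 + l"
  have lpos: "l > 0" using l1(1) by (simp add: l_def)
  show "\<exists>L>0. \<forall>a>0. \<exists>\<omega>\<in>{a..a + L}. \<forall>t. norm (f (t + \<omega>) + g (t + \<omega>) - (f t + g t)) \<le> \<epsilon>"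
  proof (intro exI[of _ "K + l + 2"] conjI allI impI)
    show "K + l + 2 > 0" using lpos by (simp add: K_def)
    fix a :: real assume a: "a > 0"
    define n where "n = nat \<lceil>a + K\<rceil>"
    have "0 \<le> a + K" using a lpos by (simp add: K_def)
    then have n: "a + K \<le> real n" "real n \<le> a + K + 1" unfolding n_def by linarith+
    define i where "i = rep n"
    define \<omega> where "\<omega> = \<tau> n - \<tau> i"
    define \<omega>' where "\<omega>' = \<sigma> n - \<sigma> i"
    have i: "0 \<le> \<tau> i" "\<tau> i \<le> K"
      using \<tau>(1)[of i] N[of n] by (auto simp: i_def K_def)
    have "\<omega> \<in> {a..a + (K + l + 2)}"
      using \<tau>(1)[of n] i n by (auto simp: \<omega>_def)
    moreover have "norm (f (t + \<omega>) + g (t + \<omega>) - (f t + g t)) \<le> \<epsilon>" for t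
    proof -
      have "\<bar>\<omega> - \<omega>'\<bar> < \<delta>"
      proof -
        have "\<lfloor>(\<tau> n - \<sigma> n) / \<delta>\<rfloor> = \<lfloor>(\<tau> i - \<sigma> i) / \<delta>\<rfloor>" using rep[of n] by (simp add: cell_def i_def)
        then have "\<bar>(\<tau> n - \<sigma> n) / \<delta> - (\<tau> i - \<sigma> i) / \<delta>\<bar> < 1" by linarith
        moreover have "(\<tau> n - \<sigma> n) / \<delta> - (\<tau> i - \<sigma> i) / \<delta> = (\<omega> - \<omega>') / \<delta>"
          by (simp add: \<omega>_def \<omega>'_def diff_divide_distrib)
        ultimately show ?thesis using \<delta>(1) by (simp add: abs_divide)
      qed
      then have "norm (g (t + \<omega>) - g (t + \<omega>')) \<le> e" by (intro \<delta>(2)) simp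
      moreover have "norm (f (t + \<omega>) - f (t - \<tau> i)) \<le> e" "norm (f t - f (t - \<tau> i)) \<le> e"
        using \<tau>(2)[of "t - \<tau> i" n] \<tau>(2)[of "t - \<tau> i" i] by (auto simp: \<omega>_def algebra_simps)
      moreover have "norm (g (t + \<omega>') - g (t - \<sigma> i)) \<le> e" "norm (g t - g (t - \<sigma> i)) \<le> e"
        using \<sigma>(2)[of "t - \<sigma> i" n] \<sigma>(2)[of "t - \<sigma> i" i] by (auto simp: \<omega>'_def algebra_simps)
      moreover have "f (t + \<omega>) + g (t + \<omega>) - (f t + g t) =
          (f (t + \<omega>) - f (t - \<tau> i)) - (f t - f (t - \<tau> i)) + (g (t + \<omega>) - g (t + \<omega>'))
          + ((g (t + \<omega>') - g (t - \<sigma> i)) - (g t - g (t - \<sigma> i)))" by simp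
      moreover have "norm ((x1 - x2 + x3) + (x4 - x5)) \<le> 5 * e"
        if "norm x1 \<le> e" "norm x2 \<le> e" "norm x3 \<le> e" "norm x4 \<le> e" "norm x5 \<le> e" for x1 x2 x3 x4 x5 :: 'a
        using that norm_triangle_ineq[of "x1 - x2 + x3" "x4 - x5"] norm_triangle_ineq[of "x1 - x2" x3]
          norm_triangle_ineq4[of x1 x2] norm_triangle_ineq4[of x4 x5] by linarith
      ultimately have "norm (f (t + \<omega>) + g (t + \<omega>) - (f t + g t)) \<le> 5 * e" by metis
      then show ?thesis by (simp add: e_def)
    qed
    ultimately show "\<exists>\<omega>\<in>{a..a + (K + l + 2)}. \<forall>t. norm (f (t + \<omega>) + g (t + \<omega>) - (f t + g t)) \<le> \<epsilon>" by blast
  qed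
qed

lemma AP_scaleC:
  fixes f :: "real \<Rightarrow> 'a::complex_banach"
  assumes f: "f \<in> AP"
  shows "(\<lambda>t. a *\<^sub>C f t) \<in> AP"
  unfolding AP_def mem_Collect_eq
proof (intro conjI allI impI)
  show "continuous_on UNIV (\<lambda>t. a *\<^sub>C f t)"
    by (intro scaleC.continuous_on continuous_on_const AP_continuous f)
  fix \<epsilon> :: real assume "\<epsilon> > 0"
  then have e: "\<epsilon> / (cmod a + 1) > 0" by (simp add: add_nonneg_pos)
  obtain l where l: "l > 0"
    "\<And>b. b > 0 \<Longrightarrow> \<exists>\<tau>\<in>{b..b + l}. \<forall>t. norm (f (t + \<tau>) - f t) \<le> \<epsilon> / (cmod a + 1)"
    by (rule AP_period[OF f e]) blast
  have "norm (a *\<^sub>C f (t + \<tau>) - a *\<^sub>C f t) \<le> \<epsilon>" if "norm (f (t + \<tau>) - f t) \<le> \<epsilon> / (cmod a + 1)" for t \<tau>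
  proof -
    have "norm (a *\<^sub>C f (t + \<tau>) - a *\<^sub>C f t) = cmod a * norm (f (t + \<tau>) - f t)"
      by (simp add: scaleC.diff_right[symmetric] norm_scaleC)
    also have "\<dots> \<le> (cmod a + 1) * (\<epsilon> / (cmod a + 1))"
      using that e by (intro mult_mono) auto
    also have "\<dots> = \<epsilon>" by (simp add: add_nonneg_pos pos_add_strict less_imp_neq[symmetric] add_nonneg_eq_0_iff)
    finally show ?thesis .
  qed
  then show "\<exists>l>0. \<forall>b>0. \<exists>\<tau>\<in>{b..b + l}. \<forall>t. norm (a *\<^sub>C f (t + \<tau>) - a *\<^sub>C f t) \<le> \<epsilon>"
    using l by meson
qed

lemma AP_shift:
  assumes f: "f \<in> AP"
  shows "(\<lambda>t. f (t + y)) \<in> AP"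
  unfolding AP_def mem_Collect_eq
proof (intro conjI allI impI)
  show "continuous_on UNIV (\<lambda>t. f (t + y))"
    by (rule continuous_on_compose2[OF AP_continuous[OF f]]) (auto intro: continuous_intros)
  fix \<epsilon> :: real assume "\<epsilon> > 0"
  then obtain l where l: "l > 0" "\<And>b. b > 0 \<Longrightarrow> \<exists>\<tau>\<in>{b..b + l}. \<forall>t. norm (f (t + \<tau>) - f t) \<le> \<epsilon>"
    by (rule AP_period[OF f]) blast
  then show "\<exists>l>0. \<forall>b>0. \<exists>\<tau>\<in>{b..b + l}. \<forall>t. norm (f (t + \<tau> + y) - f (t + y)) \<le> \<epsilon>"
    by (metis add.assoc add.commute)
qed

lemma uniform_limit_index:
  assumes "uniform_limit X g f sequentially" "e > 0"
  obtains n :: nat where "\<And>x. x \<in> X \<Longrightarrow> dist (g n x) (f x) < e"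
  using uniform_limitD[OF assms] unfolding eventually_sequentially by blast

lemma norm_diff_add_le: "norm (x - y + z) \<le> norm x + norm y + norm z"
  using norm_triangle_ineq[of "x - y" z] norm_triangle_ineq4[of x y] by linarith

lemma AP_uniform_limit:
  assumes g: "\<And>n. g n \<in> AP" and lim: "uniform_limit UNIV g f sequentially"
  shows "f \<in> AP"
  unfolding AP_def mem_Collect_eq
proof (intro conjI allI impI)
  show "continuous_on UNIV f"
    by (rule uniform_limit_theorem[OF _ lim]) (simp_all add: AP_continuous[OF g])
  fix \<epsilon> :: real assume "\<epsilon> > 0"
  then have e: "\<epsilon> / 3 > 0" by simp
  obtain n where "\<And>t. t \<in> UNIV \<Longrightarrow> dist (g n t) (f t) < \<epsilon> / 3"
    by (rule uniform_limit_index[OF lim e]) blast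
  then have n: "norm (g n t - f t) < \<epsilon> / 3" for t by (simp add: dist_norm)
  obtain l where l: "l > 0" "\<And>b. b > 0 \<Longrightarrow> \<exists>\<tau>\<in>{b..b + l}. \<forall>t. norm (g n (t + \<tau>) - g n t) \<le> \<epsilon> / 3"
    by (rule AP_period[OF g e]) blast
  have "norm (f (t + \<tau>) - f t) \<le> \<epsilon>" if "norm (g n (t + \<tau>) - g n t) \<le> \<epsilon> / 3" for t \<tau>
  proof -
    have "f (t + \<tau>) - f t = (g n (t + \<tau>) - g n t) - (g n (t + \<tau>) - f (t + \<tau>)) + (g n t - f t)" by simp
    then have "norm (f (t + \<tau>) - f t) \<le> norm (g n (t + \<tau>) - g n t) + norm (g n (t + \<tau>) - f (t + \<tau>)) + norm (g n t - f t)"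
      using norm_diff_add_le by metis
    then show ?thesis using that n[of t] n[of "t + \<tau>"] by linarith
  qed
  then show "\<exists>l>0. \<forall>b>0. \<exists>\<tau>\<in>{b..b + l}. \<forall>t. norm (f (t + \<tau>) - f t) \<le> \<epsilon>"
    using l by meson
qed

text \<open>An almost period moves \<open>t\<close> arbitrarily far to the right with little change of the value.\<close>

lemma AP_norm_le_tail:
  assumes f: "f \<in> AP" and tail: "\<And>s. s \<ge> a \<Longrightarrow> norm (f s) \<le> B"
  shows "norm (f t) \<le> B"
proof (rule field_le_epsilon)
  fix e :: real assume "e > 0"
  then obtain l where l: "l > 0" "\<And>b. b > 0 \<Longrightarrow> \<exists>\<tau>\<in>{b..b + l}. \<forall>t. norm (f (t + \<tau>) - f t) \<le> e"
    by (rule AP_period[OF f]) blast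
  obtain \<tau> where \<tau>: "\<tau> \<ge> max 1 (a - t)" "norm (f (t + \<tau>) - f t) \<le> e"
    using l(2)[of "max 1 (a - t)"] by (meson atLeastAtMost_iff less_max_iff_disj zero_less_one)
  then show "norm (f t) \<le> B + e"
    using tail[of "t + \<tau>"] norm_triangle_sub[of "f t" "f (t + \<tau>)"] by (simp add: norm_minus_commute)
qed

section \<open>Almost automorphic functions\<close>

text \<open>The companion \<open>g\<close> of \<open>f\<close> along one fixed sequence; subsequences are then handled by composition.\<close>

definition AA_along :: "(nat \<Rightarrow> real) \<Rightarrow> (real \<Rightarrow> 'a::real_normed_vector) \<Rightarrow> (real \<Rightarrow> 'a) \<Rightarrow> bool" where
  "AA_along b f g \<longleftrightarrow> (\<forall>t. (\<lambda>n. f (t + b n)) \<longlonglongrightarrow> g t) \<and> (\<forall>t. (\<lambda>n. g (t - b n)) \<longlonglongrightarrow> f t)"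

lemma AA_iff: "f \<in> AA \<longleftrightarrow> continuous_on UNIV f \<and> bounded (range f) \<and>
     (\<forall>b :: nat \<Rightarrow> real. \<exists>r :: nat \<Rightarrow> nat. \<exists>g. strict_mono r \<and> AA_along (b \<circ> r) f g)"
  by (simp add: AA_def AA_along_def)

lemma AA_continuous: "f \<in> AA \<Longrightarrow> continuous_on UNIV f"
  and AA_bounded: "f \<in> AA \<Longrightarrow> bounded (range f)"
  by (simp_all add: AA_def)

lemma AA_along_subseq:
  assumes "AA_along b f g" "strict_mono (r :: nat \<Rightarrow> nat)"
  shows "AA_along (b \<circ> r) f g"
proof -
  have sub: "(\<lambda>n. X (r n)) \<longlonglongrightarrow> L" if "X \<longlonglongrightarrow> L" for X and L :: 'a
    using LIMSEQ_subseq_LIMSEQ[OF that assms(2)] by (simp add: o_def)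
  show ?thesis
    using assms(1) sub[of "\<lambda>n. f (t + b n)" "g t" for t] sub[of "\<lambda>n. g (t - b n)" "f t" for t]
    unfolding AA_along_def by simp
qed

lemma AA_subseq:
  assumes "f \<in> AA"
  obtains r g where "strict_mono (r :: nat \<Rightarrow> nat)" "AA_along (b \<circ> r) f g"
  using assms unfolding AA_iff by blast

lemma AA_add:
  assumes f: "f \<in> AA" and g: "g \<in> AA"
  shows "(\<lambda>t. f t + g t) \<in> AA"
  unfolding AA_iff
proof (intro conjI allI)
  show "continuous_on UNIV (\<lambda>t. f t + g t)" by (intro continuous_intros AA_continuous f g)
  show "bounded (range (\<lambda>t. f t + g t))" by (intro bounded_plus_comp AA_bounded f g)
  fix b :: "nat \<Rightarrow> real"
  obtain r f' where r: "strict_mono r" "AA_along (b \<circ> r) f f'" by (rule AA_subseq[OF f])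
  obtain s g' where s: "strict_mono s" "AA_along ((b \<circ> r) \<circ> s) g g'" by (rule AA_subseq[OF g])
  have "AA_along (b \<circ> (r \<circ> s)) (\<lambda>t. f t + g t) (\<lambda>t. f' t + g' t)"
    using s(2) AA_along_subseq[OF r(2) s(1)] by (auto simp: AA_along_def o_def intro!: tendsto_intros)
  then show "\<exists>r g'. strict_mono r \<and> AA_along (b \<circ> r) (\<lambda>t. f t + g t) g'"
    using strict_mono_o[OF r(1) s(1)] by blast
qed

lemma AA_scaleC:
  fixes f :: "real \<Rightarrow> 'a::complex_banach"
  assumes f: "f \<in> AA"
  shows "(\<lambda>t. a *\<^sub>C f t) \<in> AA"
  unfolding AA_iff
proof (intro conjI allI)
  show "continuous_on UNIV (\<lambda>t. a *\<^sub>C f t)"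
    by (intro scaleC.continuous_on continuous_on_const AA_continuous f)
  show "bounded (range (\<lambda>t. a *\<^sub>C f t))"
    using bounded_linear_image[OF AA_bounded[OF f] scaleC.bounded_linear_right[of a]]
    by (simp add: image_image)
  fix b :: "nat \<Rightarrow> real"
  obtain r f' where r: "strict_mono r" "AA_along (b \<circ> r) f f'" by (rule AA_subseq[OF f])
  have "AA_along (b \<circ> r) (\<lambda>t. a *\<^sub>C f t) (\<lambda>t. a *\<^sub>C f' t)"
    using r(2) scaleC.tendsto[OF tendsto_const] unfolding AA_along_def o_def by blast
  then show "\<exists>r g'. strict_mono r \<and> AA_along (b \<circ> r) (\<lambda>t. a *\<^sub>C f t) g'"
    using r(1) by blast
qed

lemma AA_shift:
  assumes f: "f \<in> AA"
  shows "(\<lambda>t. f (t + y)) \<in> AA"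
  unfolding AA_iff
proof (intro conjI allI)
  show "continuous_on UNIV (\<lambda>t. f (t + y))"
    by (rule continuous_on_compose2[OF AA_continuous[OF f]]) (auto intro: continuous_intros)
  show "bounded (range (\<lambda>t. f (t + y)))"
    using AA_bounded[OF f] by (auto simp: bounded_iff)
  fix b :: "nat \<Rightarrow> real"
  obtain r f' where r: "strict_mono r" "AA_along (b \<circ> r) f f'" by (rule AA_subseq[OF f])
  have "AA_along (b \<circ> r) (\<lambda>t. f (t + y)) (\<lambda>t. f' (t + y))"
    unfolding AA_along_def
  proof (intro conjI allI)
    fix t
    have "(\<lambda>n. f ((t + y) + (b \<circ> r) n)) \<longlonglongrightarrow> f' (t + y)" "(\<lambda>n. f' ((t + y) - (b \<circ> r) n)) \<longlonglongrightarrow> f (t + y)"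
      using r(2) unfolding AA_along_def by blast+
    then show "(\<lambda>n. f (t + (b \<circ> r) n + y)) \<longlonglongrightarrow> f' (t + y)"
      "(\<lambda>n. f' (t - (b \<circ> r) n + y)) \<longlonglongrightarrow> f (t + y)"
      by (simp_all only: add.assoc diff_add_eq add.commute[of y])
  qed
  then show "\<exists>r g'. strict_mono r \<and> AA_along (b \<circ> r) (\<lambda>t. f (t + y)) g'"
    using r(1) by blast
qed

lemma AA_along_norm_le:
  assumes "AA_along b f f'" "\<And>t. norm (f t) \<le> B"
  shows "norm (f' t) \<le> B"
  using assms unfolding AA_along_def by (intro Lim_norm_ubound[of sequentially "\<lambda>n. f (t + b n)"]) auto

lemma AA_along_diff:
  assumes "AA_along b f f'" "AA_along b g g'"
  shows "AA_along b (\<lambda>t. f t - g t) (\<lambda>t. f' t - g' t)"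
  using assms by (auto simp: AA_along_def intro!: tendsto_intros)

text \<open>Interchange of limits along a moving sequence of points.\<close>

lemma uniform_limit_of_uniform_limits:
  fixes f :: "'a \<Rightarrow> 'b::metric_space"
  assumes u: "uniform_limit X g f sequentially"
    and g: "\<And>m. (\<lambda>n. g m (x n)) \<longlonglongrightarrow> l m" and l: "l \<longlonglongrightarrow> L" and x: "\<And>n. x n \<in> X"
  shows "(\<lambda>n. f (x n)) \<longlonglongrightarrow> L"
proof (rule metric_LIMSEQ_I)
  fix e :: real assume e: "e > 0"
  have "\<forall>\<^sub>F m in sequentially. (\<forall>y\<in>X. dist (g m y) (f y) < e / 3) \<and> dist (l m) L < e / 3"
    using uniform_limitD[OF u, of "e / 3"] tendstoD[OF l, of "e / 3"] e by (auto intro: eventually_conj)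
  then obtain m where m: "\<And>y. y \<in> X \<Longrightarrow> dist (g m y) (f y) < e / 3" "dist (l m) L < e / 3"
    by (auto simp: eventually_sequentially)
  obtain N where N: "\<And>n. n \<ge> N \<Longrightarrow> dist (g m (x n)) (l m) < e / 3"
    using metric_LIMSEQ_D[OF g[of m], of "e / 3"] e by auto
  have "dist (f (x n)) L < e" if "n \<ge> N" for n
  proof -
    have "dist (f (x n)) L \<le> dist (f (x n)) (g m (x n)) + dist (g m (x n)) (l m) + dist (l m) L"
      by (meson add_right_mono dist_triangle order_trans)
    then show ?thesis using m(1)[OF x[of n]] N[OF that] m(2) by (simp add: dist_commute)
  qed
  then show "\<exists>N. \<forall>n\<ge>N. dist (f (x n)) L < e" by blast
qed

text \<open>A diagonal sequence serves all \<open>g n\<close> simultaneously; the companions inherit the uniform Cauchy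
  property, and their limit is the companion of \<open>f\<close>.\<close>

lemma AA_uniform_limit:
  fixes f :: "real \<Rightarrow> 'a::banach"
  assumes g: "\<And>n. g n \<in> AA" and lim: "uniform_limit UNIV g f sequentially"
  shows "f \<in> AA"
  unfolding AA_iff
proof (intro conjI allI)
  show "continuous_on UNIV f"
    by (rule uniform_limit_theorem[OF _ lim]) (simp_all add: AA_continuous[OF g])
  show "bounded (range f)"
  proof -
    obtain n where n: "\<And>t. t \<in> UNIV \<Longrightarrow> dist (g n t) (f t) < 1"
      by (rule uniform_limit_index[OF lim zero_less_one]) blast
    obtain B where B: "\<And>t. norm (g n t) \<le> B" using AA_bounded[OF g] by (auto simp: bounded_iff)
    have "norm (f t) \<le> B + 1" for t
      using n[of t] B[of t] norm_triangle_sub[of "f t" "g n t"] by (simp add: dist_norm norm_minus_commute)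
    then show ?thesis by (auto simp: bounded_iff)
  qed
  fix b :: "nat \<Rightarrow> real"
  interpret subseqs "\<lambda>n s. \<exists>g'. AA_along (b \<circ> s) (g n) g'"
  proof
    fix n and s :: "nat \<Rightarrow> nat"
    obtain r g' where "strict_mono (r :: nat \<Rightarrow> nat)" "AA_along ((b \<circ> s) \<circ> r) (g n) g'" by (rule AA_subseq[OF g])
    then show "\<exists>r'. strict_mono r' \<and> (\<exists>g'. AA_along (b \<circ> (s \<circ> r')) (g n) g')"
      by (auto simp: o_assoc)
  qed
  have "\<exists>g'. AA_along (b \<circ> diagseq) (g n) g'" for n
  proof -
    have "\<exists>g'. AA_along (b \<circ> (diagseq \<circ> (+) (Suc n))) (g n) g'"
    proof (rule diagseq_holds)
      fix r s :: "nat \<Rightarrow> nat" and n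
      assume "strict_mono r" "\<exists>g'. AA_along (b \<circ> s) (g n) g'"
      then show "\<exists>g'. AA_along (b \<circ> (s \<circ> r)) (g n) g'"
        using AA_along_subseq by (metis o_assoc)
    qed
    then obtain g' where g': "AA_along (b \<circ> (diagseq \<circ> (+) (Suc n))) (g n) g'" by blast
    have "(\<lambda>i. g n (t + b (diagseq i))) \<longlonglongrightarrow> g' t" for t
      by (rule LIMSEQ_offset[of _ "Suc n"]) (use g' in \<open>simp add: AA_along_def o_def add.commute\<close>)
    moreover have "(\<lambda>i. g' (t - b (diagseq i))) \<longlonglongrightarrow> g n t" for t
      by (rule LIMSEQ_offset[of _ "Suc n"]) (use g' in \<open>simp add: AA_along_def o_def add.commute\<close>)
    ultimately show ?thesis unfolding AA_along_def o_def by blast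
  qed
  then obtain g' where g': "\<And>n. AA_along (b \<circ> diagseq) (g n) (g' n)" by metis
  have "uniformly_Cauchy_on UNIV g"
    by (rule uniformly_convergent_Cauchy[OF uniformly_convergentI[OF lim]])
  then have "uniformly_Cauchy_on UNIV g'"
    unfolding uniformly_Cauchy_on_def
  proof (intro allI impI)
    fix e :: real assume *: "\<forall>e>0. \<exists>M. \<forall>x\<in>UNIV. \<forall>m\<ge>M. \<forall>n\<ge>M. dist (g m x) (g n x) < e" and e: "e > 0"
    have "\<exists>N. \<forall>x\<in>UNIV. \<forall>m\<ge>N. \<forall>n\<ge>N. dist (g m x) (g n x) < e / 2"
      using spec[OF *, of "e / 2"] e by simp
    then obtain N where N: "\<And>x m n. m \<ge> N \<Longrightarrow> n \<ge> N \<Longrightarrow> dist (g m x) (g n x) < e / 2"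
      by blast
    have "dist (g' m x) (g' n x) < e" if "m \<ge> N" "n \<ge> N" for m n x
      using AA_along_norm_le[OF AA_along_diff[OF g' g'], of m n "e / 2" x] N[OF that] e
      by (simp add: dist_norm less_imp_le)
    then show "\<exists>M. \<forall>x\<in>UNIV. \<forall>m\<ge>M. \<forall>n\<ge>M. dist (g' m x) (g' n x) < e" by blast
  qed
  then have "uniformly_convergent_on UNIV g'" by (rule Cauchy_uniformly_convergent)
  then obtain h where h: "uniform_limit UNIV g' h sequentially"
    unfolding uniformly_convergent_on_def by blast
  have gt: "(\<lambda>n. g m (t + (b \<circ> diagseq) n)) \<longlonglongrightarrow> g' m t"
    and gt': "(\<lambda>n. g' m (t - (b \<circ> diagseq) n)) \<longlonglongrightarrow> g m t" for m t
    using g'[of m] by (simp_all add: AA_along_def)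
  have "(\<lambda>n. f (t + (b \<circ> diagseq) n)) \<longlonglongrightarrow> h t" for t
    by (rule uniform_limit_of_uniform_limits[OF lim gt tendsto_uniform_limitI[OF h]]) simp_all
  moreover have "(\<lambda>n. h (t - (b \<circ> diagseq) n)) \<longlonglongrightarrow> f t" for t
    by (rule uniform_limit_of_uniform_limits[OF h gt' tendsto_uniform_limitI[OF lim]]) simp_all
  ultimately have "AA_along (b \<circ> diagseq) f h"
    unfolding AA_along_def by blast
  then show "\<exists>r g'. strict_mono r \<and> AA_along (b \<circ> r) f g'" using subseq_diagseq by blast
qed

text \<open>Along a sequence of translations to the right, \<open>f\<close> converges to a companion that obeys the
  bound of the tail, and the companion translated back converges to \<open>f\<close>.\<close>

lemma AA_norm_le_tail:
  assumes f: "f \<in> AA" and tail: "\<And>s. s \<ge> a \<Longrightarrow> norm (f s) \<le> B"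
  shows "norm (f t) \<le> B"
proof -
  obtain r g where r: "strict_mono r" "AA_along (real \<circ> r) f g" by (rule AA_subseq[OF f])
  have "norm (g s) \<le> B" for s
  proof (rule Lim_norm_ubound[of sequentially "\<lambda>n. f (s + (real \<circ> r) n)"])
    show "(\<lambda>n. f (s + (real \<circ> r) n)) \<longlonglongrightarrow> g s" using r(2) by (simp add: AA_along_def)
    obtain N :: nat where N: "a - s \<le> real N" using real_arch_simple by blast
    show "\<forall>\<^sub>F n in sequentially. norm (f (s + (real \<circ> r) n)) \<le> B"
    proof (rule eventually_sequentiallyI[of N])
      fix n assume "N \<le> n"
      then have "N \<le> r n" using seq_suble[OF r(1), of n] by linarith
      then have "real N \<le> real (r n)" by simp
      then show "norm (f (s + (real \<circ> r) n)) \<le> B" using N by (intro tail) auto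
    qed
  qed auto
  moreover have "(\<lambda>n. g (t - (real \<circ> r) n)) \<longlonglongrightarrow> f t" using r(2) by (simp add: AA_along_def)
  ultimately show ?thesis by (intro Lim_norm_ubound[of sequentially "\<lambda>n. g (t - (real \<circ> r) n)"]) auto
qed

section \<open>Both kinds of recurrence, and the asymptotic functions\<close>

lemma kind_fun_continuous: "f \<in> kind_fun k \<Longrightarrow> continuous_on UNIV f"
  by (cases k) (auto simp: kind_fun_def AP_continuous AA_continuous)

lemma kind_fun_add: "f \<in> kind_fun k \<Longrightarrow> g \<in> kind_fun k \<Longrightarrow> (\<lambda>t. f t + g t) \<in> kind_fun k"
  by (cases k) (auto simp: kind_fun_def AP_add AA_add)

lemma kind_fun_scaleC:
  fixes f :: "real \<Rightarrow> 'a::complex_banach"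
  shows "f \<in> kind_fun k \<Longrightarrow> (\<lambda>t. a *\<^sub>C f t) \<in> kind_fun k"
  by (cases k) (auto simp: kind_fun_def AP_scaleC AA_scaleC)

lemma kind_fun_diff:
  fixes f g :: "real \<Rightarrow> 'a::complex_banach"
  shows "f \<in> kind_fun k \<Longrightarrow> g \<in> kind_fun k \<Longrightarrow> (\<lambda>t. f t - g t) \<in> kind_fun k"
  using kind_fun_add[OF _ kind_fun_scaleC, of f k g "-1"] by (simp add: scaleC_minus_one)

lemma kind_fun_shift: "f \<in> kind_fun k \<Longrightarrow> (\<lambda>t. f (t + y)) \<in> kind_fun k"
  by (cases k) (auto simp: kind_fun_def AP_shift AA_shift)

lemma kind_fun_uniform_limit:
  fixes f :: "real \<Rightarrow> 'a::banach"
  assumes "\<And>n. g n \<in> kind_fun k" "uniform_limit UNIV g f sequentially"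
  shows "f \<in> kind_fun k"
  using AP_uniform_limit[OF _ assms(2)] AA_uniform_limit[OF _ assms(2)] assms(1)
  by (cases k) (auto simp: kind_fun_def)

lemma kind_fun_norm_le_tail:
  assumes "f \<in> kind_fun k" "\<And>s. s \<ge> a \<Longrightarrow> norm (f s) \<le> B"
  shows "norm (f t) \<le> B"
  using AP_norm_le_tail[OF _ assms(2)] AA_norm_le_tail[OF _ assms(2)] assms(1)
  by (cases k) (auto simp: kind_fun_def)

lemma kind_fun_norm_le_eventually:
  assumes "f \<in> kind_fun k" "\<forall>\<^sub>F s in at_top. norm (f s) \<le> B"
  shows "norm (f t) \<le> B"
  using assms kind_fun_norm_le_tail unfolding eventually_at_top_linorder by metis

lemma kind_fun_zero: "(\<lambda>_. 0 :: 'a::real_normed_vector) \<in> kind_fun k"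
proof (cases k)
  case Periodic
  have "\<forall>\<epsilon>>0. \<exists>l>0. \<forall>a>0. \<exists>\<tau>\<in>{a..a + l::real}. \<forall>t::real. norm ((0::'a) - 0) \<le> \<epsilon>"
  proof (intro allI impI exI[of _ "1::real"] conjI)
    fix a \<epsilon> :: real assume "\<epsilon> > 0"
    then show "\<exists>\<tau>\<in>{a..a + 1}. \<forall>t::real. norm ((0::'a) - 0) \<le> \<epsilon>" by (intro bexI[of _ a]) auto
  qed simp
  then show ?thesis using Periodic by (simp add: kind_fun_def AP_def)
next
  case Automorphic
  have "AA_along b (\<lambda>_. 0 :: 'a) (\<lambda>_. 0)" for b by (simp add: AA_along_def)
  then show ?thesis using Automorphic strict_mono_id by (auto simp: kind_fun_def AA_iff)
qed

text \<open>The decaying part is bounded and continuous automatically, so only its limit has to be recorded.\<close>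

lemma asymp_fun_iff:
  "f \<in> asymp_fun k \<longleftrightarrow> continuous_on UNIV f \<and> (\<exists>g\<in>kind_fun k. ((\<lambda>t. f t - g t) \<longlongrightarrow> 0) at_top)"
proof
  assume "f \<in> asymp_fun k"
  then obtain q g where *: "continuous_on UNIV f" "q \<in> C0_half" "g \<in> kind_fun k" "\<And>t. t \<ge> 0 \<Longrightarrow> f t = g t + q t"
    by (auto simp: asymp_fun_def asymp_def)
  have "((\<lambda>t. f t - g t) \<longlongrightarrow> 0) at_top"
  proof (rule Lim_transform_eventually)
    show "(q \<longlongrightarrow> 0) at_top" using *(2) by (simp add: C0_half_def)
    show "\<forall>\<^sub>F t in at_top. q t = f t - g t"
      using eventually_ge_at_top[of "0::real"] by eventually_elim (simp add: *(4))
  qed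
  then show "continuous_on UNIV f \<and> (\<exists>g\<in>kind_fun k. ((\<lambda>t. f t - g t) \<longlongrightarrow> 0) at_top)"
    using * by blast
next
  assume "continuous_on UNIV f \<and> (\<exists>g\<in>kind_fun k. ((\<lambda>t. f t - g t) \<longlongrightarrow> 0) at_top)"
  then obtain g where f: "continuous_on UNIV f" and g: "g \<in> kind_fun k" "((\<lambda>t. f t - g t) \<longlongrightarrow> 0) at_top"
    by blast
  let ?q = "\<lambda>t. f t - g t"
  have c: "continuous_on UNIV ?q" by (intro continuous_intros f kind_fun_continuous[OF g(1)])
  have "\<forall>\<^sub>F t in at_top. norm (?q t) < 1" using tendstoD[OF g(2), of 1] by (simp add: dist_norm)
  then obtain N where N: "\<And>t. t \<ge> N \<Longrightarrow> norm (?q t) < 1" by (auto simp: eventually_at_top_linorder)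
  have "bounded (?q ` {0..N})"
    by (intro compact_imp_bounded compact_continuous_image continuous_on_subset[OF c]) auto
  then obtain B where B: "\<And>s. s \<in> {0..N} \<Longrightarrow> norm (?q s) \<le> B"
    unfolding bounded_iff by blast
  have "norm (?q t) \<le> max B 1" if "t \<ge> 0" for t
    using B[of t] N[of t] that by (cases "t \<le> N") auto
  then have "bounded (?q ` {0..})" unfolding bounded_iff by (intro exI[of _ "max B 1"]) auto
  then have "?q \<in> C0_half" using g(2) continuous_on_subset[OF c] by (auto simp: C0_half_def)
  then show "f \<in> asymp_fun k"
    unfolding asymp_fun_def asymp_def mem_Collect_eq using f g(1)
    by (intro conjI bexI[of _ ?q] bexI[of _ g]) simp_all
qed

lemma asymp_funI:
  "continuous_on UNIV f \<Longrightarrow> g \<in> kind_fun k \<Longrightarrow> ((\<lambda>t. f t - g t) \<longlongrightarrow> 0) at_top \<Longrightarrow> f \<in> asymp_fun k"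
  unfolding asymp_fun_iff by blast

lemma asymp_funE:
  assumes "f \<in> asymp_fun k"
  obtains g where "g \<in> kind_fun k" "((\<lambda>t. f t - g t) \<longlongrightarrow> 0) at_top"
  using assms unfolding asymp_fun_iff by blast

lemma asymp_fun_continuous: "f \<in> asymp_fun k \<Longrightarrow> continuous_on UNIV f"
  unfolding asymp_fun_iff by blast

lemma asymp_fun_add:
  assumes "f \<in> asymp_fun k" "g \<in> asymp_fun k"
  shows "(\<lambda>t. f t + g t) \<in> asymp_fun k"
proof -
  obtain f' g' where *: "f' \<in> kind_fun k" "((\<lambda>t. f t - f' t) \<longlongrightarrow> 0) at_top"
      "g' \<in> kind_fun k" "((\<lambda>t. g t - g' t) \<longlongrightarrow> 0) at_top"
    using asymp_funE[OF assms(1)] asymp_funE[OF assms(2)] by metis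
  have "((\<lambda>t. (f t + g t) - (f' t + g' t)) \<longlongrightarrow> 0) at_top"
    using tendsto_add[OF *(2,4)] by (simp add: algebra_simps)
  moreover have "continuous_on UNIV (\<lambda>t. f t + g t)"
    by (intro continuous_intros asymp_fun_continuous[OF assms(1)] asymp_fun_continuous[OF assms(2)])
  ultimately show ?thesis using asymp_funI kind_fun_add[OF *(1,3)] by blast
qed

lemma asymp_fun_scaleC:
  fixes f :: "real \<Rightarrow> 'a::complex_banach"
  assumes "f \<in> asymp_fun k"
  shows "(\<lambda>t. a *\<^sub>C f t) \<in> asymp_fun k"
proof -
  obtain f' where *: "f' \<in> kind_fun k" "((\<lambda>t. f t - f' t) \<longlongrightarrow> 0) at_top"
    by (rule asymp_funE[OF assms]) blast
  have "((\<lambda>t. a *\<^sub>C f t - a *\<^sub>C f' t) \<longlongrightarrow> 0) at_top"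
    using scaleC.tendsto[OF tendsto_const *(2), of a] by (simp add: scaleC.diff_right scaleC.zero_right)
  moreover have "continuous_on UNIV (\<lambda>t. a *\<^sub>C f t)"
    by (intro scaleC.continuous_on continuous_on_const asymp_fun_continuous[OF assms])
  ultimately show ?thesis using asymp_funI kind_fun_scaleC[OF *(1)] by blast
qed

lemma kind_fun_asymp_fun: "f \<in> kind_fun k \<Longrightarrow> f \<in> asymp_fun k"
  by (rule asymp_funI[of f f]) (simp_all add: kind_fun_continuous)

lemma asymp_fun_sum:
  fixes f :: "'i \<Rightarrow> real \<Rightarrow> 'a::complex_banach"
  assumes "finite I" "\<And>i. i \<in> I \<Longrightarrow> f i \<in> asymp_fun k"
  shows "(\<lambda>t. \<Sum>i\<in>I. f i t) \<in> asymp_fun k"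
  using assms by (induction I) (auto intro: asymp_fun_add kind_fun_asymp_fun kind_fun_zero)

lemma asymp_fun_eventually_eq:
  assumes "f \<in> asymp_fun k" "continuous_on UNIV g" "\<forall>\<^sub>F t in at_top. f t = g t"
  shows "g \<in> asymp_fun k"
proof -
  obtain f' where *: "f' \<in> kind_fun k" "((\<lambda>t. f t - f' t) \<longlongrightarrow> 0) at_top"
    by (rule asymp_funE[OF assms(1)]) blast
  have "((\<lambda>t. g t - f' t) \<longlongrightarrow> 0) at_top"
    by (rule Lim_transform_eventually[OF *(2) eventually_mono[OF assms(3)]]) simp
  then show ?thesis by (rule asymp_funI[OF assms(2) *(1)])
qed

lemma asymp_fun_shift:
  assumes "f \<in> asymp_fun k"
  shows "(\<lambda>t. f (t + y)) \<in> asymp_fun k"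
proof -
  obtain f' where *: "f' \<in> kind_fun k" "((\<lambda>t. f t - f' t) \<longlongrightarrow> 0) at_top"
    by (rule asymp_funE[OF assms]) blast
  have "filterlim (\<lambda>t::real. t + y) at_top at_top"
    using filterlim_tendsto_add_at_top[OF tendsto_const[of y] filterlim_ident[of at_top]] by (simp add: add.commute)
  from filterlim_compose[OF *(2) this]
  have "((\<lambda>t. f (t + y) - f' (t + y)) \<longlongrightarrow> 0) at_top" .
  moreover have "continuous_on UNIV (\<lambda>t. f (t + y))"
    by (rule continuous_on_compose2[OF asymp_fun_continuous[OF assms]]) (auto intro: continuous_intros)
  ultimately show ?thesis using asymp_funI kind_fun_shift[OF *(1)] by blast
qed

text \<open>The recurrent parts are controlled by the functions near plus infinity, so they form a uniform
  Cauchy sequence although the functions themselves converge on a half-line only.\<close>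

lemma asymp_fun_uniform_limit:
  fixes f :: "real \<Rightarrow> 'a::complex_banach"
  assumes F: "\<And>n. F n \<in> asymp_fun k" and f: "continuous_on UNIV f"
    and lim: "uniform_limit {a..} F f sequentially"
  shows "f \<in> asymp_fun k"
proof -
  have "\<exists>g\<in>kind_fun k. ((\<lambda>t. F n t - g t) \<longlongrightarrow> 0) at_top" for n
    using F[of n] unfolding asymp_fun_iff by blast
  then obtain g where g: "\<And>n. g n \<in> kind_fun k" "\<And>n. ((\<lambda>t. F n t - g n t) \<longlongrightarrow> 0) at_top"
    by metis
  have ev: "\<forall>\<^sub>F t in at_top. norm (F n t - g n t) < e" if "e > 0" for n e
    using tendstoD[OF g(2)[of n] that] by (simp add: dist_norm)
  have "uniformly_Cauchy_on UNIV g"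
    unfolding uniformly_Cauchy_on_def
  proof (intro allI impI)
    fix e :: real assume e: "e > 0"
    have "uniformly_Cauchy_on {a..} F"
      by (rule uniformly_convergent_Cauchy[OF uniformly_convergentI[OF lim]])
    then have "\<exists>N. \<forall>x\<in>{a..}. \<forall>m\<ge>N. \<forall>n\<ge>N. dist (F m x) (F n x) < e / 4"
      using e unfolding uniformly_Cauchy_on_def by (elim allE[of _ "e / 4"]) simp
    then obtain N where N: "\<And>x m n. x \<in> {a..} \<Longrightarrow> m \<ge> N \<Longrightarrow> n \<ge> N \<Longrightarrow> dist (F m x) (F n x) < e / 4"
      by blast
    have "dist (g m x) (g n x) < e" if mn: "m \<ge> N" "n \<ge> N" for m n x
    proof -
      have "\<forall>\<^sub>F t in at_top. norm (F m t - g m t) < e / 4 \<and> norm (F n t - g n t) < e / 4 \<and> t \<ge> a"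
        using ev[of "e / 4"] e by (intro eventually_conj eventually_ge_at_top) simp_all
      then have "\<forall>\<^sub>F t in at_top. norm (g m t - g n t) \<le> 3 * e / 4"
      proof eventually_elim
        case (elim t)
        have "g m t - g n t = (F n t - g n t) - (F m t - g m t) + (F m t - F n t)" by simp
        then have "norm (g m t - g n t) \<le> norm (F n t - g n t) + norm (F m t - g m t) + norm (F m t - F n t)"
          using norm_diff_add_le by metis
        then show ?case using elim N[of t, OF _ mn] by (simp add: dist_norm)
      qed
      then have "norm (g m x - g n x) \<le> 3 * e / 4"
        by (rule kind_fun_norm_le_eventually[OF kind_fun_diff[OF g(1) g(1)]])
      then show ?thesis using e by (simp add: dist_norm)
    qed
    then show "\<exists>M. \<forall>x\<in>UNIV. \<forall>m\<ge>M. \<forall>n\<ge>M. dist (g m x) (g n x) < e" by blast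
  qed
  then have "uniformly_convergent_on UNIV g" by (rule Cauchy_uniformly_convergent)
  then obtain h where h: "uniform_limit UNIV g h sequentially"
    unfolding uniformly_convergent_on_def by blast
  have hk: "h \<in> kind_fun k" by (rule kind_fun_uniform_limit[OF g(1) h])
  have "((\<lambda>t. f t - h t) \<longlongrightarrow> 0) at_top"
  proof (rule tendstoI)
    fix e :: real assume e: "e > 0"
    have "\<forall>\<^sub>F n in sequentially. (\<forall>t\<in>{a..}. dist (F n t) (f t) < e / 3) \<and> (\<forall>t\<in>UNIV. dist (g n t) (h t) < e / 3)"
      using uniform_limitD[OF lim, of "e / 3"] uniform_limitD[OF h, of "e / 3"] e by (intro eventually_conj) auto
    then obtain n where n: "\<And>t. t \<ge> a \<Longrightarrow> dist (F n t) (f t) < e / 3" "\<And>t. dist (g n t) (h t) < e / 3"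
      unfolding eventually_sequentially by (metis UNIV_I atLeast_iff order_refl)
    have "\<forall>\<^sub>F t in at_top. norm (F n t - g n t) < e / 3 \<and> t \<ge> a"
      using ev[of "e / 3"] e by (intro eventually_conj eventually_ge_at_top) simp_all
    then show "\<forall>\<^sub>F t in at_top. dist (f t - h t) 0 < e"
    proof eventually_elim
      case (elim t)
      have "f t - h t = (F n t - g n t) - (F n t - f t) + (g n t - h t)" by simp
      then have "norm (f t - h t) \<le> norm (F n t - g n t) + norm (F n t - f t) + norm (g n t - h t)"
        using norm_diff_add_le by metis
      then show ?case using elim n(1)[of t] n(2)[of t] by (simp add: dist_norm)
    qed
  qed
  then show ?thesis by (rule asymp_funI[OF f hk])
qed

section \<open>Regular ultradistributions of recurrent functions\<close>

lemma has_integral_shift_UNIV: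
  fixes f :: "real \<Rightarrow> 'a::banach"
  assumes "(f has_integral i) UNIV"
  shows "((\<lambda>t. f (t + y)) has_integral i) UNIV"
  unfolding has_integral'[where S = UNIV]
proof (intro allI impI)
  fix e :: real assume "e > 0"
  then obtain B where B: "B > 0"
    "\<And>a b. ball 0 B \<subseteq> cbox a b \<Longrightarrow> \<exists>z. (f has_integral z) (cbox a b) \<and> norm (z - i) < e"
    using assms unfolding has_integral'[where S = UNIV] by auto
  show "\<exists>B>0. \<forall>a b. ball 0 B \<subseteq> cbox a b \<longrightarrow>
      (\<exists>z. ((\<lambda>x. if x \<in> UNIV then f (x + y) else 0) has_integral z) (cbox a b) \<and> norm (z - i) < e)"
  proof (intro exI[of _ "B + \<bar>y\<bar>"] conjI allI impI)
    show "B + \<bar>y\<bar> > 0" using B(1) by simp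
    fix a b :: real assume sub: "ball 0 (B + \<bar>y\<bar>) \<subseteq> cbox a b"
    have "ball 0 B \<subseteq> cbox (a + y) (b + y)"
    proof
      fix x :: real assume "x \<in> ball 0 B"
      then have "x - y \<in> ball 0 (B + \<bar>y\<bar>)" by (auto simp: dist_real_def)
      then have "x - y \<in> cbox a b" using sub by blast
      then show "x \<in> cbox (a + y) (b + y)" by auto
    qed
    then obtain z where z: "(f has_integral z) (cbox (a + y) (b + y))" "norm (z - i) < e" using B(2) by blast
    have "((\<lambda>t. f (t + y)) has_integral z) (cbox a b)"
      using has_integral_affinity'[OF z(1), of 1 y] by simp
    then show "\<exists>z. ((\<lambda>x. if x \<in> UNIV then f (x + y) else 0) has_integral z) (cbox a b) \<and> norm (z - i) < e"
      using z(2) by auto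
  qed
qed

lemma regular_translate:
  fixes f :: "real \<Rightarrow> 'a::complex_banach"
  assumes "continuous_on UNIV f" "bounded (range f)" "\<phi> \<in> DL1"
  shows "translate x (regular f) \<phi> = regular (\<lambda>t. f (t + x)) \<phi>"
proof -
  obtain B where B: "\<And>t. norm (f t) \<le> B" using assms(2) by (auto simp: bounded_iff)
  have "(\<lambda>t. \<phi> (t - x)) \<in> DL1" using DL1_affine[OF assms(3), of 1 "- x"] by simp
  from regular_integrable[OF assms(1) B this, of 0]
  have "((\<lambda>t. \<phi> (t - x) *\<^sub>C f t) has_integral regular f (\<lambda>t. \<phi> (t - x))) UNIV"
    by (simp add: regular_def has_integral_integral)
  from has_integral_shift_UNIV[OF this, of x] show ?thesis
    by (simp add: regular_def translate_def integral_unique)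
qed

lemma regular_norm_le:
  fixes f :: "real \<Rightarrow> 'a::complex_banach"
  assumes f: "continuous_on UNIV f" "bounded (range f)" and \<phi>: "\<phi> \<in> DL1"
  shows "norm (regular f \<phi>) \<le> (LINT t|lborel. cmod (\<phi> t) * norm (f t))"
    and "integrable lborel (\<lambda>t. cmod (\<phi> t) * norm (f t))"
proof -
  obtain B where B: "\<And>t. norm (f t) \<le> B" using f(2) by (auto simp: bounded_iff)
  have m: "(\<lambda>t. norm (f t)) \<in> borel_measurable borel"
    by (intro borel_measurable_continuous_onI continuous_on_norm f(1))
  have B0: "0 \<le> B" using B[of 0] norm_ge_zero order_trans by blast
  show i: "integrable lborel (\<lambda>t. cmod (\<phi> t) * norm (f t))"
  proof (rule Bochner_Integration.integrable_bound)
    show "integrable lborel (\<lambda>t. cmod (\<phi> t) * B)" using DL1_integrable0[OF \<phi>] by simp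
    show "(\<lambda>t. cmod (\<phi> t) * norm (f t)) \<in> borel_measurable lborel"
      using m borel_measurable_integrable[OF DL1_integrable0[OF \<phi>]] by simp
    show "AE t in lborel. norm (cmod (\<phi> t) * norm (f t)) \<le> norm (cmod (\<phi> t) * B)"
      using B B0 by (auto simp: abs_mult intro!: mult_left_mono)
  qed
  have "norm (regular f \<phi>) \<le> integral UNIV (\<lambda>t. cmod (\<phi> t) * norm (f t))"
    unfolding regular_def
    by (rule integral_norm_bound_integral[OF _ integrable_on_lborel[OF i]])
      (use regular_integrable[OF f(1) B \<phi>, of 0] in \<open>auto simp: norm_scaleC\<close>)
  then show "norm (regular f \<phi>) \<le> (LINT t|lborel. cmod (\<phi> t) * norm (f t))"
    using integral_lborel[OF i] by simp
qed

lemma regular_diff_fun: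
  fixes f g :: "real \<Rightarrow> 'a::complex_banach"
  assumes f: "continuous_on UNIV f" "bounded (range f)" and g: "continuous_on UNIV g" "bounded (range g)"
    and \<phi>: "\<phi> \<in> DL1"
  shows "regular (\<lambda>t. f t - g t) \<phi> = regular f \<phi> - regular g \<phi>"
proof -
  obtain B B' where B: "\<And>t. norm (f t) \<le> B" "\<And>t. norm (g t) \<le> B'" using f g by (auto simp: bounded_iff)
  show ?thesis
    unfolding regular_def scaleC.diff_right
    using regular_integrable[OF f(1) B(1) \<phi>, of 0] regular_integrable[OF g(1) B(2) \<phi>, of 0]
    by (intro Henstock_Kurzweil_Integration.integral_diff) auto
qed

lemma shift_continuous_bounded:
  fixes f :: "real \<Rightarrow> 'a::real_normed_vector"
  assumes "continuous_on UNIV f" "bounded (range f)"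
  shows "continuous_on UNIV (\<lambda>t. f (t + x))" "bounded (range (\<lambda>t. f (t + x)))"
  using assms by (auto intro!: continuous_on_compose2[OF assms(1)] continuous_intros simp: bounded_iff)

lemma regular_translate_diff:
  fixes f :: "real \<Rightarrow> 'a::complex_banach"
  assumes f: "continuous_on UNIV f" "bounded (range f)" and \<phi>: "\<phi> \<in> DL1"
  shows "norm (translate x (regular f) \<phi> - translate y (regular f) \<phi>)
      \<le> (LINT t|lborel. cmod (\<phi> t) * norm (f (t + x) - f (t + y)))"
    and "integrable lborel (\<lambda>t. cmod (\<phi> t) * norm (f (t + x) - f (t + y)))"
proof -
  note s = shift_continuous_bounded[OF f]
  have c: "continuous_on UNIV (\<lambda>t. f (t + x) - f (t + y))" by (intro continuous_on_diff s)
  have b: "bounded (range (\<lambda>t. f (t + x) - f (t + y)))" by (intro bounded_minus_comp s)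
  show "norm (translate x (regular f) \<phi> - translate y (regular f) \<phi>)
      \<le> (LINT t|lborel. cmod (\<phi> t) * norm (f (t + x) - f (t + y)))"
    unfolding regular_translate[OF f \<phi>] regular_diff_fun[OF s s \<phi>, symmetric]
    by (rule regular_norm_le[OF c b \<phi>])
  show "integrable lborel (\<lambda>t. cmod (\<phi> t) * norm (f (t + x) - f (t + y)))"
    by (rule regular_norm_le(2)[OF c b \<phi>])
qed

lemma nderiv_outside:
  fixes \<phi> :: "real \<Rightarrow> complex"
  assumes "closed K" "\<And>t. t \<notin> K \<Longrightarrow> \<phi> t = 0" "t \<notin> K"
  shows "nderiv p \<phi> t = 0"
  using assms(3)
proof (induction p arbitrary: t)
  case (Suc p)
  have "((\<lambda>_. 0) has_vector_derivative 0) (at t)" by simp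
  then have "(nderiv p \<phi> has_vector_derivative 0) (at t)"
    by (rule has_vector_derivative_transform_within_open[OF _ open_Compl[OF assms(1)]]) (use Suc in auto)
  then show ?case by (simp add: nderiv_Suc vector_derivative_at)
qed (simp add: assms(2))

context weight_sequence
begin

lemma translate_continuous_bounded:
  fixes T :: "(real \<Rightarrow> complex) \<Rightarrow> 'a::complex_banach"
  assumes "T \<in> DL1_dual c M" "w \<in> DL1_space c M"
  shows "continuous_on UNIV (\<lambda>x. translate x T w)" "bounded (range (\<lambda>x. translate x T w))"
  using translates_continuous_bounded[OF assms] by (simp_all add: translate_def)

text \<open>An almost period of \<open>f\<close> is, up to the factor \<open>L1 \<phi>\<close>, one of the convolution.\<close>

lemma AP_translate_regular:
  fixes f :: "real \<Rightarrow> 'a::complex_banach"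
  assumes f: "f \<in> AP" and \<phi>: "\<phi> \<in> DL1_space c M"
  shows "(\<lambda>x. translate x (regular f) \<phi>) \<in> AP"
  unfolding AP_def mem_Collect_eq
proof (intro conjI allI impI)
  note fc = AP_continuous[OF f] AP_bounded[OF f] and \<phi>D = DL1_space_DL1[OF \<phi>]
  show "continuous_on UNIV (\<lambda>x. translate x (regular f) \<phi>)"
    by (rule translate_continuous_bounded[OF regular_dual[OF fc] \<phi>])
  fix \<epsilon> :: real assume \<epsilon>: "\<epsilon> > 0"
  have L: "L1 \<phi> + 1 > 0" using L1_nonneg[of \<phi>] by linarith
  then have e: "\<epsilon> / (L1 \<phi> + 1) > 0" using \<epsilon> by simp
  obtain l where l: "l > 0"
    "\<And>b. b > 0 \<Longrightarrow> \<exists>\<tau>\<in>{b..b + l}. \<forall>t. norm (f (t + \<tau>) - f t) \<le> \<epsilon> / (L1 \<phi> + 1)"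
    by (rule AP_period[OF f e]) blast
  have "norm (translate (x + \<tau>) (regular f) \<phi> - translate x (regular f) \<phi>) \<le> \<epsilon>"
    if \<tau>: "\<And>t. norm (f (t + \<tau>) - f t) \<le> \<epsilon> / (L1 \<phi> + 1)" for x \<tau>
  proof -
    have "norm (translate (x + \<tau>) (regular f) \<phi> - translate x (regular f) \<phi>)
        \<le> (LINT t|lborel. cmod (\<phi> t) * norm (f (t + (x + \<tau>)) - f (t + x)))"
      by (rule regular_translate_diff(1)[OF fc \<phi>D])
    also have "\<dots> \<le> (LINT t|lborel. cmod (\<phi> t) * (\<epsilon> / (L1 \<phi> + 1)))"
      using DL1_integrable0[OF \<phi>D] \<tau>
      by (intro integral_mono regular_translate_diff(2)[OF fc \<phi>D] mult_left_mono)
        (auto simp: add.assoc[symmetric])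
    also have "\<dots> = L1 \<phi> * (\<epsilon> / (L1 \<phi> + 1))"
      by (simp add: L1_def)
    also have "\<dots> \<le> (L1 \<phi> + 1) * (\<epsilon> / (L1 \<phi> + 1))" using e by (intro mult_right_mono) auto
    also have "\<dots> = \<epsilon>" using L by simp
    finally show ?thesis .
  qed
  then show "\<exists>l>0. \<forall>a>0. \<exists>\<tau>\<in>{a..a + l}. \<forall>t.
      norm (translate (t + \<tau>) (regular f) \<phi> - translate t (regular f) \<phi>) \<le> \<epsilon>"
    using l by meson
qed

text \<open>The companion function of a convolution is obtained from completeness; the companion
  function of \<open>f\<close>, which need not be measurable as a vector-valued function, only enters through
  norms of differences, which are limits of continuous real functions.\<close>

lemma AA_translate_regular:
  fixes f :: "real \<Rightarrow> 'a::complex_banach"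
  assumes f: "f \<in> AA" and \<phi>: "\<phi> \<in> DL1_space c M"
  shows "(\<lambda>x. translate x (regular f) \<phi>) \<in> AA"
  unfolding AA_iff
proof (intro conjI allI)
  note fc = AA_continuous[OF f] AA_bounded[OF f] and \<phi>D = DL1_space_DL1[OF \<phi>]
  show "continuous_on UNIV (\<lambda>x. translate x (regular f) \<phi>)" "bounded (range (\<lambda>x. translate x (regular f) \<phi>))"
    by (rule translate_continuous_bounded[OF regular_dual[OF fc] \<phi>])+
  obtain B where B: "\<And>t. norm (f t) \<le> B" using fc(2) by (auto simp: bounded_iff)
  have B0: "0 \<le> B" using B[of 0] norm_ge_zero order_trans by blast
  let ?G = "\<lambda>x. translate x (regular f) \<phi>"
  have \<phi>m: "\<phi> \<in> borel_measurable borel" using borel_measurable_integrable[OF DL1_integrable0[OF \<phi>D]] by simp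
  have dom: "integrable lborel (\<lambda>t. cmod (\<phi> t) * (2 * B))" using DL1_integrable0[OF \<phi>D] by simp
  fix b :: "nat \<Rightarrow> real"
  obtain r g where r: "strict_mono r" "AA_along (b \<circ> r) f g" by (rule AA_subseq[OF f])
  define d where "d = b \<circ> r"
  have fg: "\<And>t. (\<lambda>n. f (t + d n)) \<longlonglongrightarrow> g t" and gf: "\<And>t. (\<lambda>n. g (t - d n)) \<longlonglongrightarrow> f t"
    using r(2) by (simp_all add: AA_along_def d_def)
  have gB: "norm (g t) \<le> B" for t by (rule AA_along_norm_le[OF r(2) B])
  \<comment> \<open>Dominated convergence for the real functions that occur below.\<close>
  have dct: "(\<lambda>n. LINT t|lborel. cmod (\<phi> t) * u n t) \<longlonglongrightarrow> (LINT t|lborel. cmod (\<phi> t) * v t)"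
    if um: "\<And>n. u n \<in> borel_measurable borel" and ub: "\<And>n t. 0 \<le> u n t \<and> u n t \<le> 2 * B"
      and uv: "\<And>t. (\<lambda>n. u n t) \<longlonglongrightarrow> v t" for u :: "nat \<Rightarrow> real \<Rightarrow> real" and v
  proof (rule integral_dominated_convergence[OF _ _ dom])
    have vm: "v \<in> borel_measurable borel" by (rule borel_measurable_LIMSEQ_real[OF uv um])
    show "(\<lambda>t. cmod (\<phi> t) * v t) \<in> borel_measurable lborel" using vm \<phi>m by simp
    show "(\<lambda>t. cmod (\<phi> t) * u n t) \<in> borel_measurable lborel" for n using um \<phi>m by simp
    show "AE t in lborel. (\<lambda>n. cmod (\<phi> t) * u n t) \<longlonglongrightarrow> cmod (\<phi> t) * v t"
      by (intro AE_I2 tendsto_mult_left uv)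
    show "AE t in lborel. norm (cmod (\<phi> t) * u n t) \<le> cmod (\<phi> t) * (2 * B)" for n
      using ub by (intro AE_I2) (auto simp: abs_mult intro!: mult_left_mono)
  qed
  have shm: "(\<lambda>t. norm (f (t + x) - f (t + y))) \<in> borel_measurable borel" for x y
    by (intro borel_measurable_continuous_onI continuous_on_norm continuous_on_diff shift_continuous_bounded[OF fc])
  have bd2: "norm (p - q) \<le> 2 * B" if "norm p \<le> B" "norm q \<le> B" for p q :: 'a
    using that norm_triangle_ineq4[of p q] by linarith
  have lim: "\<exists>L. (\<lambda>n. ?G (x + d n)) \<longlonglongrightarrow> L" for x
  proof -
    define u where "u n t = norm (f (t + (x + d n)) - g (t + x))" for n t
    have lim_u: "(\<lambda>m. norm (f (t + (x + d n)) - f (t + (x + d m)))) \<longlonglongrightarrow> u n t" for n t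
      unfolding u_def using fg[of "t + x"] by (intro tendsto_intros) (simp add: add.assoc)
    have um: "u n \<in> borel_measurable borel" for n
      by (rule borel_measurable_LIMSEQ_real[OF lim_u shm])
    have ub: "0 \<le> u n t \<and> u n t \<le> 2 * B" for n t
      unfolding u_def using bd2[OF B gB] by simp
    have u0: "(\<lambda>n. u n t) \<longlonglongrightarrow> 0" for t
      unfolding u_def using fg[of "t + x"]
      by (intro tendsto_norm_zero) (simp add: add.assoc LIM_zero)
    define U where "U n = (LINT t|lborel. cmod (\<phi> t) * u n t)" for n
    have U: "U \<longlonglongrightarrow> 0" using dct[OF um ub u0] by (simp add: U_def[abs_def])
    have ui: "integrable lborel (\<lambda>t. cmod (\<phi> t) * u n t)" for n
      by (rule Bochner_Integration.integrable_bound[OF dom])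
        (use um \<phi>m ub B0 in \<open>auto simp: abs_mult intro!: mult_left_mono\<close>)
    have le: "norm (?G (x + d n) - ?G (x + d m)) \<le> U n + U m" for n m
    proof -
      have "norm (?G (x + d n) - ?G (x + d m))
          \<le> (LINT t|lborel. cmod (\<phi> t) * norm (f (t + (x + d n)) - f (t + (x + d m))))"
        by (rule regular_translate_diff(1)[OF fc \<phi>D])
      also have "\<dots> \<le> (LINT t|lborel. cmod (\<phi> t) * u n t + cmod (\<phi> t) * u m t)"
      proof (rule integral_mono[OF regular_translate_diff(2)[OF fc \<phi>D] Bochner_Integration.integrable_add[OF ui ui]])
        fix t
        have "norm (f (t + (x + d n)) - f (t + (x + d m))) \<le> u n t + u m t"
          unfolding u_def
          using norm_triangle_ineq4[of "f (t + (x + d n)) - g (t + x)" "f (t + (x + d m)) - g (t + x)"] by simp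
        then have "cmod (\<phi> t) * norm (f (t + (x + d n)) - f (t + (x + d m))) \<le> cmod (\<phi> t) * (u n t + u m t)"
          by (rule mult_left_mono) simp
        then show "cmod (\<phi> t) * norm (f (t + (x + d n)) - f (t + (x + d m))) \<le> cmod (\<phi> t) * u n t + cmod (\<phi> t) * u m t"
          by (simp add: distrib_left)
      qed
      also have "\<dots> = U n + U m"
        unfolding U_def by (rule Bochner_Integration.integral_add[OF ui ui])
      finally show ?thesis .
    qed
    have "Cauchy (\<lambda>n. ?G (x + d n))"
    proof (rule CauchyI)
      fix e :: real assume e: "e > 0"
      then obtain N where N: "\<And>n. n \<ge> N \<Longrightarrow> norm (U n - 0) < e / 2" using LIMSEQ_D[OF U, of "e / 2"] by auto
      have "norm (?G (x + d m) - ?G (x + d n)) < e" if "m \<ge> N" "n \<ge> N" for m n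
        using le[of m n] N[OF that(1)] N[OF that(2)] by (simp add: abs_less_iff)
      then show "\<exists>N. \<forall>m\<ge>N. \<forall>n\<ge>N. norm (?G (x + d m) - ?G (x + d n)) < e" by blast
    qed
    then show ?thesis by (simp add: Cauchy_convergent_iff convergent_def)
  qed
  then obtain L where L: "\<And>x. (\<lambda>n. ?G (x + d n)) \<longlonglongrightarrow> L x" by metis
  have returns: "(\<lambda>m. L (x - d m)) \<longlonglongrightarrow> ?G x" for x
  proof -
    define v where "v m t = norm (g (t + x - d m) - f (t + x))" for m t
    have lim_v: "(\<lambda>n. norm (f (t + (x - d m + d n)) - f (t + x))) \<longlonglongrightarrow> v m t" for m t
      unfolding v_def using fg[of "t + x - d m"]
      by (intro tendsto_intros) (simp add: algebra_simps)
    have vm: "v m \<in> borel_measurable borel" for m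
      by (rule borel_measurable_LIMSEQ_real[OF lim_v shm])
    have vb: "0 \<le> v m t \<and> v m t \<le> 2 * B" for m t
      unfolding v_def using bd2[OF gB B] by simp
    have v0: "(\<lambda>m. v m t) \<longlonglongrightarrow> 0" for t
      unfolding v_def using gf[of "t + x"]
      by (intro tendsto_norm_zero) (simp add: LIM_zero)
    have le: "norm (L (x - d m) - ?G x) \<le> (LINT t|lborel. cmod (\<phi> t) * v m t)" for m
    proof (rule LIMSEQ_le)
      show "(\<lambda>n. norm (?G (x - d m + d n) - ?G x)) \<longlonglongrightarrow> norm (L (x - d m) - ?G x)"
        by (intro tendsto_intros L)
      show "(\<lambda>n. LINT t|lborel. cmod (\<phi> t) * norm (f (t + (x - d m + d n)) - f (t + x))) \<longlonglongrightarrow>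
          (LINT t|lborel. cmod (\<phi> t) * v m t)"
        by (rule dct[OF shm _ lim_v]) (use bd2[OF B B] in auto)
      show "\<exists>N. \<forall>n\<ge>N. norm (?G (x - d m + d n) - ?G x)
          \<le> (LINT t|lborel. cmod (\<phi> t) * norm (f (t + (x - d m + d n)) - f (t + x)))"
        using regular_translate_diff(1)[OF fc \<phi>D] by blast
    qed
    have "(\<lambda>m. LINT t|lborel. cmod (\<phi> t) * v m t) \<longlonglongrightarrow> 0"
      using dct[OF vm vb v0] by simp
    then have "(\<lambda>m. L (x - d m) - ?G x) \<longlonglongrightarrow> 0"
      by (rule Lim_null_comparison[OF always_eventually[OF allI[OF le]]])
    then show ?thesis by (simp add: LIM_zero_iff)
  qed
  show "\<exists>r g'. strict_mono r \<and> AA_along (b \<circ> r) ?G g'"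
    using r(1) L returns unfolding AA_along_def d_def by blast
qed

lemma kind_fun_translate_regular:
  fixes f :: "real \<Rightarrow> 'a::complex_banach"
  assumes "f \<in> kind_fun k" "\<phi> \<in> DL1_space c M"
  shows "(\<lambda>x. translate x (regular f) \<phi>) \<in> kind_fun k"
  using AP_translate_regular[OF _ assms(2)] AA_translate_regular[OF _ assms(2)] assms(1)
  by (cases k) (auto simp: kind_fun_def)

lemma regular_compact_integrable:
  fixes f :: "real \<Rightarrow> 'a::complex_banach"
  assumes "continuous_on UNIV f" "continuous_on UNIV \<phi>" "\<And>t. t \<notin> {a..b} \<Longrightarrow> \<phi> t = 0"
  shows "(\<lambda>t. \<phi> t *\<^sub>C f t) integrable_on UNIV"
proof (rule integrable_on_superset[of _ "{a..b}"])
  show "(\<lambda>t. \<phi> t *\<^sub>C f t) integrable_on {a..b}"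
    by (intro integrable_continuous_interval scaleC.continuous_on) (auto intro: continuous_on_subset assms)
qed (auto simp: assms(3) scaleC.zero_left)

text \<open>Since \<open>\<phi>\<close> has compact support, its far translates only see the two functions near plus infinity.\<close>

lemma translate_regular_tendsto:
  fixes f g :: "real \<Rightarrow> 'a::complex_banach"
  assumes f: "continuous_on UNIV f" and g: "continuous_on UNIV g" and lim: "((\<lambda>t. f t - g t) \<longlongrightarrow> 0) at_top"
    and \<phi>: "\<phi> \<in> DL1" "\<And>t. t \<notin> {a..b} \<Longrightarrow> \<phi> t = 0"
  shows "((\<lambda>x. translate x (regular f) \<phi> - translate x (regular g) \<phi>) \<longlongrightarrow> 0) at_top"
proof (rule tendstoI)
  fix e :: real assume e: "e > 0"
  have L: "L1 \<phi> + 1 > 0" using L1_nonneg[of \<phi>] by linarith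
  then have "e / (L1 \<phi> + 1) > 0" using e by simp
  from tendstoD[OF lim this] obtain N where N: "\<And>t. t \<ge> N \<Longrightarrow> norm (f t - g t) < e / (L1 \<phi> + 1)"
    by (auto simp: eventually_at_top_linorder dist_norm)
  have \<phi>c: "continuous_on UNIV \<phi>" using smooth_continuous_on[OF DL1_smooth[OF \<phi>(1)], of UNIV 0] by simp
  have "dist (translate x (regular f) \<phi> - translate x (regular g) \<phi>) 0 < e" if x: "x \<ge> N - a" for x
  proof -
    let ?\<phi> = "\<lambda>t. \<phi> (t - x)"
    have c: "continuous_on UNIV ?\<phi>"
      by (rule continuous_on_compose2[OF \<phi>c]) (auto intro: continuous_intros)
    have z: "?\<phi> t = 0" if "t \<notin> {a + x..b + x}" for t using that by (intro \<phi>(2)) auto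
    note i = regular_compact_integrable[OF f c z] regular_compact_integrable[OF g c z]
    have "translate x (regular f) \<phi> - translate x (regular g) \<phi> = integral UNIV (\<lambda>t. ?\<phi> t *\<^sub>C (f t - g t))"
      unfolding translate_def regular_def scaleC.diff_right
      by (rule Henstock_Kurzweil_Integration.integral_diff[OF i, symmetric])
    also have "norm \<dots> \<le> e / (L1 \<phi> + 1) * L1 ?\<phi>"
    proof (rule norm_integral_scaleC_le)
      show "integrable lborel ?\<phi>" by (rule integrable_shift[OF DL1_integrable0[OF \<phi>(1)]])
      show "norm (f t - g t) \<le> e / (L1 \<phi> + 1)" if "?\<phi> t \<noteq> 0" for t
        using z[of t] that x by (intro less_imp_le[OF N]) force
      show "(\<lambda>t. ?\<phi> t *\<^sub>C (f t - g t)) integrable_on UNIV"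
        unfolding scaleC.diff_right by (rule Henstock_Kurzweil_Integration.integrable_diff[OF i])
    qed
    also have "\<dots> < e"
      using L e by (simp add: L1_shift field_simps)
    finally show ?thesis by (simp add: dist_norm)
  qed
  then show "\<forall>\<^sub>F x in at_top. dist (translate x (regular f) \<phi> - translate x (regular g) \<phi>) 0 < e"
    unfolding eventually_at_top_linorder by blast
qed

text \<open>As \<open>f\<close> may be unbounded near minus infinity, the continuity result for orbits of elements of the
  dual does not apply to it; continuity is therefore a premise.\<close>

lemma asymp_fun_translate_regular:
  fixes f :: "real \<Rightarrow> 'a::complex_banach"
  assumes f: "f \<in> asymp_fun k" and \<phi>: "\<phi> \<in> DL1_space c M" "\<And>t. t \<notin> {a..b} \<Longrightarrow> \<phi> t = 0"
    and cont: "continuous_on UNIV (\<lambda>x. translate x (regular f) \<phi>)"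
  shows "(\<lambda>x. translate x (regular f) \<phi>) \<in> asymp_fun k"
proof -
  obtain g where g: "g \<in> kind_fun k" "((\<lambda>t. f t - g t) \<longlongrightarrow> 0) at_top" and fc: "continuous_on UNIV f"
    using f unfolding asymp_fun_iff by blast
  have "((\<lambda>x. translate x (regular f) \<phi> - translate x (regular g) \<phi>) \<longlongrightarrow> 0) at_top"
    by (rule translate_regular_tendsto[OF fc kind_fun_continuous[OF g(1)] g(2) DL1_space_DL1[OF \<phi>(1)] \<phi>(2)])
  then show ?thesis
    by (rule asymp_funI[OF cont kind_fun_translate_regular[OF g(1) \<phi>(1)]])
qed

text \<open>Term by term the orbit is a convolution of \<open>f\<close> with a derivative of \<open>\<phi>\<close>; the series converges
  uniformly because translations preserve the norms.\<close>

lemma asymp_fun_translate_ultradiff: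
  fixes f g :: "real \<Rightarrow> 'a::complex_banach"
  assumes f: "f \<in> bdd_asymp_fun k" and g: "g \<in> bdd_asymp_fun k" and a: "ultradiff_class c M a"
    and \<phi>: "\<phi> \<in> DL1_space c M" "\<And>t. t \<notin> {b..d} \<Longrightarrow> \<phi> t = 0"
  shows "(\<lambda>x. translate x (\<lambda>\<phi>. ultradiff a f \<phi> + regular g \<phi>) \<phi>) \<in> asymp_fun k"
proof -
  have fc: "continuous_on UNIV f" "bounded (range f)" "f \<in> asymp_fun k"
    and gc: "continuous_on UNIV g" "bounded (range g)" "g \<in> asymp_fun k"
    using f g by (auto simp: bdd_asymp_fun_def asymp_fun_iff)
  obtain B where B: "\<And>t. norm (f t) \<le> B" using fc(2) by (auto simp: bounded_iff)
  have B0: "0 \<le> B" using B[of 0] norm_ge_zero order_trans by blast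
  let ?S = "\<lambda>\<phi>. ultradiff a f \<phi> + regular g \<phi>"
  have S: "?S \<in> DL1_dual c M" by (rule ultradiff_dual[OF fc(1,2) gc(1,2) a])
  have cont: "continuous_on UNIV (\<lambda>x. translate x ?S \<phi>)"
    by (rule translate_continuous_bounded(1)[OF S \<phi>(1)])
  have sh: "(\<lambda>t. \<phi> (t - x)) \<in> DL1_space c M" for x by (rule DL1_space_shift[OF \<phi>(1)])
  have nd: "nderiv p (\<lambda>t. \<phi> (t - x)) = (\<lambda>t. nderiv p \<phi> (t - x))" for p x
    using nderiv_affine(2)[OF DL1_smooth[OF DL1_space_DL1[OF \<phi>(1)]], of p 1 "- x"] by simp
  define F where "F n x = (\<Sum>p<n. ultradiff_term a f (\<lambda>t. \<phi> (t - x)) p) + translate x (regular g) \<phi>" for n x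
  have term_asymp: "(\<lambda>x. ultradiff_term a f (\<lambda>t. \<phi> (t - x)) p) \<in> asymp_fun k" for p
  proof -
    have "(\<lambda>x. translate x (regular f) (nderiv p \<phi>)) \<in> asymp_fun k"
      by (rule asymp_fun_translate_regular[OF fc(3) DL1_space_nderiv[OF \<phi>(1)] nderiv_outside[OF closed_atLeastAtMost \<phi>(2)]
          translate_continuous_bounded(1)[OF regular_dual[OF fc(1,2)] DL1_space_nderiv[OF \<phi>(1)]]])
    then show ?thesis unfolding ultradiff_term_def nd translate_def by (rule asymp_fun_scaleC)
  qed
  have F: "F n \<in> asymp_fun k" for n
    unfolding F_def
    by (intro asymp_fun_add asymp_fun_sum finite_lessThan term_asymp
        asymp_fun_translate_regular[OF gc(3) \<phi>] translate_continuous_bounded(1)[OF regular_dual[OF gc(1,2)] \<phi>(1)])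
  from a have "at_scales c (\<lambda>l. \<exists>C\<ge>0. \<forall>p. cmod (a p) \<le> C * l ^ p / M p)"
    using ultradiff_class_iff[of M, OF M_pos] by blast
  then obtain l where l: "l > 0" "\<exists>C\<ge>0. \<forall>p. cmod (a p) \<le> C * l ^ p / M p" "\<phi> \<in> DL1_step M (2 * l)"
    by (rule at_scales_DL1_space[OF _ \<phi>(1), of _ 2]) auto
  then obtain C where C: "C \<ge> 0" "\<And>p. cmod (a p) \<le> C * l ^ p / M p" by blast
  let ?N = "DL1_norm M (2 * l) \<phi>"
  have tb: "norm (ultradiff_term a f (\<lambda>t. \<phi> (t - x)) p) \<le> C * B * ?N * (1 / 2) ^ p" for x p
  proof -
    have s: "(\<lambda>t. \<phi> (t - x)) \<in> DL1_step M (2 * l)" "DL1_norm M (2 * l) (\<lambda>t. \<phi> (t - x)) \<le> ?N"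
      using DL1_step_isometry[OF l(3), of 1 "- x"] l(1) by simp_all
    have "norm (ultradiff_term a f (\<lambda>t. \<phi> (t - x)) p) \<le> C * B * DL1_norm M (2 * l) (\<lambda>t. \<phi> (t - x)) * (1 / 2) ^ p"
      by (rule ultradiff_term_bound[OF fc(1) B C(2,1) s(1) l(1)])
    also have "\<dots> \<le> C * B * ?N * (1 / 2) ^ p"
      using C(1) B0 by (intro mult_right_mono mult_left_mono s(2)) auto
    finally show ?thesis .
  qed
  have "uniform_limit UNIV (\<lambda>n x. \<Sum>p<n. ultradiff_term a f (\<lambda>t. \<phi> (t - x)) p)
      (\<lambda>x. suminf (ultradiff_term a f (\<lambda>t. \<phi> (t - x)))) sequentially"
    by (rule Weierstrass_m_test[OF tb]) (intro summable_mult summable_geometric, simp)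
  then have "uniform_limit {0..} (\<lambda>n x. \<Sum>p<n. ultradiff_term a f (\<lambda>t. \<phi> (t - x)) p)
      (\<lambda>x. suminf (ultradiff_term a f (\<lambda>t. \<phi> (t - x)))) sequentially"
    by (rule uniform_limit_on_subset[OF _ subset_UNIV])
  from uniform_limit_add[OF this uniform_limit_const[where S = "{0..}" and c = "\<lambda>x. translate x (regular g) \<phi>"]]
  have "uniform_limit {0..} F (\<lambda>x. translate x ?S \<phi>) sequentially"
    by (simp add: F_def[abs_def] translate_def ultradiff_eq)
  from asymp_fun_uniform_limit[OF F cont this] show ?thesis .
qed

end

section \<open>Compactly supported test functions\<close>

lemma supp_subset_iff:
  assumes "closed K"
  shows "supp \<phi> \<subseteq> K \<longleftrightarrow> (\<forall>t. t \<notin> K \<longrightarrow> \<phi> t = 0)"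
proof
  assume *: "supp \<phi> \<subseteq> K"
  have "t \<in> supp \<phi>" if "\<phi> t \<noteq> 0" for t
    unfolding supp_def using that by (intro subsetD[OF closure_subset]) simp
  then show "\<forall>t. t \<notin> K \<longrightarrow> \<phi> t = 0" using * by blast
next
  assume "\<forall>t. t \<notin> K \<longrightarrow> \<phi> t = 0"
  then have "{t. \<phi> t \<noteq> 0} \<subseteq> K" by blast
  then show "supp \<phi> \<subseteq> K" unfolding supp_def by (rule closure_minimal[OF _ assms])
qed

lemma L1_compact:
  assumes "continuous_on UNIV f" "\<And>t. t \<notin> {a..b} \<Longrightarrow> f t = 0" "\<And>t. cmod (f t) \<le> B" "a \<le> b"
  shows "integrable lborel f" and "L1 f \<le> B * (b - a)"
proof -
  have B: "0 \<le> B" using assms(3)[of 0] norm_ge_zero order_trans by blast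
  have i: "integrable lborel (\<lambda>t. indicator {a..b} t * B)"
    using assms(4) by (intro integrable_mult_left integrable_real_indicator) auto
  have le: "cmod (f t) \<le> indicator {a..b} t * B" for t
    using assms(2,3)[of t] by (auto simp: indicator_def)
  show f: "integrable lborel f"
  proof (rule Bochner_Integration.integrable_bound[OF i])
    show "f \<in> borel_measurable lborel" using borel_measurable_continuous_onI[OF assms(1)] by simp
    show "AE t in lborel. norm (f t) \<le> norm (indicator {a..b} t * B)"
      by (rule AE_I2, rule order_trans[OF le]) simp
  qed
  have "L1 f \<le> (LINT t|lborel. indicator {a..b} t * B)"
    unfolding L1_def by (rule integral_mono[OF integrable_norm[OF f] i le])
  then show "L1 f \<le> B * (b - a)" using assms(4) by (simp add: mult.commute)
qed

lemma compact_smooth_DL1: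
  assumes "smooth \<phi>" "\<And>t. t \<notin> {a..b} \<Longrightarrow> \<phi> t = 0"
  shows "\<phi> \<in> DL1"
  unfolding DL1_def mem_Collect_eq
proof (intro conjI allI assms(1))
  fix j
  define a' b' where "a' = min a b" and "b' = max a b"
  have ab: "a' \<le> b'" "{a..b} \<subseteq> {a'..b'}" by (auto simp: a'_def b'_def)
  have z: "nderiv j \<phi> t = 0" if "t \<notin> {a'..b'}" for t
    by (rule nderiv_outside[of "{a'..b'}"]) (use that ab assms(2) in auto)
  have "bounded (nderiv j \<phi> ` {a'..b'})"
    by (intro compact_imp_bounded compact_continuous_image smooth_continuous_on assms(1)) auto
  then obtain B where B: "\<And>t. t \<in> {a'..b'} \<Longrightarrow> cmod (nderiv j \<phi> t) \<le> B"
    unfolding bounded_iff by blast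
  have "cmod (nderiv j \<phi> t) \<le> max B 0" for t
    using B[of t] z[of t] by (cases "t \<in> {a'..b'}") auto
  from L1_compact(1)[OF smooth_continuous_on[OF assms(1)] z this ab(1)]
  show "integrable lborel (nderiv j \<phi>)" .
qed

context weight_sequence
begin

lemma D_step_DL1_step:
  assumes "compact K" "h > 0" "\<phi> \<in> D_step M K h"
  shows "\<phi> \<in> DL1_step M h" and "\<exists>a b. a \<le> b \<and> (\<forall>t. t \<notin> {a..b} \<longrightarrow> \<phi> t = 0)"
proof -
  have sm: "smooth \<phi>" and sup: "supp \<phi> \<subseteq> K"
    and bd: "bdd_above ((\<lambda>(p, t). h ^ p * cmod (nderiv p \<phi> t) / M p) ` (UNIV \<times> K))"
    using assms(3) by (auto simp: D_step_def)
  note cK = compact_imp_closed[OF assms(1)]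
  obtain r where r: "\<And>t. t \<in> K \<Longrightarrow> norm t \<le> r" using compact_imp_bounded[OF assms(1)] unfolding bounded_iff by blast
  define b where "b = max r 0"
  have Kb: "K \<subseteq> {- b..b}" using r by (force simp: b_def)
  have z: "\<phi> t = 0" if "t \<notin> K" for t using sup that supp_subset_iff[OF cK] by blast
  then have zb: "\<phi> t = 0" if "t \<notin> {- b..b}" for t using that Kb by blast
  show "\<exists>a b. a \<le> b \<and> (\<forall>t. t \<notin> {a..b} \<longrightarrow> \<phi> t = 0)"
    by (rule exI[of _ "- b"], rule exI[of _ b]) (use zb in \<open>auto simp: b_def\<close>)
  from bd obtain B0 where B0: "\<And>p t. t \<in> K \<Longrightarrow> h ^ p * cmod (nderiv p \<phi> t) / M p \<le> B0"
    unfolding bdd_above_def by fastforce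
  define B where "B = max B0 0"
  have B: "cmod (nderiv p \<phi> t) \<le> B * M p / h ^ p" for p t
  proof (cases "t \<in> K")
    case True
    then have "h ^ p * cmod (nderiv p \<phi> t) / M p \<le> B" using B0[of t p] by (simp add: B_def)
    then show ?thesis using assms(2) M_pos[of p] by (simp add: field_simps)
  next
    case False
    have "nderiv p \<phi> t = 0" by (rule nderiv_outside[OF cK z False])
    then show ?thesis using assms(2) M_nonneg[of p] by (simp add: B_def)
  qed
  note \<phi> = compact_smooth_DL1[OF sm zb]
  show "\<phi> \<in> DL1_step M h"
  proof (rule DL1_stepI(1)[OF \<phi>])
    fix p
    have "L1 (nderiv p \<phi>) \<le> B * M p / h ^ p * (b - - b)"
      by (rule L1_compact(2)[OF smooth_continuous_on[OF sm] nderiv_outside[OF closed_atLeastAtMost zb] B])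
        (auto simp: b_def)
    then have "h ^ p * L1 (nderiv p \<phi>) / M p \<le> h ^ p * (B * M p / h ^ p * (b - - b)) / M p"
      using assms(2) M_nonneg[of p] by (intro divide_right_mono mult_left_mono) auto
    also have "\<dots> = B * (b - - b)" using assms(2) M_pos[of p] by simp
    finally show "h ^ p * L1 (nderiv p \<phi>) / M p \<le> B * (b - - b)" .
  qed
qed

lemma DL1_step_D_step:
  assumes "\<phi> \<in> DL1" "nderiv 1 \<phi> \<in> DL1_step M h" "h > 0" "\<And>t. t \<notin> {a..b} \<Longrightarrow> \<phi> t = 0"
  shows "\<phi> \<in> D_step M {a..b} h"
  unfolding D_step_def mem_Collect_eq
proof (intro conjI)
  show "smooth \<phi>" by (rule DL1_smooth[OF assms(1)])
  show "supp \<phi> \<subseteq> {a..b}" using assms(4) by (simp add: supp_subset_iff)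
  have "h ^ p * cmod (nderiv p \<phi> t) / M p \<le> DL1_norm M h (nderiv 1 \<phi>)" for p t
  proof -
    have "h ^ p * cmod (nderiv p \<phi> t) / M p \<le> h ^ p * L1 (nderiv p (nderiv 1 \<phi>)) / M p"
      using DL1_sup_bound[OF assms(1), of p t] assms(3) M_nonneg[of p]
      by (intro divide_right_mono mult_left_mono) (auto simp: nderiv_nderiv)
    also have "\<dots> \<le> DL1_norm M h (nderiv 1 \<phi>)" by (rule DL1_step_quot_le[OF assms(2)])
    finally show ?thesis .
  qed
  then show "bdd_above ((\<lambda>(p, t). h ^ p * cmod (nderiv p \<phi> t) / M p) ` (UNIV \<times> {a..b}))"
    by (intro bdd_aboveI) auto
qed

text \<open>On compactly supported functions, supremum and \<open>L\<^sup>1\<close> norms of all derivatives control each other, the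
  latter after one more differentiation.\<close>

lemma D_space_iff:
  "\<phi> \<in> D_space c M \<longleftrightarrow> \<phi> \<in> DL1_space c M \<and> (\<exists>a b. \<forall>t. t \<notin> {a..b} \<longrightarrow> \<phi> t = 0)"
proof
  assume "\<phi> \<in> D_space c M"
  then obtain K where K: "compact K" "\<phi> \<in> D_on c M K" by (auto simp: D_space_def)
  show "\<phi> \<in> DL1_space c M \<and> (\<exists>a b. \<forall>t. t \<notin> {a..b} \<longrightarrow> \<phi> t = 0)"
  proof (cases c)
    case Beurling
    then have d: "\<phi> \<in> D_step M K h" if "h > 0" for h using K(2) that by (auto simp: D_on_def)
    then have "\<phi> \<in> DL1_space c M"
      using D_step_DL1_step(1)[OF K(1)] Beurling by (auto simp: DL1_space_def)
    moreover have "\<exists>a b. \<forall>t. t \<notin> {a..b} \<longrightarrow> \<phi> t = 0"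
      using D_step_DL1_step(2)[OF K(1) _ d, of 1] by auto
    ultimately show ?thesis ..
  next
    case Roumieu
    then obtain h where "h > 0" "\<phi> \<in> D_step M K h" using K(2) by (auto simp: D_on_def)
    then show ?thesis
      using D_step_DL1_step[OF K(1)] Roumieu by (auto simp: DL1_space_def) blast
  qed
next
  assume "\<phi> \<in> DL1_space c M \<and> (\<exists>a b. \<forall>t. t \<notin> {a..b} \<longrightarrow> \<phi> t = 0)"
  then obtain a b where \<phi>: "\<phi> \<in> DL1_space c M" and z: "\<And>t. t \<notin> {a..b} \<Longrightarrow> \<phi> t = 0" by blast
  note \<phi>' = DL1_space_nderiv[OF \<phi>, of 1] and d = DL1_space_DL1[OF \<phi>]
  have "\<phi> \<in> D_on c M {a..b}"
    using \<phi>' DL1_step_D_step[OF d _ _ z] by (cases c) (auto simp: D_on_def DL1_space_def)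
  then show "\<phi> \<in> D_space c M" unfolding D_space_def by blast
qed

lemma D0_space_iff:
  "\<phi> \<in> D0_space c M \<longleftrightarrow> \<phi> \<in> D_space c M \<and> (\<forall>t<0. \<phi> t = 0)"
  by (auto simp: D0_space_def supp_subset_iff not_le)

lemma DL1_space_Beurling: "\<phi> \<in> DL1_space Beurling M \<Longrightarrow> \<phi> \<in> DL1_space c M"
  by (cases c) (auto simp: DL1_space_def intro: zero_less_one)

end

section \<open>Infinite convolutions\<close>

lemma L1_suminf:
  assumes d: "\<And>j. integrable lborel (d j)" and s: "summable (\<lambda>j. L1 (d j))" and p: "\<And>x. summable (\<lambda>j. cmod (d j x))"
  shows "integrable lborel (\<lambda>x. \<Sum>j. d j x)" and "L1 (\<lambda>x. \<Sum>j. d j x) \<le> (\<Sum>j. L1 (d j))"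
proof -
  have s': "summable (\<lambda>j. LINT x|lborel. norm (d j x))" using s by (simp add: L1_def)
  have p': "AE x in lborel. summable (\<lambda>j. norm (d j x))" using p by simp
  show i: "integrable lborel (\<lambda>x. \<Sum>j. d j x)"
    by (rule integrable_suminf[OF d p' s'])
  have i2: "integrable lborel (\<lambda>x. \<Sum>j. cmod (d j x))"
    by (rule integrable_suminf) (use d p' s' in auto)
  have e2: "(LINT x|lborel. (\<Sum>j. cmod (d j x))) = (\<Sum>j. LINT x|lborel. cmod (d j x))"
    by (rule integral_suminf) (use d p' s' in auto)
  have "L1 (\<lambda>x. \<Sum>j. d j x) \<le> (LINT x|lborel. (\<Sum>j. cmod (d j x)))"
    unfolding L1_def by (rule integral_mono[OF integrable_norm[OF i] i2]) (rule summable_norm[OF p])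
  then show "L1 (\<lambda>x. \<Sum>j. d j x) \<le> (\<Sum>j. L1 (d j))" by (simp add: e2 L1_def)
qed

text \<open>A form of completeness of the space of smooth functions with integrable derivatives:
  the \<open>L\<^sup>1\<close> norm of the next derivative controls the supremum, so summable increments give
  uniform convergence of all derivatives.\<close>

lemma DL1_summable_increments:
  assumes F: "\<And>N. F N \<in> DL1" and e: "summable e"
    and inc: "\<And>N p. L1 (\<lambda>x. nderiv p (F (Suc N)) x - nderiv p (F N) x) \<le> e N * b p"
  obtains G where "G \<in> DL1" "\<And>p. uniform_limit UNIV (\<lambda>N. nderiv p (F N)) (nderiv p G) sequentially"
    "\<And>p. (\<lambda>N. L1 (\<lambda>x. nderiv p G x - nderiv p (F N) x)) \<longlonglongrightarrow> 0"
proof -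
  define d where "d p N x = nderiv p (F (Suc N)) x - nderiv p (F N) x" for p N x
  have dD: "(\<lambda>x. F (Suc N) x - F N x) \<in> DL1" for N by (rule DL1_diff[OF F F])
  have dn: "d p N = nderiv p (\<lambda>x. F (Suc N) x - F N x)" for p N
    unfolding d_def[abs_def] by (rule nderiv_diff[OF DL1_smooth[OF F] DL1_smooth[OF F], symmetric])
  have di: "integrable lborel (d p N)" for p N unfolding dn by (rule DL1_integrable[OF dD])
  have dL: "L1 (d p N) \<le> e N * b p" for p N using inc by (simp add: d_def[abs_def])
  have db: "cmod (d p N x) \<le> e N * b (Suc p)" for p N x
    using DL1_sup_bound[OF dD, of p N x] dL[of "Suc p" N] unfolding dn by linarith
  have sm: "summable (\<lambda>N. e N * b p)" for p using e by (rule summable_mult2)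
  have ps: "summable (\<lambda>N. cmod (d p (N + K) x))" for p K x
    by (rule summable_comparison_test'[OF summable_ignore_initial_segment[OF sm, of K "Suc p"], of 0])
      (use db in auto)
  have tele: "nderiv p (F N) x = nderiv p (F 0) x + (\<Sum>j<N. d p j x)" for p N x
    by (induction N) (simp_all add: d_def)
  define G where "G p x = nderiv p (F 0) x + (\<Sum>j. d p j x)" for p x
  have ul: "uniform_limit UNIV (\<lambda>N. nderiv p (F N)) (G p) sequentially" for p
  proof -
    have "uniform_limit UNIV (\<lambda>N x. \<Sum>j<N. d p j x) (\<lambda>x. \<Sum>j. d p j x) sequentially"
      by (rule Weierstrass_m_test[OF db sm])
    from uniform_limit_add[OF uniform_limit_const[where c = "nderiv p (F 0)"] this]
    have "uniform_limit UNIV (\<lambda>N x. nderiv p (F 0) x + (\<Sum>j<N. d p j x)) (G p) sequentially"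
      by (simp only: G_def[abs_def])
    moreover have "(\<lambda>N x. nderiv p (F 0) x + (\<Sum>j<N. d p j x)) = (\<lambda>N. nderiv p (F N))"
      by (intro ext) (rule tele[symmetric])
    ultimately show ?thesis by (simp only:)
  qed
  have der: "(G p has_vector_derivative G (Suc p) x) (at x)" for p x
  proof -
    have "\<exists>g. \<forall>x\<in>UNIV. (\<lambda>N. nderiv p (F N) x) \<longlonglongrightarrow> g x \<and>
        (g has_derivative (\<lambda>h. h *\<^sub>R G (Suc p) x)) (at x within UNIV)"
    proof (rule has_derivative_sequence)
      show "(nderiv p (F N) has_derivative (\<lambda>h. h *\<^sub>R nderiv (Suc p) (F N) x)) (at x within UNIV)" for N x
        using smooth_has_vector_derivative[OF DL1_smooth[OF F]] by (simp add: has_vector_derivative_def)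
      show "(\<lambda>N. nderiv p (F N) 0) \<longlonglongrightarrow> G p 0" by (rule tendsto_uniform_limitI[OF ul]) simp
      fix r :: real assume "r > 0"
      from uniform_limitD[OF ul[of "Suc p"] this]
      show "\<forall>\<^sub>F N in sequentially. \<forall>x\<in>UNIV. \<forall>h. norm (h *\<^sub>R nderiv (Suc p) (F N) x - h *\<^sub>R G (Suc p) x) \<le> r * norm h"
      proof eventually_elim
        case (elim N)
        show ?case
        proof (intro ballI allI)
          fix x h :: real
          have "norm (h *\<^sub>R nderiv (Suc p) (F N) x - h *\<^sub>R G (Suc p) x) = \<bar>h\<bar> * norm (nderiv (Suc p) (F N) x - G (Suc p) x)"
            by (simp add: scaleR_diff_right[symmetric])
          also have "\<dots> \<le> \<bar>h\<bar> * r" using elim by (intro mult_left_mono) (auto simp: dist_norm less_imp_le)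
          finally show "norm (h *\<^sub>R nderiv (Suc p) (F N) x - h *\<^sub>R G (Suc p) x) \<le> r * norm h" by (simp add: mult.commute)
        qed
      qed
    qed auto
    then obtain g where g: "\<And>x. (\<lambda>N. nderiv p (F N) x) \<longlonglongrightarrow> g x"
      "\<And>x. (g has_derivative (\<lambda>h. h *\<^sub>R G (Suc p) x)) (at x)" by auto
    have "g x = G p x" for x
      by (rule LIMSEQ_unique[OF g(1) tendsto_uniform_limitI[OF ul]]) simp
    then have "g = G p" by auto
    then show ?thesis using g(2) by (simp add: has_vector_derivative_def)
  qed
  have Gn: "smooth (G 0)" "nderiv p (G 0) = G p" for p
    using smooth_by_derivatives[of G "G 0", OF refl der] by auto
  have tail: "G p x - nderiv p (F N) x = (\<Sum>j. d p (j + N) x)" for p N x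
  proof -
    have "summable (\<lambda>j. d p j x)" using summable_norm_cancel[of "\<lambda>j. d p j x"] ps[of p 0 x] by simp
    from suminf_minus_initial_segment[OF this, of N] show ?thesis by (simp add: G_def tele[of p N])
  qed
  have sL: "summable (\<lambda>j. L1 (d p j))" for p
    by (rule summable_comparison_test'[OF sm[of p], of 0]) (use dL L1_nonneg in auto)
  have t1: "integrable lborel (\<lambda>x. G p x - nderiv p (F N) x)"
    "L1 (\<lambda>x. G p x - nderiv p (F N) x) \<le> (\<Sum>j. L1 (d p (j + N)))" for p N
    unfolding tail using L1_suminf[OF di summable_ignore_initial_segment[OF sL] ps] by auto
  have "integrable lborel (G p)" for p
    using Bochner_Integration.integrable_add[OF t1(1) DL1_integrable[OF F], of p 0 p 0] by simp
  then have GD: "G 0 \<in> DL1" using Gn by (simp add: DL1_def)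
  have "(\<lambda>N. L1 (\<lambda>x. G p x - nderiv p (F N) x)) \<longlonglongrightarrow> 0" for p
  proof (rule tendsto_sandwich[OF _ _ tendsto_const])
    show "(\<lambda>N. \<Sum>j. L1 (d p (j + N))) \<longlonglongrightarrow> 0" by (rule suminf_exist_split2[OF sL])
  qed (use t1(2) L1_nonneg in auto)
  then show thesis using that[of "G 0"] GD ul Gn by simp
qed

primrec iter_conv :: "(nat \<Rightarrow> real \<Rightarrow> complex) \<Rightarrow> nat \<Rightarrow> (real \<Rightarrow> complex) \<Rightarrow> real \<Rightarrow> complex" where
  "iter_conv k 0 \<phi> = \<phi>"
| "iter_conv k (Suc N) \<phi> = conv (k N) (iter_conv k N \<phi>)"

text \<open>Kernels tending to the identity fast enough for the infinite convolution to exist; \<open>\<gamma> j\<close> is the cost of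
  moving one derivative onto the kernel \<open>k j\<close>.\<close>

locale smoothing_kernels =
  fixes k :: "nat \<Rightarrow> real \<Rightarrow> complex" and \<epsilon> \<gamma> :: "nat \<Rightarrow> real"
  assumes k_integrable: "integrable lborel (k j)" and k_L1: "L1 (k j) \<le> 1"
    and \<epsilon>_abs_summable: "summable (\<lambda>j. \<bar>\<epsilon> j\<bar>)"
    and k_approx: "\<phi> \<in> DL1 \<Longrightarrow> L1 (\<lambda>s. conv (k j) \<phi> s - \<phi> s) \<le> \<epsilon> j * L1 (nderiv 1 \<phi>)"
    and \<gamma>_nonneg: "0 \<le> \<gamma> j"
    and k_smoothing: "\<phi> \<in> DL1 \<Longrightarrow> L1 (conv (k j) (nderiv 1 \<phi>)) \<le> \<gamma> j * L1 \<phi>"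
begin

lemma iter_DL1: "\<phi> \<in> DL1 \<Longrightarrow> iter_conv k N \<phi> \<in> DL1"
  by (induction N) (auto intro: conv_DL1(1)[OF k_integrable])

lemma nderiv_iter: "\<phi> \<in> DL1 \<Longrightarrow> nderiv p (iter_conv k N \<phi>) = iter_conv k N (nderiv p \<phi>)"
  by (induction N) (auto simp: conv_smooth(2)[OF k_integrable iter_DL1])

lemma L1_conv_k: "\<phi> \<in> DL1 \<Longrightarrow> L1 (conv (k j) \<phi>) \<le> L1 \<phi>"
  using conv_integrable_L1(2)[OF k_integrable DL1_integrable0, of \<phi> j]
    mult_right_mono[OF k_L1[of j] L1_nonneg[of \<phi>]] by simp

lemma L1_iter_antimono:
  assumes "\<phi> \<in> DL1" "N \<le> N'"
  shows "L1 (iter_conv k N' \<phi>) \<le> L1 (iter_conv k N \<phi>)"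
  using assms(2)
proof (induction rule: dec_induct)
  case (step n)
  then show ?case using L1_conv_k[OF iter_DL1[OF assms(1)], of n n] by simp
qed simp

lemma L1_iter_nderiv_le: "\<phi> \<in> DL1 \<Longrightarrow> L1 (iter_conv k p (nderiv p \<phi>)) \<le> (\<Prod>j<p. \<gamma> j) * L1 \<phi>"
proof (induction p)
  case (Suc p)
  have d: "iter_conv k p (nderiv p \<phi>) \<in> DL1" by (rule iter_DL1[OF DL1_nderiv[OF Suc.prems]])
  have "iter_conv k (Suc p) (nderiv (Suc p) \<phi>) = conv (k p) (nderiv 1 (iter_conv k p (nderiv p \<phi>)))"
    by (simp add: nderiv_iter[OF DL1_nderiv[OF Suc.prems]] nderiv_nderiv)
  then have "L1 (iter_conv k (Suc p) (nderiv (Suc p) \<phi>)) \<le> \<gamma> p * L1 (iter_conv k p (nderiv p \<phi>))"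
    using k_smoothing[OF d, of p] by simp
  also have "\<dots> \<le> \<gamma> p * ((\<Prod>j<p. \<gamma> j) * L1 \<phi>)"
    by (rule mult_left_mono[OF Suc.IH[OF Suc.prems] \<gamma>_nonneg])
  finally show ?case by (simp add: mult_ac)
qed simp

text \<open>The first bound on the derivatives spends one derivative on each of the first \<open>p\<close> kernels; the second
  one leaves all derivatives on \<open>\<phi>\<close>.\<close>

lemma infinite_convolution:
  assumes \<phi>: "\<phi> \<in> DL1"
  obtains \<Phi> where "\<Phi> \<in> DL1"
    "\<And>p x. (\<lambda>N. nderiv p (iter_conv k N \<phi>) x) \<longlonglongrightarrow> nderiv p \<Phi> x"
    "(\<lambda>N. L1 (\<lambda>x. \<Phi> x - iter_conv k N \<phi> x)) \<longlonglongrightarrow> 0"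
    "\<And>p. L1 (nderiv p \<Phi>) \<le> (\<Prod>j<p. \<gamma> j) * L1 \<phi>"
    "\<And>p. L1 (nderiv p \<Phi>) \<le> L1 (nderiv p \<phi>)"
proof -
  note W = iter_DL1[OF \<phi>]
  have inc: "L1 (\<lambda>x. nderiv p (iter_conv k (Suc N) \<phi>) x - nderiv p (iter_conv k N \<phi>) x) \<le> \<bar>\<epsilon> N\<bar> * L1 (nderiv (Suc p) \<phi>)" for N p
  proof -
    have d: "iter_conv k N (nderiv p \<phi>) \<in> DL1" by (rule iter_DL1[OF DL1_nderiv[OF \<phi>]])
    have "L1 (\<lambda>x. nderiv p (iter_conv k (Suc N) \<phi>) x - nderiv p (iter_conv k N \<phi>) x) \<le> \<epsilon> N * L1 (nderiv 1 (iter_conv k N (nderiv p \<phi>)))"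
      unfolding nderiv_iter[OF \<phi>] unfolding iter_conv.simps by (rule k_approx[OF d])
    also have "\<dots> \<le> \<bar>\<epsilon> N\<bar> * L1 (nderiv 1 (iter_conv k N (nderiv p \<phi>)))"
      by (rule mult_right_mono) (auto simp: L1_nonneg)
    also have "nderiv 1 (iter_conv k N (nderiv p \<phi>)) = iter_conv k N (nderiv (Suc p) \<phi>)"
      using nderiv_iter[OF DL1_nderiv[OF \<phi>], of 1 N p] by (simp add: nderiv_nderiv)
    also have "\<bar>\<epsilon> N\<bar> * L1 \<dots> \<le> \<bar>\<epsilon> N\<bar> * L1 (nderiv (Suc p) \<phi>)"
      using L1_iter_antimono[OF DL1_nderiv[OF \<phi>], of 0 N "Suc p"] by (intro mult_left_mono) auto
    finally show ?thesis .
  qed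
  obtain \<Phi> where \<Phi>: "\<Phi> \<in> DL1" "\<And>p. uniform_limit UNIV (\<lambda>N. nderiv p (iter_conv k N \<phi>)) (nderiv p \<Phi>) sequentially"
    "\<And>p. (\<lambda>N. L1 (\<lambda>x. nderiv p \<Phi> x - nderiv p (iter_conv k N \<phi>) x)) \<longlonglongrightarrow> 0"
    by (rule DL1_summable_increments[of "\<lambda>N. iter_conv k N \<phi>" "\<lambda>N. \<bar>\<epsilon> N\<bar>" "\<lambda>p. L1 (nderiv (Suc p) \<phi>)", OF W _ inc])
      (use \<epsilon>_abs_summable in blast)+
  have le: "L1 (nderiv p \<Phi>) \<le> B" if B: "\<forall>\<^sub>F N in sequentially. L1 (nderiv p (iter_conv k N \<phi>)) \<le> B" for p B
  proof (rule tendsto_le[OF _ _ tendsto_const])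
    show "(\<lambda>N. L1 (\<lambda>x. nderiv p \<Phi> x - nderiv p (iter_conv k N \<phi>) x) + B) \<longlonglongrightarrow> B"
      using tendsto_add[OF \<Phi>(3)[of p] tendsto_const[of B]] by simp
    show "\<forall>\<^sub>F N in sequentially. L1 (nderiv p \<Phi>) \<le> L1 (\<lambda>x. nderiv p \<Phi> x - nderiv p (iter_conv k N \<phi>) x) + B"
      using B
    proof eventually_elim
      case (elim N)
      have "L1 (nderiv p \<Phi>) = L1 (\<lambda>x. (nderiv p \<Phi> x - nderiv p (iter_conv k N \<phi>) x) + nderiv p (iter_conv k N \<phi>) x)" by simp
      also have "\<dots> \<le> L1 (\<lambda>x. nderiv p \<Phi> x - nderiv p (iter_conv k N \<phi>) x) + L1 (nderiv p (iter_conv k N \<phi>))"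
        by (intro L1_triangle Bochner_Integration.integrable_diff DL1_integrable \<Phi>(1) W)
      finally show ?case using elim by linarith
    qed
  qed auto
  have "L1 (nderiv p \<Phi>) \<le> (\<Prod>j<p. \<gamma> j) * L1 \<phi>" for p
  proof (rule le, rule eventually_sequentiallyI[of p])
    fix N assume "p \<le> N"
    then show "L1 (nderiv p (iter_conv k N \<phi>)) \<le> (\<Prod>j<p. \<gamma> j) * L1 \<phi>"
      unfolding nderiv_iter[OF \<phi>]
      using L1_iter_antimono[OF DL1_nderiv[OF \<phi>]] L1_iter_nderiv_le[OF \<phi>] order_trans by blast
  qed
  moreover have "L1 (nderiv p \<Phi>) \<le> L1 (nderiv p \<phi>)" for p
    by (rule le) (use L1_iter_antimono[OF DL1_nderiv[OF \<phi>], of 0] in \<open>auto simp: nderiv_iter[OF \<phi>]\<close>)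
  moreover have "(\<lambda>N. nderiv p (iter_conv k N \<phi>) x) \<longlonglongrightarrow> nderiv p \<Phi> x" for p x
    by (rule tendsto_uniform_limitI[OF \<Phi>(2)]) simp
  ultimately show thesis using that[OF \<Phi>(1)] \<Phi>(3)[of 0] by simp
qed

end

section \<open>Non-quasianalyticity: bump functions and mollifiers\<close>

primrec flat_poly :: "nat \<Rightarrow> real poly" where
  "flat_poly 0 = 1"
| "flat_poly (Suc n) = [:0, 0, 1:] * (flat_poly n - pderiv (flat_poly n))"

text \<open>The derivatives of \<open>exp (- 1 / t)\<close>, continued by zero to the negative axis.\<close>

definition flat :: "nat \<Rightarrow> real \<Rightarrow> complex" where
  "flat n t = (if t > 0 then complex_of_real (poly (flat_poly n) (inverse t) * exp (- inverse t)) else 0)"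

lemma power_le_fact_exp:
  fixes x :: real
  assumes "x \<ge> 0"
  shows "x ^ i \<le> fact i * exp x"
proof -
  have s: "(\<lambda>n. x ^ n /\<^sub>R fact n) sums exp x" by (rule exp_converges)
  have "x ^ i /\<^sub>R fact i = (\<Sum>n\<in>{i}. x ^ n /\<^sub>R fact n)" by simp
  also have "\<dots> \<le> (\<Sum>n. x ^ n /\<^sub>R fact n)"
    by (rule sum_le_suminf) (use s assms in \<open>auto simp: sums_iff\<close>)
  also have "\<dots> = exp x" using s by (simp add: sums_iff)
  finally show ?thesis by (simp add: field_simps)
qed

lemma poly_exp_bounded:
  fixes p :: "real poly"
  obtains C where "\<And>x. x \<ge> 0 \<Longrightarrow> \<bar>poly p x * exp (- x)\<bar> \<le> C"
proof
  fix x :: real assume x: "x \<ge> 0"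
  have "\<bar>poly p x * exp (- x)\<bar> = \<bar>\<Sum>i\<le>degree p. coeff p i * x ^ i\<bar> * exp (- x)"
    by (simp add: poly_altdef abs_mult)
  also have "\<dots> \<le> (\<Sum>i\<le>degree p. \<bar>coeff p i\<bar> * (fact i * exp x)) * exp (- x)"
  proof (rule mult_right_mono)
    have "\<bar>\<Sum>i\<le>degree p. coeff p i * x ^ i\<bar> \<le> (\<Sum>i\<le>degree p. \<bar>coeff p i * x ^ i\<bar>)" by (rule sum_abs)
    also have "\<dots> \<le> (\<Sum>i\<le>degree p. \<bar>coeff p i\<bar> * (fact i * exp x))"
      using x by (intro sum_mono) (auto simp: abs_mult intro!: mult_left_mono power_le_fact_exp)
    finally show "\<bar>\<Sum>i\<le>degree p. coeff p i * x ^ i\<bar> \<le> (\<Sum>i\<le>degree p. \<bar>coeff p i\<bar> * (fact i * exp x))" .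
  qed simp
  also have "\<dots> = (\<Sum>i\<le>degree p. \<bar>coeff p i\<bar> * fact i)"
    by (simp add: sum_distrib_right mult.assoc exp_minus_inverse)
  finally show "\<bar>poly p x * exp (- x)\<bar> \<le> (\<Sum>i\<le>degree p. \<bar>coeff p i\<bar> * fact i)" .
qed

lemma flat_has_vector_derivative: "(flat n has_vector_derivative flat (Suc n) t) (at t)"
proof -
  consider "t > 0" | "t < 0" | "t = 0" by linarith
  then show ?thesis
  proof cases
    case 1
    let ?q = "\<lambda>t. poly (flat_poly n) (inverse t) * exp (- inverse t)"
    have "(?q has_real_derivative
        (poly (pderiv (flat_poly n)) (inverse t) * (- (inverse t * inverse t))) * exp (- inverse t)
        + exp (- inverse t) * (inverse t * inverse t) * poly (flat_poly n) (inverse t)) (at t)"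
      using 1 by (auto intro!: derivative_eq_intros simp: power2_eq_square)
    also have "(poly (pderiv (flat_poly n)) (inverse t) * (- (inverse t * inverse t))) * exp (- inverse t)
        + exp (- inverse t) * (inverse t * inverse t) * poly (flat_poly n) (inverse t)
        = poly (flat_poly (Suc n)) (inverse t) * exp (- inverse t)"
      by (simp add: algebra_simps)
    finally have "(?q has_vector_derivative poly (flat_poly (Suc n)) (inverse t) * exp (- inverse t)) (at t)"
      by (simp add: has_real_derivative_iff_has_vector_derivative)
    then have "((\<lambda>t. complex_of_real (?q t)) has_vector_derivative flat (Suc n) t) (at t)"
      using 1 unfolding flat_def if_P[OF 1]
      by (simp only: has_vector_derivative_of_real has_real_derivative_iff_has_vector_derivative)
    then show ?thesis
      by (rule has_vector_derivative_transform_within_open[of _ _ _ "{0<..}"]) (use 1 in \<open>auto simp: flat_def\<close>)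
  next
    case 2
    have "((\<lambda>_. 0) has_vector_derivative flat (Suc n) t) (at t)" using 2 by (simp add: flat_def)
    then show ?thesis
      by (rule has_vector_derivative_transform_within_open[of _ _ _ "{..<0}"]) (use 2 in \<open>auto simp: flat_def\<close>)
  next
    case 3
    obtain C where C: "\<And>x. x \<ge> 0 \<Longrightarrow> \<bar>poly ([:0, 0, 1:] * flat_poly n) x * exp (- x)\<bar> \<le> C"
      by (rule poly_exp_bounded[of "[:0, 0, 1:] * flat_poly n"]) blast
    have "(flat n has_vector_derivative 0) (at 0)"
    proof (rule quadratic_remainder_has_vector_derivative[where C = C])
      fix \<delta> :: real
      show "norm (flat n (0 + \<delta>) - flat n 0 - \<delta> *\<^sub>R 0) \<le> C * \<delta>\<^sup>2"
      proof (cases "\<delta> > 0")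
        case True
        then have "\<bar>inverse \<delta> * inverse \<delta> * (poly (flat_poly n) (inverse \<delta>) * exp (- inverse \<delta>))\<bar> \<le> C"
          using C[of "inverse \<delta>"] by (simp add: mult.assoc)
        then have "\<bar>poly (flat_poly n) (inverse \<delta>) * exp (- inverse \<delta>)\<bar> \<le> C * \<delta>\<^sup>2"
          using True by (simp add: abs_mult field_simps power2_eq_square)
        then show ?thesis using True by (simp only: flat_def if_True add_0 less_irrefl if_False diff_0_right scaleR_zero_right norm_of_real)
      next
        case False
        have "0 \<le> C" using C[of 0] by simp
        then show ?thesis using False by (simp add: flat_def)
      qed
    qed
    then show ?thesis using 3 by (simp add: flat_def)
  qed
qed

lemma smooth_bump:
  obtains \<phi> where "\<phi> \<in> DL1" "\<And>t. t \<notin> {0..1} \<Longrightarrow> \<phi> t = 0" "(LINT t|lborel. \<phi> t) \<noteq> 0"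
proof
  define \<phi> where "\<phi> t = flat 0 t * flat 0 (- 1 * t + 1)" for t
  have s: "smooth (flat 0)" by (rule smooth_by_derivatives[of flat, OF refl flat_has_vector_derivative])
  have sm: "smooth \<phi>" unfolding \<phi>_def by (intro nderiv_mult nderiv_affine s)
  show z: "\<phi> t = 0" if "t \<notin> {0..1}" for t using that by (auto simp: \<phi>_def flat_def)
  show D: "\<phi> \<in> DL1" by (rule compact_smooth_DL1[OF sm z])
  define r where "r t = (if 0 < t \<and> t < 1 then exp (- inverse t) * exp (- inverse (1 - t)) else 0 :: real)" for t
  have \<phi>r: "\<phi> t = complex_of_real (r t)" for t by (auto simp: \<phi>_def flat_def r_def)
  have ri: "integrable lborel r"
    using integrable_Re[OF DL1_integrable0[OF D]] by (simp add: \<phi>r)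
  have "exp (- 8) / 2 = (LINT t|lborel. indicator {1/4..3/4::real} t * exp (- 8 :: real))" by simp
  also have "\<dots> \<le> (LINT t|lborel. r t)"
  proof (rule integral_mono[OF _ ri])
    show "integrable lborel (\<lambda>t. indicator {1/4..3/4::real} t * exp (- 8 :: real))"
      by (intro integrable_mult_left integrable_real_indicator) (auto simp: less_top[symmetric])
    fix t :: real
    show "indicator {1/4..3/4} t * exp (- 8) \<le> r t"
    proof (cases "t \<in> {1/4..3/4}")
      case True
      then have "inverse t \<le> 4" "inverse (1 - t) \<le> 4"
        using le_imp_inverse_le[of "1/4" t] le_imp_inverse_le[of "1/4" "1 - t"] by auto
      then have "exp (- 8) \<le> exp (- inverse t + - inverse (1 - t))" by simp
      then have "exp (- 8) \<le> exp (- inverse t) * exp (- inverse (1 - t))" by (simp only: exp_add)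
      then show ?thesis using True by (simp add: r_def)
    qed (simp add: r_def)
  qed
  finally have "(LINT t|lborel. r t) \<noteq> 0" using exp_gt_zero[of "- 8 :: real"] by linarith
  then show "(LINT t|lborel. \<phi> t) \<noteq> 0" by (simp add: \<phi>r)
qed

text \<open>With the remainders \<open>r j\<close> of the series, \<open>c j = 1 / sqrt (r j)\<close> works: \<open>(r j - r (j + 1)) / sqrt (r j)\<close> is at
  most twice the telescoping difference of square roots.\<close>

lemma summable_boost:
  fixes x :: "nat \<Rightarrow> real"
  assumes x: "\<And>j. x j > 0" and s: "summable x"
  obtains c where "\<And>j. c j > 0" "filterlim c at_top sequentially" "summable (\<lambda>j. c j * x j)"
proof
  define r where "r j = (\<Sum>i. x (i + j))" for j
  have sj: "summable (\<lambda>i. x (i + j))" for j by (rule summable_ignore_initial_segment[OF s])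
  have rpos: "r j > 0" for j unfolding r_def by (rule suminf_pos[OF sj x])
  have rx: "x j = r j - r (Suc j)" for j
    using suminf_split_head[OF sj[of j]] by (simp add: r_def)
  have r0: "r \<longlonglongrightarrow> 0" unfolding r_def by (rule suminf_exist_split2[OF s])
  show "1 / sqrt (r j) > 0" for j using rpos by simp
  show "filterlim (\<lambda>j. 1 / sqrt (r j)) at_top sequentially"
  proof -
    have "(\<lambda>j. sqrt (r j)) \<longlonglongrightarrow> 0" using tendsto_real_sqrt[OF r0] by simp
    then have "filterlim (\<lambda>j. inverse (sqrt (r j))) at_top sequentially"
      by (rule filterlim_inverse_at_top) (simp add: rpos)
    then show ?thesis by (simp add: inverse_eq_divide)
  qed
  show "summable (\<lambda>j. 1 / sqrt (r j) * x j)"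
  proof (rule summable_comparison_test')
    have "(\<lambda>j. sqrt (r j)) \<longlonglongrightarrow> sqrt 0" by (rule tendsto_real_sqrt[OF r0])
    then have "summable (\<lambda>j. sqrt (r j) - sqrt (r (Suc j)))" by (rule telescope_summable')
    then show "summable (\<lambda>j. 2 * (sqrt (r j) - sqrt (r (Suc j))))" by (rule summable_mult)
    fix j :: nat
    have p: "sqrt (r j) > 0" "sqrt (r (Suc j)) > 0" using rpos by simp_all
    have le: "sqrt (r (Suc j)) \<le> sqrt (r j)" using rx[of j] x[of j] by simp
    have "x j = (sqrt (r j) - sqrt (r (Suc j))) * (sqrt (r j) + sqrt (r (Suc j)))"
      using rpos[of j] rpos[of "Suc j"] by (simp add: rx algebra_simps less_imp_le)
    also have "\<dots> \<le> (sqrt (r j) - sqrt (r (Suc j))) * (2 * sqrt (r j))"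
      using le by (intro mult_left_mono) auto
    finally have "1 / sqrt (r j) * x j \<le> 1 / sqrt (r j) * ((sqrt (r j) - sqrt (r (Suc j))) * (2 * sqrt (r j)))"
      using p by (intro mult_left_mono) auto
    then show "norm (1 / sqrt (r j) * x j) \<le> 2 * (sqrt (r j) - sqrt (r (Suc j)))"
      using p x[of j] by (simp add: abs_mult)
  qed
qed

definition box_density :: "real \<Rightarrow> real \<Rightarrow> complex" where
  "box_density a t = complex_of_real (1 / a) * indicator {0..a} t"

lemma box_density_kernel:
  assumes "a > 0"
  shows "integrable lborel (box_density a)" "L1 (box_density a) = 1" "(LINT t|lborel. box_density a t) = 1"
proof -
  show "integrable lborel (box_density a)"
    unfolding box_density_def[abs_def] using assms by (intro integrable_mult_right indicator_kernel(1)) simp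
  show "L1 (box_density a) = 1"
    unfolding box_density_def[abs_def] L1_cmult using indicator_kernel(2)[of 0 a] assms by (simp add: norm_divide)
  show "(LINT t|lborel. box_density a t) = 1"
    unfolding box_density_def[abs_def] using indicator_kernel(3)[of 0 a] assms by simp
qed

lemma conv_box_density_nderiv:
  assumes "a > 0" "\<phi> \<in> DL1"
  shows "conv (box_density a) (nderiv 1 \<phi>) s = complex_of_real (1 / a) * (\<phi> s - \<phi> (s - a))"
proof -
  have d: "((\<lambda>t. - \<phi> (s - t)) has_vector_derivative nderiv 1 \<phi> (s - t)) (at t within {0..a})" for t
  proof -
    have "((\<lambda>t. s - t) has_vector_derivative - 1) (at t)" by (auto intro!: derivative_eq_intros)
    from vector_diff_chain_at[OF this, of \<phi>] smooth_has_vector_derivative[OF DL1_smooth[OF assms(2)], of 0]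
    have "((\<lambda>t. \<phi> (s - t)) has_vector_derivative - nderiv 1 \<phi> (s - t)) (at t)" by (simp add: o_def)
    from has_vector_derivative_minus[OF this] show ?thesis by (auto intro: has_vector_derivative_at_within)
  qed
  have "(LINT t|lborel. indicator {0..a} t *\<^sub>R nderiv 1 \<phi> (s - t)) = - \<phi> (s - a) - - \<phi> (s - 0)"
    using assms(1)
    by (intro integral_FTC_Icc[OF _ d])
      (auto intro!: continuous_intros continuous_on_compose2[OF smooth_continuous_on[OF DL1_smooth[OF assms(2)], of UNIV]])
  moreover have "conv (box_density a) (nderiv 1 \<phi>) s = complex_of_real (1 / a) * (LINT t|lborel. indicator {0..a} t *\<^sub>R nderiv 1 \<phi> (s - t))"
    unfolding conv_def box_density_def integral_mult_right_zero[symmetric]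
    by (rule Bochner_Integration.integral_cong) (auto simp: indicator_def)
  ultimately show ?thesis by simp
qed

lemma prod_eventually_le_1_bounded:
  fixes u :: "nat \<Rightarrow> real"
  assumes "\<And>j. 0 \<le> u j" "\<forall>\<^sub>F j in sequentially. u j \<le> 1"
  obtains B where "\<And>p. (\<Prod>j<p. u j) \<le> B"
proof -
  obtain J where J: "\<And>j. j \<ge> J \<Longrightarrow> u j \<le> 1" using assms(2) by (auto simp: eventually_sequentially)
  let ?v = "\<lambda>j. max 1 (u j)"
  have "(\<Prod>j<p. u j) \<le> (\<Prod>j<J. ?v j)" for p
  proof -
    have "(\<Prod>j<p. u j) \<le> (\<Prod>j<p. ?v j)" by (rule prod_mono) (auto simp: assms(1))
    also have "\<dots> \<le> (\<Prod>j<max p J. ?v j)" by (rule prod_mono2) auto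
    also have "\<dots> = (\<Prod>j<J. ?v j)"
      by (rule prod.mono_neutral_right) (auto simp: J max.absorb1)
    finally show ?thesis .
  qed
  then show thesis using that by blast
qed

locale nonquasianalytic = weight_sequence +
  assumes M3': "cond_M3' M"
begin

text \<open>The infinite convolution of boxes whose widths \<open>a j\<close> are summable although the quotients
  \<open>a j / (M j / M (j + 1))\<close> tend to infinity: the former makes the support compact, the latter
  gives derivative bounds at every scale.\<close>

lemma Beurling_bump:
  obtains \<rho> R where "\<rho> \<in> DL1_space Beurling M" "R > 0" "\<And>t. t \<notin> {0..R} \<Longrightarrow> \<rho> t = 0" "(LINT t|lborel. \<rho> t) = 1"
proof -
  obtain c where c: "\<And>j. c j > 0" "filterlim c at_top sequentially" "summable (\<lambda>j. c j * (M j / M (Suc j)))"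
    by (rule summable_boost[of "\<lambda>j. M j / M (Suc j)"]) (use M3' M_pos in \<open>auto simp: cond_M3'_def\<close>)
  define a where "a j = c j * (M j / M (Suc j))" for j
  have a: "a j > 0" for j using c(1) M_pos by (simp add: a_def)
  have sa: "summable a" using c(3) by (simp add: a_def[abs_def])
  interpret smoothing_kernels "\<lambda>j. box_density (a j)" a "\<lambda>j. 2 / a j"
  proof
    show "integrable lborel (box_density (a j))" "L1 (box_density (a j)) \<le> 1" for j using box_density_kernel[OF a] by auto
    show "summable (\<lambda>j. \<bar>a j\<bar>)" using sa a by (simp add: less_imp_le)
    show "0 \<le> 2 / a j" for j using a[of j] by simp
    fix \<phi> j assume \<phi>: "\<phi> \<in> DL1"
    show "L1 (\<lambda>s. conv (box_density (a j)) \<phi> s - \<phi> s) \<le> a j * L1 (nderiv 1 \<phi>)"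
      using conv_concentrated_bound[OF box_density_kernel(1)[OF a] _ \<phi>, of j "a j"] box_density_kernel(2,3)[OF a, of j]
      by (auto simp: box_density_def indicator_def split: if_splits)
    have "L1 (conv (box_density (a j)) (nderiv 1 \<phi>)) = 1 / a j * L1 (\<lambda>s. \<phi> s - \<phi> (s - a j))"
      unfolding conv_box_density_nderiv[OF a \<phi>] L1_cmult using a[of j] by (simp add: norm_divide)
    also have "\<dots> \<le> 1 / a j * (L1 \<phi> + L1 \<phi>)"
      using L1_triangle_diff[OF DL1_integrable0[OF \<phi>] integrable_shift[OF DL1_integrable0[OF \<phi>], of "a j"]] a[of j]
      by (intro mult_left_mono) (auto simp: L1_shift)
    finally show "L1 (conv (box_density (a j)) (nderiv 1 \<phi>)) \<le> 2 / a j * L1 \<phi>" by simp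
  qed
  obtain \<phi> where \<phi>: "\<phi> \<in> DL1" "\<And>t. t \<notin> {0..1} \<Longrightarrow> \<phi> t = 0" "(LINT t|lborel. \<phi> t) \<noteq> 0"
    by (rule smooth_bump) blast
  obtain \<Phi> where \<Phi>: "\<Phi> \<in> DL1"
    "\<And>p x. (\<lambda>N. nderiv p (iter_conv (\<lambda>j. box_density (a j)) N \<phi>) x) \<longlonglongrightarrow> nderiv p \<Phi> x"
    "(\<lambda>N. L1 (\<lambda>x. \<Phi> x - iter_conv (\<lambda>j. box_density (a j)) N \<phi> x)) \<longlonglongrightarrow> 0"
    "\<And>p. L1 (nderiv p \<Phi>) \<le> (\<Prod>j<p. 2 / a j) * L1 \<phi>"
    by (rule infinite_convolution[OF \<phi>(1)]) blast
  let ?W = "\<lambda>N. iter_conv (\<lambda>j. box_density (a j)) N \<phi>"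
  \<comment> \<open>The support grows by \<open>a j\<close> in step \<open>j\<close>.\<close>
  define R where "R = 1 + suminf a"
  have R: "R > 0" using suminf_pos[OF sa a] by (simp add: R_def)
  have "?W N t = 0" if "t \<notin> {0..1 + (\<Sum>j<N. a j)}" for N t
    using that
  proof (induction N arbitrary: t)
    case 0
    then show ?case using \<phi>(2) by simp
  next
    case (Suc N)
    have "box_density (a N) u * ?W N (t - u) = 0" for u
    proof (cases "u \<in> {0..a N}")
      case True
      then have "t - u \<notin> {0..1 + (\<Sum>j<N. a j)}" using Suc.prems by auto
      then show ?thesis using Suc.IH by simp
    qed (simp add: box_density_def)
    then show ?case by (simp only: iter_conv.simps conv_def) simp
  qed
  then have WR: "?W N t = 0" if "t \<notin> {0..R}" for N t
    using that sum_le_suminf[OF sa, of "{..<N}"] a by (fastforce simp: R_def less_imp_le)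
  have z: "\<Phi> t = 0" if "t \<notin> {0..R}" for t
    using \<Phi>(2)[of 0 t] WR[OF that] by (simp add: LIMSEQ_const_iff)
  have iW: "(LINT t|lborel. ?W N t) = (LINT t|lborel. \<phi> t)" for N
    by (induction N) (use conv_integrable_L1(3)[OF k_integrable DL1_integrable0[OF iter_DL1[OF \<phi>(1)]]] box_density_kernel(3)[OF a] in auto)
  have "cmod ((LINT t|lborel. \<Phi> t) - (LINT t|lborel. \<phi> t)) \<le> 0"
  proof (rule LIMSEQ_le_const[OF \<Phi>(3)], intro exI allI impI)
    fix N :: nat
    have "(LINT t|lborel. \<Phi> t) - (LINT t|lborel. \<phi> t) = (LINT t|lborel. \<Phi> t - ?W N t)"
      using iW[of N] Bochner_Integration.integral_diff[OF DL1_integrable0[OF \<Phi>(1)] DL1_integrable0[OF iter_DL1[OF \<phi>(1)]], of N] by simp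
    then show "cmod ((LINT t|lborel. \<Phi> t) - (LINT t|lborel. \<phi> t)) \<le> L1 (\<lambda>x. \<Phi> x - ?W N x)"
      unfolding L1_def using integral_norm_bound[of lborel "\<lambda>t. \<Phi> t - ?W N t"] by simp
  qed
  then have I: "(LINT t|lborel. \<Phi> t) = (LINT t|lborel. \<phi> t)" by simp
  have pa: "(\<Prod>j<p. 2 / a j) = M p * (\<Prod>j<p. 2 / c j)" for p
  proof (induction p)
    case (Suc p)
    then show ?case using M_pos[of p] M_pos[of "Suc p"] c(1)[of p] by (simp add: a_def field_simps)
  qed (simp add: M_0)
  have "\<Phi> \<in> DL1_step M h" if h: "h > 0" for h
  proof -
    have "\<forall>\<^sub>F j in sequentially. 2 * h / c j \<le> 1"
      using filterlim_at_top[THEN iffD1, OF c(2), rule_format, of "2 * h"]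
      by eventually_elim (use c(1) in \<open>simp add: divide_le_eq_1\<close>)
    then obtain B where B: "\<And>p. (\<Prod>j<p. 2 * h / c j) \<le> B"
      by (rule prod_eventually_le_1_bounded[rotated]) (use c(1) h in \<open>auto simp: less_imp_le\<close>)
    show ?thesis
    proof (rule DL1_stepI(1)[OF \<Phi>(1)])
      fix p
      have "h ^ p * L1 (nderiv p \<Phi>) / M p \<le> h ^ p * ((\<Prod>j<p. 2 / a j) * L1 \<phi>) / M p"
        using \<Phi>(4)[of p] h M_nonneg[of p] by (intro divide_right_mono mult_left_mono) auto
      also have "\<dots> = (h ^ p * (\<Prod>j<p. 2 / c j)) * L1 \<phi>" using M_pos[of p] by (simp add: pa)
      also have "h ^ p * (\<Prod>j<p. 2 / c j) = (\<Prod>j<p. 2 * h / c j)"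
        by (induction p) auto
      also have "(\<Prod>j<p. 2 * h / c j) * L1 \<phi> \<le> B * L1 \<phi>" by (rule mult_right_mono[OF B L1_nonneg])
      finally show "h ^ p * L1 (nderiv p \<Phi>) / M p \<le> B * L1 \<phi>" .
    qed
  qed
  then have "\<Phi> \<in> DL1_space Beurling M" by (simp add: DL1_space_def)
  from DL1_space_cmult[OF this, of "1 / (LINT t|lborel. \<phi> t)"]
  show thesis
    by (rule that[OF _ R]) (use z I \<phi>(3) in auto)
qed

text \<open>Rescaled copies of one bump: a dilation does not leave the space, because all scales are admitted.\<close>

lemma mollifier:
  obtains \<rho> :: "nat \<Rightarrow> real \<Rightarrow> complex" and B where "\<And>n. \<rho> n \<in> DL1_space Beurling M"
    "\<And>n t. t \<notin> {0..1 / real (Suc n)} \<Longrightarrow> \<rho> n t = 0" "\<And>n. (LINT t|lborel. \<rho> n t) = 1" "\<And>n. L1 (\<rho> n) \<le> B"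
proof -
  obtain \<rho> R where \<rho>: "\<rho> \<in> DL1_space Beurling M" "R > 0" "\<And>t. t \<notin> {0..R} \<Longrightarrow> \<rho> t = 0" "(LINT t|lborel. \<rho> t) = 1"
    by (rule Beurling_bump) blast
  define \<alpha> where "\<alpha> n = R * real (Suc n)" for n
  have \<alpha>: "\<alpha> n > 0" for n using \<rho>(2) by (simp add: \<alpha>_def)
  let ?\<rho> = "\<lambda>n t. complex_of_real (\<alpha> n) * \<rho> (\<alpha> n * t + 0)"
  show thesis
  proof (rule that[of ?\<rho> "L1 \<rho>"])
    show "?\<rho> n \<in> DL1_space Beurling M" for n
      using \<alpha>[of n] by (intro DL1_space_cmult DL1_space_affine \<rho>(1)) auto
    show "?\<rho> n t = 0" if "t \<notin> {0..1 / real (Suc n)}" for n t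
    proof -
      have "\<alpha> n * t \<notin> {0..R}"
      proof
        assume *: "\<alpha> n * t \<in> {0..R}"
        then have "0 \<le> t" using \<alpha>[of n] by (simp add: zero_le_mult_iff)
        moreover have "R * (real (Suc n) * t) \<le> R * 1" using * by (simp add: \<alpha>_def mult.assoc)
        then have "real (Suc n) * t \<le> 1" using \<rho>(2) by (simp only: mult_le_cancel_left_pos)
        then have "t \<le> 1 / real (Suc n)" by (simp add: field_simps)
        ultimately show False using that by simp
      qed
      then show ?thesis using \<rho>(3) by simp
    qed
    show "(LINT t|lborel. ?\<rho> n t) = 1" for n
      using lborel_integral_real_affine[of "\<alpha> n" \<rho> 0] \<alpha>[of n] \<rho>(4) by (simp add: scaleR_conv_of_real)
    show "L1 (?\<rho> n) \<le> L1 \<rho>" for n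
      unfolding L1_cmult using L1_affine[of "\<alpha> n" \<rho> 0] \<alpha>[of n] by simp
  qed
qed

end

section \<open>Density of the compactly supported test functions\<close>

context weight_sequence
begin

text \<open>The Leibniz rule, with \<open>M j * M q \<le> M (j + q)\<close> distributing the weights over the two factors. The
  binomial coefficients cost a factor \<open>2\<close> in the scale, and another \<open>2\<close> makes \<open>\<sigma>\<close> summable uniformly in \<open>S\<close>,
  as needed for dominated convergence when \<open>S\<close> shrinks.\<close>

lemma multiplier_step:
  assumes \<phi>: "\<phi> \<in> DL1_step M (4 * h)" "h > 0"
    and \<theta>: "smooth \<theta>" "\<And>q t. cmod (nderiv q \<theta> t) \<le> b q" "\<And>q t. t \<notin> S \<Longrightarrow> nderiv q \<theta> t = 0" "S \<in> sets borel"
    and K: "\<And>q. (2 * h) ^ q * b q / M q \<le> K"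
  defines "\<sigma> \<equiv> \<lambda>j. (2 * h) ^ j * L1 (\<lambda>t. indicator S t * nderiv j \<phi> t) / M j"
  shows "\<sigma> j \<le> DL1_norm M (4 * h) \<phi> * (1 / 2) ^ j" and "0 \<le> \<sigma> j"
    and "(\<lambda>t. \<phi> t * \<theta> t) \<in> DL1_step M h" and "DL1_norm M h (\<lambda>t. \<phi> t * \<theta> t) \<le> K * suminf \<sigma>"
proof -
  note \<phi>D = DL1_step_DL1[OF \<phi>(1)]
  let ?N = "DL1_norm M (4 * h) \<phi>"
  define \<tau> where "\<tau> j = L1 (\<lambda>t. indicator S t * nderiv j \<phi> t)" for j
  have \<tau>0: "0 \<le> \<tau> j" for j by (simp add: \<tau>_def L1_nonneg)
  have ii: "integrable lborel (\<lambda>t. indicator S t * nderiv j \<phi> t)" for j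
    by (rule integrable_indicator_mult[OF DL1_integrable[OF \<phi>D] \<theta>(4)])
  have \<tau>L: "\<tau> j \<le> L1 (nderiv j \<phi>)" for j
    unfolding \<tau>_def L1_def
    by (rule integral_mono[OF integrable_norm[OF ii] integrable_norm[OF DL1_integrable[OF \<phi>D]]]) (auto simp: indicator_def)
  show \<sigma>0: "0 \<le> \<sigma> j" for j
    using \<phi>(2) M_nonneg[of j] by (simp add: \<sigma>_def L1_nonneg)
  show \<sigma>: "\<sigma> j \<le> ?N * (1 / 2) ^ j" for j
  proof -
    have "\<sigma> j \<le> (2 * h) ^ j * (?N * M j / (4 * h) ^ j) / M j"
      unfolding \<sigma>_def \<tau>_def[symmetric] using order_trans[OF \<tau>L DL1_step_L1_le[OF \<phi>(1)]] \<phi>(2) M_nonneg[of j]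
      by (intro divide_right_mono mult_left_mono) auto
    also have "\<dots> = ?N * ((2 * h) ^ j / (4 * h) ^ j)" using M_pos[of j] by simp
    also have "(2 * h) ^ j / (4 * h) ^ j = (1 / 2) ^ j"
      unfolding power_divide[symmetric] using \<phi>(2) by simp
    finally show ?thesis .
  qed
  have sm: "summable \<sigma>"
    by (rule summable_comparison_test'[of "\<lambda>j. ?N * (1 / 2) ^ j" 0])
      (use \<sigma> \<sigma>0 in \<open>auto intro!: summable_mult summable_geometric\<close>)
  have K0: "0 \<le> K"
  proof -
    have "0 \<le> b 0" using \<theta>(2)[of 0 0] norm_ge_zero order_trans by blast
    then have "0 \<le> (2 * h) ^ 0 * b 0 / M 0" using M_nonneg by simp
    then show ?thesis using K[of 0] by linarith
  qed
  note \<theta>m = smooth_measurable[OF \<theta>(1)]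
  have factor: "integrable lborel (\<lambda>t. nderiv j \<phi> t * nderiv q \<theta> t) \<and> L1 (\<lambda>t. nderiv j \<phi> t * nderiv q \<theta> t) \<le> \<tau> j * b q" for j q
  proof -
    have le: "cmod (nderiv j \<phi> t * nderiv q \<theta> t) \<le> cmod (indicator S t * nderiv j \<phi> t) * b q" for t
      using \<theta>(2)[of q t] \<theta>(3)[of t q]
      by (cases "t \<in> S") (auto simp: norm_mult intro: mult_left_mono)
    have d: "integrable lborel (\<lambda>t. cmod (indicator S t * nderiv j \<phi> t) * b q)"
      by (intro integrable_mult_left integrable_norm ii)
    have i: "integrable lborel (\<lambda>t. nderiv j \<phi> t * nderiv q \<theta> t)"
    proof (rule Bochner_Integration.integrable_bound[OF d])
      show "(\<lambda>t. nderiv j \<phi> t * nderiv q \<theta> t) \<in> borel_measurable lborel"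
        using \<theta>m[of q] smooth_measurable[OF DL1_smooth[OF \<phi>D], of j] by simp
      show "AE t in lborel. norm (nderiv j \<phi> t * nderiv q \<theta> t) \<le> norm (cmod (indicator S t * nderiv j \<phi> t) * b q)"
        by (rule AE_I2, rule order_trans[OF le]) simp
    qed
    have "L1 (\<lambda>t. nderiv j \<phi> t * nderiv q \<theta> t) \<le> (LINT t|lborel. cmod (indicator S t * nderiv j \<phi> t) * b q)"
      unfolding L1_def by (rule integral_mono[OF integrable_norm[OF i] d le])
    also have "\<dots> = \<tau> j * b q" by (simp only: \<tau>_def L1_def integral_mult_left_zero)
    finally show ?thesis using i by blast
  qed
  have sm\<theta>: "smooth (\<lambda>t. \<phi> t * \<theta> t)" by (rule nderiv_mult(1)[OF DL1_smooth[OF \<phi>D] \<theta>(1)])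
  have nd: "nderiv p (\<lambda>t. \<phi> t * \<theta> t) = (\<lambda>t. \<Sum>j\<le>p. of_nat (p choose j) * (nderiv j \<phi> t * nderiv (p - j) \<theta> t))" for p
    unfolding nderiv_mult(2)[OF DL1_smooth[OF \<phi>D] \<theta>(1)] by (simp add: mult.assoc)
  have ti: "integrable lborel (\<lambda>t. of_nat (p choose j) * (nderiv j \<phi> t * nderiv (p - j) \<theta> t))" for p j
    using factor[of j "p - j"] by (intro integrable_mult_right) blast
  have D: "(\<lambda>t. \<phi> t * \<theta> t) \<in> DL1"
    unfolding DL1_def mem_Collect_eq nd
    by (intro conjI sm\<theta> allI Bochner_Integration.integrable_sum ti)
  have L1sum: "L1 (\<lambda>t. \<Sum>i\<in>I. f i t) \<le> (\<Sum>i\<in>I. L1 (f i))" if "finite I" "\<And>i. integrable lborel (f i)" for I and f :: "nat \<Rightarrow> real \<Rightarrow> complex"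
    using that(1)
  proof (induction I)
    case (insert i I)
    then show ?case
      using L1_triangle[OF that(2)[of i] Bochner_Integration.integrable_sum[of I lborel f, OF that(2)]] by simp
  qed (simp add: L1_def)
  have key: "h ^ p * L1 (nderiv p (\<lambda>t. \<phi> t * \<theta> t)) / M p \<le> K * suminf \<sigma>" for p
  proof -
    have "L1 (nderiv p (\<lambda>t. \<phi> t * \<theta> t)) \<le> (\<Sum>j\<le>p. L1 (\<lambda>t. of_nat (p choose j) * (nderiv j \<phi> t * nderiv (p - j) \<theta> t)))"
      unfolding nd by (rule L1sum[OF _ ti]) simp
    also have "\<dots> \<le> (\<Sum>j\<le>p. 2 ^ p * (\<tau> j * b (p - j)))"
    proof (rule sum_mono)
      fix j assume "j \<in> {..p}"
      have "real (p choose j) \<le> 2 ^ p"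
        using binomial_le_pow2[of p j] by (metis of_nat_le_iff of_nat_numeral of_nat_power)
      then show "L1 (\<lambda>t. of_nat (p choose j) * (nderiv j \<phi> t * nderiv (p - j) \<theta> t)) \<le> 2 ^ p * (\<tau> j * b (p - j))"
        unfolding L1_cmult using factor[of j "p - j"] by (intro mult_mono) (auto simp: L1_nonneg)
    qed
    finally have "h ^ p * L1 (nderiv p (\<lambda>t. \<phi> t * \<theta> t)) / M p \<le> h ^ p * (\<Sum>j\<le>p. 2 ^ p * (\<tau> j * b (p - j))) / M p"
      using \<phi>(2) M_nonneg[of p] by (intro divide_right_mono mult_left_mono) auto
    also have "\<dots> = (\<Sum>j\<le>p. (2 * h) ^ p * (\<tau> j * b (p - j)) / M p)"
      by (simp add: sum_distrib_left sum_divide_distrib power_mult_distrib mult_ac)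
    also have "\<dots> \<le> (\<Sum>j\<le>p. \<sigma> j * K)"
    proof (rule sum_mono)
      fix j assume j: "j \<in> {..p}"
      have b0: "0 \<le> b (p - j)" using \<theta>(2)[of "p - j" 0] norm_ge_zero order_trans by blast
      have "(2 * h) ^ p * (\<tau> j * b (p - j)) / M p \<le> (2 * h) ^ p * (\<tau> j * b (p - j)) / (M j * M (p - j))"
        using M_supermult[of j "p - j"] j \<phi>(2) \<tau>0[of j] b0 M_pos[of j] M_pos[of "p - j"]
        by (intro divide_left_mono) (auto intro!: mult_pos_pos M_pos)
      also have "\<dots> = \<sigma> j * ((2 * h) ^ (p - j) * b (p - j) / M (p - j))"
      proof -
        have "(2 * h) ^ p = (2 * h) ^ j * (2 * h) ^ (p - j)" using j by (simp only: power_add[symmetric]) simp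
        then show ?thesis by (simp add: \<sigma>_def \<tau>_def)
      qed
      also have "\<dots> \<le> \<sigma> j * K" by (rule mult_left_mono[OF K \<sigma>0])
      finally show "(2 * h) ^ p * (\<tau> j * b (p - j)) / M p \<le> \<sigma> j * K" .
    qed
    also have "\<dots> = K * (\<Sum>j\<le>p. \<sigma> j)" by (simp add: sum_distrib_left mult.commute)
    also have "\<dots> \<le> K * suminf \<sigma>" by (rule mult_left_mono[OF sum_le_suminf[OF sm] K0]) (auto simp: \<sigma>0)
    finally show ?thesis .
  qed
  show "(\<lambda>t. \<phi> t * \<theta> t) \<in> DL1_step M h" "DL1_norm M h (\<lambda>t. \<phi> t * \<theta> t) \<le> K * suminf \<sigma>"
    by (rule DL1_stepI[OF D key])+
qed

end

context nonquasianalytic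
begin

text \<open>Indicators of growing intervals, mollified at unit scale: the derivative bounds do not depend on \<open>n\<close>.\<close>

lemma cutoff:
  obtains X' :: "nat \<Rightarrow> real \<Rightarrow> complex" and b where "\<And>n. smooth (X' n)"
    "\<And>n q t. cmod (nderiv q (X' n) t) \<le> b q" "\<And>n t. \<bar>t\<bar> > real n + 1 \<Longrightarrow> X' n t = 0"
    "\<And>n t. \<bar>t\<bar> \<le> real n \<Longrightarrow> X' n t = 1" "\<And>h. h > 0 \<Longrightarrow> \<exists>K. \<forall>q. h ^ q * b q / M q \<le> K"
proof -
  obtain \<rho> B where \<rho>: "\<And>n. \<rho> n \<in> DL1_space Beurling M"
    "\<And>n t. t \<notin> {0..1 / real (Suc n)} \<Longrightarrow> \<rho> n t = 0" "\<And>n. (LINT t|lborel. \<rho> n t) = 1" "\<And>n. L1 (\<rho> n) \<le> B"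
    by (rule mollifier) blast
  let ?r = "\<rho> 0"
  have rD: "?r \<in> DL1" by (rule DL1_space_DL1[OF \<rho>(1)])
  have r0: "?r t = 0" if "t \<notin> {0..1}" for t using \<rho>(2)[of t 0] that by simp
  \<comment> \<open>The mollifier lives on \<open>[0, 1]\<close>; extending the interval to the left by \<open>1\<close> makes the convolution \<open>1\<close> on \<open>[-n, n]\<close>.\<close>
  define k where "k n = (indicator {- real n - 1..real n} :: real \<Rightarrow> complex)" for n
  have k: "integrable lborel (k n)" for n unfolding k_def by (rule indicator_kernel) simp
  define c where "c n = conv (k n) ?r" for n
  have c: "c n s = (LINT t|lborel. ?r t * k n (s - t))" for n s
    unfolding c_def by (subst conv_commute) (simp add: conv_def)
  show thesis
  proof (rule that[of c "\<lambda>q. L1 (nderiv q ?r)"])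
    show "smooth (c n)" for n unfolding c_def by (rule conv_smooth(1)[OF k rD])
    show "cmod (nderiv q (c n) t) \<le> L1 (nderiv q ?r)" for n q t
    proof -
      have i: "integrable lborel (nderiv q ?r)" by (rule DL1_integrable[OF rD])
      have "nderiv q (c n) t = (LINT u|lborel. nderiv q ?r u * k n (t - u))"
        unfolding c_def conv_smooth(2)[OF k rD] by (subst conv_commute) (simp add: conv_def)
      also have "cmod \<dots> \<le> (LINT u|lborel. cmod (nderiv q ?r u * k n (t - u)))"
        by (rule integral_norm_bound)
      also have "\<dots> \<le> L1 (nderiv q ?r)"
        unfolding L1_def
        by (rule integral_mono[OF integrable_norm[OF conv_integrable[OF i, of "k n" 1]] integrable_norm[OF i]])
          (auto simp: k_def indicator_def norm_mult)
      finally show ?thesis .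
    qed
    show "c n t = 0" if "\<bar>t\<bar> > real n + 1" for n t
    proof -
      have "?r u * k n (t - u) = 0" for u
        using that r0[of u] by (cases "u \<in> {0..1}") (auto simp: k_def indicator_def)
      then show ?thesis unfolding c by (simp only:) simp
    qed
    show "c n t = 1" if "\<bar>t\<bar> \<le> real n" for n t
    proof -
      have "?r u * k n (t - u) = ?r u" for u
        using that r0[of u] by (cases "u \<in> {0..1}") (auto simp: k_def indicator_def)
      then show ?thesis unfolding c by (simp only: \<rho>(3))
    qed
    show "\<exists>K. \<forall>q. h ^ q * L1 (nderiv q ?r) / M q \<le> K" if "h > 0" for h
      using DL1_step_quot_le[of ?r M h] \<rho>(1)[of 0] that by (auto simp: DL1_space_def)
  qed
qed

lemma D_space_dense:
  assumes "\<phi> \<in> DL1_space c M"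
  obtains \<phi>' where "\<And>n. \<phi>' n \<in> D_space c M"
    "\<And>h. h > 0 \<Longrightarrow> \<phi> \<in> DL1_step M (4 * h) \<Longrightarrow>
      (\<forall>n. (\<lambda>t. \<phi>' n t - \<phi> t) \<in> DL1_step M h) \<and> (\<lambda>n. DL1_norm M h (\<lambda>t. \<phi>' n t - \<phi> t)) \<longlonglongrightarrow> 0"
proof -
  obtain X' b where X': "\<And>n. smooth (X' n)"
    "\<And>n q t. cmod (nderiv q (X' n) t) \<le> b q" "\<And>n t. \<bar>t\<bar> > real n + 1 \<Longrightarrow> X' n t = (0::complex)"
    "\<And>n t. \<bar>t\<bar> \<le> real n \<Longrightarrow> X' n t = 1" "\<And>h. h > 0 \<Longrightarrow> \<exists>K. \<forall>q. h ^ q * b q / M q \<le> K"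
    by (rule cutoff) blast
  have b0: "0 \<le> b q" for q using X'(2)[of q 0 0] norm_ge_zero order_trans by blast
  define \<theta> where "\<theta> n t = X' n t - 1" for n t
  have const: "smooth (\<lambda>t::real. 1::complex)" "nderiv q (\<lambda>t::real. 1::complex) = (\<lambda>t. if q = 0 then 1 else 0)" for q
    by (rule smooth_by_derivatives[where F = "\<lambda>q t. if q = 0 then 1 else 0"]; simp)+
  have \<theta>: "smooth (\<theta> n)" for n
    unfolding \<theta>_def using nderiv_add(1)[OF X'(1) nderiv_cmult(1)[OF const(1), of "-1"], of n] by simp
  have \<theta>n: "nderiv q (\<theta> n) t = nderiv q (X' n) t - (if q = 0 then 1 else 0)" for q n t
    unfolding \<theta>_def[abs_def] nderiv_diff[OF X'(1) const(1)] const(2) by simp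
  define b' where "b' q = b q + (if q = 0 then 1 else 0)" for q
  have \<theta>b: "cmod (nderiv q (\<theta> n) t) \<le> b' q" for q n t
    using X'(2)[of q n t] norm_triangle_ineq4[of "nderiv q (X' n) t" 1] by (auto simp: \<theta>n b'_def)
  define S where "S n = - {- real n<..<real n}" for n
  have \<theta>z: "nderiv q (\<theta> n) t = 0" if "t \<notin> S n" for q n t
    by (rule nderiv_outside[of "S n"]) (use that X'(4) in \<open>auto simp: S_def \<theta>_def closed_Compl\<close>)
  have Sb: "S n \<in> sets borel" for n by (auto simp: S_def)
  show thesis
  proof (rule that[of "\<lambda>n t. \<phi> t * X' n t"])
    show "(\<lambda>t. \<phi> t * X' n t) \<in> D_space c M" for n
      unfolding D_space_iff
    proof
      show "(\<lambda>t. \<phi> t * X' n t) \<in> DL1_space c M"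
      proof (rule DL1_space_transfer[OF assms, of 4])
        fix h :: real assume h: "h > 0" "\<phi> \<in> DL1_step M (4 * h)"
        obtain K where K: "\<And>q. (2 * h) ^ q * b q / M q \<le> K" using X'(5)[of "2 * h"] h(1) by auto
        show "(\<lambda>t. \<phi> t * X' n t) \<in> DL1_step M h"
          by (rule multiplier_step(3)[OF h(2,1) X'(1,2) _ _ K, of UNIV]) auto
      qed simp
      show "\<exists>a b. \<forall>t. t \<notin> {a..b} \<longrightarrow> \<phi> t * X' n t = 0"
        using X'(3)[of n] by (intro exI[of _ "- (real n + 1)"] exI[of _ "real n + 1"]) auto
    qed
    fix h :: real assume h: "h > 0" "\<phi> \<in> DL1_step M (4 * h)"
    obtain K where K: "\<And>q. (2 * h) ^ q * b q / M q \<le> K" using X'(5)[of "2 * h"] h(1) by auto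
    have K': "(2 * h) ^ q * b' q / M q \<le> K + 1" for q
      using K[of q] by (auto simp: b'_def M_0)
    have eq: "(\<lambda>t. \<phi> t * X' n t - \<phi> t) = (\<lambda>t. \<phi> t * \<theta> n t)" for n by (simp add: \<theta>_def algebra_simps)
    define \<sigma> where "\<sigma> j n = (2 * h) ^ j * L1 (\<lambda>t. indicator (S n) t * nderiv j \<phi> t) / M j" for j n
    note ms = multiplier_step[OF h(2,1) \<theta> \<theta>b \<theta>z Sb K', folded \<sigma>_def]
    have "\<sigma> j \<longlonglongrightarrow> (2 * h) ^ j * 0 / M j" for j
      unfolding \<sigma>_def[abs_def]
    proof (intro tendsto_intros L1_tail_tendsto DL1_integrable DL1_step_DL1[OF h(2)] Sb)
      fix t :: real
      obtain n0 :: nat where "\<bar>t\<bar> < real n0" using reals_Archimedean2 by blast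
      then show "\<forall>\<^sub>F n in sequentially. t \<notin> S n"
        by (intro eventually_sequentiallyI[of n0]) (auto simp: S_def)
    qed (use M_pos[of j] in auto)
    then have "(\<lambda>n. \<Sum>j. \<sigma> j n) \<longlonglongrightarrow> (\<Sum>j. 0)"
      using tannerys_theorem[of \<sigma> "\<lambda>_. 0" sequentially "\<lambda>j. DL1_norm M (4 * h) \<phi> * (1 / 2) ^ j"] ms(1,2)
      by (auto intro!: always_eventually summable_mult summable_geometric)
    then have "(\<lambda>n. (K + 1) * (\<Sum>j. \<sigma> j n)) \<longlonglongrightarrow> 0" by (auto intro: tendsto_mult_right_zero)
    then have "(\<lambda>n. DL1_norm M h (\<lambda>t. \<phi> t * X' n t - \<phi> t)) \<longlonglongrightarrow> 0"
      by (rule tendsto_sandwich[OF _ _ tendsto_const, rotated 2])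
        (use ms(4) DL1_norm_nonneg[OF ms(3) h(1)] in \<open>auto simp: eq\<close>)
    then show "(\<forall>n. (\<lambda>t. \<phi> t * X' n t - \<phi> t) \<in> DL1_step M h) \<and> (\<lambda>n. DL1_norm M h (\<lambda>t. \<phi> t * X' n t - \<phi> t)) \<longlonglongrightarrow> 0"
      using ms(3) by (simp add: eq)
  qed
qed

end

section \<open>Orbits under translation\<close>

lemma convol_translate: "convol T \<phi> x = translate x T (\<lambda>t. \<phi> (- t))"
  by (simp add: convol_def translate_def)

lemma translate_add: "translate x T (\<lambda>t. \<phi> (t - y)) = translate (x + y) T \<phi>"
  by (simp add: translate_def algebra_simps)

text \<open>The difference of two candidates is again recurrent and tends to zero.\<close>

lemma kind_fun_limit_unique:
  fixes g g' :: "real \<Rightarrow> 'a::complex_banach"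
  assumes g: "g \<in> kind_fun k" "((\<lambda>t. f t - g t) \<longlongrightarrow> 0) at_top"
    and g': "g' \<in> kind_fun k" "((\<lambda>t. f t - g' t) \<longlongrightarrow> 0) at_top"
  shows "g = g'"
proof
  fix t
  have "((\<lambda>t. (f t - g' t) - (f t - g t)) \<longlongrightarrow> 0 - 0) at_top" by (rule tendsto_diff[OF g'(2) g(2)])
  then have lim: "((\<lambda>t. g t - g' t) \<longlongrightarrow> 0) at_top" by simp
  have "norm (g t - g' t) \<le> 0 + e" if "e > 0" for e
  proof (rule kind_fun_norm_le_eventually[OF kind_fun_diff[OF g(1) g'(1)]])
    show "\<forall>\<^sub>F s in at_top. norm (g s - g' s) \<le> 0 + e"
      using tendstoD[OF lim that] by eventually_elim (simp add: dist_norm less_imp_le)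
  qed
  then have "norm (g t - g' t) \<le> 0" by (rule field_le_epsilon)
  then show "g t = g' t" by simp
qed

lemma kind_fun_limit_bound:
  fixes g :: "real \<Rightarrow> 'a::complex_banach"
  assumes g: "g \<in> kind_fun k" "((\<lambda>t. f t - g t) \<longlongrightarrow> 0) at_top" and f: "\<And>t. norm (f t) \<le> B"
  shows "norm (g t) \<le> B"
proof (rule field_le_epsilon)
  fix e :: real assume e: "e > 0"
  show "norm (g t) \<le> B + e"
  proof (rule kind_fun_norm_le_eventually[OF g(1)])
    show "\<forall>\<^sub>F s in at_top. norm (g s) \<le> B + e"
      using tendstoD[OF g(2) e]
    proof eventually_elim
      case (elim s)
      then show ?case using f[of s] norm_triangle_sub[of "g s" "f s"] by (simp add: dist_norm norm_minus_commute)
    qed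
  qed
qed

context weight_sequence
begin

lemma D_space_DL1_space: "\<phi> \<in> D_space c M \<Longrightarrow> \<phi> \<in> DL1_space c M"
  by (simp add: D_space_iff)

lemma D0_space_DL1_space: "\<phi> \<in> D0_space c M \<Longrightarrow> \<phi> \<in> DL1_space c M"
  by (simp add: D0_space_iff D_space_DL1_space)

lemma D_space_support:
  assumes "\<phi> \<in> D_space c M"
  obtains a b where "\<And>t. t \<notin> {a..b} \<Longrightarrow> \<phi> t = 0"
  using assms unfolding D_space_iff by blast

lemma D_space_shift:
  assumes "\<phi> \<in> D_space c M"
  shows "(\<lambda>t. \<phi> (t - y)) \<in> D_space c M"
proof -
  obtain a b where ab: "\<And>t. t \<notin> {a..b} \<Longrightarrow> \<phi> t = 0" by (rule D_space_support[OF assms]) blast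
  have "\<forall>t. t \<notin> {a + y..b + y} \<longrightarrow> \<phi> (t - y) = 0" by (auto intro!: ab)
  then show ?thesis using DL1_space_shift[OF D_space_DL1_space[OF assms]] unfolding D_space_iff by blast
qed

lemma D_space_reflect:
  assumes "\<phi> \<in> D_space c M"
  shows "(\<lambda>t. \<phi> (- t)) \<in> D_space c M"
proof -
  obtain a b where ab: "\<And>t. t \<notin> {a..b} \<Longrightarrow> \<phi> t = 0" by (rule D_space_support[OF assms]) blast
  have "\<forall>t. t \<notin> {- b..- a} \<longrightarrow> \<phi> (- t) = 0" by (auto intro!: ab)
  then show ?thesis using DL1_space_reflect[OF D_space_DL1_space[OF assms], of 0] unfolding D_space_iff by auto
qed

lemma D_space_reflect_iff: "(\<forall>\<phi>\<in>D_space c M. P (\<lambda>t. \<phi> (- t))) \<longleftrightarrow> (\<forall>\<phi>\<in>D_space c M. P \<phi>)"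
proof
  assume *: "\<forall>\<phi>\<in>D_space c M. P (\<lambda>t. \<phi> (- t))"
  show "\<forall>\<phi>\<in>D_space c M. P \<phi>"
  proof
    fix \<phi> assume "\<phi> \<in> D_space c M"
    from bspec[OF * D_space_reflect[OF this]] show "P \<phi>" by simp
  qed
qed (auto intro: D_space_reflect)

text \<open>Equality on the half-line thus determines the orbit near plus infinity.\<close>

lemma D_space_eventually_shift_D0:
  assumes "\<phi> \<in> D_space c M"
  shows "\<forall>\<^sub>F x in at_top. (\<lambda>t. \<phi> (t - x)) \<in> D0_space c M"
proof -
  obtain a b where ab: "\<And>t. t \<notin> {a..b} \<Longrightarrow> \<phi> t = 0" by (rule D_space_support[OF assms]) blast
  have "(\<lambda>t. \<phi> (t - x)) \<in> D0_space c M" if "x \<ge> - a" for x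
    unfolding D0_space_iff using D_space_shift[OF assms] that by (auto intro!: ab)
  then show ?thesis unfolding eventually_at_top_linorder by blast
qed

lemma assertion_x_iff:
  "assertion_x k c M T \<longleftrightarrow> (\<forall>\<phi>\<in>D_space c M. (\<lambda>x. translate x T \<phi>) \<in> asymp_fun k)"
  unfolding assertion_x_def convol_translate[abs_def]
  by (rule D_space_reflect_iff[where P = "\<lambda>\<phi>. (\<lambda>x. translate x T \<phi>) \<in> asymp_fun k"])

text \<open>Translations do not increase the norm, hence bounds for \<open>T\<close> hold along whole orbits.\<close>

lemma DL1_dual_translate_bound:
  assumes bd: "\<And>\<psi>. \<psi> \<in> DL1_space c M \<Longrightarrow> \<psi> \<in> DL1_step M h \<Longrightarrow> norm (T \<psi>) \<le> C * DL1_norm M h \<psi>"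
    and hC: "h > 0" "C \<ge> 0" and \<psi>: "\<psi> \<in> DL1_space c M" "\<psi> \<in> DL1_step M h"
  shows "norm (translate x T \<psi>) \<le> C * DL1_norm M h \<psi>"
proof -
  have s: "(\<lambda>t. \<psi> (t - x)) \<in> DL1_step M h" "DL1_norm M h (\<lambda>t. \<psi> (t - x)) \<le> DL1_norm M h \<psi>"
    using DL1_step_isometry[OF \<psi>(2) hC(1), of 1 "- x"] by simp_all
  have "norm (translate x T \<psi>) \<le> C * DL1_norm M h (\<lambda>t. \<psi> (t - x))"
    unfolding translate_def by (rule bd[OF DL1_space_shift[OF \<psi>(1)] s(1)])
  also have "\<dots> \<le> C * DL1_norm M h \<psi>" by (rule mult_left_mono[OF s(2) hC(2)])
  finally show ?thesis .
qed

lemma translate_diff: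
  assumes "T \<in> DL1_dual c M" "\<phi> \<in> DL1_space c M" "\<psi> \<in> DL1_space c M"
  shows "translate x T (\<lambda>t. \<phi> t - \<psi> t) = translate x T \<phi> - translate x T \<psi>"
  unfolding translate_def by (rule DL1_dual_diff[OF assms(1) DL1_space_shift[OF assms(2)] DL1_space_shift[OF assms(3)]])

lemma translate_uniform_limit:
  fixes T :: "(real \<Rightarrow> complex) \<Rightarrow> 'a::complex_banach"
  assumes T: "T \<in> DL1_dual c M"
    and bd: "\<And>\<psi>. \<psi> \<in> DL1_space c M \<Longrightarrow> \<psi> \<in> DL1_step M h \<Longrightarrow> norm (T \<psi>) \<le> C * DL1_norm M h \<psi>"
    and hC: "h > 0" "C \<ge> 0"
    and \<phi>: "\<And>n. \<phi>' n \<in> DL1_space c M" "\<phi> \<in> DL1_space c M" "\<And>n. (\<lambda>t. \<phi>' n t - \<phi> t) \<in> DL1_step M h"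
    and lim: "(\<lambda>n. DL1_norm M h (\<lambda>t. \<phi>' n t - \<phi> t)) \<longlonglongrightarrow> 0"
  shows "uniform_limit UNIV (\<lambda>n x. translate x T (\<phi>' n)) (\<lambda>x. translate x T \<phi>) sequentially"
proof (rule uniform_limitI)
  fix e :: real assume e: "e > 0"
  have "(\<lambda>n. C * DL1_norm M h (\<lambda>t. \<phi>' n t - \<phi> t)) \<longlonglongrightarrow> C * 0" by (intro tendsto_mult_left lim)
  then have "\<forall>\<^sub>F n in sequentially. C * DL1_norm M h (\<lambda>t. \<phi>' n t - \<phi> t) < e"
    using e by (intro order_tendstoD(2)) auto
  then show "\<forall>\<^sub>F n in sequentially. \<forall>x\<in>UNIV. dist (translate x T (\<phi>' n)) (translate x T \<phi>) < e"
  proof eventually_elim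
    case (elim n)
    have "norm (translate x T (\<phi>' n) - translate x T \<phi>) \<le> C * DL1_norm M h (\<lambda>t. \<phi>' n t - \<phi> t)" for x
      using DL1_dual_translate_bound[OF bd hC DL1_space_diff[OF \<phi>(1,2)] \<phi>(3)] translate_diff[OF T \<phi>(1,2)] by simp
    then show ?case using elim by (auto simp: dist_norm intro: le_less_trans)
  qed
qed

text \<open>Any compactly supported function is a translate of one with support in \<open>[0, \<infinity>)\<close>, and the class is
  invariant under translations.\<close>

lemma assertion_viii_imp_x:
  fixes T :: "(real \<Rightarrow> complex) \<Rightarrow> 'a::complex_banach"
  assumes "assertion_viii k c M T"
  shows "assertion_x k c M T"
  unfolding assertion_x_def
proof
  fix \<phi> assume \<phi>: "\<phi> \<in> D_space c M"
  obtain y where y: "(\<lambda>t. \<phi> (t - y)) \<in> D0_space c M"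
    using D_space_eventually_shift_D0[OF \<phi>] unfolding eventually_at_top_linorder by blast
  then have "convol T (\<lambda>t. \<phi> (t - y)) \<in> asymp_fun k" using assms by (simp add: assertion_viii_def)
  from asymp_fun_shift[OF this, of y] show "convol T \<phi> \<in> asymp_fun k"
    by (simp add: convol_def[abs_def] algebra_simps)
qed

lemma assertion_vii_imp_x:
  fixes T :: "(real \<Rightarrow> complex) \<Rightarrow> 'a::complex_banach"
  assumes "assertion_vii k c M T"
  shows "assertion_x k c M T"
  unfolding assertion_x_iff
proof
  fix \<phi> assume \<phi>: "\<phi> \<in> D_space c M"
  obtain T1 Q where T: "T \<in> DL1_dual c M" and T1: "T1 \<in> B_kind k c M" and Q: "Q \<in> B_plus0 c M"
    and eq: "\<And>\<phi>. \<phi> \<in> D0_space c M \<Longrightarrow> T \<phi> = T1 \<phi> + Q \<phi>"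
    using assms unfolding assertion_vii_def B_asymp_def by blast
  have 1: "(\<lambda>x. translate x T1 \<phi>) \<in> kind_fun k"
  proof -
    have "convol T1 (\<lambda>t. \<phi> (- t)) \<in> kind_fun k" using T1 D_space_reflect[OF \<phi>] by (simp add: B_kind_def)
    then show ?thesis by (simp add: convol_translate[abs_def])
  qed
  have 2: "((\<lambda>x. translate x Q \<phi>) \<longlongrightarrow> 0) at_top" using Q \<phi> by (simp add: B_plus0_def)
  have "((\<lambda>x. translate x T \<phi> - translate x T1 \<phi>) \<longlongrightarrow> 0) at_top"
  proof (rule Lim_transform_eventually[OF 2 eventually_mono[OF D_space_eventually_shift_D0[OF \<phi>]]])
    fix x assume "(\<lambda>t. \<phi> (t - x)) \<in> D0_space c M"
    from eq[OF this] show "translate x Q \<phi> = translate x T \<phi> - translate x T1 \<phi>" by (simp add: translate_def)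
  qed
  then show "(\<lambda>x. translate x T \<phi>) \<in> asymp_fun k"
    by (rule asymp_funI[OF translate_continuous_bounded(1)[OF T D_space_DL1_space[OF \<phi>]] 1])
qed

lemma assertion_iv_imp_x:
  fixes T :: "(real \<Rightarrow> complex) \<Rightarrow> 'a::complex_banach"
  assumes "assertion_iv k c M T" and T: "T \<in> DL1_dual c M"
  shows "assertion_x k c M T"
  unfolding assertion_x_iff
proof
  fix \<phi> assume \<phi>: "\<phi> \<in> D_space c M"
  note \<phi>D = D_space_DL1_space[OF \<phi>]
  obtain S a f1 f2 where f: "f1 \<in> bdd_asymp_fun k" "f2 \<in> bdd_asymp_fun k"
    and r: "ultradiff_repr c M (DL1_space c M) S a f1 f2" and eq: "eq_half c M S T"
    using assms(1) unfolding assertion_iv_def by blast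
  let ?P = "\<lambda>\<phi>. ultradiff a f1 \<phi> + regular f2 \<phi>"
  obtain b d where bd: "\<And>t. t \<notin> {b..d} \<Longrightarrow> \<phi> t = 0" by (rule D_space_support[OF \<phi>]) blast
  have 1: "(\<lambda>x. translate x ?P \<phi>) \<in> asymp_fun k"
    using r by (intro asymp_fun_translate_ultradiff[OF f _ \<phi>D bd]) (auto simp: ultradiff_repr_def)
  show "(\<lambda>x. translate x T \<phi>) \<in> asymp_fun k"
  proof (rule asymp_fun_eventually_eq[OF 1 translate_continuous_bounded(1)[OF T \<phi>D]
        eventually_mono[OF D_space_eventually_shift_D0[OF \<phi>]]])
    fix x assume x: "(\<lambda>t. \<phi> (t - x)) \<in> D0_space c M"
    then have "S (\<lambda>t. \<phi> (t - x)) = ?P (\<lambda>t. \<phi> (t - x))"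
      using r D0_space_DL1_space[OF x] unfolding ultradiff_repr_def by blast
    moreover have "S (\<lambda>t. \<phi> (t - x)) = T (\<lambda>t. \<phi> (t - x))" using eq x unfolding eq_half_def by blast
    ultimately show "translate x ?P \<phi> = translate x T \<phi>" by (simp add: translate_def)
  qed
qed

lemma assertion_i_imp_ii: "assertion_i k c M T \<Longrightarrow> assertion_ii k c M T"
  unfolding assertion_i_def assertion_ii_def ultradiff_repr_def eq_half_def
  using D0_space_DL1_space[of _ c] by metis

lemma assertion_ii_imp_iii: "assertion_ii k c M T \<Longrightarrow> assertion_iii k c M T"
  unfolding assertion_ii_def assertion_iii_def by blast

text \<open>The right-hand side of the representation makes sense on the whole test space and serves as \<open>S\<close>.\<close>

lemma assertion_iii_imp_iv:
  fixes T :: "(real \<Rightarrow> complex) \<Rightarrow> 'a::complex_banach"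
  assumes "assertion_iii k c M T"
  shows "assertion_iv k c M T"
proof -
  obtain a f1 f2 where f: "f1 \<in> bdd_asymp_fun k" "f2 \<in> bdd_asymp_fun k"
    and r: "ultradiff_repr c M (D0_space c M) T a f1 f2"
    using assms unfolding assertion_iii_def by blast
  let ?P = "\<lambda>\<phi>. ultradiff a f1 \<phi> + regular f2 \<phi>"
  have a: "ultradiff_class c M a" using r by (simp add: ultradiff_repr_def)
  have "?P \<in> DL1_dual c M"
    using f by (intro ultradiff_dual a) (auto simp: bdd_asymp_fun_def asymp_fun_continuous)
  moreover have "ultradiff_repr c M (DL1_space c M) ?P a f1 f2" using a by (simp add: ultradiff_repr_def)
  moreover have "eq_half c M ?P T" using r by (simp add: ultradiff_repr_def eq_half_def)
  ultimately show ?thesis unfolding assertion_iv_def using f by blast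
qed

end

context nonquasianalytic
begin

text \<open>Density, used along the whole orbit at once.\<close>

lemma asymp_fun_translate_DL1_space:
  fixes T :: "(real \<Rightarrow> complex) \<Rightarrow> 'a::complex_banach"
  assumes x: "assertion_x k c M T" and T: "T \<in> DL1_dual c M" and \<phi>: "\<phi> \<in> DL1_space c M"
  shows "(\<lambda>x. translate x T \<phi>) \<in> asymp_fun k"
proof -
  obtain \<phi>' where \<phi>': "\<And>n. \<phi>' n \<in> D_space c M"
    "\<And>h. h > 0 \<Longrightarrow> \<phi> \<in> DL1_step M (4 * h) \<Longrightarrow>
      (\<forall>n. (\<lambda>t. \<phi>' n t - \<phi> t) \<in> DL1_step M h) \<and> (\<lambda>n. DL1_norm M h (\<lambda>t. \<phi>' n t - \<phi> t)) \<longlonglongrightarrow> 0"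
    by (rule D_space_dense[OF \<phi>]) blast
  obtain h C where h: "h > 0" "C \<ge> 0" "\<phi> \<in> DL1_step M (4 * h)"
    "\<And>\<psi>. \<psi> \<in> DL1_space c M \<Longrightarrow> \<psi> \<in> DL1_step M h \<Longrightarrow> norm (T \<psi>) \<le> C * DL1_norm M h \<psi>"
    by (rule DL1_dual_bound[OF T \<phi>, of 4]) auto
  have d: "(\<lambda>t. \<phi>' n t - \<phi> t) \<in> DL1_step M h" "(\<lambda>n. DL1_norm M h (\<lambda>t. \<phi>' n t - \<phi> t)) \<longlonglongrightarrow> 0" for n
    using \<phi>'(2)[OF h(1,3)] by auto
  have u: "uniform_limit UNIV (\<lambda>n x. translate x T (\<phi>' n)) (\<lambda>x. translate x T \<phi>) sequentially"
    by (rule translate_uniform_limit[OF T h(4,1,2) D_space_DL1_space[OF \<phi>'(1)] \<phi> d])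
  show ?thesis
    by (rule asymp_fun_uniform_limit[OF _ translate_continuous_bounded(1)[OF T \<phi>]
          uniform_limit_on_subset[OF u, of "{0..}"]])
      (use x \<phi>'(1) in \<open>simp_all add: assertion_x_iff\<close>)
qed

text \<open>\<open>T1 \<phi>\<close> is the value at \<open>0\<close> of the recurrent part of the orbit of \<open>\<phi>\<close>. That part is unique, so it depends
  linearly on \<open>\<phi>\<close> and commutes with translations; it inherits the bounds of the orbit, so \<open>T1\<close> is continuous.\<close>

lemma assertion_x_imp_vii:
  fixes T :: "(real \<Rightarrow> complex) \<Rightarrow> 'a::complex_banach"
  assumes x: "assertion_x k c M T" and T: "T \<in> DL1_dual c M"
  shows "assertion_vii k c M T"
proof -
  let ?E = "DL1_space c M"
  define G where "G \<phi> = (SOME g. g \<in> kind_fun k \<and> ((\<lambda>t. translate t T \<phi> - g t) \<longlongrightarrow> 0) at_top)" for \<phi>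
  have G: "G \<phi> \<in> kind_fun k \<and> ((\<lambda>t. translate t T \<phi> - G \<phi> t) \<longlongrightarrow> 0) at_top" if "\<phi> \<in> ?E" for \<phi>
  proof -
    have ex: "\<exists>g. g \<in> kind_fun k \<and> ((\<lambda>t. translate t T \<phi> - g t) \<longlongrightarrow> 0) at_top"
      by (rule asymp_funE[OF asymp_fun_translate_DL1_space[OF x T that]]) blast
    from someI_ex[OF ex] show ?thesis unfolding G_def .
  qed
  have G1: "G \<phi> \<in> kind_fun k" and G2: "((\<lambda>t. translate t T \<phi> - G \<phi> t) \<longlongrightarrow> 0) at_top" if "\<phi> \<in> ?E" for \<phi>
    using G[OF that] by auto
  have Gu: "G \<phi> = g" if "\<phi> \<in> ?E" "g \<in> kind_fun k" "((\<lambda>t. translate t T \<phi> - g t) \<longlongrightarrow> 0) at_top" for \<phi> g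
    by (rule kind_fun_limit_unique[OF G1 G2 that(2,3)]) (fact that(1))+
  note lin = DL1_dual_linear[OF T]
  have Gadd: "G (\<lambda>t. \<phi> t + \<psi> t) = (\<lambda>t. G \<phi> t + G \<psi> t)" if "\<phi> \<in> ?E" "\<psi> \<in> ?E" for \<phi> \<psi>
  proof (rule Gu[OF DL1_space_add[OF that] kind_fun_add[OF G1[OF that(1)] G1[OF that(2)]]])
    have "translate t T (\<lambda>t. \<phi> t + \<psi> t) = translate t T \<phi> + translate t T \<psi>" for t
      unfolding translate_def by (rule linear_map_on_add[OF lin DL1_space_shift[OF that(1)] DL1_space_shift[OF that(2)]])
    then show "((\<lambda>t. translate t T (\<lambda>t. \<phi> t + \<psi> t) - (G \<phi> t + G \<psi> t)) \<longlongrightarrow> 0) at_top"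
      using tendsto_add[OF G2[OF that(1)] G2[OF that(2)]] by (simp add: algebra_simps)
  qed
  have Gcm: "G (\<lambda>t. a * \<phi> t) = (\<lambda>t. a *\<^sub>C G \<phi> t)" if "\<phi> \<in> ?E" for a \<phi>
  proof (rule Gu[OF DL1_space_cmult[OF that] kind_fun_scaleC[OF G1[OF that]]])
    have "translate t T (\<lambda>t. a * \<phi> t) = a *\<^sub>C translate t T \<phi>" for t
      unfolding translate_def by (rule linear_map_on_cmult[OF lin DL1_space_shift[OF that]])
    then show "((\<lambda>t. translate t T (\<lambda>t. a * \<phi> t) - a *\<^sub>C G \<phi> t) \<longlongrightarrow> 0) at_top"
      using scaleC.tendsto[OF tendsto_const G2[OF that], of a] by (simp add: scaleC.diff_right scaleC.zero_right)
  qed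
  have Gsh: "G (\<lambda>t. \<phi> (t - y)) = (\<lambda>t. G \<phi> (t + y))" if "\<phi> \<in> ?E" for \<phi> y
  proof (rule Gu[OF DL1_space_shift[OF that] kind_fun_shift[OF G1[OF that]]])
    have "filterlim (\<lambda>t::real. t + y) at_top at_top"
      using filterlim_tendsto_add_at_top[OF tendsto_const[of y] filterlim_ident[of at_top]] by (simp add: add.commute)
    from filterlim_compose[OF G2[OF that] this]
    show "((\<lambda>t. translate t T (\<lambda>t. \<phi> (t - y)) - G \<phi> (t + y)) \<longlongrightarrow> 0) at_top"
      by (simp add: translate_add)
  qed
  define T1 where "T1 \<phi> = G \<phi> 0" for \<phi>
  define Q where "Q \<phi> = T \<phi> - T1 \<phi>" for \<phi>
  have tT1: "translate y T1 \<phi> = G \<phi> y" if "\<phi> \<in> ?E" for \<phi> y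
    using fun_cong[OF Gsh[OF that], of y 0] by (simp add: translate_def T1_def)
  have linT1: "linear_map_on ?E T1"
    unfolding linear_map_on_def T1_def using Gadd Gcm by simp
  have linQ: "linear_map_on ?E Q"
    using linT1 lin unfolding linear_map_on_def Q_def by (simp add: scaleC.diff_right)
  have sc: "at_scales c (\<lambda>h. \<exists>C\<ge>0. \<forall>\<phi>\<in>?E \<inter> DL1_step M h. norm (T \<phi>) \<le> C * DL1_norm M h \<phi>)"
    using T DL1_dual_iff by blast
  have sc': "at_scales c (\<lambda>h. (\<exists>C\<ge>0. \<forall>\<phi>\<in>?E \<inter> DL1_step M h. norm (T1 \<phi>) \<le> C * DL1_norm M h \<phi>) \<and>
      (\<exists>C\<ge>0. \<forall>\<phi>\<in>?E \<inter> DL1_step M h. norm (Q \<phi>) \<le> C * DL1_norm M h \<phi>))"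
  proof (rule at_scales_mono[OF sc])
    fix h :: real assume h: "h > 0" and "\<exists>C\<ge>0. \<forall>\<phi>\<in>?E \<inter> DL1_step M h. norm (T \<phi>) \<le> C * DL1_norm M h \<phi>"
    then obtain C where C: "C \<ge> 0" "\<And>\<phi>. \<phi> \<in> ?E \<Longrightarrow> \<phi> \<in> DL1_step M h \<Longrightarrow> norm (T \<phi>) \<le> C * DL1_norm M h \<phi>"
      by blast
    have 1: "norm (T1 \<phi>) \<le> C * DL1_norm M h \<phi>" if "\<phi> \<in> ?E" "\<phi> \<in> DL1_step M h" for \<phi>
      unfolding T1_def
      by (rule kind_fun_limit_bound[OF G1[OF that(1)] G2[OF that(1)] DL1_dual_translate_bound[OF C(2) h C(1) that]])
    have 2: "norm (Q \<phi>) \<le> (2 * C) * DL1_norm M h \<phi>" if "\<phi> \<in> ?E" "\<phi> \<in> DL1_step M h" for \<phi>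
      using 1[OF that] C(2)[OF that] norm_triangle_ineq4[of "T \<phi>" "T1 \<phi>"] by (simp add: Q_def)
    show "(\<exists>C\<ge>0. \<forall>\<phi>\<in>?E \<inter> DL1_step M h. norm (T1 \<phi>) \<le> C * DL1_norm M h \<phi>) \<and>
      (\<exists>C\<ge>0. \<forall>\<phi>\<in>?E \<inter> DL1_step M h. norm (Q \<phi>) \<le> C * DL1_norm M h \<phi>)"
      using C(1) 1 2 by (intro conjI exI[of _ C] exI[of _ "2 * C"]) auto
  qed
  have T1d: "T1 \<in> DL1_dual c M" unfolding DL1_dual_iff
    by (rule conjI[OF linT1 at_scales_mono[OF sc' conjunct1]])
  have Qd: "Q \<in> DL1_dual c M" unfolding DL1_dual_iff
    by (rule conjI[OF linQ at_scales_mono[OF sc' conjunct2]])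
  have "convol T1 \<phi> \<in> kind_fun k" if "\<phi> \<in> D_space c M" for \<phi>
  proof -
    have "(\<lambda>t. \<phi> (- t)) \<in> ?E" by (rule D_space_DL1_space[OF D_space_reflect[OF that]])
    then show ?thesis using G1 tT1 by (simp add: convol_translate[abs_def])
  qed
  then have "T1 \<in> B_kind k c M" using T1d by (simp add: B_kind_def)
  moreover have "Q \<in> B_plus0 c M"
    unfolding B_plus0_def
  proof (intro CollectI conjI Qd ballI)
    fix \<phi> assume "\<phi> \<in> D_space c M"
    then have \<phi>: "\<phi> \<in> ?E" by (rule D_space_DL1_space)
    have "translate h Q \<phi> = translate h T \<phi> - G \<phi> h" for h
      using tT1[OF \<phi>, of h] by (simp add: translate_def Q_def)
    then show "((\<lambda>h. translate h Q \<phi>) \<longlongrightarrow> 0) at_top" using G2[OF \<phi>] by simp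
  qed
  moreover have "T \<phi> = T1 \<phi> + Q \<phi>" for \<phi> by (simp add: Q_def)
  ultimately show ?thesis unfolding assertion_vii_def B_asymp_def using T by blast
qed

end

section \<open>Approximation by smooth functions\<close>

lemma conv_add_right:
  assumes "integrable lborel k" "\<phi> \<in> DL1" "\<psi> \<in> DL1"
  shows "conv k (\<lambda>t. \<phi> t + \<psi> t) = (\<lambda>s. conv k \<phi> s + conv k \<psi> s)"
  using conv_integrable_DL1[OF assms(1,2), of 0] conv_integrable_DL1[OF assms(1,3), of 0]
  by (simp add: conv_def distrib_left fun_eq_iff)

lemma conv_cmult_right: "conv k (\<lambda>t. a * \<phi> t) = (\<lambda>s. a * conv k \<phi> s)"
  by (rule ext) (simp add: conv_def mult.left_commute[of _ a])

context weight_sequence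
begin

lemma translation_step_remainder:
  assumes w: "w \<in> DL1" "nderiv 2 w \<in> DL1_step M h" "h > 0"
  shows "(\<lambda>s. w (s - y) - w s + complex_of_real y * nderiv 1 w s) \<in> DL1_step M h" (is "?e \<in> _")
    and "DL1_norm M h (\<lambda>s. w (s - y) - w s + complex_of_real y * nderiv 1 w s) \<le> y\<^sup>2 * DL1_norm M h (nderiv 2 w)"
proof -
  note w1 = DL1_nderiv[OF w(1), of 1]
  have ws: "(\<lambda>s. w (s - y)) \<in> DL1" using DL1_affine[OF w(1), of 1 "- y"] by simp
  note d = DL1_diff[OF ws w(1)] and c = DL1_cmult[OF w1, of "complex_of_real y"]
  have e: "?e \<in> DL1" by (rule DL1_add[OF d c])
  have "L1 (nderiv p ?e) \<le> y\<^sup>2 * L1 (nderiv p (nderiv 2 w))" for p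
  proof -
    have "nderiv p ?e = (\<lambda>s. nderiv p w (s - y) - nderiv p w s + complex_of_real y * nderiv 1 (nderiv p w) s)"
      unfolding nderiv_add(2)[OF DL1_smooth[OF d] DL1_smooth[OF c]] nderiv_diff[OF DL1_smooth[OF ws] DL1_smooth[OF w(1)]]
        nderiv_cmult(2)[OF DL1_smooth[OF w1]]
      using nderiv_affine(2)[OF DL1_smooth[OF w(1)], of p 1 "- y"] by (simp add: nderiv_nderiv)
    then show ?thesis
      using translation_L1_remainder[OF DL1_nderiv[OF w(1)], of p y] by (simp add: nderiv_nderiv add.commute)
  qed
  from DL1_step_dominated[OF e this w(2,3)]
  show "?e \<in> DL1_step M h" "DL1_norm M h ?e \<le> y\<^sup>2 * DL1_norm M h (nderiv 2 w)" by simp_all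
qed

text \<open>The Taylor remainder of a translate is quadratically small in the norm of a step.\<close>

lemma translate_has_vector_derivative:
  fixes T :: "(real \<Rightarrow> complex) \<Rightarrow> 'a::complex_banach"
  assumes T: "T \<in> DL1_dual c M" and w: "w \<in> DL1_space c M"
  shows "((\<lambda>x. translate x T w) has_vector_derivative - translate x T (nderiv 1 w)) (at x)"
proof -
  obtain h C where h: "h > 0" "C \<ge> 0" "w \<in> DL1_step M h" "\<And>q. nderiv q w \<in> DL1_step M h"
    "\<And>\<psi>. \<psi> \<in> DL1_space c M \<Longrightarrow> \<psi> \<in> DL1_step M h \<Longrightarrow> norm (T \<psi>) \<le> C * DL1_norm M h \<psi>"
    by (rule DL1_dual_bound_deriv[OF T w]) blast
  note wD = DL1_space_DL1[OF w] and w1 = DL1_space_nderiv[OF w, of 1] and lin = DL1_dual_linear[OF T]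
  show ?thesis
  proof (rule quadratic_remainder_has_vector_derivative[where C = "C * DL1_norm M h (nderiv 2 w)"])
    fix \<delta> :: real
    let ?e = "\<lambda>s. w (s - \<delta>) - w s + complex_of_real \<delta> * nderiv 1 w s"
    note e = translation_step_remainder[OF wD h(4)[of 2] h(1), of \<delta>]
    note s1 = DL1_space_shift[OF w] and s2 = DL1_space_cmult[OF w1, of "complex_of_real \<delta>"]
    have eE: "?e \<in> DL1_space c M" by (rule DL1_space_add[OF DL1_space_diff[OF s1 w] s2])
    have "translate x T ?e = translate x T (\<lambda>s. w (s - \<delta>) - w s) + translate x T (\<lambda>s. complex_of_real \<delta> * nderiv 1 w s)"
      unfolding translate_def
      by (rule linear_map_on_add[OF lin DL1_space_shift[OF DL1_space_diff[OF s1 w]] DL1_space_shift[OF s2]])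
    also have "translate x T (\<lambda>s. w (s - \<delta>) - w s) = translate (x + \<delta>) T w - translate x T w"
      unfolding translate_diff[OF T s1 w] translate_add ..
    also have "translate x T (\<lambda>s. complex_of_real \<delta> * nderiv 1 w s) = \<delta> *\<^sub>R translate x T (nderiv 1 w)"
      unfolding translate_def scaleC_of_real[symmetric]
      by (rule linear_map_on_cmult[OF lin DL1_space_shift[OF w1]])
    finally have eq: "translate (x + \<delta>) T w - translate x T w - \<delta> *\<^sub>R - translate x T (nderiv 1 w) = translate x T ?e"
      by simp
    have "norm (translate x T ?e) \<le> C * DL1_norm M h ?e"
      by (rule DL1_dual_translate_bound[OF h(5,1,2) eE e(1)])
    also have "\<dots> \<le> C * (\<delta>\<^sup>2 * DL1_norm M h (nderiv 2 w))" by (rule mult_left_mono[OF e(2) h(2)])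
    finally show "norm (translate (x + \<delta>) T w - translate x T w - \<delta> *\<^sub>R - translate x T (nderiv 1 w))
        \<le> C * DL1_norm M h (nderiv 2 w) * \<delta>\<^sup>2"
      unfolding eq by (simp add: mult_ac)
  qed
qed

lemma translate_smooth:
  fixes T :: "(real \<Rightarrow> complex) \<Rightarrow> 'a::complex_banach"
  assumes T: "T \<in> DL1_dual c M" and w: "w \<in> DL1_space c M"
  shows "smooth (\<lambda>x. translate x T w)"
    and "nderiv p (\<lambda>x. translate x T w) = (\<lambda>x. (- 1) ^ p *\<^sub>R translate x T (nderiv p w))"
proof -
  let ?F = "\<lambda>p x. (- 1) ^ p *\<^sub>R translate x T (nderiv p w)"
  have d: "(?F p has_vector_derivative ?F (Suc p) x) (at x)" for p x
  proof -
    have "(?F p has_vector_derivative (- 1) ^ p *\<^sub>R - translate x T (nderiv 1 (nderiv p w))) (at x)"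
      by (rule bounded_linear.has_vector_derivative[OF bounded_linear_scaleR_right
            translate_has_vector_derivative[OF T DL1_space_nderiv[OF w]]])
    then show ?thesis by (simp add: nderiv_nderiv)
  qed
  show "smooth (\<lambda>x. translate x T w)" "nderiv p (\<lambda>x. translate x T w) = ?F p"
    by (rule smooth_by_derivatives[of ?F, OF _ d]; simp)+
qed

text \<open>A function of Beurling type has derivatives that are small at every scale, so its orbit is
  ultradifferentiable in both cases.\<close>

lemma translate_E_space:
  fixes T :: "(real \<Rightarrow> complex) \<Rightarrow> 'a::complex_banach"
  assumes T: "T \<in> DL1_dual c M" and w: "w \<in> DL1_space Beurling M"
  shows "(\<lambda>x. translate x T w) \<in> E_space c M"
proof -
  have wc: "w \<in> DL1_space c M" by (rule DL1_space_Beurling[OF w])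
  obtain A H where AH: "A > 1" "H > 1" "\<And>p q. M (p + q) \<le> A * H ^ (p + q) * (M p * M q)"
    by (rule M_stability) blast
  obtain h0 C where h0: "h0 > 0" "C \<ge> 0"
    "\<And>\<psi>. \<psi> \<in> DL1_space c M \<Longrightarrow> \<psi> \<in> DL1_step M h0 \<Longrightarrow> norm (T \<psi>) \<le> C * DL1_norm M h0 \<psi>"
    by (rule DL1_dual_bound[OF T wc zero_less_one]) blast
  have bd: "bdd_above ((\<lambda>(p, t). h1 ^ p * norm (nderiv p (\<lambda>x. translate x T w) t) / M p) ` (UNIV \<times> K))"
    if h1: "h1 > 0" for h1 and K :: "real set"
  proof (rule bdd_aboveI, clarify)
    fix p and t :: real
    define h where "h = max h0 h1"
    have h: "h > 0" "h0 \<le> h" "h1 \<le> h" using h1 h0(1) by (auto simp: h_def)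
    have wh: "w \<in> DL1_step M (H * h)" using w h(1) AH(2) by (auto simp: DL1_space_def)
    let ?N = "DL1_norm M (H * h) w"
    have N: "0 \<le> ?N" using DL1_norm_nonneg[OF wh] AH(2) h(1) by simp
    note n = nderiv_DL1_step[OF AH wh h(1), of p]
    note n0 = DL1_step_mono[OF n(1) h0(1) h(2)]
    have "norm (translate t T (nderiv p w)) \<le> C * DL1_norm M h0 (nderiv p w)"
      by (rule DL1_dual_translate_bound[OF h0(3,1,2) DL1_space_nderiv[OF wc] n0(1)])
    also have "\<dots> \<le> C * (A * M p / h ^ p * ?N)"
      by (rule mult_left_mono[OF order_trans[OF n0(2) n(2)] h0(2)])
    finally have "h1 ^ p * norm (translate t T (nderiv p w)) / M p \<le> h1 ^ p * (C * (A * M p / h ^ p * ?N)) / M p"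
      using h1 M_nonneg[of p] by (intro divide_right_mono mult_left_mono) auto
    also have "\<dots> = C * A * ?N * (h1 ^ p / h ^ p)" using M_pos[of p] by simp
    also have "\<dots> \<le> C * A * ?N * 1"
      using h h1 h0(2) AH(1) N by (intro mult_left_mono) (auto simp: divide_le_eq_1 intro: power_mono)
    finally show "h1 ^ p * norm (nderiv p (\<lambda>x. translate x T w) t) / M p \<le> C * A * DL1_norm M (H * max h0 h1) w"
      by (simp add: translate_smooth(2)[OF T wc] h_def)
  qed
  show ?thesis
    unfolding E_space_def mem_Collect_eq Let_def
  proof (intro conjI allI impI translate_smooth(1)[OF T wc])
    fix K :: "real set"
    let ?bd = "\<lambda>h. bdd_above ((\<lambda>(p, t). h ^ p * norm (nderiv p (\<lambda>x. translate x T w) t) / M p) ` (UNIV \<times> K))"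
    show "case c of Beurling \<Rightarrow> \<forall>h>0. ?bd h | Roumieu \<Rightarrow> \<exists>h>0. ?bd h"
    proof (cases c)
      case Beurling
      then show ?thesis using bd by simp
    next
      case Roumieu
      have "\<exists>h>0. ?bd h" by (intro exI[of _ 1] conjI bd) simp_all
      then show ?thesis using Roumieu by simp
    qed
  qed
qed

text \<open>In the inductive limit, boundedness is defined through all continuous seminorms, so it need
  not be localised in a single step: it suffices to exhibit a seminorm that dominates the
  quantity of interest.\<close>

lemma DL1_bounded_seminorm:
  assumes B: "DL1_bounded c M B" and q: "seminorm_on (DL1_space c M) q"
    and bd: "at_scales c (\<lambda>h. \<exists>C\<ge>0. \<forall>\<phi>\<in>DL1_space c M \<inter> DL1_step M h. q \<phi> \<le> C * DL1_norm M h \<phi>)"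
  obtains C where "\<And>\<phi>. \<phi> \<in> B \<Longrightarrow> q \<phi> \<le> C"
proof (cases c)
  case Beurling
  then obtain h C where h: "h > 0" "C \<ge> 0" "\<And>\<phi>. \<phi> \<in> DL1_space c M \<inter> DL1_step M h \<Longrightarrow> q \<phi> \<le> C * DL1_norm M h \<phi>"
    using bd by (auto simp: at_scales_def)
  have "DL1_norm M h \<in> DL1_seminorms c M" using Beurling h(1) by (auto simp: DL1_seminorms_def)
  then have "bdd_above (DL1_norm M h ` B)" using B by (simp add: DL1_bounded_def)
  then obtain K where K: "\<And>\<phi>. \<phi> \<in> B \<Longrightarrow> DL1_norm M h \<phi> \<le> K" unfolding bdd_above_def by blast
  have "q \<phi> \<le> C * K" if "\<phi> \<in> B" for \<phi>
  proof -
    have \<phi>: "\<phi> \<in> DL1_space c M" using B that by (auto simp: DL1_bounded_def)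
    then have "\<phi> \<in> DL1_step M h" using Beurling h(1) by (auto simp: DL1_space_def)
    then have "q \<phi> \<le> C * DL1_norm M h \<phi>" using h(3) \<phi> by simp
    also have "\<dots> \<le> C * K" by (rule mult_left_mono[OF K[OF that] h(2)])
    finally show ?thesis .
  qed
  then show thesis by (rule that)
next
  case Roumieu
  have "\<exists>C. \<forall>\<phi>\<in>DL1_step M h. q \<phi> \<le> C * DL1_norm M h \<phi>" if h: "h > 0" for h
  proof -
    obtain C where "\<forall>\<phi>\<in>DL1_space c M \<inter> DL1_step M h. q \<phi> \<le> C * DL1_norm M h \<phi>"
      using at_scales_Roumieu[OF bd Roumieu h] by blast
    moreover have "DL1_step M h \<subseteq> DL1_space c M" using h Roumieu by (auto simp: DL1_space_def)
    ultimately show ?thesis by blast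
  qed
  then have "q \<in> DL1_seminorms c M" using q Roumieu by (simp add: DL1_seminorms_def)
  then have "bdd_above (q ` B)" using B by (simp add: DL1_bounded_def)
  then obtain C where "\<And>\<phi>. \<phi> \<in> B \<Longrightarrow> q \<phi> \<le> C" unfolding bdd_above_def by blast
  then show thesis by (rule that)
qed

text \<open>A continuous seminorm is bounded by the norm of one step that contains \<open>\<phi>\<close>, and this norm is invariant
  under translations.\<close>

lemma DL1_bounded_shifts:
  assumes \<phi>: "\<phi> \<in> DL1_space c M"
  shows "DL1_bounded c M (range (\<lambda>x t. \<phi> (t - x)))"
  unfolding DL1_bounded_def
proof (intro conjI ballI)
  show "range (\<lambda>x t. \<phi> (t - x)) \<subseteq> DL1_space c M" using DL1_space_shift[OF \<phi>] by auto
  fix p assume p: "p \<in> DL1_seminorms c M"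
  have "at_scales c (\<lambda>h. \<exists>C\<ge>0. \<forall>q\<in>{p}. \<forall>\<phi>\<in>DL1_space c M \<inter> DL1_step M h. q \<phi> \<le> C * DL1_norm M h \<phi>)"
    by (rule finite_seminorms_bound) (use p in auto)
  then obtain h where h: "h > 0" "\<exists>C\<ge>0. \<forall>q\<in>{p}. \<forall>\<phi>\<in>DL1_space c M \<inter> DL1_step M h. q \<phi> \<le> C * DL1_norm M h \<phi>"
    "\<phi> \<in> DL1_step M (1 * h)"
    by (rule at_scales_DL1_space[OF _ \<phi> zero_less_one]) blast
  then obtain C where C: "C \<ge> 0" "\<And>\<phi>. \<phi> \<in> DL1_space c M \<Longrightarrow> \<phi> \<in> DL1_step M h \<Longrightarrow> p \<phi> \<le> C * DL1_norm M h \<phi>" by blast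
  have \<phi>h: "\<phi> \<in> DL1_step M h" using h(3) by simp
  have "p (\<lambda>t. \<phi> (t - x)) \<le> C * DL1_norm M h \<phi>" for x
  proof -
    have s: "(\<lambda>t. \<phi> (t - x)) \<in> DL1_step M h" "DL1_norm M h (\<lambda>t. \<phi> (t - x)) \<le> DL1_norm M h \<phi>"
      using DL1_step_isometry[OF \<phi>h h(1), of 1 "- x"] by simp_all
    have "p (\<lambda>t. \<phi> (t - x)) \<le> C * DL1_norm M h (\<lambda>t. \<phi> (t - x))"
      by (rule C(2)[OF DL1_space_shift[OF \<phi>] s(1)])
    also have "\<dots> \<le> C * DL1_norm M h \<phi>" by (rule mult_left_mono[OF s(2) C(1)])
    finally show ?thesis .
  qed
  then show "bdd_above (p ` range (\<lambda>x t. \<phi> (t - x)))" by (intro bdd_aboveI) auto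
qed

text \<open>Convergence uniform on the bounded set of translates of \<open>\<phi>\<close> is uniform convergence of orbits.\<close>

lemma assertion_ix_imp_x:
  fixes T :: "(real \<Rightarrow> complex) \<Rightarrow> 'a::complex_banach"
  assumes ix: "assertion_ix k c M T" and T: "T \<in> DL1_dual c M"
  shows "assertion_x k c M T"
  unfolding assertion_x_iff
proof
  fix \<phi> assume \<phi>: "\<phi> \<in> D_space c M"
  note \<phi>E = D_space_DL1_space[OF \<phi>]
  obtain u U where u: "\<And>n. u n \<in> asymp_fun k" and U: "\<And>n. U n \<in> DL1_dual c M"
    and eq: "\<And>n \<phi>. \<phi> \<in> D_space c M \<Longrightarrow> U n \<phi> = regular (u n) \<phi>" and lim: "DL1_dual_tendsto c M U T"
    using ix unfolding assertion_ix_def by blast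
  obtain a b where ab: "\<And>t. t \<notin> {a..b} \<Longrightarrow> \<phi> t = 0" by (rule D_space_support[OF \<phi>]) blast
  have tr: "translate x (U n) \<phi> = translate x (regular (u n)) \<phi>" for x n
    unfolding translate_def by (rule eq[OF D_space_shift[OF \<phi>]])
  have "(\<lambda>x. translate x (regular (u n)) \<phi>) \<in> asymp_fun k" for n
    by (rule asymp_fun_translate_regular[OF u \<phi>E ab])
      (use translate_continuous_bounded(1)[OF U \<phi>E, of n] in \<open>simp_all add: tr\<close>)
  then have F: "(\<lambda>x. translate x (U n) \<phi>) \<in> asymp_fun k" for n by (simp add: tr)
  have "uniform_limit (range (\<lambda>x t. \<phi> (t - x))) U T sequentially"
    using lim DL1_bounded_shifts[OF \<phi>E] unfolding DL1_dual_tendsto_def by blast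
  then have "uniform_limit {0..} (\<lambda>n x. translate x (U n) \<phi>) (\<lambda>x. translate x T \<phi>) sequentially"
    unfolding uniform_limit_iff translate_def by (fast elim: eventually_mono)
  from asymp_fun_uniform_limit[OF F translate_continuous_bounded(1)[OF T \<phi>E] this]
  show "(\<lambda>x. translate x T \<phi>) \<in> asymp_fun k" .
qed

lemma conv_dual:
  fixes T :: "(real \<Rightarrow> complex) \<Rightarrow> 'a::complex_banach"
  assumes T: "T \<in> DL1_dual c M" and k: "integrable lborel k"
  shows "(\<lambda>\<phi>. T (conv k \<phi>)) \<in> DL1_dual c M"
  unfolding DL1_dual_iff
proof
  note lin = DL1_dual_linear[OF T] and kE = conv_DL1_space[OF k]
  show "linear_map_on (DL1_space c M) (\<lambda>\<phi>. T (conv k \<phi>))"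
    unfolding linear_map_on_def
    using linear_map_on_add[OF lin kE kE] linear_map_on_cmult[OF lin kE] conv_add_right[OF k DL1_space_DL1 DL1_space_DL1]
    by (simp add: conv_cmult_right)
  have "at_scales c (\<lambda>h. \<exists>C\<ge>0. \<forall>\<phi>\<in>DL1_space c M \<inter> DL1_step M h. norm (T \<phi>) \<le> C * DL1_norm M h \<phi>)"
    using T DL1_dual_iff by blast
  then show "at_scales c (\<lambda>h. \<exists>C\<ge>0. \<forall>\<phi>\<in>DL1_space c M \<inter> DL1_step M h. norm (T (conv k \<phi>)) \<le> C * DL1_norm M h \<phi>)"
  proof (rule at_scales_mono)
    fix h :: real assume h: "h > 0" and "\<exists>C\<ge>0. \<forall>\<phi>\<in>DL1_space c M \<inter> DL1_step M h. norm (T \<phi>) \<le> C * DL1_norm M h \<phi>"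
    then obtain C where C: "C \<ge> 0" "\<And>\<phi>. \<phi> \<in> DL1_space c M \<Longrightarrow> \<phi> \<in> DL1_step M h \<Longrightarrow> norm (T \<phi>) \<le> C * DL1_norm M h \<phi>"
      by blast
    have "norm (T (conv k \<phi>)) \<le> (C * L1 k) * DL1_norm M h \<phi>" if "\<phi> \<in> DL1_space c M \<inter> DL1_step M h" for \<phi>
    proof -
      have \<phi>: "\<phi> \<in> DL1_space c M" "\<phi> \<in> DL1_step M h" using that by auto
      have "norm (T (conv k \<phi>)) \<le> C * DL1_norm M h (conv k \<phi>)"
        by (rule C(2)[OF kE[OF \<phi>(1)] conv_DL1_step(1)[OF k \<phi>(2) h]])
      also have "\<dots> \<le> C * (L1 k * DL1_norm M h \<phi>)"
        by (rule mult_left_mono[OF conv_DL1_step(2)[OF k \<phi>(2) h] C(1)])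
      finally show ?thesis by (simp add: mult.assoc)
    qed
    then show "\<exists>C\<ge>0. \<forall>\<phi>\<in>DL1_space c M \<inter> DL1_step M h. norm (T (conv k \<phi>)) \<le> C * DL1_norm M h \<phi>"
      using C(1) L1_nonneg[of k] by (intro exI[of _ "C * L1 k"]) auto
  qed
qed

end

lemma seminorm_on_SUP:
  fixes p :: "nat \<Rightarrow> (real \<Rightarrow> complex) \<Rightarrow> real"
  assumes p: "\<And>n. seminorm_on E (p n)" and bd: "\<And>\<phi>. \<phi> \<in> E \<Longrightarrow> bdd_above (range (\<lambda>n. p n \<phi>))"
    and E: "\<And>a \<phi>. \<phi> \<in> E \<Longrightarrow> (\<lambda>t. a * \<phi> t) \<in> E"
  shows "seminorm_on E (\<lambda>\<phi>. SUP n. p n \<phi>)"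
proof -
  let ?q = "\<lambda>\<phi>. SUP n. p n \<phi>"
  have up: "p n \<phi> \<le> ?q \<phi>" if "\<phi> \<in> E" for n \<phi> by (rule cSUP_upper[OF UNIV_I bd[OF that]])
  have nn: "0 \<le> ?q \<phi>" if "\<phi> \<in> E" for \<phi>
    using up[OF that, of 0] p[of 0] that unfolding seminorm_on_def by force
  have hom: "p n (\<lambda>t. a * \<phi> t) = cmod a * p n \<phi>" if "\<phi> \<in> E" for n a \<phi>
    using p[of n] that unfolding seminorm_on_def by blast
  have le: "?q (\<lambda>t. a * \<phi> t) \<le> cmod a * ?q \<phi>" if "\<phi> \<in> E" for a \<phi>
    by (rule cSUP_least) (auto simp: hom[OF that] intro!: mult_left_mono up[OF that])
  have ge: "cmod a * ?q \<phi> \<le> ?q (\<lambda>t. a * \<phi> t)" if "\<phi> \<in> E" for a \<phi>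
  proof (cases "a = 0")
    case True
    then show ?thesis using nn[OF E[OF that], of a] by simp
  next
    case False
    have "?q (\<lambda>t. (1 / a) * (a * \<phi> t)) \<le> cmod (1 / a) * ?q (\<lambda>t. a * \<phi> t)" by (rule le[OF E[OF that]])
    then show ?thesis using False by (simp add: norm_divide field_simps)
  qed
  have tri: "?q (\<lambda>t. \<phi> t + \<psi> t) \<le> ?q \<phi> + ?q \<psi>" if "\<phi> \<in> E" "\<psi> \<in> E" for \<phi> \<psi>
  proof (rule cSUP_least)
    fix n
    have "p n (\<lambda>t. \<phi> t + \<psi> t) \<le> p n \<phi> + p n \<psi>" using p[of n] that unfolding seminorm_on_def by blast
    then show "p n (\<lambda>t. \<phi> t + \<psi> t) \<le> ?q \<phi> + ?q \<psi>" using up[OF that(1), of n] up[OF that(2), of n] by linarith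
  qed simp
  show ?thesis
    unfolding seminorm_on_def
  proof (intro conjI ballI allI)
    show "?q (\<lambda>t. a * \<phi> t) = cmod a * ?q \<phi>" if "\<phi> \<in> E" for a \<phi>
      by (rule antisym[OF le[OF that] ge[OF that]])
  qed (use nn tri in blast)+
qed

context nonquasianalytic
begin

text \<open>The approximants are orbits of the mollifiers, acting by \<open>U n \<phi> = T (conv (\<rho> n) \<phi>)\<close>. That the convergence
  is uniform on bounded sets is expressed by the single continuous seminorm
  \<open>SUP n. (n + 1) * norm (T (conv (\<rho> n) \<phi> - \<phi>))\<close>, whose boundedness yields the rate \<open>1 / (n + 1)\<close>.\<close>

lemma assertion_x_imp_ix:
  fixes T :: "(real \<Rightarrow> complex) \<Rightarrow> 'a::complex_banach"
  assumes x: "assertion_x k c M T" and T: "T \<in> DL1_dual c M"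
  shows "assertion_ix k c M T"
proof -
  let ?E = "DL1_space c M"
  obtain \<rho> B where \<rho>: "\<And>n. \<rho> n \<in> DL1_space Beurling M"
    "\<And>n t. t \<notin> {0..1 / real (Suc n)} \<Longrightarrow> \<rho> n t = 0" "\<And>n. (LINT t|lborel. \<rho> n t) = 1" "\<And>n. L1 (\<rho> n) \<le> B"
    by (rule mollifier) blast
  have \<rho>E: "\<rho> n \<in> ?E" for n by (rule DL1_space_Beurling[OF \<rho>(1)])
  have \<rho>D: "\<rho> n \<in> D_space c M" for n unfolding D_space_iff using \<rho>E \<rho>(2) by blast
  have \<rho>i: "integrable lborel (\<rho> n)" for n by (rule DL1_integrable0[OF DL1_space_DL1[OF \<rho>(1)]])
  have B: "0 \<le> B" using \<rho>(4)[of 0] L1_nonneg[of "\<rho> 0"] by linarith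
  define u where "u n x = translate x T (\<rho> n)" for n x
  define U where "U n \<phi> = T (conv (\<rho> n) \<phi>)" for n \<phi>
  have u: "u n \<in> E_space c M \<inter> asymp_fun k" for n
    using translate_E_space[OF T \<rho>(1)] x \<rho>D unfolding u_def[abs_def] assertion_x_iff by blast
  have U: "U n \<in> DL1_dual c M" for n unfolding U_def[abs_def] by (rule conv_dual[OF T \<rho>i])
  have eq: "U n \<phi> = regular (u n) \<phi>" if "\<phi> \<in> D_space c M" for n \<phi>
    using regular_translates[OF T \<rho>E DL1_space_DL1[OF D_space_DL1_space[OF that]], of n]
    unfolding U_def u_def[abs_def] translate_def conv_commute[of \<phi>] by simp
  define p where "p n \<phi> = real (Suc n) * norm (T (\<lambda>s. conv (\<rho> n) \<phi> s - \<phi> s))" for n \<phi>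
  note lin = DL1_dual_linear[OF T]
  have dE: "(\<lambda>s. conv (\<rho> n) \<phi> s - \<phi> s) \<in> ?E" if "\<phi> \<in> ?E" for n \<phi>
    by (rule DL1_space_diff[OF conv_DL1_space[OF \<rho>i that] that])
  have psn: "seminorm_on ?E (p n)" for n
    unfolding seminorm_on_def
  proof (intro conjI ballI allI)
    fix \<phi> assume \<phi>: "\<phi> \<in> ?E"
    show "0 \<le> p n \<phi>" by (simp add: p_def)
    show "p n (\<lambda>t. a * \<phi> t) = cmod a * p n \<phi>" for a
      using linear_map_on_cmult[OF lin dE[OF \<phi>], of a n]
      by (simp add: p_def conv_cmult_right right_diff_distrib[symmetric] norm_scaleC)
    fix \<psi> assume \<psi>: "\<psi> \<in> ?E"
    have "T (\<lambda>s. conv (\<rho> n) (\<lambda>t. \<phi> t + \<psi> t) s - (\<phi> s + \<psi> s)) =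
        T (\<lambda>s. conv (\<rho> n) \<phi> s - \<phi> s) + T (\<lambda>s. conv (\<rho> n) \<psi> s - \<psi> s)"
      using linear_map_on_add[OF lin dE[OF \<phi>] dE[OF \<psi>], of n n]
      by (simp add: conv_add_right[OF \<rho>i DL1_space_DL1[OF \<phi>] DL1_space_DL1[OF \<psi>]] algebra_simps)
    then show "p n (\<lambda>t. \<phi> t + \<psi> t) \<le> p n \<phi> + p n \<psi>"
      unfolding p_def distrib_left[symmetric]
      by (intro mult_left_mono) (simp_all add: norm_triangle_ineq)
  qed
  obtain A H where AH: "A > 1" "H > 1" "\<And>p q. M (p + q) \<le> A * H ^ (p + q) * (M p * M q)"
    by (rule M_stability) blast
  have "at_scales c (\<lambda>h. \<exists>C\<ge>0. \<forall>\<phi>\<in>?E \<inter> DL1_step M h. norm (T \<phi>) \<le> C * DL1_norm M h \<phi>)"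
    using T DL1_dual_iff by blast
  then have sc: "at_scales c (\<lambda>h. \<exists>C\<ge>0. \<forall>\<phi>\<in>?E \<inter> DL1_step M h. \<forall>n. p n \<phi> \<le> C * DL1_norm M h \<phi>)"
  proof (rule at_scales_rescale[of _ _ H])
    show "H > 0" using AH(2) by simp
    fix h :: real assume h: "h > 0" and "\<exists>C\<ge>0. \<forall>\<phi>\<in>?E \<inter> DL1_step M h. norm (T \<phi>) \<le> C * DL1_norm M h \<phi>"
    then obtain C where C: "C \<ge> 0" "\<And>\<phi>. \<phi> \<in> ?E \<Longrightarrow> \<phi> \<in> DL1_step M h \<Longrightarrow> norm (T \<phi>) \<le> C * DL1_norm M h \<phi>"
      by blast
    let ?C = "C * B * (A * M 1 / h)"
    have "p n \<phi> \<le> ?C * DL1_norm M (H * h) \<phi>" if \<phi>: "\<phi> \<in> ?E" "\<phi> \<in> DL1_step M (H * h)" for n \<phi>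
    proof -
      note d = nderiv_DL1_step[OF AH \<phi>(2) h, of 1]
      have N: "0 \<le> DL1_norm M h (nderiv 1 \<phi>)" by (rule DL1_norm_nonneg[OF d(1) h])
      have dn: "0 \<le> 1 / real (Suc n)" by (intro divide_nonneg_nonneg) auto
      have sup: "\<bar>t - 0\<bar> \<le> 1 / real (Suc n)" if "\<rho> n t \<noteq> 0" for t using \<rho>(2)[of t n] that by force
      have "(\<lambda>s. conv (\<rho> n) \<phi> s - (LINT t|lborel. \<rho> n t) * \<phi> (s - 0)) = (\<lambda>s. conv (\<rho> n) \<phi> s - \<phi> s)"
        using \<rho>(3) by simp
      note e = conv_concentrated_step[OF \<rho>i sup dn DL1_space_DL1[OF \<phi>(1)] d(1) h, of n, unfolded this]
      have "norm (T (\<lambda>s. conv (\<rho> n) \<phi> s - \<phi> s)) \<le> C * DL1_norm M h (\<lambda>s. conv (\<rho> n) \<phi> s - \<phi> s)"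
        by (rule C(2)[OF dE[OF \<phi>(1)] e(1)])
      also have "\<dots> \<le> C * (L1 (\<rho> n) * (1 / real (Suc n)) * DL1_norm M h (nderiv 1 \<phi>))"
        by (rule mult_left_mono[OF e(2) C(1)])
      also have "\<dots> \<le> C * (B * (1 / real (Suc n)) * DL1_norm M h (nderiv 1 \<phi>))"
        using C(1) N by (intro mult_left_mono mult_right_mono \<rho>(4)) auto
      finally have "p n \<phi> \<le> real (Suc n) * (C * (B * (1 / real (Suc n)) * DL1_norm M h (nderiv 1 \<phi>)))"
        unfolding p_def by (rule mult_left_mono) simp
      also have "\<dots> = C * B * DL1_norm M h (nderiv 1 \<phi>)" by simp
      also have "\<dots> \<le> C * B * (A * M 1 / h ^ 1 * DL1_norm M (H * h) \<phi>)"
        using C(1) B by (intro mult_left_mono d(2)) auto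
      finally show ?thesis by (simp add: mult.assoc)
    qed
    moreover have "0 \<le> ?C" using C(1) B AH(1) M_nonneg h by simp
    ultimately show "\<exists>C\<ge>0. \<forall>\<phi>\<in>?E \<inter> DL1_step M (H * h). \<forall>n. p n \<phi> \<le> C * DL1_norm M (H * h) \<phi>" by blast
  qed
  have pb: "bdd_above (range (\<lambda>n. p n \<phi>))" if \<phi>: "\<phi> \<in> ?E" for \<phi>
  proof -
    obtain h where "\<exists>C\<ge>0. \<forall>\<phi>\<in>?E \<inter> DL1_step M h. \<forall>n. p n \<phi> \<le> C * DL1_norm M h \<phi>" "\<phi> \<in> DL1_step M (1 * h)"
      by (rule at_scales_DL1_space[OF sc \<phi> zero_less_one]) blast
    then obtain C where "\<And>n. p n \<phi> \<le> C * DL1_norm M h \<phi>" using \<phi> by auto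
    then show ?thesis by (intro bdd_aboveI) auto
  qed
  let ?q = "\<lambda>\<phi>. SUP n. p n \<phi>"
  have qs: "seminorm_on ?E ?q" by (rule seminorm_on_SUP[OF psn pb DL1_space_cmult])
  have qb: "at_scales c (\<lambda>h. \<exists>C\<ge>0. \<forall>\<phi>\<in>?E \<inter> DL1_step M h. ?q \<phi> \<le> C * DL1_norm M h \<phi>)"
  proof (rule at_scales_mono[OF sc])
    fix h :: real assume "\<exists>C\<ge>0. \<forall>\<phi>\<in>?E \<inter> DL1_step M h. \<forall>n. p n \<phi> \<le> C * DL1_norm M h \<phi>"
    then obtain C where C: "C \<ge> 0" "\<And>\<phi> n. \<phi> \<in> ?E \<inter> DL1_step M h \<Longrightarrow> p n \<phi> \<le> C * DL1_norm M h \<phi>" by blast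
    have "?q \<phi> \<le> C * DL1_norm M h \<phi>" if "\<phi> \<in> ?E \<inter> DL1_step M h" for \<phi>
      by (rule cSUP_least) (use C(2)[OF that] in auto)
    then show "\<exists>C\<ge>0. \<forall>\<phi>\<in>?E \<inter> DL1_step M h. ?q \<phi> \<le> C * DL1_norm M h \<phi>" using C(1) by blast
  qed
  have "DL1_dual_tendsto c M U T"
    unfolding DL1_dual_tendsto_def
  proof (intro allI impI)
    fix Bs assume Bs: "DL1_bounded c M Bs"
    obtain C where C: "\<And>\<phi>. \<phi> \<in> Bs \<Longrightarrow> ?q \<phi> \<le> C" by (rule DL1_bounded_seminorm[OF Bs qs qb]) blast
    have le: "norm (U n \<phi> - T \<phi>) \<le> C / real (Suc n)" if "\<phi> \<in> Bs" for n \<phi>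
    proof -
      have \<phi>: "\<phi> \<in> ?E" using Bs that by (auto simp: DL1_bounded_def)
      have "p n \<phi> \<le> C" using cSUP_upper[OF UNIV_I pb[OF \<phi>], of n] C[OF that] by linarith
      moreover have "U n \<phi> - T \<phi> = T (\<lambda>s. conv (\<rho> n) \<phi> s - \<phi> s)"
        using DL1_dual_diff[OF T conv_DL1_space[OF \<rho>i \<phi>] \<phi>, of n] by (simp add: U_def)
      ultimately show ?thesis by (simp add: p_def field_simps)
    qed
    show "uniform_limit Bs U T sequentially"
    proof (rule uniform_limitI)
      fix e :: real assume e: "e > 0"
      have "(\<lambda>n. C * inverse (real (Suc n))) \<longlonglongrightarrow> C * 0"
        by (intro tendsto_mult_left LIMSEQ_inverse_real_of_nat)
      then have "\<forall>\<^sub>F n in sequentially. C / real (Suc n) < e"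
        using e by (intro order_tendstoD(2)[of _ 0]) (auto simp: divide_inverse)
      then show "\<forall>\<^sub>F n in sequentially. \<forall>\<phi>\<in>Bs. dist (U n \<phi>) (T \<phi>) < e"
        by eventually_elim (use le in \<open>auto simp: dist_norm intro: le_less_trans\<close>)
    qed
  qed
  then show ?thesis unfolding assertion_ix_def using u U eq by blast
qed

end

section \<open>Resolvent kernels of the derivative\<close>

text \<open>The density of the exponential distribution: it inverts \<open>1 + (1/a) d/dx\<close>.\<close>

definition exp_density :: "real \<Rightarrow> real \<Rightarrow> complex" where
  "exp_density a t = complex_of_real (indicator {0..} t * (a * exp (- a * t)))"

lemma exp_density_kernel:
  assumes "a > 0"
  shows "integrable lborel (exp_density a)" "L1 (exp_density a) = 1" "cmod (exp_density a t) \<le> a"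
proof -
  have lim: "((\<lambda>t. - exp (- a * t)) \<longlongrightarrow> 0) at_top"
  proof -
    have "filterlim (\<lambda>t. a * t) at_top at_top"
      using assms by (intro filterlim_tendsto_pos_mult_at_top[OF tendsto_const _ filterlim_ident])
    then have "filterlim (\<lambda>t. - (a * t)) at_bot at_top"
      by (simp add: filterlim_uminus_at_top)
    from filterlim_compose[OF exp_at_bot this] have "((\<lambda>t. exp (- (a * t))) \<longlongrightarrow> 0) at_top" .
    from tendsto_minus[OF this] show ?thesis by simp
  qed
  have "(\<integral>\<^sup>+t. ennreal (a * exp (- a * t)) * indicator {0..} t \<partial>lborel) = ennreal (0 - - exp (- a * 0))"
    by (rule nn_integral_FTC_atLeast[OF _ _ _ lim]) (use assms in \<open>auto intro!: derivative_eq_intros\<close>)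
  moreover have "ennreal (a * exp (- a * t)) * indicator {0..} t = ennreal (indicator {0..} t * (a * exp (- a * t)))" for t
    by (auto simp: indicator_def)
  ultimately have nn: "(\<integral>\<^sup>+t. ennreal (indicator {0..} t * (a * exp (- a * t))) \<partial>lborel) = ennreal 1" by simp
  have hb: "has_bochner_integral lborel (\<lambda>t. indicator {0..} t * (a * exp (- a * t))) 1"
    by (rule has_bochner_integral_nn_integral[OF _ _ _ nn]) (use assms in auto)
  then have i: "integrable lborel (\<lambda>t. indicator {0..} t * (a * exp (- a * t)))"
    and v: "(LINT t|lborel. indicator {0..} t * (a * exp (- a * t))) = 1"
    by (auto simp: has_bochner_integral_iff)
  show "integrable lborel (exp_density a)"
    unfolding exp_density_def[abs_def] by (rule integrable_of_real[OF i])
  have "cmod (exp_density a t) = indicator {0..} t * (a * exp (- a * t))" for t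
    unfolding exp_density_def norm_of_real using assms by (simp add: indicator_def)
  then show "L1 (exp_density a) = 1" unfolding L1_def using v by simp
  show "cmod (exp_density a t) \<le> a"
    unfolding exp_density_def norm_of_real using assms by (auto simp: indicator_def)
qed

text \<open>Integration by parts; the boundary term at \<open>0\<close> is the jump of the density.\<close>

lemma conv_exp_density_nderiv:
  assumes a: "a > 0" and \<phi>: "\<phi> \<in> DL1"
  shows "conv (exp_density a) (nderiv 1 \<phi>) s = complex_of_real a * (\<phi> s - conv (exp_density a) \<phi> s)"
proof -
  note k = exp_density_kernel[OF a]
  define g where "g t = complex_of_real a * (exp_density a t * \<phi> (s - t)) + exp_density a t * nderiv 1 \<phi> (s - t)" for t
  have i: "integrable lborel (\<lambda>t. exp_density a t * nderiv p \<phi> (s - t))" for p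
    by (rule conv_integrable_DL1[OF k(1) \<phi>])
  have gi: "integrable lborel g"
    unfolding g_def[abs_def] using i[of 0] i[of 1] by (intro Bochner_Integration.integrable_add integrable_mult_right) simp_all
  have gI: "(LINT t|lborel. g t) = complex_of_real a * conv (exp_density a) \<phi> s + conv (exp_density a) (nderiv 1 \<phi>) s"
    unfolding g_def[abs_def] conv_def
    using i[of 0] i[of 1] by (subst Bochner_Integration.integral_add) simp_all
  have part: "(LINT t|lborel. g t) - complex_of_real a * (\<phi> s - complex_of_real (exp (- a * real N)) * \<phi> (s - real N))
      = (LINT t|lborel. indicator {real N<..} t * g t)" for N :: nat
  proof -
    let ?F = "\<lambda>t. complex_of_real (- a * exp (- a * t)) * \<phi> (s - t)"
    let ?f = "\<lambda>t. complex_of_real (a * exp (- a * t)) * (complex_of_real a * \<phi> (s - t) + nderiv 1 \<phi> (s - t))"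
    have d: "(?F has_vector_derivative ?f t) (at t within {0..real N})" for t
    proof -
      have "((\<lambda>t. s - t) has_vector_derivative - 1) (at t)" by (auto intro!: derivative_eq_intros)
      from vector_diff_chain_at[OF this, of \<phi>] smooth_has_vector_derivative[OF DL1_smooth[OF \<phi>], of 0]
      have 1: "((\<lambda>t. \<phi> (s - t)) has_vector_derivative - nderiv 1 \<phi> (s - t)) (at t)" by (simp add: o_def)
      have 2: "((\<lambda>t. complex_of_real (- a * exp (- a * t))) has_vector_derivative complex_of_real (a * a * exp (- a * t))) (at t)"
        by (rule has_vector_derivative_of_real) (auto intro!: derivative_eq_intros)
      have ring: "(- A * E) * (- d) + (A * A * E) * p = (A * E) * (A * p + d)" for A E d p :: complex
        by (simp add: algebra_simps)
      have eq: "complex_of_real (- a * exp (- a * t)) * (- nderiv 1 \<phi> (s - t)) + complex_of_real (a * a * exp (- a * t)) * \<phi> (s - t) = ?f t"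
        unfolding of_real_mult of_real_minus by (rule ring)
      have "(?F has_vector_derivative (complex_of_real (- a * exp (- a * t)) * (- nderiv 1 \<phi> (s - t))
          + complex_of_real (a * a * exp (- a * t)) * \<phi> (s - t))) (at t)"
        by (rule has_vector_derivative_mult[OF 2 1])
      then show ?thesis unfolding eq by (rule has_vector_derivative_at_within)
    qed
    have \<phi>c: "continuous_on UNIV (nderiv p \<phi>)" for p by (rule smooth_continuous_on[OF DL1_smooth[OF \<phi>]])
    have c: "continuous_on {0..real N} ?f"
      by (intro continuous_intros continuous_on_compose2[OF \<phi>c[of 0, unfolded nderiv_0]] continuous_on_compose2[OF \<phi>c[of 1]]) auto
    have "(LINT t|lborel. indicator {0..real N} t *\<^sub>R ?f t) = ?F (real N) - ?F 0"
      by (rule integral_FTC_Icc[OF _ d c]) simp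
    moreover have "(LINT t|lborel. indicator {0..real N} t *\<^sub>R ?f t) = (LINT t|lborel. indicator {..real N} t * g t)"
      by (rule Bochner_Integration.integral_cong) (auto simp: g_def exp_density_def indicator_def algebra_simps)
    moreover have "(LINT t|lborel. g t) = (LINT t|lborel. indicator {..real N} t * g t) + (LINT t|lborel. indicator {real N<..} t * g t)"
    proof -
      have ia: "integrable lborel (\<lambda>t. indicator {..real N} t * g t)" "integrable lborel (\<lambda>t. indicator {real N<..} t * g t)"
        by (rule integrable_indicator_mult[OF gi]; simp)+
      show ?thesis
        unfolding Bochner_Integration.integral_add[OF ia, symmetric]
        by (rule Bochner_Integration.integral_cong) (auto simp: indicator_def)
    qed
    ultimately show ?thesis by (simp add: algebra_simps)
  qed
  have "(\<lambda>N. L1 (\<lambda>t. indicator {real N<..} t * g t)) \<longlonglongrightarrow> 0"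
  proof (rule L1_tail_tendsto[OF gi])
    fix t :: real
    obtain n0 :: nat where "t < real n0" using reals_Archimedean2 by blast
    then show "\<forall>\<^sub>F n in sequentially. t \<notin> {real n<..}"
      by (intro eventually_sequentiallyI[of n0]) auto
  qed auto
  then have "(\<lambda>N. LINT t|lborel. indicator {real N<..} t * g t) \<longlonglongrightarrow> 0"
    by (rule Lim_null_comparison[rotated]) (auto simp: L1_def intro!: always_eventually integral_norm_bound)
  then have l1: "(\<lambda>N. (LINT t|lborel. g t) - complex_of_real a * (\<phi> s - complex_of_real (exp (- a * real N)) * \<phi> (s - real N))) \<longlonglongrightarrow> 0"
    unfolding part .
  have e0: "(\<lambda>N. exp (- a * real N)) \<longlonglongrightarrow> 0"
  proof -
    have "(\<lambda>N. exp (- a) ^ N) \<longlonglongrightarrow> 0" using a by (intro LIMSEQ_realpow_zero) auto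
    then show ?thesis by (simp add: exp_of_nat_mult[symmetric] mult.commute)
  qed
  have "(\<lambda>N. complex_of_real (exp (- a * real N)) * \<phi> (s - real N)) \<longlonglongrightarrow> 0"
  proof (rule Lim_null_comparison[OF always_eventually[OF allI]])
    show "cmod (complex_of_real (exp (- a * real N)) * \<phi> (s - real N)) \<le> exp (- a * real N) * L1 (nderiv 1 \<phi>)" for N
      using DL1_sup_bound[OF \<phi>, of 0 "s - real N"] by (simp add: norm_mult)
    show "(\<lambda>N. exp (- a * real N) * L1 (nderiv 1 \<phi>)) \<longlonglongrightarrow> 0"
      using tendsto_mult_right[OF e0, of "L1 (nderiv 1 \<phi>)"] by simp
  qed
  then have "(\<lambda>N. (LINT t|lborel. g t) - complex_of_real a * (\<phi> s - complex_of_real (exp (- a * real N)) * \<phi> (s - real N)))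
      \<longlonglongrightarrow> (LINT t|lborel. g t) - complex_of_real a * (\<phi> s - 0)"
    by (intro tendsto_intros)
  from LIMSEQ_unique[OF l1 this] show ?thesis
    by (simp add: gI algebra_simps)
qed

definition exp_density_reflected :: "real \<Rightarrow> real \<Rightarrow> complex" where
  "exp_density_reflected a t = exp_density a (- t)"

lemma exp_density_reflected_kernel:
  assumes "a > 0"
  shows "integrable lborel (exp_density_reflected a)" "L1 (exp_density_reflected a) = 1"
  using exp_density_kernel[OF assms] lborel_integrable_real_affine[of "exp_density a" "-1" 0]
    L1_affine[of "-1" "exp_density a" 0]
  by (simp_all add: exp_density_reflected_def[abs_def])

lemma conv_reflected_kernel: "conv (\<lambda>t. k (- t)) \<phi> s = conv k (\<lambda>t. \<phi> (- t)) (- s)"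
  unfolding conv_def
  using lborel_integral_real_affine[of "-1" "\<lambda>t. k t * \<phi> (s + t)" 0] by (simp add: add.commute)

lemma conv_exp_density_reflected_nderiv:
  assumes a: "a > 0" and \<phi>: "\<phi> \<in> DL1"
  shows "conv (exp_density_reflected a) (nderiv 1 \<phi>) s = - complex_of_real a * (\<phi> s - conv (exp_density_reflected a) \<phi> s)"
proof -
  let ?\<psi> = "\<lambda>t. \<phi> (- t)"
  have \<psi>: "?\<psi> \<in> DL1" using DL1_affine[OF \<phi>, of "-1" 0] by simp
  have "nderiv 1 ?\<psi> = (\<lambda>t. - nderiv 1 \<phi> (- t))"
    using nderiv_affine(2)[OF DL1_smooth[OF \<phi>], of 1 "-1" 0] by simp
  then have eq: "(\<lambda>t. nderiv 1 \<phi> (- t)) = (\<lambda>t. - 1 * nderiv 1 ?\<psi> t)" by (simp add: fun_eq_iff)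
  show ?thesis
    unfolding exp_density_reflected_def[abs_def] conv_reflected_kernel eq conv_cmult_right
      conv_exp_density_nderiv[OF a \<psi>] by simp
qed

text \<open>The convolution of the two, the density of the Laplace distribution, inverts
  \<open>1 - (1/a\<^sup>2) (d/dx)\<^sup>2\<close>.\<close>

definition laplace :: "real \<Rightarrow> real \<Rightarrow> complex" where
  "laplace a = conv (exp_density_reflected a) (exp_density a)"

lemma conv_assoc:
  assumes "integrable lborel k" "integrable lborel \<phi>" "integrable lborel k'" "\<And>t. cmod (k' t) \<le> B"
  shows "conv (conv k k') \<phi> = conv k (conv k' \<phi>)"
proof -
  have "k' \<in> borel_measurable borel" using borel_measurable_integrable[OF assms(3)] by simp
  from conv_left_commute[OF assms(2,1) this assms(4)]
  show ?thesis by (simp add: conv_commute[of \<phi>])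
qed

context
  fixes a :: real
  assumes a: "a > 0"
begin

private lemma kernels: "integrable lborel (exp_density a)" "integrable lborel (exp_density_reflected a)"
  "L1 (exp_density a) = 1" "L1 (exp_density_reflected a) = 1"
  using exp_density_kernel[OF a] exp_density_reflected_kernel[OF a] by simp_all

lemma laplace_kernel: "integrable lborel (laplace a)" "L1 (laplace a) \<le> 1"
  unfolding laplace_def using conv_integrable_L1(1,2)[OF kernels(2,1)] kernels(3,4) by simp_all

lemma conv_laplace:
  assumes "integrable lborel \<phi>"
  shows "conv (laplace a) \<phi> = conv (exp_density_reflected a) (conv (exp_density a) \<phi>)"
  unfolding laplace_def by (rule conv_assoc[OF kernels(2) assms kernels(1) exp_density_kernel(3)[OF a]])

lemma L1_conv_laplace_nderiv:
  assumes \<phi>: "\<phi> \<in> DL1"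
  shows "L1 (conv (laplace a) (nderiv 1 \<phi>)) \<le> 2 * a * L1 \<phi>"
proof -
  note i = DL1_integrable0[OF \<phi>] and c = conv_integrable_L1[OF kernels(1) DL1_integrable0[OF \<phi>]]
  have "L1 (conv (laplace a) (nderiv 1 \<phi>)) \<le> 1 * L1 (conv (exp_density a) (nderiv 1 \<phi>))"
    unfolding conv_laplace[OF DL1_integrable[OF \<phi>]]
    using conv_integrable_L1(2)[OF kernels(2) conv_integrable_L1(1)[OF kernels(1) DL1_integrable[OF \<phi>]], of 1] kernels(4) by simp
  also have "conv (exp_density a) (nderiv 1 \<phi>) = (\<lambda>s. complex_of_real a * (\<phi> s - conv (exp_density a) \<phi> s))"
    using conv_exp_density_nderiv[OF a \<phi>] by (intro ext)
  also have "L1 \<dots> = a * L1 (\<lambda>s. \<phi> s - conv (exp_density a) \<phi> s)" unfolding L1_cmult using a by simp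
  also have "\<dots> \<le> a * (L1 \<phi> + L1 \<phi>)"
    using L1_triangle_diff[OF i c(1)] c(2) kernels(3) a by (intro mult_left_mono) auto
  finally show ?thesis by simp
qed

text \<open>Each of the two exponential densities moves \<open>\<phi>\<close> by at most the mean \<open>1 / a\<close> of its distribution.\<close>

lemma L1_conv_laplace_diff:
  assumes \<phi>: "\<phi> \<in> DL1"
  shows "L1 (\<lambda>s. conv (laplace a) \<phi> s - \<phi> s) \<le> 2 / a * L1 (nderiv 1 \<phi>)"
proof -
  let ?\<psi> = "conv (exp_density a) \<phi>"
  note \<psi> = conv_DL1(1)[OF kernels(1) \<phi>] and \<phi>1 = DL1_integrable[OF \<phi>, of 1]
  have 1: "?\<psi> s - \<phi> s = complex_of_real (- 1 / a) * conv (exp_density a) (nderiv 1 \<phi>) s" for s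
    unfolding conv_exp_density_nderiv[OF a \<phi>] using a by simp
  have 2: "conv (exp_density_reflected a) ?\<psi> s - ?\<psi> s = complex_of_real (1 / a) * conv (exp_density_reflected a) (nderiv 1 ?\<psi>) s" for s
    unfolding conv_exp_density_reflected_nderiv[OF a \<psi>] using a by simp
  have n1: "L1 (conv (exp_density a) (nderiv 1 \<phi>)) \<le> L1 (nderiv 1 \<phi>)"
    using conv_integrable_L1(2)[OF kernels(1) \<phi>1] kernels(3) by simp
  have n2: "L1 (conv (exp_density_reflected a) (nderiv 1 ?\<psi>)) \<le> L1 (nderiv 1 \<phi>)"
    using conv_integrable_L1(2)[OF kernels(2) DL1_integrable[OF \<psi>, of 1]] kernels(4) n1
      conv_smooth(2)[OF kernels(1) \<phi>, of 1] by simp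
  have i1: "integrable lborel (\<lambda>s. ?\<psi> s - \<phi> s)"
    by (intro Bochner_Integration.integrable_diff DL1_integrable0 \<psi> \<phi>)
  have i2: "integrable lborel (\<lambda>s. conv (exp_density_reflected a) ?\<psi> s - ?\<psi> s)"
    by (intro Bochner_Integration.integrable_diff DL1_integrable0 conv_DL1(1)[OF kernels(2)] \<psi>)
  have "L1 (\<lambda>s. conv (laplace a) \<phi> s - \<phi> s) = L1 (\<lambda>s. (conv (exp_density_reflected a) ?\<psi> s - ?\<psi> s) + (?\<psi> s - \<phi> s))"
    by (simp add: conv_laplace[OF DL1_integrable0[OF \<phi>]])
  also have "\<dots> \<le> L1 (\<lambda>s. conv (exp_density_reflected a) ?\<psi> s - ?\<psi> s) + L1 (\<lambda>s. ?\<psi> s - \<phi> s)"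
    by (rule L1_triangle[OF i2 i1])
  also have "L1 (\<lambda>s. conv (exp_density_reflected a) ?\<psi> s - ?\<psi> s) = 1 / a * L1 (conv (exp_density_reflected a) (nderiv 1 ?\<psi>))"
    unfolding 2 L1_cmult norm_of_real using a by simp
  also have "L1 (\<lambda>s. ?\<psi> s - \<phi> s) = 1 / a * L1 (conv (exp_density a) (nderiv 1 \<phi>))"
    unfolding 1 L1_cmult norm_of_real using a by simp
  also have "1 / a * L1 (conv (exp_density_reflected a) (nderiv 1 ?\<psi>)) + 1 / a * L1 (conv (exp_density a) (nderiv 1 \<phi>))
      \<le> 1 / a * L1 (nderiv 1 \<phi>) + 1 / a * L1 (nderiv 1 \<phi>)"
    using n1 n2 a by (intro add_mono mult_left_mono) auto
  finally show ?thesis by simp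
qed

text \<open>The two factors \<open>1 + (1/a) d/dx\<close> and \<open>1 - (1/a) d/dx\<close> are undone one after the other.\<close>

lemma conv_laplace_inverse:
  assumes \<phi>: "\<phi> \<in> DL1"
  shows "conv (laplace a) \<phi> s - complex_of_real (1 / a\<^sup>2) * nderiv 2 (conv (laplace a) \<phi>) s = \<phi> s"
proof -
  let ?\<psi> = "conv (exp_density a) \<phi>" and ?\<eta> = "conv (laplace a) \<phi>"
  note \<psi> = conv_DL1(1)[OF kernels(1) \<phi>]
  have \<eta>: "?\<eta> = conv (exp_density_reflected a) ?\<psi>" by (rule conv_laplace[OF DL1_integrable0[OF \<phi>]])
  have \<eta>1: "nderiv 1 ?\<eta> s = complex_of_real a * ?\<eta> s - complex_of_real a * ?\<psi> s" for s
    unfolding \<eta> conv_smooth(2)[OF kernels(2) \<psi>] conv_exp_density_reflected_nderiv[OF a \<psi>] by (simp add: algebra_simps)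
  have \<psi>1: "nderiv 1 ?\<psi> s = complex_of_real a * \<phi> s - complex_of_real a * ?\<psi> s" for s
    unfolding conv_smooth(2)[OF kernels(1) \<phi>] conv_exp_density_nderiv[OF a \<phi>] by (simp add: algebra_simps)
  have \<eta>D: "?\<eta> \<in> DL1" unfolding \<eta> by (rule conv_DL1(1)[OF kernels(2) \<psi>])
  have n1: "nderiv 1 ?\<eta> = (\<lambda>s. complex_of_real a * ?\<eta> s - complex_of_real a * ?\<psi> s)" using \<eta>1 by (intro ext)
  have "nderiv 2 ?\<eta> s = nderiv 1 (nderiv 1 ?\<eta>) s" by (simp add: nderiv_nderiv numeral_2_eq_2)
  also have "\<dots> = complex_of_real a * nderiv 1 ?\<eta> s - complex_of_real a * nderiv 1 ?\<psi> s"
    unfolding n1 nderiv_diff[OF nderiv_cmult(1)[OF DL1_smooth[OF \<eta>D]] nderiv_cmult(1)[OF DL1_smooth[OF \<psi>]]]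
      nderiv_cmult(2)[OF DL1_smooth[OF \<eta>D]] nderiv_cmult(2)[OF DL1_smooth[OF \<psi>]] ..
  also have "\<dots> = complex_of_real (a\<^sup>2) * (?\<eta> s - \<phi> s)"
    unfolding \<eta>1 \<psi>1 by (simp add: algebra_simps power2_eq_square)
  finally have "nderiv 2 ?\<eta> s = complex_of_real (a\<^sup>2) * (?\<eta> s - \<phi> s)" .
  then have "complex_of_real (1 / a\<^sup>2) * nderiv 2 ?\<eta> s = complex_of_real (1 / a\<^sup>2 * a\<^sup>2) * (?\<eta> s - \<phi> s)"
    by (simp only: of_real_mult mult.assoc)
  also have "1 / a\<^sup>2 * a\<^sup>2 = 1" using a by simp
  finally show ?thesis by simp
qed

end

lemma exp_density_translation:
  assumes "t \<ge> 0"
  shows "L1 (\<lambda>s. exp_density 1 (s - t) - exp_density 1 s) \<le> 2 * t"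
proof -
  note k = exp_density_kernel[of 1, simplified]
  let ?u = "\<lambda>s. complex_of_real (1 - exp (- t)) * exp_density 1 (s - t)"
  let ?v = "\<lambda>s. indicator {0..t} s * exp_density 1 s"
  have ui: "integrable lborel ?u" by (intro integrable_mult_right integrable_shift k(1))
  have vi: "integrable lborel ?v" by (rule integrable_indicator_mult[OF k(1)]) simp
  have i: "integrable lborel (\<lambda>s. exp_density 1 (s - t) - exp_density 1 s)"
    by (intro Bochner_Integration.integrable_diff integrable_shift k(1))
  have le: "cmod (exp_density 1 (s - t) - exp_density 1 s) \<le> cmod (?u s) + cmod (?v s)" for s
  proof -
    consider "s < 0" | "0 \<le> s" "s < t" | "t \<le> s" using assms by linarith
    then show ?thesis
    proof cases
      case 3
      have "exp (- s) = exp (- t) * exp (t - s)" by (simp add: exp_add[symmetric])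
      then have "exp_density 1 (s - t) - exp_density 1 s = ?u s"
        using 3 assms by (simp add: exp_density_def algebra_simps)
      then show ?thesis by simp
    qed (use assms in \<open>auto simp: exp_density_def\<close>)
  qed
  have "L1 (\<lambda>s. exp_density 1 (s - t) - exp_density 1 s) \<le> (LINT s|lborel. cmod (?u s) + cmod (?v s))"
    unfolding L1_def using ui vi by (intro integral_mono integrable_norm[OF i] le) simp
  also have "\<dots> = L1 ?u + L1 ?v" unfolding L1_def using ui vi by simp
  also have "L1 ?u = (1 - exp (- t)) * 1"
    unfolding L1_cmult L1_shift k(2) norm_of_real using assms by simp
  also have "L1 ?v \<le> (LINT s|lborel. indicator {0..t} s)"
    unfolding L1_def
  proof (rule integral_mono[OF integrable_norm[OF vi]])
    show "integrable lborel (indicator {0..t} :: real \<Rightarrow> real)"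
      by (rule integrable_real_indicator) (auto simp: assms)
    show "cmod (?v s) \<le> indicator {0..t} s" for s using k(3)[of s] by (auto simp: indicator_def)
  qed
  also have "\<dots> = t" using assms by simp
  finally show ?thesis using exp_ge_add_one_self[of "- t"] by simp
qed

text \<open>The gain for functions with mean zero concentrated near \<open>0\<close>: it is what the factor \<open>1 + x\<^sup>2\<close> of the
  canonical product is for. Subtracting the value of the kernel at \<open>s\<close> leaves only its increments.\<close>

lemma L1_conv_laplace_mean_zero:
  assumes \<eta>: "\<eta> \<in> DL1" "(LINT t|lborel. \<eta> t) = 0" and supp: "\<And>t. \<eta> t \<noteq> 0 \<Longrightarrow> 0 \<le> t \<and> t \<le> \<delta>"
  shows "L1 (conv (laplace 1) \<eta>) \<le> L1 \<eta> * (2 * \<delta>)"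
proof -
  note k = exp_density_kernel[of 1, simplified] and k' = exp_density_reflected_kernel[of 1, simplified]
  note i = DL1_integrable0[OF \<eta>(1)]
  have m: "exp_density 1 \<in> borel_measurable borel" using borel_measurable_integrable[OF k(1)] by simp
  then have m': "(\<lambda>(t, s). exp_density 1 (s - t) - exp_density 1 s) \<in> borel_measurable (borel \<Otimes>\<^sub>M borel)" by simp
  have d: "integrable lborel (\<lambda>s. exp_density 1 (s - t) - exp_density 1 s)" for t
    by (intro Bochner_Integration.integrable_diff integrable_shift k(1))
  have b: "L1 (\<lambda>s. exp_density 1 (s - t) - exp_density 1 s) \<le> 2 * \<delta>" if "\<eta> t \<noteq> 0" for t
    using exp_density_translation[of t] supp[OF that] by linarith
  have "conv (exp_density 1) \<eta> s = (LINT t|lborel. \<eta> t * (exp_density 1 (s - t) - exp_density 1 s))" for s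
  proof -
    have i1: "integrable lborel (\<lambda>t. \<eta> t * exp_density 1 (s - t))" by (rule conv_integrable[OF i m k(3)])
    have i2: "integrable lborel (\<lambda>t. \<eta> t * exp_density 1 s)" using i by simp
    show ?thesis
      unfolding right_diff_distrib Bochner_Integration.integral_diff[OF i1 i2]
      using \<eta>(2) by (subst conv_commute) (simp add: conv_def)
  qed
  then have 1: "L1 (conv (exp_density 1) \<eta>) \<le> L1 \<eta> * (2 * \<delta>)"
    using L1_superposition(2)[OF i m' d b] by (simp add: L1_def)
  have "L1 (conv (laplace 1) \<eta>) \<le> 1 * L1 (conv (exp_density 1) \<eta>)"
    unfolding conv_laplace[OF zero_less_one i]
    using conv_integrable_L1(2)[OF k'(1) conv_integrable_L1(1)[OF k(1) i]] k'(2) by simp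
  then show ?thesis using 1 by simp
qed

section \<open>The coefficients of an even canonical product\<close>

text \<open>The partial products of \<open>P\<^sub>l\<close> as real polynomials: with \<open>b j = 1 / (l m)\<^sup>2\<close> their coefficients are
  nonnegative.\<close>

definition canon_poly :: "(nat \<Rightarrow> real) \<Rightarrow> nat \<Rightarrow> real poly" where
  "canon_poly b N = [:1, 0, 1:] * (\<Prod>j<N. [:1, 0, b j:])"

lemma canon_poly_Suc: "canon_poly b (Suc N) = canon_poly b N * [:1, 0, b N:]"
  unfolding canon_poly_def lessThan_Suc
  by (subst prod.insert) (simp_all only: finite_lessThan lessThan_iff less_irrefl not_False_eq_True mult.assoc mult.commute[of "[:1, 0, b N:]"])

lemma coeff_mult_quadratic:
  fixes q :: "real poly"
  shows "coeff (q * [:1, 0, c:]) n = coeff q n + (if n \<ge> 2 then c * coeff q (n - 2) else 0)"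
proof -
  have "q * [:1, 0, c:] = q + smult c (pCons 0 (pCons 0 q))" by (simp add: mult_pCons_right)
  moreover have "coeff (pCons 0 (pCons 0 q)) n = (if n \<ge> 2 then coeff q (n - 2) else 0)"
    by (cases n; cases "n - 1") (auto simp: coeff_pCons split: nat.split)
  ultimately show ?thesis by (simp only: coeff_add coeff_smult if_distrib[of "(*) c"] mult_zero_right)
qed

lemma poly_canon_poly:
  "poly (canon_poly b N) x = (1 + x\<^sup>2) * (\<Prod>j<N. 1 + b j * x\<^sup>2)"
  by (simp add: canon_poly_def poly_prod power2_eq_square algebra_simps)

context
  fixes b :: "nat \<Rightarrow> real"
  assumes b: "\<And>j. 0 \<le> b j"
begin

lemma coeff_canon_poly_nonneg: "0 \<le> coeff (canon_poly b N) n"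
proof (induction N arbitrary: n)
  case 0
  show ?case by (cases n; cases "n - 1"; cases "n - 2") (auto simp: canon_poly_def coeff_pCons split: nat.split)
next
  case (Suc N)
  then show ?case unfolding canon_poly_Suc coeff_mult_quadratic using b[of N] by simp
qed

lemma coeff_canon_poly_mono: "coeff (canon_poly b N) n \<le> coeff (canon_poly b (Suc N)) n"
  unfolding canon_poly_Suc coeff_mult_quadratic using b[of N] coeff_canon_poly_nonneg[of N "n - 2"] by simp

lemma coeff_canon_poly_odd: "odd n \<Longrightarrow> coeff (canon_poly b N) n = 0"
proof (induction N arbitrary: n)
  case 0
  then show ?case by (cases n; cases "n - 1"; cases "n - 2") (auto simp: canon_poly_def coeff_pCons split: nat.split)
next
  case (Suc N)
  then show ?case unfolding canon_poly_Suc coeff_mult_quadratic by (auto simp: even_diff_nat)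
qed

text \<open>Cauchy's estimate; since all coefficients are nonnegative, the maximum on the circle is the value at
  \<open>r\<close>.\<close>

lemma coeff_canon_poly_le:
  assumes "r > 0"
  shows "coeff (canon_poly b N) n \<le> poly (canon_poly b N) r / r ^ n"
proof -
  have "coeff (canon_poly b N) n * r ^ n \<le> (\<Sum>i\<le>max n (degree (canon_poly b N)). coeff (canon_poly b N) i * r ^ i)"
    using assms by (intro member_le_sum) (auto intro!: mult_nonneg_nonneg coeff_canon_poly_nonneg)
  also have "\<dots> = poly (canon_poly b N) r"
    unfolding poly_altdef by (rule sum.mono_neutral_right) (auto simp: coeff_eq_0)
  finally show ?thesis using assms by (simp add: field_simps)
qed

end

lemma prod_lessThan_add:
  fixes f :: "nat \<Rightarrow> 'a::comm_monoid_mult"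
  shows "(\<Prod>j<k + N. f j) = (\<Prod>j<k. f j) * (\<Prod>j<N. f (k + j))"
  by (induction N) (simp_all add: mult.assoc)

lemma coeff_canon_poly_0: "coeff (canon_poly b N) 0 = 1"
  using poly_canon_poly[of b N 0] by (simp add: poly_0_coeff_0)

lemma coeff_canon_poly_beyond: "2 * N + 3 \<le> n \<Longrightarrow> coeff (canon_poly b N) n = 0"
proof (induction N arbitrary: n)
  case 0
  then show ?case by (intro coeff_eq_0) (simp add: canon_poly_def)
next
  case (Suc N)
  then show ?case unfolding canon_poly_Suc coeff_mult_quadratic by simp
qed

lemma tendsto_suminf_majorised:
  fixes a :: "nat \<Rightarrow> nat \<Rightarrow> complex"
  assumes lim: "\<And>k. (\<lambda>n. a k n) \<longlonglongrightarrow> b k" and bd: "\<And>k n. norm (a k n) \<le> B k" and B: "summable B"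
  shows "summable b" and "(\<lambda>n. \<Sum>k. a k n) \<longlonglongrightarrow> (\<Sum>k. b k)"
proof -
  have "\<forall>\<^sub>F (k, n) in sequentially \<times>\<^sub>F sequentially. norm (a k n) \<le> B k"
    by (rule always_eventually) (use bd in auto)
  from tannerys_theorem[OF lim this B sequentially_bot]
  show "summable b" "(\<lambda>n. \<Sum>k. a k n) \<longlonglongrightarrow> (\<Sum>k. b k)"
    by (blast intro: summable_norm_cancel)+
qed

text \<open>The coefficients of the partial products increase, so a common majorant \<open>K\<close> makes them
  converge; near \<open>0\<close> dominated convergence of power series identifies their limits as the Taylor
  coefficients of the infinite product.\<close>

lemma canonical_product_expansion:
  fixes b K :: "nat \<Rightarrow> real"
  assumes b: "\<And>j. 0 \<le> b j" "summable b" and K: "\<And>N n. coeff (canon_poly b N) n \<le> K n"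
    and R: "R > 0" "summable (\<lambda>n. K n * R ^ n)"
  obtains c where "\<And>n. (\<lambda>N. coeff (canon_poly b N) n) \<longlonglongrightarrow> c n" "\<And>n. 0 \<le> c n" "\<And>n. c n \<le> K n"
    "(\<lambda>z. (1 + z\<^sup>2) * (\<Prod>p. 1 + z\<^sup>2 * complex_of_real (b p))) has_fps_expansion Abs_fps (\<lambda>n. complex_of_real (c n))"
proof -
  note nn = coeff_canon_poly_nonneg[of b, OF b(1)]
  have ex: "\<exists>c. (\<lambda>N. coeff (canon_poly b N) n) \<longlonglongrightarrow> c" for n
  proof -
    have inc: "incseq (\<lambda>N. coeff (canon_poly b N) n)"
      by (rule incseq_SucI) (rule coeff_canon_poly_mono[of b, OF b(1)])
    have "\<forall>N. coeff (canon_poly b N) n \<le> K n" using K by simp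
    from incseq_convergent[OF inc this] show ?thesis by blast
  qed
  then obtain c where c: "\<And>n. (\<lambda>N. coeff (canon_poly b N) n) \<longlonglongrightarrow> c n" by metis
  have cK: "c n \<le> K n" for n using LIMSEQ_le_const2[OF c] K by blast
  have c0: "0 \<le> c n" for n using LIMSEQ_le_const[OF c] nn by blast
  have sums: "(\<lambda>n. complex_of_real (c n) * z ^ n) sums ((1 + z\<^sup>2) * (\<Prod>p. 1 + z\<^sup>2 * complex_of_real (b p)))"
    if z: "cmod z \<le> R" for z
  proof -
    let ?a = "\<lambda>n N. complex_of_real (coeff (canon_poly b N) n) * z ^ n"
    let ?f = "\<lambda>p. 1 + z\<^sup>2 * complex_of_real (b p)"
    have bd: "cmod (?a n N) \<le> K n * R ^ n" for n N
      unfolding norm_mult norm_of_real norm_power using nn[of N n] z K[of N n]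
      by (intro mult_mono power_mono) auto
    have "(\<lambda>N. ?a n N) \<longlonglongrightarrow> complex_of_real (c n) * z ^ n" for n
      by (intro tendsto_intros c)
    note T = tendsto_suminf_majorised[OF this bd R(2)]
    have val: "(\<Sum>n. ?a n N) = (1 + z\<^sup>2) * (\<Prod>j<N. ?f j)" for N
    proof -
      have "(\<Sum>n. ?a n N) = (\<Sum>n<2 * N + 3. ?a n N)"
        by (rule suminf_finite) (auto simp: coeff_canon_poly_beyond)
      also have "\<dots> = (\<Sum>n\<le>degree (map_poly complex_of_real (canon_poly b N)). ?a n N)"
      proof (rule sum.mono_neutral_right)
        have "n < 2 * N + 3" if "n \<le> degree (map_poly complex_of_real (canon_poly b N))" for n
        proof (rule ccontr)
          assume n: "\<not> n < 2 * N + 3"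
          then have "degree (map_poly complex_of_real (canon_poly b N)) \<ge> 2 * N + 3" using that by linarith
          then have "coeff (canon_poly b N) (degree (map_poly complex_of_real (canon_poly b N))) = 0"
            by (rule coeff_canon_poly_beyond)
          then have "lead_coeff (map_poly complex_of_real (canon_poly b N)) = 0" by (simp add: coeff_map_poly)
          then have "map_poly complex_of_real (canon_poly b N) = 0" by simp
          then have "coeff (canon_poly b N) 0 = 0" by (simp add: map_poly_eq_0_iff)
          then show False by (simp add: coeff_canon_poly_0)
        qed
        then show "{..degree (map_poly complex_of_real (canon_poly b N))} \<subseteq> {..<2 * N + 3}" by auto
        show "\<forall>i\<in>{..<2 * N + 3} - {..degree (map_poly complex_of_real (canon_poly b N))}. ?a i N = 0"
          using coeff_eq_0[of "map_poly complex_of_real (canon_poly b N)"] by (auto simp: coeff_map_poly)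
      qed simp
      also have "\<dots> = poly (map_poly complex_of_real (canon_poly b N)) z"
        by (simp add: poly_altdef coeff_map_poly)
      also have "map_poly complex_of_real (canon_poly b N) = [:1, 0, 1:] * (\<Prod>j<N. [:1, 0, complex_of_real (b j):])"
      proof (induction N)
        case (Suc N)
        have "map_poly complex_of_real (canon_poly b (Suc N)) = map_poly complex_of_real (canon_poly b N) * map_poly complex_of_real [:1, 0, b N:]"
          unfolding canon_poly_Suc by (intro poly_eqI) (simp add: coeff_map_poly coeff_mult del: mult_pCons_left mult_pCons_right)
        also have "map_poly complex_of_real [:1, 0, b N:] = [:1, 0, complex_of_real (b N):]" by (simp add: map_poly_pCons)
        finally show ?case unfolding Suc.IH prod.lessThan_Suc mult.assoc .
      qed (simp add: canon_poly_def map_poly_pCons)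
      also have "poly \<dots> z = (1 + z\<^sup>2) * (\<Prod>j<N. ?f j)"
        by (simp add: poly_prod power2_eq_square algebra_simps)
      finally show ?thesis .
    qed
    have "summable (\<lambda>p. norm (?f p - 1))"
      using summable_mult[OF b(2), of "(cmod z)\<^sup>2"] b(1) by (simp add: norm_mult norm_power)
    then have "convergent_prod ?f"
      by (intro abs_convergent_prod_imp_convergent_prod summable_imp_abs_convergent_prod)
    then have "(\<lambda>N. \<Prod>j<N. ?f j) \<longlonglongrightarrow> prodinf ?f"
      using convergent_prod_LIMSEQ[of ?f] by (simp add: LIMSEQ_lessThan_iff_atMost)
    then have "(\<lambda>N. \<Sum>n. ?a n N) \<longlonglongrightarrow> (1 + z\<^sup>2) * prodinf ?f"
      unfolding val by (intro tendsto_intros)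
    then have "(\<Sum>n. complex_of_real (c n) * z ^ n) = (1 + z\<^sup>2) * prodinf ?f"
      using LIMSEQ_unique[OF T(2)] by simp
    with T(1) show ?thesis by (simp add: sums_iff)
  qed
  have "\<forall>\<^sub>F z in nhds 0. cmod z \<le> R"
    unfolding eventually_nhds_metric using R(1) by (intro exI[of _ R]) (auto simp: dist_norm)
  then have "(\<lambda>z. (1 + z\<^sup>2) * (\<Prod>p. 1 + z\<^sup>2 * complex_of_real (b p))) has_fps_expansion Abs_fps (\<lambda>n. complex_of_real (c n))"
    by (intro has_fps_expansionI) (auto elim!: eventually_mono intro: sums)
  then show thesis using that c c0 cK by blast
qed

locale strongly_nonquasianalytic = nonquasianalytic +
  assumes M3: "cond_M3 M"
begin

text \<open>The number \<open>m_seq M (Suc j)\<close>.\<close>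

definition ratio :: "nat \<Rightarrow> real" where
  "ratio j = M (Suc j) / M j"

lemma ratio_pos: "0 < ratio j"
  using M_pos by (simp add: ratio_def)

lemma ratio_mono: "i \<le> j \<Longrightarrow> ratio i \<le> ratio j"
  unfolding ratio_def by (rule M_ratio_mono)

lemma prod_ratio: "(\<Prod>j<k. ratio j) = M k"
  using M_pos by (induction k) (auto simp: M_0 ratio_def less_imp_neq[symmetric])

lemma summable_inverse_ratio: "summable (\<lambda>j. 1 / ratio j)"
  using M3' by (simp add: cond_M3'_def ratio_def)

lemma summable_inverse_ratio_square: "summable (\<lambda>j. 1 / (l * ratio j)\<^sup>2)"
proof -
  have "summable (\<lambda>j. 1 / (l\<^sup>2 * ratio 0) * (1 / ratio j))"
    by (rule summable_mult[OF summable_inverse_ratio])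
  moreover have "norm (1 / (l * ratio j)\<^sup>2) \<le> 1 / (l\<^sup>2 * ratio 0) * (1 / ratio j)" for j
  proof -
    have "1 / ratio j \<le> 1 / ratio 0" using ratio_mono[of 0 j] ratio_pos[of 0] by (simp add: frac_le)
    then have "1 / ratio j * (1 / ratio j) \<le> 1 / ratio 0 * (1 / ratio j)"
      using ratio_pos[of j] by (intro mult_right_mono) auto
    then have "1 / l\<^sup>2 * (1 / ratio j * (1 / ratio j)) \<le> 1 / l\<^sup>2 * (1 / ratio 0 * (1 / ratio j))"
      by (rule mult_left_mono) simp
    then have "1 / (l * ratio j)\<^sup>2 \<le> 1 / (l\<^sup>2 * ratio 0) * (1 / ratio j)" by (simp add: power2_eq_square mult_ac)
    moreover have "0 \<le> 1 / (l * ratio j)\<^sup>2" by simp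
    ultimately show ?thesis by (simp only: real_norm_def abs_of_nonneg)
  qed
  ultimately show ?thesis by (rule summable_comparison_test'[of _ 0])
qed

text \<open>Evaluating at \<open>r = l * ratio i\<close>: the first \<open>i + 1\<close> factors contribute about
  \<open>(r / l) ^ (2 i + 2) / (M (i + 1))\<^sup>2\<close>, and (M.3) bounds the product of all others by an
  exponential in \<open>i\<close>.\<close>

lemma canonical_product_growth:
  assumes l: "l > 0"
  obtains C where "\<And>i N. poly (canon_poly (\<lambda>j. 1 / (l * ratio j)\<^sup>2) (Suc i + N)) (l * ratio i)
    \<le> (1 + (l * ratio i)\<^sup>2) * ((2 * exp C) ^ Suc i * ratio i ^ (2 * Suc i) / (M (Suc i))\<^sup>2)"
proof -
  obtain C where C: "\<And>p. p \<ge> 1 \<Longrightarrow> summable (\<lambda>j. M (p + j) * M (p + 1) / (real p * M p * M (p + 1 + j))) \<and>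
        (\<Sum>j. M (p + j) * M (p + 1) / (real p * M p * M (p + 1 + j))) \<le> C"
    using M3 unfolding cond_M3_def by blast
  have tail: "(\<Sum>j<N. ratio (Suc i) / ratio (Suc i + j)) \<le> C * real (Suc i)" for i N
  proof -
    let ?t = "\<lambda>j. M (Suc i + j) * M (Suc i + 1) / (real (Suc i) * M (Suc i) * M (Suc i + 1 + j))"
    have t: "?t j = ratio (Suc i) / ratio (Suc i + j) / real (Suc i)" for j
      using M_pos by (simp add: ratio_def field_simps)
    have nn: "0 \<le> ?t j" for j unfolding t using ratio_pos[of "Suc i"] ratio_pos[of "Suc i + j"] by simp
    have "(\<Sum>j<N. ?t j) \<le> (\<Sum>j. ?t j)"
      using C[of "Suc i"] nn by (intro sum_le_suminf) auto
    also have "\<dots> \<le> C" using C[of "Suc i"] by simp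
    finally have "(\<Sum>j<N. ratio (Suc i) / ratio (Suc i + j)) / real (Suc i) \<le> C"
      unfolding t sum_divide_distrib .
    then show ?thesis by (simp add: field_simps)
  qed
  show thesis
  proof (rule that[of C])
    fix i N
    let ?k = "Suc i"
    let ?f = "\<lambda>j. 1 + 1 / (l * ratio j)\<^sup>2 * (l * ratio i)\<^sup>2"
    have f: "?f j = 1 + (ratio i / ratio j)\<^sup>2" for j
      using l by (simp add: power_divide power_mult_distrib)
    have 1: "(\<Prod>j<?k. ?f j) \<le> (\<Prod>j<?k. 2 * (ratio i / ratio j)\<^sup>2)"
    proof (rule prod_mono)
      fix j assume "j \<in> {..<?k}"
      then have "1 \<le> (ratio i / ratio j)" using ratio_mono[of j i] ratio_pos[of j] by simp
      then have "1 \<le> (ratio i / ratio j)\<^sup>2" by simp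
      then show "0 \<le> ?f j \<and> ?f j \<le> 2 * (ratio i / ratio j)\<^sup>2" unfolding f by simp
    qed
    have 2: "(\<Prod>j<?k. 2 * (ratio i / ratio j)\<^sup>2) = 2 ^ ?k * (ratio i ^ (2 * ?k) / (M ?k)\<^sup>2)"
    proof -
      have "(\<Prod>j<?k. 2 * (ratio i / ratio j)\<^sup>2) = 2 ^ ?k * (\<Prod>j<?k. ratio i / ratio j)\<^sup>2"
        by (simp only: prod.distrib prod_constant card_lessThan prod_power_distrib)
      also have "(\<Prod>j<?k. ratio i / ratio j) = ratio i ^ ?k / M ?k"
        by (simp only: prod_dividef prod_constant card_lessThan prod_ratio)
      finally show ?thesis by (simp only: power_divide power_mult[symmetric] mult.commute[of 2 ?k])
    qed
    have 3: "(\<Prod>j<N. ?f (?k + j)) \<le> exp C ^ ?k"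
    proof -
      have "(\<Prod>j<N. ?f (?k + j)) \<le> (\<Prod>j<N. exp (ratio ?k / ratio (?k + j)))"
      proof (rule prod_mono)
        fix j
        have "ratio i / ratio (?k + j) \<le> ratio ?k / ratio (?k + j)" "ratio i / ratio (?k + j) \<le> 1"
          using ratio_mono[of i ?k] ratio_mono[of i "?k + j"] ratio_pos[of "?k + j"] by (auto intro: divide_right_mono)
        moreover have "0 \<le> ratio i / ratio (?k + j)" using ratio_pos[of i] ratio_pos[of "?k + j"] by simp
        ultimately have "(ratio i / ratio (?k + j))\<^sup>2 \<le> ratio ?k / ratio (?k + j)"
          using mult_mono[of "ratio i / ratio (?k + j)" "ratio ?k / ratio (?k + j)" "ratio i / ratio (?k + j)" 1]
          by (simp add: power2_eq_square)
        then have "?f (?k + j) \<le> 1 + ratio ?k / ratio (?k + j)" unfolding f by simp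
        also have "\<dots> \<le> exp (ratio ?k / ratio (?k + j))" by (rule exp_ge_add_one_self)
        finally show "0 \<le> ?f (?k + j) \<and> ?f (?k + j) \<le> exp (ratio ?k / ratio (?k + j))" unfolding f by simp
      qed
      also have "\<dots> = exp (\<Sum>j<N. ratio ?k / ratio (?k + j))" by (simp add: exp_sum)
      also have "\<dots> \<le> exp (C * real ?k)" using tail[of i N] by (subst exp_le_cancel_iff)
      also have "\<dots> = exp C ^ ?k" by (rule exp_of_nat2_mult)
      finally show ?thesis .
    qed
    have "(\<Prod>j<?k + N. ?f j) \<le> (2 ^ ?k * (ratio i ^ (2 * ?k) / (M ?k)\<^sup>2)) * exp C ^ ?k"
      unfolding prod_lessThan_add[of ?f ?k N] using 1 3 unfolding 2
      by (rule mult_mono) (use ratio_pos[of i] in \<open>auto intro!: prod_nonneg mult_nonneg_nonneg divide_nonneg_nonneg\<close>)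
    also have "\<dots> = (2 * exp C) ^ ?k * ratio i ^ (2 * ?k) / (M ?k)\<^sup>2" by (simp only: power_mult_distrib times_divide_eq_right mult_ac)
    finally show "poly (canon_poly (\<lambda>j. 1 / (l * ratio j)\<^sup>2) (Suc i + N)) (l * ratio i)
        \<le> (1 + (l * ratio i)\<^sup>2) * ((2 * exp C) ^ Suc i * ratio i ^ (2 * Suc i) / (M (Suc i))\<^sup>2)"
      unfolding poly_canon_poly by (rule mult_left_mono) simp
  qed
qed

text \<open>Cauchy's estimate at \<open>r = l * ratio i\<close> gives the bound \<open>1 / (M k)\<^sup>2\<close> for the coefficient of index \<open>2 k\<close>,
  where \<open>k = i + 1\<close>; (M.2) turns it into \<open>1 / M (2 k)\<close>.\<close>

lemma canonical_product_coeff_bound: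
  assumes l: "l > 0"
  obtains C L where "C \<ge> 0" "L > 0" "\<And>N n. coeff (canon_poly (\<lambda>j. 1 / (l * ratio j)\<^sup>2) N) n \<le> C * L ^ n / M n"
proof -
  let ?b = "\<lambda>j. 1 / (l * ratio j)\<^sup>2"
  have b: "0 \<le> ?b j" for j by simp
  obtain A H where AH: "A > 1" "H > 1" "\<And>p q. M (p + q) \<le> A * H ^ (p + q) * (M p * M q)"
    by (rule M_stability) blast
  obtain D where D: "\<And>i N. poly (canon_poly ?b (Suc i + N)) (l * ratio i)
    \<le> (1 + (l * ratio i)\<^sup>2) * ((2 * exp D) ^ Suc i * ratio i ^ (2 * Suc i) / (M (Suc i))\<^sup>2)"
    by (rule canonical_product_growth[OF l]) blast
  define E where "E = 1 + (l * (A * M 1))\<^sup>2"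
  define L where "L = sqrt (2 * exp D) * H\<^sup>2 / l"
  have L: "L > 0" using AH l by (simp add: L_def)
  have E: "E \<ge> 1" by (simp add: E_def)
  have L2: "L ^ (2 * k) = (2 * exp D) ^ k * (H\<^sup>2) ^ k * H ^ (2 * k) / l ^ (2 * k)" for k
  proof -
    have "L\<^sup>2 = 2 * exp D * H\<^sup>2 * H\<^sup>2 / l\<^sup>2"
      by (simp add: L_def power_mult_distrib power_divide power2_eq_square)
    then show ?thesis by (simp add: power_mult power_mult_distrib power_divide)
  qed
  have even: "coeff (canon_poly ?b N) (2 * Suc i) \<le> E * A * L ^ (2 * Suc i) / M (2 * Suc i)" for N i
  proof -
    let ?k = "Suc i"
    have r: "l * ratio i > 0" using l ratio_pos by simp
    have rE: "1 + (l * ratio i)\<^sup>2 \<le> E * (H\<^sup>2) ^ ?k"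
    proof -
      have "ratio i \<le> A * M 1 * H ^ ?k"
        using AH(3)[of i 1] M_pos[of i] by (simp add: ratio_def field_simps)
      then have "(l * ratio i)\<^sup>2 \<le> (l * (A * M 1 * H ^ ?k))\<^sup>2"
        using l ratio_pos[of i] by (intro power_mono mult_left_mono) auto
      also have "\<dots> = (l * (A * M 1))\<^sup>2 * (H\<^sup>2) ^ ?k"
        by (simp only: power_mult_distrib power_mult[symmetric] mult_ac)
      finally have "1 + (l * ratio i)\<^sup>2 \<le> (H\<^sup>2) ^ ?k + (l * (A * M 1))\<^sup>2 * (H\<^sup>2) ^ ?k"
        using AH(2) one_le_power[of "H\<^sup>2" ?k] by simp
      then show ?thesis unfolding E_def distrib_right by simp
    qed
    have Mk: "1 / (M ?k)\<^sup>2 \<le> A * H ^ (2 * ?k) / M (2 * ?k)"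
      using AH(3)[of ?k ?k] M_pos[of ?k] M_pos[of "2 * ?k"]
      by (simp add: field_simps power2_eq_square mult_2[symmetric] del: mult_Suc_right power_Suc)
    have "coeff (canon_poly ?b N) (2 * ?k) \<le> coeff (canon_poly ?b (?k + N)) (2 * ?k)"
    proof -
      have "incseq (\<lambda>N. coeff (canon_poly ?b N) (2 * ?k))"
        by (rule incseq_SucI) (rule coeff_canon_poly_mono[of ?b, OF b])
      then show ?thesis by (rule incseqD) simp
    qed
    also have "\<dots> \<le> poly (canon_poly ?b (?k + N)) (l * ratio i) / (l * ratio i) ^ (2 * ?k)"
      by (rule coeff_canon_poly_le[of ?b, OF b r])
    also have "\<dots> \<le> (1 + (l * ratio i)\<^sup>2) * ((2 * exp D) ^ ?k * ratio i ^ (2 * ?k) / (M ?k)\<^sup>2) / (l * ratio i) ^ (2 * ?k)"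
      using r by (intro divide_right_mono[OF D]) simp
    also have "\<dots> = ((1 + (l * ratio i)\<^sup>2) * (2 * exp D) ^ ?k / l ^ (2 * ?k)) * (1 / (M ?k)\<^sup>2)"
      using ratio_pos[of i] l M_pos[of ?k] by (simp add: power_mult_distrib del: power_Suc mult_Suc_right)
    also have "\<dots> \<le> (E * (H\<^sup>2) ^ ?k * (2 * exp D) ^ ?k / l ^ (2 * ?k)) * (A * H ^ (2 * ?k) / M (2 * ?k))"
      using l E AH by (intro mult_mono[OF _ Mk] divide_right_mono mult_right_mono rE) auto
    also have "\<dots> = E * A * L ^ (2 * ?k) / M (2 * ?k)"
      unfolding L2 by (simp only: times_divide_eq_left times_divide_eq_right divide_divide_eq_left mult_ac)
    finally show ?thesis .
  qed
  show thesis
  proof (rule that[of "E * A" L])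
    show "0 \<le> E * A" "L > 0" using E AH L by simp_all
    fix N n
    consider "n = 0" | "odd n" | i where "n = 2 * Suc i"
    proof (cases "even n")
      case True
      then obtain j where "n = 2 * j" by blast
      then show ?thesis using that by (cases j) auto
    qed
    then show "coeff (canon_poly ?b N) n \<le> E * A * L ^ n / M n"
    proof cases
      case 1
      then show ?thesis using mult_mono[of 1 E 1 A] E AH by (simp add: coeff_canon_poly_0 M_0)
    next
      case 2
      then show ?thesis using E AH L M_pos[of n] by (simp add: coeff_canon_poly_odd[of ?b, OF b])
    next
      case 3
      show ?thesis unfolding 3 by (rule even)
    qed
  qed
qed

lemma P_coeff_limit:
  assumes l: "l > 0"
  obtains c C L where "\<And>n. (\<lambda>N. coeff (canon_poly (\<lambda>j. 1 / (l * ratio j)\<^sup>2) N) n) \<longlonglongrightarrow> c n"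
    "\<And>n. P_coeff M (\<lambda>_. l) n = complex_of_real (c n)" "C \<ge> 0" "L > 0"
    "\<And>N n. 0 \<le> coeff (canon_poly (\<lambda>j. 1 / (l * ratio j)\<^sup>2) N) n"
    "\<And>N n. coeff (canon_poly (\<lambda>j. 1 / (l * ratio j)\<^sup>2) N) n \<le> C * L ^ n / M n"
    "\<And>n. 0 \<le> c n" "\<And>n. c n \<le> C * L ^ n / M n"
proof -
  let ?b = "\<lambda>j. 1 / (l * ratio j)\<^sup>2"
  obtain C L where CL: "C \<ge> 0" "L > 0" "\<And>N n. coeff (canon_poly ?b N) n \<le> C * L ^ n / M n"
    by (rule canonical_product_coeff_bound[OF l]) blast
  have M1n: "M 1 ^ n \<le> M n" for n
  proof (induction n)
    case (Suc n)
    then have "M 1 * M 1 ^ n \<le> M 1 * M n" using M_pos[of 1] by (intro mult_left_mono) auto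
    also have "\<dots> \<le> M (1 + n)" by (rule M_supermult)
    finally show ?case by simp
  qed (simp add: M_0)
  have R: "M 1 / (2 * L) > 0" using M_pos[of 1] CL by simp
  have "summable (\<lambda>n. C * L ^ n / M n * (M 1 / (2 * L)) ^ n)"
  proof (rule summable_comparison_test')
    show "summable (\<lambda>n. C * (1 / 2) ^ n :: real)" by (intro summable_mult summable_geometric) simp
    fix n
    have "C * L ^ n / M n * (M 1 / (2 * L)) ^ n = C * (1 / 2) ^ n * (M 1 ^ n / M n)"
      using CL(2) by (simp add: power_divide power_mult_distrib)
    also have "\<dots> \<le> C * (1 / 2) ^ n * 1"
      using M1n[of n] M_pos[of n] CL(1) by (intro mult_left_mono) auto
    finally show "norm (C * L ^ n / M n * (M 1 / (2 * L)) ^ n) \<le> C * (1 / 2) ^ n"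
      using CL(1,2) M_pos[of n] M_pos[of 1] by simp
  qed
  note sK = this
  have b0: "0 \<le> ?b j" for j by simp
  obtain c where c: "\<And>n. (\<lambda>N. coeff (canon_poly ?b N) n) \<longlonglongrightarrow> c n" "\<And>n. 0 \<le> c n" "\<And>n. c n \<le> C * L ^ n / M n"
    "(\<lambda>z. (1 + z\<^sup>2) * (\<Prod>p. 1 + z\<^sup>2 * complex_of_real (?b p))) has_fps_expansion Abs_fps (\<lambda>n. complex_of_real (c n))"
    by (rule canonical_product_expansion[of ?b "\<lambda>n. C * L ^ n / M n", OF b0 summable_inverse_ratio_square CL(3) R sK]) blast
  have "P_fun M (\<lambda>_. l) = (\<lambda>z. (1 + z\<^sup>2) * (\<Prod>p. 1 + z\<^sup>2 * complex_of_real (?b p)))"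
    by (simp add: P_fun_def[abs_def] m_seq_def ratio_def power_mult_distrib power_divide)
  then have P: "P_coeff M (\<lambda>_. l) n = complex_of_real (c n)" for n
    using fps_expansion_eqI[OF c(4)] by (simp add: P_coeff_def)
  have "0 \<le> coeff (canon_poly ?b N) n" for N n by (rule coeff_canon_poly_nonneg) simp
  then show thesis using that[OF c(1) P CL(1,2) _ CL(3) c(2,3)] by blast
qed

end

section \<open>Inverting the operator by an infinite convolution\<close>

lemma conv_diff_right:
  assumes "integrable lborel k" "\<phi> \<in> DL1" "\<psi> \<in> DL1"
  shows "conv k (\<lambda>t. \<phi> t - \<psi> t) = (\<lambda>s. conv k \<phi> s - conv k \<psi> s)"
  using conv_integrable_DL1[OF assms(1,2), of 0] conv_integrable_DL1[OF assms(1,3), of 0]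
  by (intro ext) (simp add: conv_def right_diff_distrib)

text \<open>Each factor \<open>1 + x\<^sup>2 / (a j)\<^sup>2\<close>, with \<open>x\<close> replaced by \<open>D = -\<i> d/dx\<close>, undoes one convolution with a Laplace
  density, and \<open>1 + x\<^sup>2\<close> undoes \<open>laplace 1\<close>. The factors \<open>\<i> ^ p\<close> instead of \<open>(- \<i>) ^ p\<close> make no difference
  for an even polynomial.\<close>

lemma canon_poly_iter_conv:
  assumes a: "\<And>j. a j > 0" and \<rho>: "\<rho> \<in> DL1"
  shows "(\<Sum>p<2 * N + 3. complex_of_real (coeff (canon_poly (\<lambda>j. 1 / (a j)\<^sup>2) N) p) *
    (\<i> ^ p * nderiv p (iter_conv (\<lambda>j. laplace (a j)) N (conv (laplace 1) \<rho>)) x)) = \<rho> x"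
proof (induction N)
  case 0
  show ?case
    using conv_laplace_inverse[OF zero_less_one \<rho>, of x]
    by (simp add: numeral_3_eq_3 numeral_2_eq_2 canon_poly_def)
next
  case (Suc N)
  let ?W = "iter_conv (\<lambda>j. laplace (a j)) N (conv (laplace 1) \<rho>)"
  let ?V = "conv (laplace (a N)) ?W" and ?b = "\<lambda>j. 1 / (a j)\<^sup>2"
  let ?c = "\<lambda>p. complex_of_real (coeff (canon_poly ?b N) p)" and ?n = "2 * N + 3"
  let ?X = "\<lambda>p. \<i> ^ p * nderiv p ?V x"
  note k = laplace_kernel(1)[OF a]
  have W: "?W \<in> DL1"
    by (induction N) (simp_all add: conv_DL1(1)[OF k] conv_DL1(1)[OF laplace_kernel(1)[OF zero_less_one] \<rho>])
  have V: "nderiv p ?V x - complex_of_real (?b N) * nderiv (Suc (Suc p)) ?V x = nderiv p ?W x" for p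
    using conv_laplace_inverse[OF a DL1_nderiv[OF W], of N p x]
    unfolding conv_smooth(2)[OF k W, symmetric] nderiv_nderiv by simp
  have "(\<Sum>p<2 * Suc N + 3. complex_of_real (coeff (canon_poly ?b (Suc N)) p) * ?X p)
      = (\<Sum>p<Suc (Suc ?n). ?c p * ?X p + (if p \<ge> 2 then complex_of_real (?b N) * ?c (p - 2) * ?X p else 0))"
    unfolding canon_poly_Suc coeff_mult_quadratic by (rule sum.cong) (auto simp: algebra_simps)
  also have "\<dots> = (\<Sum>p<Suc (Suc ?n). ?c p * ?X p) + (\<Sum>p<Suc (Suc ?n). if p \<ge> 2 then complex_of_real (?b N) * ?c (p - 2) * ?X p else 0)"
    by (rule sum.distrib)
  also have "(\<Sum>p<Suc (Suc ?n). ?c p * ?X p) = (\<Sum>p<?n. ?c p * ?X p)"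
    unfolding sum.lessThan_Suc coeff_canon_poly_beyond[of N ?n ?b, OF order_refl]
      coeff_canon_poly_beyond[of N "Suc ?n" ?b, OF le_SucI[OF order_refl]] by simp
  also have "(\<Sum>p<Suc (Suc ?n). if p \<ge> 2 then complex_of_real (?b N) * ?c (p - 2) * ?X p else 0)
      = (\<Sum>p<?n. complex_of_real (?b N) * ?c p * ?X (Suc (Suc p)))"
    unfolding sum.lessThan_Suc_shift by simp
  also have "(\<Sum>p<?n. ?c p * ?X p) + (\<Sum>p<?n. complex_of_real (?b N) * ?c p * ?X (Suc (Suc p)))
      = (\<Sum>p<?n. ?c p * (\<i> ^ p * (nderiv p ?V x - complex_of_real (?b N) * nderiv (Suc (Suc p)) ?V x)))"
    unfolding sum.distrib[symmetric] by (rule sum.cong) (simp_all add: algebra_simps)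
  also have "\<dots> = \<rho> x" unfolding V by (rule Suc.IH)
  finally show ?case by simp
qed

lemma conv_sums:
  assumes k: "integrable lborel k" and d: "\<And>p. d p \<in> DL1" "\<And>p x. cmod (d p x) \<le> e p" "summable e"
  shows "(\<lambda>p. conv k (d p) s) sums conv k (\<lambda>x. \<Sum>p. d p x) s"
proof -
  have i: "integrable lborel (\<lambda>t. k t * d p (s - t))" for p
    using conv_integrable_DL1[OF k d(1)[of p], of 0 s] by simp
  have sd: "summable (\<lambda>p. d p x)" for x by (rule summable_comparison_test'[OF d(3), of 0]) (rule d(2))
  have b: "cmod (k t * d p (s - t)) \<le> cmod (k t) * e p" for p t
    unfolding norm_mult by (rule mult_left_mono[OF d(2)]) simp
  have s1: "summable (\<lambda>p. cmod (k t * d p (s - t)))" for t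
    by (rule summable_comparison_test'[OF summable_mult[OF d(3)], of 0]) (use b in simp)
  have s2: "summable (\<lambda>p. LINT t|lborel. cmod (k t * d p (s - t)))"
  proof (rule summable_comparison_test'[OF summable_mult[OF d(3), of "L1 k"], of 0])
    fix p
    have "(LINT t|lborel. cmod (k t * d p (s - t))) \<le> (LINT t|lborel. cmod (k t) * e p)"
      by (rule integral_mono[OF integrable_norm[OF i] _ b]) (use k in simp)
    then show "norm (LINT t|lborel. cmod (k t * d p (s - t))) \<le> L1 k * e p" by (simp add: L1_def)
  qed
  have "(\<lambda>p. LINT t|lborel. k t * d p (s - t)) sums (LINT t|lborel. (\<Sum>p. k t * d p (s - t)))"
    by (rule sums_integral[OF i _ s2]) (simp add: s1)
  then show ?thesis unfolding conv_def suminf_mult[OF sd] .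
qed

text \<open>The map \<open>k \<mapsto> T (conv k w)\<close> is continuous for the \<open>L\<^sup>1\<close> norm.\<close>

lemma (in positive_sequence) dual_conv_sums:
  fixes T :: "(real \<Rightarrow> complex) \<Rightarrow> 'a::complex_banach"
  assumes T: "T \<in> DL1_dual c M" and w: "w \<in> DL1_space c M"
    and d: "\<And>p. d p \<in> DL1" "summable (\<lambda>p. L1 (d p))" "\<And>x. summable (\<lambda>p. cmod (d p x))"
  shows "(\<lambda>p. T (conv (d p) w)) sums T (conv (\<lambda>x. \<Sum>p. d p x) w)"
proof -
  obtain h C where h: "h > 0" "C \<ge> 0" "w \<in> DL1_step M (1 * h)"
    "\<And>\<psi>. \<psi> \<in> DL1_space c M \<Longrightarrow> \<psi> \<in> DL1_step M h \<Longrightarrow> norm (T \<psi>) \<le> C * DL1_norm M h \<psi>"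
    by (rule DL1_dual_bound[OF T w zero_less_one]) blast
  have w1: "w \<in> DL1_step M h" using h(3) by simp
  let ?s = "\<lambda>P x. \<Sum>p<P. d p x" and ?k = "\<lambda>x. \<Sum>p. d p x"
  have sD: "?s P \<in> DL1" for P
    by (induction P) (use DL1_cmult[OF d(1)[of 0], of 0] in \<open>simp_all add: DL1_add[OF _ d(1)]\<close>)
  note kI = L1_suminf(1)[OF DL1_integrable0[OF d(1)] d(2,3)]
  have S: "T (conv (?s P) w) = (\<Sum>p<P. T (conv (d p) w))" for P
  proof (induction P)
    case 0
    have "T (\<lambda>x. 0 * w x) = 0 *\<^sub>C T w" by (rule linear_map_on_cmult[OF DL1_dual_linear[OF T] w])
    then show ?case by (simp add: conv_def scaleC.zero_left)
  next
    case (Suc P)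
    have "conv (?s (Suc P)) w = (\<lambda>x. conv (?s P) w x + conv (d P) w x)"
      unfolding sum.lessThan_Suc conv_commute[of _ w]
      by (rule conv_add_right[OF DL1_integrable0[OF DL1_space_DL1[OF w]] sD d(1)])
    then show ?case
      using linear_map_on_add[OF DL1_dual_linear[OF T] conv_DL1_space[OF DL1_integrable0[OF sD] w] conv_DL1_space[OF DL1_integrable0[OF d(1)] w], of P P]
        Suc.IH by simp
  qed
  have tail: "norm (T (conv ?k w) - (\<Sum>p<P. T (conv (d p) w))) \<le> C * ((\<Sum>j. L1 (d (j + P))) * DL1_norm M h w)" for P
  proof -
    note r = L1_suminf[OF DL1_integrable0[OF d(1)] summable_ignore_initial_segment[OF d(2)] summable_ignore_initial_segment[OF d(3)], of P]
    have "?k x - ?s P x = (\<Sum>j. d (j + P) x)" for x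
      using suminf_minus_initial_segment[OF summable_norm_cancel[OF d(3)[of x]], of P] by simp
    then have eq: "(\<lambda>s. conv ?k w s - conv (?s P) w s) = conv (\<lambda>x. \<Sum>j. d (j + P) x) w"
      unfolding conv_diff_kernel[OF kI DL1_integrable0[OF sD] DL1_space_DL1[OF w], symmetric] by presburger
    have "T (conv ?k w) - (\<Sum>p<P. T (conv (d p) w)) = T (conv (\<lambda>x. \<Sum>j. d (j + P) x) w)"
      unfolding S[symmetric] eq[symmetric]
      by (rule DL1_dual_diff[OF T conv_DL1_space[OF kI w] conv_DL1_space[OF DL1_integrable0[OF sD] w], symmetric])
    also have "norm \<dots> \<le> C * DL1_norm M h (conv (\<lambda>x. \<Sum>j. d (j + P) x) w)"
      by (rule h(4)[OF conv_DL1_space[OF r(1) w] conv_DL1_step(1)[OF r(1) w1 h(1)]])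
    also have "\<dots> \<le> C * ((\<Sum>j. L1 (d (j + P))) * DL1_norm M h w)"
      using conv_DL1_step(2)[OF r(1) w1 h(1)] mult_right_mono[OF r(2) DL1_norm_nonneg[OF w1 h(1)]]
      by (intro mult_left_mono h(2)) linarith
    finally show ?thesis .
  qed
  have "(\<lambda>P. \<Sum>j. L1 (d (j + P))) \<longlonglongrightarrow> 0" by (rule suminf_exist_split2[OF d(2)])
  then have "(\<lambda>P. C * ((\<Sum>j. L1 (d (j + P))) * DL1_norm M h w)) \<longlonglongrightarrow> C * (0 * DL1_norm M h w)"
    by (intro tendsto_intros)
  then have "(\<lambda>P. T (conv ?k w) - (\<Sum>p<P. T (conv (d p) w))) \<longlonglongrightarrow> 0"
    by (intro Lim_null_comparison[OF always_eventually[OF allI[OF tail]]]) simp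
  from tendsto_diff[OF tendsto_const[of "T (conv ?k w)"] this] show ?thesis by (simp add: sums_def)
qed

context weight_sequence
begin

lemma ultradiff_coeff_summable:
  assumes \<phi>: "\<phi> \<in> DL1_space Beurling M" and a: "\<And>p. cmod (a p) \<le> C * L ^ p / M p" "C \<ge> 0" "L > 0"
  shows "summable (\<lambda>p. cmod (a p) * L1 (nderiv p \<phi>))"
proof (rule summable_comparison_test'[of "\<lambda>p. C * DL1_norm M (2 * L) \<phi> * (1 / 2) ^ p" 0])
  show "summable (\<lambda>p. C * DL1_norm M (2 * L) \<phi> * (1 / 2) ^ p)" by (intro summable_mult summable_geometric) simp
  fix p
  have \<phi>': "\<phi> \<in> DL1_step M (2 * L)" using \<phi> a(3) by (simp add: DL1_space_def)
  have "cmod (a p) * L1 (nderiv p \<phi>) \<le> (C * L ^ p / M p) * (DL1_norm M (2 * L) \<phi> * M p / (2 * L) ^ p)"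
    using a M_pos[of p] by (intro mult_mono DL1_step_L1_le[OF \<phi>'] L1_nonneg) auto
  also have "\<dots> = C * DL1_norm M (2 * L) \<phi> * (1 / 2) ^ p"
    using a(3) M_pos[of p] by (simp add: power_mult_distrib power_divide)
  finally show "norm (cmod (a p) * L1 (nderiv p \<phi>)) \<le> C * DL1_norm M (2 * L) \<phi> * (1 / 2) ^ p"
    by (simp add: L1_nonneg)
qed

text \<open>Moving all derivatives from the test function to \<open>w\<close>.\<close>

lemma ultradiff_translate:
  fixes T :: "(real \<Rightarrow> complex) \<Rightarrow> 'a::complex_banach"
  assumes T: "T \<in> DL1_dual Beurling M" and w: "w \<in> DL1_space Beurling M" and \<phi>: "\<phi> \<in> DL1_space Beurling M"
    and a: "\<And>p. cmod (a p) \<le> C * L ^ p / M p" "C \<ge> 0" "L > 0"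
    and \<rho>: "\<And>x. (\<lambda>p. a p * \<i> ^ p * nderiv p w x) sums \<rho> x"
  shows "ultradiff a (\<lambda>x. translate x T w) \<phi> = T (conv \<phi> \<rho>)"
proof -
  define d where "d \<psi> p x = a p * \<i> ^ p * nderiv p \<psi> x" for \<psi> p x
  have dD: "d \<psi> p \<in> DL1" if "\<psi> \<in> DL1_space Beurling M" for \<psi> p
    unfolding d_def[abs_def] by (rule DL1_cmult[OF DL1_nderiv[OF DL1_space_DL1[OF that]]])
  have dL: "L1 (d \<psi> p) = cmod (a p) * L1 (nderiv p \<psi>)" for \<psi> p
    unfolding d_def[abs_def] L1_cmult by (simp add: norm_mult norm_power)
  have ds: "summable (\<lambda>p. L1 (d \<psi> p))" if "\<psi> \<in> DL1_space Beurling M" for \<psi>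
    unfolding dL by (rule ultradiff_coeff_summable[OF that a])
  have ds1: "summable (\<lambda>p. cmod (a p) * L1 (nderiv (Suc p) \<psi>))" if "\<psi> \<in> DL1_space Beurling M" for \<psi>
    using ultradiff_coeff_summable[OF DL1_space_nderiv[OF that, of 1] a] by (simp add: nderiv_nderiv)
  have db: "cmod (d \<psi> p x) \<le> cmod (a p) * L1 (nderiv (Suc p) \<psi>)" if "\<psi> \<in> DL1_space Beurling M" for \<psi> p x
    using DL1_sup_bound[OF DL1_space_DL1[OF that], of p x]
    by (simp add: d_def norm_mult norm_power mult_left_mono)
  have da: "summable (\<lambda>p. cmod (d \<psi> p x))" if "\<psi> \<in> DL1_space Beurling M" for \<psi> x
    by (rule summable_comparison_test'[OF ds1[OF that], of 0]) (use db[OF that] in simp)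
  note \<phi>i = DL1_integrable0[OF DL1_space_DL1[OF \<phi>]] and wi = DL1_integrable0[OF DL1_space_DL1[OF w]]
  note \<phi>D = DL1_space_DL1[OF \<phi>] and wD = DL1_space_DL1[OF w]
  have \<rho>': "(\<lambda>x. \<Sum>p. d w p x) = \<rho>" unfolding d_def using sums_unique[OF \<rho>] by (intro ext) simp
  have move: "conv w (d \<phi> p) s = conv \<phi> (d w p) s" for p s
  proof -
    have "conv w (nderiv p \<phi>) = nderiv p (conv w \<phi>)" by (rule conv_smooth(2)[OF wi \<phi>D, symmetric])
    also have "conv w \<phi> = conv \<phi> w" by (rule conv_commute)
    also have "nderiv p \<dots> = conv \<phi> (nderiv p w)" by (rule conv_smooth(2)[OF \<phi>i wD])
    finally have "conv w (nderiv p \<phi>) = conv \<phi> (nderiv p w)" .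
    then show ?thesis unfolding d_def[abs_def] conv_cmult_right by simp
  qed
  have "conv (\<lambda>x. \<Sum>p. d \<phi> p x) w = conv \<phi> \<rho>"
  proof
    fix s
    have "(\<lambda>p. conv w (d \<phi> p) s) sums conv w (\<lambda>x. \<Sum>p. d \<phi> p x) s"
      by (rule conv_sums[OF wi dD[OF \<phi>] db[OF \<phi>] ds1[OF \<phi>]])
    moreover have "(\<lambda>p. conv \<phi> (d w p) s) sums conv \<phi> (\<lambda>x. \<Sum>p. d w p x) s"
      by (rule conv_sums[OF \<phi>i dD[OF w] db[OF w] ds1[OF w]])
    ultimately show "conv (\<lambda>x. \<Sum>p. d \<phi> p x) w s = conv \<phi> \<rho> s"
      unfolding move \<rho>' conv_commute[of _ w] by (rule sums_unique2)
  qed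
  with dual_conv_sums[OF T w dD[OF \<phi>] ds[OF \<phi>] da[OF \<phi>]]
  have S: "(\<lambda>p. T (conv (d \<phi> p) w)) sums T (conv \<phi> \<rho>)" by simp
  have "T (conv (d \<phi> p) w) = ultradiff_term a (\<lambda>x. translate x T w) \<phi> p" for p
  proof -
    have r: "regular (\<lambda>x. translate x T w) (nderiv p \<phi>) = T (conv (nderiv p \<phi>) w)"
      unfolding translate_def by (rule regular_translates[OF T w DL1_nderiv[OF \<phi>D]])
    have "conv (d \<phi> p) w = (\<lambda>s. a p * \<i> ^ p * conv (nderiv p \<phi>) w s)"
      unfolding d_def[abs_def] conv_commute[of _ w] by (rule conv_cmult_right)
    then have "T (conv (d \<phi> p) w) = (a p * \<i> ^ p) *\<^sub>C T (conv (nderiv p \<phi>) w)"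
      using linear_map_on_cmult[OF DL1_dual_linear[OF T] conv_DL1_space[OF DL1_integrable[OF \<phi>D, of p] w], of "a p * \<i> ^ p"]
      by simp
    moreover have "(- \<i>) ^ p * (- 1) ^ p = \<i> ^ p" unfolding power_mult_distrib[symmetric] by simp
    ultimately show ?thesis unfolding ultradiff_term_def r mult.assoc by simp
  qed
  then have "ultradiff_term a (\<lambda>x. translate x T w) \<phi> sums T (conv \<phi> \<rho>)" using S by simp
  then show ?thesis unfolding ultradiff_eq by (rule sums_unique[symmetric])
qed

lemma ultradiff_uniform_limit:
  fixes f :: "real \<Rightarrow> 'a::complex_banach"
  assumes F: "\<And>n. continuous_on UNIV (F n)" "\<And>n. bounded (range (F n))"
    and f: "continuous_on UNIV f" "bounded (range f)" and lim: "uniform_limit UNIV F f sequentially"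
    and a: "ultradiff_class c M a" and \<phi>: "\<phi> \<in> DL1_space c M"
  shows "(\<lambda>n. ultradiff a (F n) \<phi>) \<longlonglongrightarrow> ultradiff a f \<phi>"
proof -
  have "at_scales c (\<lambda>l. \<exists>C\<ge>0. \<forall>p. cmod (a p) \<le> C * l ^ p / M p)"
    using a ultradiff_class_iff[of M, OF M_pos] by blast
  then obtain l where l0: "l > 0" "\<exists>C\<ge>0. \<forall>p. cmod (a p) \<le> C * l ^ p / M p" "\<phi> \<in> DL1_step M (2 * l)"
    by (rule at_scales_DL1_space[OF _ \<phi>, of _ 2]) auto
  then obtain C where l: "C \<ge> 0" "\<And>p. cmod (a p) \<le> C * l ^ p / M p" by blast
  let ?K = "C * DL1_norm M (2 * l) \<phi> * 2"
  have N: "0 \<le> DL1_norm M (2 * l) \<phi>" by (rule DL1_norm_nonneg[OF l0(3)]) (use l0(1) in simp)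
  have K: "?K \<ge> 0" using l(1) N by simp
  have bnd: "norm (ultradiff a (F n) \<phi> - ultradiff a f \<phi>) \<le> ?K * e" if e: "\<And>x. norm (F n x - f x) \<le> e" for n e
  proof -
    obtain B B' where B: "\<And>x. norm (F n x) \<le> B" "\<And>x. norm (f x) \<le> B'"
      using F(2)[of n] f(2) by (auto simp: bounded_iff)
    have c: "continuous_on UNIV (\<lambda>x. F n x - f x)" by (intro continuous_intros F(1) f(1))
    have t: "ultradiff_term a (F n) \<phi> p - ultradiff_term a f \<phi> p = ultradiff_term a (\<lambda>x. F n x - f x) \<phi> p" for p
      unfolding ultradiff_term_def
        regular_diff_fun[OF F(1) F(2) f DL1_nderiv[OF DL1_space_DL1[OF \<phi>]]] scaleC.diff_right ..
    have g: "(\<lambda>p. C * e * DL1_norm M (2 * l) \<phi> * (1 / 2) ^ p) sums (C * e * DL1_norm M (2 * l) \<phi> * 2)"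
      using sums_mult[OF geometric_sums[of "1 / 2 :: real"], of "C * e * DL1_norm M (2 * l) \<phi>"] by simp
    have "ultradiff a (F n) \<phi> - ultradiff a f \<phi> = (\<Sum>p. ultradiff_term a (\<lambda>x. F n x - f x) \<phi> p)"
      unfolding ultradiff_eq t[symmetric]
      by (rule suminf_diff[OF ultradiff_summable[OF F(1) B(1) a \<phi>] ultradiff_summable[OF f(1) B(2) a \<phi>]])
    also have "norm \<dots> \<le> (\<Sum>p. C * e * DL1_norm M (2 * l) \<phi> * (1 / 2) ^ p)"
      by (rule norm_suminf_le[OF ultradiff_term_bound[OF c e l(2,1) l0(3,1)] sums_summable[OF g]])
    also have "\<dots> = ?K * e" unfolding sums_unique[OF g, symmetric] by (simp only: mult_ac)
    finally show ?thesis .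
  qed
  show ?thesis
  proof (rule metric_LIMSEQ_I)
    fix r :: real assume r: "r > 0"
    have q: "r / (2 * (?K + 1)) > 0" using r K by simp
    from uniform_limitD[OF lim q] obtain n0 where n0: "\<And>n x. n \<ge> n0 \<Longrightarrow> dist (F n x) (f x) < r / (2 * (?K + 1))"
      unfolding eventually_sequentially by auto
    have "dist (ultradiff a (F n) \<phi>) (ultradiff a f \<phi>) < r" if "n \<ge> n0" for n
    proof -
      have "norm (ultradiff a (F n) \<phi> - ultradiff a f \<phi>) \<le> ?K * (r / (2 * (?K + 1)))"
        using n0[OF that] by (intro bnd) (simp add: dist_norm less_imp_le)
      also have "\<dots> \<le> (?K + 1) * (r / (2 * (?K + 1)))" using q by (intro mult_right_mono) auto
      also have "\<dots> = r / 2" using K by (simp add: field_simps)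
      also have "\<dots> < r" using r by simp
      finally show ?thesis by (simp add: dist_norm)
    qed
    then show "\<exists>n0. \<forall>n\<ge>n0. dist (ultradiff a (F n) \<phi>) (ultradiff a f \<phi>) < r" by blast
  qed
qed

end

context strongly_nonquasianalytic
begin

lemma laplace_smoothing_kernels:
  assumes l: "l > 0"
  shows "smoothing_kernels (\<lambda>j. laplace (l * ratio j)) (\<lambda>j. 2 / (l * ratio j)) (\<lambda>j. 2 * (l * ratio j))"
proof
  have a: "l * ratio j > 0" for j using l ratio_pos by simp
  show "integrable lborel (laplace (l * ratio j))" "L1 (laplace (l * ratio j)) \<le> 1" for j
    by (rule laplace_kernel[OF a])+
  have "summable (\<lambda>j. 2 / l * (1 / ratio j))" by (rule summable_mult[OF summable_inverse_ratio])
  moreover have "\<bar>2 / (l * ratio j)\<bar> = 2 / l * (1 / ratio j)" for j using l ratio_pos[of j] by simp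
  ultimately show "summable (\<lambda>j. \<bar>2 / (l * ratio j)\<bar>)" by simp
  show "0 \<le> 2 * (l * ratio j)" for j using a[of j] by simp
  fix \<phi> j assume \<phi>: "\<phi> \<in> DL1"
  show "L1 (\<lambda>s. conv (laplace (l * ratio j)) \<phi> s - \<phi> s) \<le> 2 / (l * ratio j) * L1 (nderiv 1 \<phi>)"
    by (rule L1_conv_laplace_diff[OF a \<phi>])
  show "L1 (conv (laplace (l * ratio j)) (nderiv 1 \<phi>)) \<le> 2 * (l * ratio j) * L1 \<phi>"
    by (rule L1_conv_laplace_nderiv[OF a \<phi>])
qed

abbreviation regularised :: "real \<Rightarrow> (real \<Rightarrow> complex) \<Rightarrow> nat \<Rightarrow> real \<Rightarrow> complex" where
  "regularised l \<rho> N \<equiv> iter_conv (\<lambda>j. laplace (l * ratio j)) N (conv (laplace 1) \<rho>)"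

text \<open>Convolution of \<open>\<rho>\<close> with the fundamental solution of \<open>P\<^sub>l(D)\<close>.\<close>

definition parametrix :: "real \<Rightarrow> (real \<Rightarrow> complex) \<Rightarrow> real \<Rightarrow> complex" where
  "parametrix l \<rho> x = lim (\<lambda>N. regularised l \<rho> N x)"

text \<open>The first bound only involves \<open>\<rho>\<close> itself, so differences of parametrices can be small although the
  derivatives of \<open>\<rho>\<close> are large; the second one keeps the parametrix in the test space.\<close>

lemma parametrix_limit:
  assumes l: "l > 0" and \<rho>: "\<rho> \<in> DL1"
  shows "parametrix l \<rho> \<in> DL1"
    and "(\<lambda>N. nderiv p (regularised l \<rho> N) x) \<longlonglongrightarrow> nderiv p (parametrix l \<rho>) x"
    and "L1 (nderiv p (parametrix l \<rho>)) \<le> (2 * l) ^ p * M p * L1 (conv (laplace 1) \<rho>)"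
    and "L1 (nderiv p (parametrix l \<rho>)) \<le> L1 (nderiv p (conv (laplace 1) \<rho>))"
proof -
  interpret smoothing_kernels "\<lambda>j. laplace (l * ratio j)" "\<lambda>j. 2 / (l * ratio j)" "\<lambda>j. 2 * (l * ratio j)"
    by (rule laplace_smoothing_kernels[OF l])
  obtain \<Phi> where \<Phi>: "\<Phi> \<in> DL1" "\<And>p x. (\<lambda>N. nderiv p (regularised l \<rho> N) x) \<longlonglongrightarrow> nderiv p \<Phi> x"
    "\<And>p. L1 (nderiv p \<Phi>) \<le> (\<Prod>j<p. 2 * (l * ratio j)) * L1 (conv (laplace 1) \<rho>)"
    "\<And>p. L1 (nderiv p \<Phi>) \<le> L1 (nderiv p (conv (laplace 1) \<rho>))"
    by (rule infinite_convolution[OF conv_DL1(1)[OF laplace_kernel(1)[OF zero_less_one] \<rho>]]) blast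
  have eq: "parametrix l \<rho> = \<Phi>"
    unfolding parametrix_def[abs_def] using limI[OF \<Phi>(2)[of 0]] by (intro ext) simp
  have "(\<Prod>j<p. 2 * (l * ratio j)) = (2 * l) ^ p * M p"
    unfolding mult.assoc[symmetric] prod.distrib prod_ratio by simp
  with \<Phi> show "parametrix l \<rho> \<in> DL1"
    "(\<lambda>N. nderiv p (regularised l \<rho> N) x) \<longlonglongrightarrow> nderiv p (parametrix l \<rho>) x"
    "L1 (nderiv p (parametrix l \<rho>)) \<le> (2 * l) ^ p * M p * L1 (conv (laplace 1) \<rho>)"
    "L1 (nderiv p (parametrix l \<rho>)) \<le> L1 (nderiv p (conv (laplace 1) \<rho>))"
    unfolding eq by metis+
qed

lemma parametrix_diff:
  assumes l: "l > 0" and \<rho>: "\<rho> \<in> DL1" "\<rho>' \<in> DL1"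
  shows "parametrix l (\<lambda>t. \<rho> t - \<rho>' t) = (\<lambda>x. parametrix l \<rho> x - parametrix l \<rho>' x)"
proof
  fix x
  note k1 = laplace_kernel(1)[OF zero_less_one] and k = laplace_kernel(1)[OF mult_pos_pos[OF l ratio_pos]]
  have D: "regularised l \<psi> N \<in> DL1" if "\<psi> \<in> DL1" for \<psi> N
    by (induction N) (simp_all add: conv_DL1(1)[OF k] conv_DL1(1)[OF k1 that])
  have "regularised l (\<lambda>t. \<rho> t - \<rho>' t) N = (\<lambda>x. regularised l \<rho> N x - regularised l \<rho>' N x)" for N
    by (induction N) (simp_all add: conv_diff_right[OF k1 \<rho>] conv_diff_right[OF k D[OF \<rho>(1)] D[OF \<rho>(2)]])
  then have "(\<lambda>N. regularised l \<rho> N x - regularised l \<rho>' N x) \<longlonglongrightarrow> parametrix l (\<lambda>t. \<rho> t - \<rho>' t) x"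
    using parametrix_limit(2)[OF l DL1_diff[OF \<rho>], of 0 x] by simp
  moreover have "(\<lambda>N. regularised l \<rho> N x - regularised l \<rho>' N x) \<longlonglongrightarrow> parametrix l \<rho> x - parametrix l \<rho>' x"
    using parametrix_limit(2)[OF l \<rho>(1), of 0 x] parametrix_limit(2)[OF l \<rho>(2), of 0 x] by (intro tendsto_diff) simp_all
  ultimately show "parametrix l (\<lambda>t. \<rho> t - \<rho>' t) x = parametrix l \<rho> x - parametrix l \<rho>' x"
    by (rule LIMSEQ_unique)
qed

lemma parametrix_DL1_space:
  assumes l: "l > 0" and \<rho>: "\<rho> \<in> DL1_space c M"
  shows "parametrix l \<rho> \<in> DL1_space c M"
  using parametrix_limit(1,4)[OF l DL1_space_DL1[OF \<rho>]]
  by (intro DL1_space_mono_step[OF conv_DL1_space[OF laplace_kernel(1)[OF zero_less_one] \<rho>], where K = 1]) simp_all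

text \<open>\<open>P_l(D)\<close> maps the parametrix of \<open>\<rho>\<close> to \<open>\<rho>\<close>: the partial products undo the partial convolutions,
  and the coefficient bound makes the series converge dominatedly.\<close>

lemma parametrix_inverse:
  assumes l: "l > 0" and \<rho>: "\<rho> \<in> DL1_space Beurling M"
  shows "(\<lambda>p. P_coeff M (\<lambda>_. l) p * \<i> ^ p * nderiv p (parametrix l \<rho>) x) sums \<rho> x"
proof -
  note \<rho>D = DL1_space_DL1[OF \<rho>] and k1 = laplace_kernel(1)[OF zero_less_one]
  interpret smoothing_kernels "\<lambda>j. laplace (l * ratio j)" "\<lambda>j. 2 / (l * ratio j)" "\<lambda>j. 2 * (l * ratio j)"
    by (rule laplace_smoothing_kernels[OF l])
  let ?b = "\<lambda>j. 1 / (l * ratio j)\<^sup>2" and ?\<phi> = "conv (laplace 1) \<rho>"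
  obtain c C L where c: "\<And>n. (\<lambda>N. coeff (canon_poly ?b N) n) \<longlonglongrightarrow> c n"
    "\<And>n. P_coeff M (\<lambda>_. l) n = complex_of_real (c n)" "C \<ge> 0" "L > 0"
    "\<And>N n. 0 \<le> coeff (canon_poly ?b N) n" "\<And>N n. coeff (canon_poly ?b N) n \<le> C * L ^ n / M n"
    by (rule P_coeff_limit[OF l]) blast
  have \<phi>: "?\<phi> \<in> DL1_space Beurling M" by (rule conv_DL1_space[OF k1 \<rho>])
  note \<phi>D = DL1_space_DL1[OF \<phi>]
  let ?a = "\<lambda>p N. complex_of_real (coeff (canon_poly ?b N) p) * (\<i> ^ p * nderiv p (regularised l \<rho> N) x)"
  let ?B = "\<lambda>p. C * L ^ p / M p * L1 (nderiv (Suc p) ?\<phi>)"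
  have "cmod (complex_of_real (C * L ^ p / M p)) \<le> C * L ^ p / M p" for p
    unfolding norm_of_real using c(3,4) M_pos[of p] by simp
  note ucs = ultradiff_coeff_summable[OF DL1_space_nderiv[OF \<phi>, of 1] this c(3,4)]
  have B: "summable ?B"
    using ucs c(3,4) M_pos unfolding norm_of_real nderiv_nderiv by (simp add: less_imp_le)
  have bd: "norm (?a p N) \<le> ?B p" for p N
  proof -
    have "cmod (nderiv p (regularised l \<rho> N) x) \<le> L1 (nderiv (Suc p) (regularised l \<rho> N))"
      by (rule DL1_sup_bound[OF iter_DL1[OF \<phi>D]])
    also have "\<dots> \<le> L1 (nderiv (Suc p) ?\<phi>)"
      unfolding nderiv_iter[OF \<phi>D] using L1_iter_antimono[OF DL1_nderiv[OF \<phi>D], of 0 N "Suc p"] by simp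
    finally show ?thesis
      unfolding norm_mult norm_of_real norm_power using c(3,4) c(5,6)[of N p] M_pos[of p]
      by (intro mult_mono) auto
  qed
  have lim: "(\<lambda>N. ?a p N) \<longlonglongrightarrow> P_coeff M (\<lambda>_. l) p * (\<i> ^ p * nderiv p (parametrix l \<rho>) x)" for p
    unfolding c(2) by (intro tendsto_intros c(1) parametrix_limit(2)[OF l \<rho>D])
  note T = tendsto_suminf_majorised[OF lim bd B]
  have a: "l * ratio j > 0" for j using l ratio_pos by simp
  have val: "(\<Sum>p. ?a p N) = \<rho> x" for N
  proof -
    have "(\<Sum>p. ?a p N) = (\<Sum>p<2 * N + 3. ?a p N)"
      by (rule suminf_finite) (auto simp: coeff_canon_poly_beyond)
    then show ?thesis using canon_poly_iter_conv[of "\<lambda>j. l * ratio j", OF a \<rho>D] by simp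
  qed
  have "(\<Sum>p. P_coeff M (\<lambda>_. l) p * (\<i> ^ p * nderiv p (parametrix l \<rho>) x)) = \<rho> x"
    by (rule LIMSEQ_unique[OF T(2)]) (simp only: val tendsto_const)
  with T(1) show ?thesis unfolding mult.assoc sums_iff by blast
qed

text \<open>The scale \<open>l\<close> is tuned to the continuity of \<open>T\<close>: then the parametrices of a mollifier form a
  Cauchy sequence in the norm controlling \<open>T\<close>, although the mollifiers do not. Their pairings with
  the translates of \<open>T\<close> therefore converge uniformly to a function \<open>f\<close> with \<open>P_l(D)f = T\<close>.\<close>

lemma assertion_x_imp_i:
  fixes T :: "(real \<Rightarrow> complex) \<Rightarrow> 'a::complex_banach"
  assumes x: "assertion_x k Beurling M T" and T: "T \<in> DL1_dual Beurling M"
  shows "assertion_i k Beurling M T"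
proof -
  obtain \<rho> B where \<rho>: "\<And>n. \<rho> n \<in> DL1_space Beurling M"
    "\<And>n t. t \<notin> {0..1 / real (Suc n)} \<Longrightarrow> \<rho> n t = 0" "\<And>n. (LINT t|lborel. \<rho> n t) = 1" "\<And>n. L1 (\<rho> n) \<le> B"
    by (rule mollifier) blast
  note \<rho>D = DL1_space_DL1[OF \<rho>(1)] and \<rho>i = DL1_integrable0[OF DL1_space_DL1[OF \<rho>(1)]]
  have B: "0 \<le> B" using \<rho>(4)[of 0] L1_nonneg[of "\<rho> 0"] by linarith
  obtain h C where h: "h > 0" "C \<ge> 0" "\<rho> 0 \<in> DL1_step M (1 * h)"
    "\<And>\<psi>. \<psi> \<in> DL1_space Beurling M \<Longrightarrow> \<psi> \<in> DL1_step M h \<Longrightarrow> norm (T \<psi>) \<le> C * DL1_norm M h \<psi>"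
    by (rule DL1_dual_bound[OF T \<rho>(1)[of 0] zero_less_one]) blast
  \<comment> \<open>With this \<open>l\<close> the factor \<open>(2 * l) ^ p\<close> in the derivatives of the parametrix cancels \<open>h ^ p\<close>.\<close>
  define l where "l = 1 / (2 * h)"
  have l: "l > 0" using h(1) by (simp add: l_def)
  obtain c C' L where c: "\<And>n. P_coeff M (\<lambda>_. l) n = complex_of_real (c n)" "C' \<ge> 0" "L > 0"
    "\<And>n. 0 \<le> c n" "\<And>n. c n \<le> C' * L ^ n / M n"
    by (rule P_coeff_limit[OF l]) blast
  have Pb: "cmod (P_coeff M (\<lambda>_. l) p) \<le> C' * L ^ p / M p" for p
    unfolding c(1) norm_of_real using c(4,5)[of p] by simp
  have cls: "ultradiff_class Beurling M (P_coeff M (\<lambda>_. l))"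
    unfolding ultradiff_class_iff[of M, OF M_pos] at_scales_def using Pb c(2,3) by auto
  define w where "w n = parametrix l (\<rho> n)" for n
  define F where "F n y = translate y T (w n)" for n y
  have w: "w n \<in> DL1_space Beurling M" for n unfolding w_def by (rule parametrix_DL1_space[OF l \<rho>(1)])
  have F: "continuous_on UNIV (F n)" "bounded (range (F n))" "F n \<in> asymp_fun k" for n
    unfolding F_def[abs_def]
    using translate_continuous_bounded[OF T w] asymp_fun_translate_DL1_space[OF x T w] by auto
  have inc: "norm (F n y - F m y) \<le> C * (4 * B / real (Suc m))" if "m \<le> n" for m n y
  proof -
    let ?\<eta> = "\<lambda>t. \<rho> n t - \<rho> m t"
    let ?\<delta> = "1 / real (Suc m)"
    have \<eta>: "?\<eta> \<in> DL1" by (rule DL1_diff[OF \<rho>D \<rho>D])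
    have zero: "(LINT t|lborel. ?\<eta> t) = 0"
      unfolding Bochner_Integration.integral_diff[OF \<rho>i \<rho>i] \<rho>(3) by simp
    have "1 / real (Suc n) \<le> ?\<delta>" using that by (intro divide_left_mono) auto
    then have supp: "0 \<le> t \<and> t \<le> ?\<delta>" if "?\<eta> t \<noteq> 0" for t
      using that \<rho>(2)[of t n] \<rho>(2)[of t m] by (cases "t \<in> {0..?\<delta>}") auto
    have "L1 (conv (laplace 1) ?\<eta>) \<le> L1 ?\<eta> * (2 * ?\<delta>)"
      by (rule L1_conv_laplace_mean_zero[OF \<eta> zero supp])
    also have "\<dots> \<le> (B + B) * (2 * ?\<delta>)"
      using L1_triangle_diff[OF \<rho>i \<rho>i, of n m] \<rho>(4)[of n] \<rho>(4)[of m] by (intro mult_right_mono) auto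
    finally have K: "L1 (conv (laplace 1) ?\<eta>) \<le> 4 * B / real (Suc m)" by simp
    have wd: "(\<lambda>t. w n t - w m t) = parametrix l ?\<eta>"
      unfolding w_def by (rule parametrix_diff[OF l \<rho>D \<rho>D, symmetric])
    have quot: "h ^ p * L1 (nderiv p (parametrix l ?\<eta>)) / M p \<le> 4 * B / real (Suc m)" for p
    proof -
      have "h ^ p * L1 (nderiv p (parametrix l ?\<eta>)) \<le> h ^ p * ((2 * l) ^ p * M p * L1 (conv (laplace 1) ?\<eta>))"
        using h(1) by (intro mult_left_mono parametrix_limit(3)[OF l \<eta>]) simp
      also have "\<dots> = M p * L1 (conv (laplace 1) ?\<eta>)"
        using h(1) by (simp add: l_def power_divide)
      also have "\<dots> \<le> M p * (4 * B / real (Suc m))" by (rule mult_left_mono[OF K M_nonneg])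
      finally show ?thesis using M_pos[of p] by (simp add: pos_divide_le_eq mult.commute)
    qed
    note st = DL1_stepI[OF parametrix_limit(1)[OF l \<eta>] quot]
    have "F n y - F m y = translate y T (\<lambda>t. w n t - w m t)"
      unfolding F_def by (rule translate_diff[OF T w w, symmetric])
    also have "norm \<dots> \<le> C * DL1_norm M h (\<lambda>t. w n t - w m t)"
      by (rule DL1_dual_translate_bound[OF h(4,1,2) DL1_space_diff[OF w w]]) (simp_all add: wd st(1))
    also have "\<dots> \<le> C * (4 * B / real (Suc m))" unfolding wd by (rule mult_left_mono[OF st(2) h(2)])
    finally show ?thesis .
  qed
  have null: "(\<lambda>m. C * (4 * B / real (Suc m))) \<longlonglongrightarrow> 0"
    using tendsto_mult_left[OF LIMSEQ_inverse_real_of_nat, of "C * (4 * B)"] by (simp add: divide_inverse mult.assoc)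
  have "uniformly_Cauchy_on UNIV F"
  proof (rule uniformly_Cauchy_onI)
    fix e :: real assume e: "e > 0"
    have "\<forall>\<^sub>F m in sequentially. C * (4 * B / real (Suc m)) < e" by (rule order_tendstoD(2)[OF null e])
    then obtain m0 where m0: "\<And>m. m \<ge> m0 \<Longrightarrow> C * (4 * B / real (Suc m)) < e"
      unfolding eventually_sequentially by blast
    have "dist (F m y) (F n y) < e" if "m \<ge> m0" "n \<ge> m0" for m n y
    proof (cases "m \<le> n")
      case True
      then show ?thesis using inc[OF True, of y] m0[OF that(1)] unfolding dist_norm norm_minus_commute[of "F m y"] by linarith
    next
      case False
      then have "n \<le> m" by simp
      then show ?thesis using inc[of n m y] m0[OF that(2)] unfolding dist_norm by linarith
    qed
    then show "\<exists>m0. \<forall>y\<in>UNIV. \<forall>m\<ge>m0. \<forall>n\<ge>m0. dist (F m y) (F n y) < e" by blast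
  qed
  then obtain f where lim: "uniform_limit UNIV F f sequentially"
    using Cauchy_uniformly_convergent unfolding uniformly_convergent_on_def by blast
  have fc: "continuous_on UNIV f"
    by (rule uniform_limit_theorem[OF _ lim sequentially_bot]) (simp add: F(1))
  have fb: "bounded (range f)"
    by (rule uniform_limit_bounded[OF lim]) (simp_all add: F(2))
  have fa: "f \<in> bdd_asymp_fun k"
    using asymp_fun_uniform_limit[OF F(3) fc uniform_limit_on_subset[OF lim, of "{0..}"]] fb
    by (simp add: bdd_asymp_fun_def)
  have za: "(\<lambda>_. 0 :: 'a) \<in> bdd_asymp_fun k"
    using kind_fun_asymp_fun[OF kind_fun_zero] by (simp add: bdd_asymp_fun_def)
  have repr: "T \<phi> = ultradiff (P_coeff M (\<lambda>_. l)) f \<phi> + regular (\<lambda>_. 0 :: 'a) \<phi>" if \<phi>: "\<phi> \<in> DL1_space Beurling M" for \<phi>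
  proof -
    have e1: "ultradiff (P_coeff M (\<lambda>_. l)) (F n) \<phi> = T (conv (\<rho> n) \<phi>)" for n
      unfolding F_def[abs_def] conv_commute[of "\<rho> n"]
      by (rule ultradiff_translate[OF T w \<phi> Pb c(2,3)]) (simp only: w_def parametrix_inverse[OF l \<rho>(1)])
    have l1: "(\<lambda>n. T (conv (\<rho> n) \<phi>)) \<longlonglongrightarrow> ultradiff (P_coeff M (\<lambda>_. l)) f \<phi>"
      using ultradiff_uniform_limit[OF F(1,2) fc fb lim cls \<phi>] unfolding e1 .
    have \<phi>1: "nderiv 1 \<phi> \<in> DL1_step M h" using DL1_space_nderiv[OF \<phi>, of 1] h(1) by (simp add: DL1_space_def)
    let ?N = "DL1_norm M h (nderiv 1 \<phi>)"
    have N: "0 \<le> ?N" by (rule DL1_norm_nonneg[OF \<phi>1 h(1)])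
    have b: "norm (T (conv (\<rho> n) \<phi>) - T \<phi>) \<le> C * (B * (1 / real (Suc n)) * ?N)" for n
    proof -
      have dn: "0 \<le> 1 / real (Suc n)" by (intro divide_nonneg_nonneg) auto
      have sup: "\<bar>t - 0\<bar> \<le> 1 / real (Suc n)" if "\<rho> n t \<noteq> 0" for t using \<rho>(2)[of t n] that by force
      have "(\<lambda>s. conv (\<rho> n) \<phi> s - (LINT t|lborel. \<rho> n t) * \<phi> (s - 0)) = (\<lambda>s. conv (\<rho> n) \<phi> s - \<phi> s)"
        using \<rho>(3) by simp
      note e = conv_concentrated_step[OF \<rho>i sup dn DL1_space_DL1[OF \<phi>] \<phi>1 h(1), of n, unfolded this]
      note cE = conv_DL1_space[OF \<rho>i \<phi>, of n]
      have "norm (T (conv (\<rho> n) \<phi>) - T \<phi>) \<le> C * DL1_norm M h (\<lambda>s. conv (\<rho> n) \<phi> s - \<phi> s)"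
        unfolding DL1_dual_diff[OF T cE \<phi>, symmetric] by (rule h(4)[OF DL1_space_diff[OF cE \<phi>] e(1)])
      also have "\<dots> \<le> C * (L1 (\<rho> n) * (1 / real (Suc n)) * ?N)" by (rule mult_left_mono[OF e(2) h(2)])
      also have "\<dots> \<le> C * (B * (1 / real (Suc n)) * ?N)"
        using h(2) N by (intro mult_left_mono mult_right_mono \<rho>(4)) auto
      finally show ?thesis .
    qed
    have "(\<lambda>n. C * (B * (1 / real (Suc n)) * ?N)) \<longlonglongrightarrow> C * (B * 0 * ?N)"
      by (intro tendsto_intros LIMSEQ_Suc[OF lim_1_over_n])
    then have "(\<lambda>n. T (conv (\<rho> n) \<phi>) - T \<phi>) \<longlonglongrightarrow> 0"
      by (intro Lim_null_comparison[OF always_eventually[OF allI[OF b]]]) simp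
    then have "(\<lambda>n. T (conv (\<rho> n) \<phi>)) \<longlonglongrightarrow> T \<phi>" by (simp add: LIM_zero_iff)
    then show ?thesis using LIMSEQ_unique[OF l1] by (simp add: regular_zero)
  qed
  have "ultradiff_repr Beurling M (DL1_space Beurling M) T (P_coeff M (\<lambda>_. l)) f (\<lambda>_. 0)"
    unfolding ultradiff_repr_def using cls repr by blast
  moreover have "(\<lambda>_. l) \<in> P_scales Beurling" using l by (auto simp: P_scales_def)
  moreover have "eq_half Beurling M T T" by (simp add: eq_half_def)
  ultimately show ?thesis
    unfolding assertion_i_def using T fa za by blast
qed

end

section \<open>The equivalences\<close>

theorem theorem3p4:
  fixes M :: "nat \<Rightarrow> real" and c :: ultra_case and k :: asymp_kind
    and T :: "(real \<Rightarrow> complex) \<Rightarrow> 'a::complex_banach"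
  assumes "\<exists>x::'a. x \<noteq> 0"
    and "\<And>p. M p > 0" and "M 0 = 1"
    and "cond_M1 M" and "cond_M2 M" and "cond_M3' M"
    and "T \<in> DL1_dual c M"
  shows "(assertion_i k c M T \<longrightarrow> assertion_ii k c M T) \<and>
    (assertion_ii k c M T \<longrightarrow> assertion_iii k c M T) \<and>
    (assertion_iii k c M T \<longrightarrow> assertion_iv k c M T) \<and>
    (assertion_iv k c M T \<longrightarrow> assertion_v k c M T) \<and>
    (assertion_v k c M T \<longrightarrow> assertion_vi k c M T) \<and>
    (assertion_vi k c M T \<longleftrightarrow> assertion_vii k c M T) \<and>
    (assertion_vii k c M T \<longleftrightarrow> assertion_viii k c M T) \<and>
    (assertion_viii k c M T \<longleftrightarrow> assertion_ix k c M T) \<and>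
    (assertion_ix k c M T \<longleftrightarrow> assertion_x k c M T) \<and>
    (cond_M3 M \<and> c = Beurling \<longrightarrow>
      (assertion_i k c M T \<longleftrightarrow> assertion_ii k c M T) \<and>
      (assertion_ii k c M T \<longleftrightarrow> assertion_iii k c M T) \<and>
      (assertion_iii k c M T \<longleftrightarrow> assertion_iv k c M T) \<and>
      (assertion_iv k c M T \<longleftrightarrow> assertion_v k c M T) \<and>
      (assertion_v k c M T \<longleftrightarrow> assertion_vi k c M T) \<and>
      (assertion_vi k c M T \<longleftrightarrow> assertion_vii k c M T) \<and>
      (assertion_vii k c M T \<longleftrightarrow> assertion_viii k c M T) \<and>
      (assertion_viii k c M T \<longleftrightarrow> assertion_ix k c M T) \<and>
      (assertion_ix k c M T \<longleftrightarrow> assertion_x k c M T))"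
proof -
  interpret nonquasianalytic M
    by unfold_locales (fact assms)+
  note T = assms(7)
  have viii_x: "assertion_viii k c M T \<longleftrightarrow> assertion_x k c M T"
    using assertion_viii_imp_x by (auto simp: assertion_viii_def assertion_x_def D0_space_def)
  have vii_x: "assertion_vii k c M T \<longleftrightarrow> assertion_x k c M T"
    using assertion_vii_imp_x assertion_x_imp_vii[OF _ T] by blast
  have ix_x: "assertion_ix k c M T \<longleftrightarrow> assertion_x k c M T"
    using assertion_ix_imp_x[OF _ T] assertion_x_imp_ix[OF _ T] by blast
  have vi_x: "assertion_vi k c M T \<longleftrightarrow> assertion_x k c M T"
  proof
    assume "assertion_vi k c M T"
    then show "assertion_x k c M T" using vii_x by (simp add: assertion_vi_def assertion_vii_def)
  next
    assume x: "assertion_x k c M T"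
    have "eq_half c M T T" by (simp add: eq_half_def)
    then have "\<exists>S\<in>DL1_dual c M. eq_half c M S T \<and> (\<forall>\<phi>\<in>D_space c M. convol S \<phi> \<in> asymp_fun k)"
      using T x unfolding assertion_x_def by (intro bexI[of _ T] conjI)
    with x show "assertion_vi k c M T" using vii_x by (simp add: assertion_vi_def assertion_vii_def)
  qed
  have v_iv: "assertion_v k c M T \<longleftrightarrow> assertion_vii k c M T \<and> assertion_iv k c M T"
    unfolding assertion_v_def assertion_vii_def assertion_iv_def ..
  have iv_x: "assertion_iv k c M T \<Longrightarrow> assertion_x k c M T" by (rule assertion_iv_imp_x[OF _ T])
  have x_i: "assertion_i k c M T" if "cond_M3 M" "c = Beurling" "assertion_x k c M T"
  proof -
    interpret strongly_nonquasianalytic M by unfold_locales (fact that(1))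
    show ?thesis using assertion_x_imp_i that(3) T unfolding that(2) by blast
  qed
  have "assertion_i k c M T \<Longrightarrow> assertion_ii k c M T" "assertion_ii k c M T \<Longrightarrow> assertion_iii k c M T"
    "assertion_iii k c M T \<Longrightarrow> assertion_iv k c M T"
    by (fact assertion_i_imp_ii assertion_ii_imp_iii assertion_iii_imp_iv)+
  then show ?thesis using viii_x vii_x ix_x vi_x v_iv iv_x x_i by satx
qed

end
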